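(* Let $\mathcal{C}$ be a skeletally small Grothendieck site, let $R$ be a sheaf of rings on $\mathcal{C}$, and let $\mathrm{ch}(\mathcal{N})$ be the category of unbounded chain complexes of presheaves of (left) $R$-modules on $\mathcal{C}$. There is a proper cofibrantly generated model structure on $\mathrm{ch}(\mathcal{N})$ such that: the weak equivalences are the presheaf homology-isomorphisms; the cofibrations are the retracts of relative $I$-cell complexes; the fibrations are the levelwise surjective maps of presheaves. The set of generating cofibrations is $I$, the set of generating acyclic cofibrations is $J$, and both are small (the sources of their maps are small objects).
   Context: $\mathcal{N}$ is the category of presheaves of left $R$-modules on $\mathcal{C}$ (where $R$ is regarded as a presheaf of rings). For $C\in\mathcal{C}$, $R_C\in\mathcal{N}$ is the free presheaf of $R$-modules generated by $C$, so $\mathcal{N}(R_C,X)\cong X(C)$ naturally in $X$. Complexes are homologically graded (differentials lower degree by one). For $C\in\mathcal{C}$ and $n\in\mathbb{Z}$: $i_{C,n}$ is the map of chain complexes from the complex with $R_C$ in degree $n$ and $0$ elsewhere to the complex with $R_C$ in degrees $n+1$ and $n$, differential the identity, and $0$ elsewhere; the map is the identity of $R_C$ in degree $n$. The map $j_{C,n}$ is the map from the zero complex to this same complex with $R_C$ in degrees $n+1$ and $n$. $I=\{i_{C,n}\}$ and $J=\{j_{C,n}\}$ over all $C\in\mathcal{C}$, $n\in\mathbb{Z}$ (one $C$ for each isomorphism class). A map $f\colon X\to Y$ in $\mathrm{ch}(\mathcal{N})$ is a presheaf homology-isomorphism if $H_n(f)\colon H_n(X)\to H_n(Y)$ is an isomorphism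 in $\mathcal{N}$ for every $n\in\mathbb{Z}$ (homology computed in presheaves). It is levelwise surjective if $f_n(C)\colon X_n(C)\to Y_n(C)$ is surjective for all $C\in\mathcal{C}$ and $n\in\mathbb{Z}$. *)

theory Defs
  imports "HOL-Algebra.Module" "HOL-Algebra.AbelCoset"
begin

unbundle cardinal_syntax

section \<open>Universes\<close>

text \<open>
  Size is measured by an uncountable regular cardinal \<open>\<mu>\<close>, given as a well-order on a subset of
  the type \<open>'u\<close>: small sets are those of cardinality below \<open>\<mu>\<close>, and small modules are modules
  with a small carrier consisting of elements of \<open>'u\<close>. If \<open>\<mu>\<close> is inaccessible, this is a
  Grothendieck universe. Inaccessibility is not demanded, because HOL proves no such cardinal to
  exist, whereas uncountable regular cardinals (any successor of an infinite cardinal) are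
  available. The two clauses below that are needed only when \<open>\<mu>\<close> is not inaccessible
  (in \<open>complete\<close> and in \<open>small_rel\<close>) hold automatically for every small index category and every
  small cardinal if \<open>\<mu>\<close> is inaccessible.
\<close>

definition universe :: "'u rel \<Rightarrow> bool" where
  "universe \<mu> \<longleftrightarrow> Card_order \<mu> \<and> natLeq <o \<mu> \<and> regularCard \<mu>"

definition small :: "'u rel \<Rightarrow> 'b set \<Rightarrow> bool" where
  "small \<mu> A \<longleftrightarrow> |A| <o \<mu>"


section \<open>Categories\<close>

record ('o, 'm) cat =
  Obj :: "'o set"
  Arr :: "'m set"
  Dom :: "'m \<Rightarrow> 'o"
  Cod :: "'m \<Rightarrow> 'o"
  Idn :: "'o \<Rightarrow> 'm"
  Cmp :: "'m \<Rightarrow> 'm \<Rightarrow> 'm"  (infixl \<open>\<cdot>\<index>\<close> 70)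

definition Hom :: "('o, 'm, 'z) cat_scheme \<Rightarrow> 'o \<Rightarrow> 'o \<Rightarrow> 'm set" where
  "Hom C X Y = {f \<in> Arr C. Dom C f = X \<and> Cod C f = Y}"

locale category =
  fixes C (structure)
  assumes Dom_closed: "f \<in> Arr C \<Longrightarrow> Dom C f \<in> Obj C"
    and Cod_closed: "f \<in> Arr C \<Longrightarrow> Cod C f \<in> Obj C"
    and Idn_in_Hom: "X \<in> Obj C \<Longrightarrow> Idn C X \<in> Hom C X X"
    and Cmp_in_Hom: "f \<in> Hom C X Y \<Longrightarrow> g \<in> Hom C Y Z \<Longrightarrow> g \<cdot> f \<in> Hom C X Z"
    and Cmp_Idn_right: "f \<in> Hom C X Y \<Longrightarrow> f \<cdot> Idn C X = f"
    and Cmp_Idn_left: "f \<in> Hom C X Y \<Longrightarrow> Idn C Y \<cdot> f = f"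
    and Cmp_assoc: "f \<in> Hom C W X \<Longrightarrow> g \<in> Hom C X Y \<Longrightarrow> h \<in> Hom C Y Z
                      \<Longrightarrow> (h \<cdot> g) \<cdot> f = h \<cdot> (g \<cdot> f)"

definition is_iso :: "('o, 'm, 'z) cat_scheme \<Rightarrow> 'm \<Rightarrow> bool" where
  "is_iso C f \<longleftrightarrow> f \<in> Arr C \<and>
     (\<exists>g \<in> Hom C (Cod C f) (Dom C f).
        g \<cdot>\<^bsub>C\<^esub> f = Idn C (Dom C f) \<and> f \<cdot>\<^bsub>C\<^esub> g = Idn C (Cod C f))"

definition isomorphic :: "('o, 'm, 'z) cat_scheme \<Rightarrow> 'o \<Rightarrow> 'o \<Rightarrow> bool" where
  "isomorphic C X Y \<longleftrightarrow> (\<exists>f \<in> Hom C X Y. is_iso C f)"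

text \<open>A set of representatives, one for each isomorphism class of objects.\<close>

definition is_skeleton :: "('o, 'm, 'z) cat_scheme \<Rightarrow> 'o set \<Rightarrow> bool" where
  "is_skeleton C S \<longleftrightarrow> S \<subseteq> Obj C \<and> (\<forall>X \<in> Obj C. \<exists>!Y. Y \<in> S \<and> isomorphic C X Y)"

definition skeletally_small :: "'u rel \<Rightarrow> ('o, 'm, 'z) cat_scheme \<Rightarrow> bool" where
  "skeletally_small \<mu> C \<longleftrightarrow>
     (\<exists>S. is_skeleton C S \<and> small \<mu> S) \<and>
     (\<forall>X \<in> Obj C. \<forall>Y \<in> Obj C. small \<mu> (Hom C X Y))"


subsection \<open>Limits and colimits\<close>

definition diagram ::
  "('j, 'i, 'y) cat_scheme \<Rightarrow> ('o, 'm, 'z) cat_scheme \<Rightarrow> ('j \<Rightarrow> 'o) \<Rightarrow> ('i \<Rightarrow> 'm) \<Rightarrow> bool" where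
  "diagram J C Fo Fa \<longleftrightarrow>
     (\<forall>j \<in> Obj J. Fo j \<in> Obj C) \<and>
     (\<forall>u \<in> Arr J. Fa u \<in> Hom C (Fo (Dom J u)) (Fo (Cod J u))) \<and>
     (\<forall>j \<in> Obj J. Fa (Idn J j) = Idn C (Fo j)) \<and>
     (\<forall>u \<in> Arr J. \<forall>v \<in> Arr J. Dom J v = Cod J u \<longrightarrow> Fa (v \<cdot>\<^bsub>J\<^esub> u) = Fa v \<cdot>\<^bsub>C\<^esub> Fa u)"

definition cocone where
  "cocone J C Fo Fa L \<iota> \<longleftrightarrow>
     L \<in> Obj C \<and> (\<forall>j \<in> Obj J. \<iota> j \<in> Hom C (Fo j) L) \<and>
     (\<forall>u \<in> Arr J. \<iota> (Cod J u) \<cdot>\<^bsub>C\<^esub> Fa u = \<iota> (Dom J u))"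

definition colimit_cocone where
  "colimit_cocone J C Fo Fa L \<iota> \<longleftrightarrow>
     cocone J C Fo Fa L \<iota> \<and>
     (\<forall>L' \<iota>'. cocone J C Fo Fa L' \<iota>' \<longrightarrow>
        (\<exists>!h. h \<in> Hom C L L' \<and> (\<forall>j \<in> Obj J. h \<cdot>\<^bsub>C\<^esub> \<iota> j = \<iota>' j)))"

definition cone where
  "cone J C Fo Fa L \<pi> \<longleftrightarrow>
     L \<in> Obj C \<and> (\<forall>j \<in> Obj J. \<pi> j \<in> Hom C L (Fo j)) \<and>
     (\<forall>u \<in> Arr J. Fa u \<cdot>\<^bsub>C\<^esub> \<pi> (Dom J u) = \<pi> (Cod J u))"

definition limit_cone where
  "limit_cone J C Fo Fa L \<pi> \<longleftrightarrow>
     cone J C Fo Fa L \<pi> \<and>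
     (\<forall>L' \<pi>'. cone J C Fo Fa L' \<pi>' \<longrightarrow>
        (\<exists>!h. h \<in> Hom C L' L \<and> (\<forall>j \<in> Obj J. \<pi> j \<cdot>\<^bsub>C\<^esub> h = \<pi>' j)))"

text \<open>
  Every small category is isomorphic to one whose objects and arrows are elements of \<open>'u\<close>.
\<close>

definition cocomplete :: "'u rel \<Rightarrow> ('o, 'm, 'z) cat_scheme \<Rightarrow> bool" where
  "cocomplete \<mu> C \<longleftrightarrow>
     (\<forall>(J :: ('u, 'u) cat) Fo Fa.
        category J \<and> small \<mu> (Obj J) \<and> small \<mu> (Arr J) \<and> diagram J C Fo Fa
        \<longrightarrow> (\<exists>L \<iota>. colimit_cocone J C Fo Fa L \<iota>))"

text \<open>
  A category with all limits of the size of its own set of arrows is a preorder (Freyd), so limits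
  can only be asked for over index categories such that products of small sets indexed by their
  arrows are small again. Finite index categories always qualify; if \<open>\<mu>\<close> is inaccessible, all
  small ones do.
\<close>

definition complete :: "'u rel \<Rightarrow> ('o, 'm, 'z) cat_scheme \<Rightarrow> bool" where
  "complete \<mu> C \<longleftrightarrow>
     (\<forall>(J :: ('u, 'u) cat) Fo Fa.
        category J \<and> small \<mu> (Obj J) \<and> small \<mu> (Arr J) \<and>
        (\<forall>A :: 'u set. small \<mu> A \<longrightarrow> small \<mu> (Arr J \<rightarrow>\<^sub>E A)) \<and> diagram J C Fo Fa
        \<longrightarrow> (\<exists>L \<pi>. limit_cone J C Fo Fa L \<pi>))"

definition is_pushout :: "('o, 'm, 'z) cat_scheme \<Rightarrow> 'm \<Rightarrow> 'm \<Rightarrow> 'm \<Rightarrow> 'm \<Rightarrow> bool" where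
  \<comment> \<open>\<open>q\<close> is the pushout of \<open>f\<close> along \<open>u\<close>\<close>
  "is_pushout C f u v q \<longleftrightarrow>
     {f, u, v, q} \<subseteq> Arr C \<and> Dom C u = Dom C f \<and> Dom C v = Cod C f \<and> Dom C q = Cod C u \<and>
     Cod C v = Cod C q \<and> v \<cdot>\<^bsub>C\<^esub> f = q \<cdot>\<^bsub>C\<^esub> u \<and>
     (\<forall>v' \<in> Arr C. \<forall>q' \<in> Arr C.
        Dom C v' = Cod C f \<and> Dom C q' = Cod C u \<and> Cod C v' = Cod C q' \<and> v' \<cdot>\<^bsub>C\<^esub> f = q' \<cdot>\<^bsub>C\<^esub> u \<longrightarrow>
        (\<exists>!h. h \<in> Hom C (Cod C q) (Cod C q') \<and> h \<cdot>\<^bsub>C\<^esub> v = v' \<and> h \<cdot>\<^bsub>C\<^esub> q = q'))"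

definition is_pullback :: "('o, 'm, 'z) cat_scheme \<Rightarrow> 'm \<Rightarrow> 'm \<Rightarrow> 'm \<Rightarrow> 'm \<Rightarrow> bool" where
  \<comment> \<open>\<open>q\<close> is the pullback of \<open>f\<close> along \<open>u\<close>\<close>
  "is_pullback C f u v q \<longleftrightarrow>
     {f, u, v, q} \<subseteq> Arr C \<and> Cod C u = Cod C f \<and> Cod C v = Dom C f \<and> Cod C q = Dom C u \<and>
     Dom C v = Dom C q \<and> f \<cdot>\<^bsub>C\<^esub> v = u \<cdot>\<^bsub>C\<^esub> q \<and>
     (\<forall>v' \<in> Arr C. \<forall>q' \<in> Arr C.
        Cod C v' = Dom C f \<and> Cod C q' = Dom C u \<and> Dom C v' = Dom C q' \<and> f \<cdot>\<^bsub>C\<^esub> v' = u \<cdot>\<^bsub>C\<^esub> q' \<longrightarrow>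
        (\<exists>!h. h \<in> Hom C (Dom C q') (Dom C q) \<and> v \<cdot>\<^bsub>C\<^esub> h = v' \<and> q \<cdot>\<^bsub>C\<^esub> h = q'))"


section \<open>Model categories\<close>

definition subcategory_arrows :: "('o, 'm, 'z) cat_scheme \<Rightarrow> 'm set \<Rightarrow> bool" where
  "subcategory_arrows C K \<longleftrightarrow>
     K \<subseteq> Arr C \<and> (\<forall>X \<in> Obj C. Idn C X \<in> K) \<and>
     (\<forall>f \<in> K. \<forall>g \<in> K. Dom C g = Cod C f \<longrightarrow> g \<cdot>\<^bsub>C\<^esub> f \<in> K)"

definition two_out_of_three :: "('o, 'm, 'z) cat_scheme \<Rightarrow> 'm set \<Rightarrow> bool" where
  "two_out_of_three C K \<longleftrightarrow>
     (\<forall>f \<in> Arr C. \<forall>g \<in> Arr C. Dom C g = Cod C f \<longrightarrow>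
        (f \<in> K \<and> g \<in> K \<longrightarrow> g \<cdot>\<^bsub>C\<^esub> f \<in> K) \<and>
        (f \<in> K \<and> g \<cdot>\<^bsub>C\<^esub> f \<in> K \<longrightarrow> g \<in> K) \<and>
        (g \<in> K \<and> g \<cdot>\<^bsub>C\<^esub> f \<in> K \<longrightarrow> f \<in> K))"

definition is_retract :: "('o, 'm, 'z) cat_scheme \<Rightarrow> 'm \<Rightarrow> 'm \<Rightarrow> bool" where
  \<comment> \<open>\<open>f\<close> is a retract of \<open>g\<close> in the category of arrows\<close>
  "is_retract C f g \<longleftrightarrow> f \<in> Arr C \<and> g \<in> Arr C \<and>
     (\<exists>i \<in> Hom C (Dom C f) (Dom C g). \<exists>r \<in> Hom C (Dom C g) (Dom C f).
      \<exists>i' \<in> Hom C (Cod C f) (Cod C g). \<exists>r' \<in> Hom C (Cod C g) (Cod C f).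
        r \<cdot>\<^bsub>C\<^esub> i = Idn C (Dom C f) \<and> r' \<cdot>\<^bsub>C\<^esub> i' = Idn C (Cod C f) \<and>
        g \<cdot>\<^bsub>C\<^esub> i = i' \<cdot>\<^bsub>C\<^esub> f \<and> f \<cdot>\<^bsub>C\<^esub> r = r' \<cdot>\<^bsub>C\<^esub> g)"

definition retracts :: "('o, 'm, 'z) cat_scheme \<Rightarrow> 'm set \<Rightarrow> 'm set" where
  "retracts C K = {f. \<exists>g \<in> K. is_retract C f g}"

definition has_lifts :: "('o, 'm, 'z) cat_scheme \<Rightarrow> 'm \<Rightarrow> 'm \<Rightarrow> bool" where
  "has_lifts C i p \<longleftrightarrow>
     (\<forall>u \<in> Hom C (Dom C i) (Dom C p). \<forall>v \<in> Hom C (Cod C i) (Cod C p).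
        p \<cdot>\<^bsub>C\<^esub> u = v \<cdot>\<^bsub>C\<^esub> i \<longrightarrow>
        (\<exists>h \<in> Hom C (Cod C i) (Dom C p). h \<cdot>\<^bsub>C\<^esub> i = u \<and> p \<cdot>\<^bsub>C\<^esub> h = v))"

text \<open>
  \<open>l\<close> and \<open>r\<close> are the two parts of the factorization of an arrow, and \<open>k f g u v\<close> is the map
  between the middle objects induced by a commutative square \<open>(u, v)\<close> from \<open>f\<close> to \<open>g\<close>.
\<close>

definition square :: "('o, 'm, 'z) cat_scheme \<Rightarrow> 'm \<Rightarrow> 'm \<Rightarrow> 'm \<Rightarrow> 'm \<Rightarrow> bool" where
  "square C f g u v \<longleftrightarrow> f \<in> Arr C \<and> g \<in> Arr C \<and>
     u \<in> Hom C (Dom C f) (Dom C g) \<and> v \<in> Hom C (Cod C f) (Cod C g) \<and> g \<cdot>\<^bsub>C\<^esub> u = v \<cdot>\<^bsub>C\<^esub> f"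

definition functorial_factorization ::
  "('o, 'm, 'z) cat_scheme \<Rightarrow> 'm set \<Rightarrow> 'm set \<Rightarrow> bool" where
  "functorial_factorization C K K' \<longleftrightarrow>
     (\<exists>l r k.
        (\<forall>f \<in> Arr C. l f \<in> K \<and> r f \<in> K' \<and> Dom C (l f) = Dom C f \<and> Cod C (r f) = Cod C f \<and>
           Cod C (l f) = Dom C (r f) \<and> r f \<cdot>\<^bsub>C\<^esub> l f = f) \<and>
        (\<forall>f g u v. square C f g u v \<longrightarrow>
           k f g u v \<in> Hom C (Cod C (l f)) (Cod C (l g)) \<and>
           k f g u v \<cdot>\<^bsub>C\<^esub> l f = l g \<cdot>\<^bsub>C\<^esub> u \<and> r g \<cdot>\<^bsub>C\<^esub> k f g u v = v \<cdot>\<^bsub>C\<^esub> r f) \<and>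
        (\<forall>f \<in> Arr C. k f f (Idn C (Dom C f)) (Idn C (Cod C f)) = Idn C (Cod C (l f))) \<and>
        (\<forall>f g h u v u' v'. square C f g u v \<and> square C g h u' v' \<longrightarrow>
           k f h (u' \<cdot>\<^bsub>C\<^esub> u) (v' \<cdot>\<^bsub>C\<^esub> v) = k g h u' v' \<cdot>\<^bsub>C\<^esub> k f g u v))"

definition model_structure ::
  "('o, 'm, 'z) cat_scheme \<Rightarrow> 'm set \<Rightarrow> 'm set \<Rightarrow> 'm set \<Rightarrow> bool" where
  "model_structure C W Cof Fib \<longleftrightarrow>
     subcategory_arrows C W \<and> subcategory_arrows C Cof \<and> subcategory_arrows C Fib \<and>
     two_out_of_three C W \<and>
     retracts C W \<subseteq> W \<and> retracts C Cof \<subseteq> Cof \<and> retracts C Fib \<subseteq> Fib \<and>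
     (\<forall>i \<in> Cof. \<forall>p \<in> Fib. i \<in> W \<or> p \<in> W \<longrightarrow> has_lifts C i p) \<and>
     functorial_factorization C Cof (Fib \<inter> W) \<and>
     functorial_factorization C (Cof \<inter> W) Fib"

definition model_category ::
  "'u rel \<Rightarrow> ('o, 'm, 'z) cat_scheme \<Rightarrow> 'm set \<Rightarrow> 'm set \<Rightarrow> 'm set \<Rightarrow> bool" where
  "model_category \<mu> C W Cof Fib \<longleftrightarrow>
     category C \<and> complete \<mu> C \<and> cocomplete \<mu> C \<and> model_structure C W Cof Fib"

definition left_proper where
  "left_proper C W Cof \<longleftrightarrow>
     (\<forall>f u v q. f \<in> W \<and> u \<in> Cof \<and> is_pushout C f u v q \<longrightarrow> q \<in> W)"

definition right_proper where
  "right_proper C W Fib \<longleftrightarrow>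
     (\<forall>f u v q. f \<in> W \<and> u \<in> Fib \<and> is_pullback C f u v q \<longrightarrow> q \<in> W)"

definition proper where
  "proper C W Cof Fib \<longleftrightarrow> left_proper C W Cof \<and> right_proper C W Fib"


subsection \<open>Transfinite compositions and smallness\<close>

text \<open>
  Ordinals are well-orders \<open>r\<close> on subsets of \<open>'u\<close>, regarded as categories; \<open>underS r j\<close> is the set
  of elements strictly below \<open>j\<close>.
\<close>

definition ord_cat :: "'u rel \<Rightarrow> ('u, 'u \<times> 'u) cat" where
  "ord_cat r = \<lparr>Obj = Field r, Arr = r, Dom = fst, Cod = snd,
     Idn = (\<lambda>i. (i, i)), Cmp = (\<lambda>v u. (fst u, snd v))\<rparr>"

definition is_least :: "'u rel \<Rightarrow> 'u \<Rightarrow> bool" where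
  "is_least r b \<longleftrightarrow> b \<in> Field r \<and> underS r b = {}"

definition is_succ :: "'u rel \<Rightarrow> 'u \<Rightarrow> 'u \<Rightarrow> bool" where
  "is_succ r i j \<longleftrightarrow> i \<in> underS r j \<and> (\<forall>k \<in> underS r j. (k, i) \<in> r)"

definition is_limit_elem :: "'u rel \<Rightarrow> 'u \<Rightarrow> bool" where
  "is_limit_elem r j \<longleftrightarrow> j \<in> Field r \<and> underS r j \<noteq> {} \<and> (\<nexists>i. is_succ r i j)"

text \<open>
  A \<open>\<lambda>\<close>-sequence is a colimit-preserving functor on a (nonempty) ordinal, here with all maps to
  immediate successors in \<open>K\<close>.
\<close>

definition sequence_in ::
  "('o, 'm, 'z) cat_scheme \<Rightarrow> 'm set \<Rightarrow> 'u rel \<Rightarrow> ('u \<Rightarrow> 'o) \<Rightarrow> ('u \<times> 'u \<Rightarrow> 'm) \<Rightarrow> bool" where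
  "sequence_in C K r Fo Fa \<longleftrightarrow>
     Well_order r \<and> Field r \<noteq> {} \<and> diagram (ord_cat r) C Fo Fa \<and>
     (\<forall>j. is_limit_elem r j \<longrightarrow>
        colimit_cocone (ord_cat (Restr r (underS r j))) C Fo Fa (Fo j) (\<lambda>i. Fa (i, j))) \<and>
     (\<forall>i j. is_succ r i j \<longrightarrow> Fa (i, j) \<in> K)"

definition transfinite_compositions ::
  "'u rel \<Rightarrow> ('o, 'm, 'z) cat_scheme \<Rightarrow> 'm set \<Rightarrow> 'm set" where
  "transfinite_compositions \<mu> C K =
     {f. \<exists>(r :: 'u rel) Fo Fa L \<iota> b.
        small \<mu> (Field r) \<and> sequence_in C K r Fo Fa \<and>
        colimit_cocone (ord_cat r) C Fo Fa L \<iota> \<and> is_least r b \<and> f = \<iota> b}"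

definition pushouts_of :: "('o, 'm, 'z) cat_scheme \<Rightarrow> 'm set \<Rightarrow> 'm set" where
  "pushouts_of C I = {q. \<exists>f \<in> I. \<exists>u v. is_pushout C f u v q}"

definition rel_cell :: "'u rel \<Rightarrow> ('o, 'm, 'z) cat_scheme \<Rightarrow> 'm set \<Rightarrow> 'm set" where
  "rel_cell \<mu> C I = transfinite_compositions \<mu> C (pushouts_of C I)"

definition injectives :: "('o, 'm, 'z) cat_scheme \<Rightarrow> 'm set \<Rightarrow> 'm set" where
  "injectives C I = {p \<in> Arr C. \<forall>i \<in> I. has_lifts C i p}"

text \<open>
  \<open>\<kappa>\<close>-filtered limit ordinals, for \<open>\<kappa> = |B|\<close>.
\<close>

definition filtered_ordinal :: "'b set \<Rightarrow> 'u rel \<Rightarrow> bool" where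
  "filtered_ordinal B r \<longleftrightarrow>
     Well_order r \<and> Field r \<noteq> {} \<and> (\<forall>i \<in> Field r. \<exists>j \<in> Field r. i \<in> underS r j) \<and>
     (\<forall>S \<subseteq> Field r. |S| \<le>o |B| \<longrightarrow> (\<exists>b \<in> Field r. \<forall>s \<in> S. s \<in> underS r b))"

text \<open>
  The last two conjuncts say that the map of sets from \<open>colim\<^sub>i Hom(A, F\<^sub>i)\<close> to \<open>Hom(A, L)\<close> is
  surjective and injective, for \<open>L\<close> the colimit of \<open>F\<close>.
\<close>

definition kappa_small_rel ::
  "'u rel \<Rightarrow> ('o, 'm, 'z) cat_scheme \<Rightarrow> 'm set \<Rightarrow> 'u set \<Rightarrow> 'o \<Rightarrow> bool" where
  "kappa_small_rel \<mu> C K B A \<longleftrightarrow>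
     (\<forall>(r :: 'u rel) Fo Fa L \<iota>.
        small \<mu> (Field r) \<and> filtered_ordinal B r \<and> sequence_in C K r Fo Fa \<and>
        colimit_cocone (ord_cat r) C Fo Fa L \<iota> \<longrightarrow>
        (\<forall>g \<in> Hom C A L. \<exists>i \<in> Field r. \<exists>h \<in> Hom C A (Fo i). \<iota> i \<cdot>\<^bsub>C\<^esub> h = g) \<and>
        (\<forall>i \<in> Field r. \<forall>i' \<in> Field r. \<forall>h \<in> Hom C A (Fo i). \<forall>h' \<in> Hom C A (Fo i').
           \<iota> i \<cdot>\<^bsub>C\<^esub> h = \<iota> i' \<cdot>\<^bsub>C\<^esub> h' \<longrightarrow>
           (\<exists>j. (i, j) \<in> r \<and> (i', j) \<in> r \<and> Fa (i, j) \<cdot>\<^bsub>C\<^esub> h = Fa (i', j) \<cdot>\<^bsub>C\<^esub> h')))"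

text \<open>
  The cardinal \<open>\<kappa> = |B|\<close> has to be such that its successor is still below \<open>\<mu>\<close>: then the latter is
  a small \<open>\<kappa>\<close>-filtered ordinal, so that the condition is not void.
\<close>

definition small_rel ::
  "'u rel \<Rightarrow> ('o, 'm, 'z) cat_scheme \<Rightarrow> 'm set \<Rightarrow> 'o \<Rightarrow> bool" where
  "small_rel \<mu> C K A \<longleftrightarrow>
     A \<in> Obj C \<and> (\<exists>B :: 'u set. cardSuc |B| <o \<mu> \<and> kappa_small_rel \<mu> C K B A)"

definition small_object :: "'u rel \<Rightarrow> ('o, 'm, 'z) cat_scheme \<Rightarrow> 'o \<Rightarrow> bool" where
  "small_object \<mu> C A \<longleftrightarrow> small_rel \<mu> C (Arr C) A"

definition cofibrantly_generated ::
  "'u rel \<Rightarrow> ('o, 'm, 'z) cat_scheme \<Rightarrow> 'm set \<Rightarrow> 'm set \<Rightarrow> 'm set \<Rightarrow> 'm set \<Rightarrow> bool" where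
  "cofibrantly_generated \<mu> C W Fib I J \<longleftrightarrow>
     I \<subseteq> Arr C \<and> J \<subseteq> Arr C \<and> small \<mu> I \<and> small \<mu> J \<and>
     (\<forall>i \<in> I. small_rel \<mu> C (rel_cell \<mu> C I) (Dom C i)) \<and>
     (\<forall>j \<in> J. small_rel \<mu> C (rel_cell \<mu> C J) (Dom C j)) \<and>
     Fib = injectives C J \<and> Fib \<inter> W = injectives C I"


section \<open>Sites and sheaves of rings\<close>

definition sieve :: "('o, 'a, 'z) cat_scheme \<Rightarrow> 'o \<Rightarrow> 'a set \<Rightarrow> bool" where
  "sieve C c S \<longleftrightarrow> S \<subseteq> {f \<in> Arr C. Cod C f = c} \<and>
     (\<forall>f \<in> S. \<forall>g \<in> Arr C. Cod C g = Dom C f \<longrightarrow> f \<cdot>\<^bsub>C\<^esub> g \<in> S)"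

definition pull_sieve :: "('o, 'a, 'z) cat_scheme \<Rightarrow> 'a \<Rightarrow> 'a set \<Rightarrow> 'a set" where
  "pull_sieve C h S = {g \<in> Arr C. Cod C g = Dom C h \<and> h \<cdot>\<^bsub>C\<^esub> g \<in> S}"

locale grothendieck_site = category C for C :: "('o, 'a) cat" +
  fixes T :: "'o \<Rightarrow> 'a set set"
  assumes covering_sieve: "c \<in> Obj C \<Longrightarrow> S \<in> T c \<Longrightarrow> sieve C c S"
    and maximal: "c \<in> Obj C \<Longrightarrow> {f \<in> Arr C. Cod C f = c} \<in> T c"
    and stability: "c \<in> Obj C \<Longrightarrow> S \<in> T c \<Longrightarrow> h \<in> Arr C \<Longrightarrow> Cod C h = c
                      \<Longrightarrow> pull_sieve C h S \<in> T (Dom C h)"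
    and transitivity: "c \<in> Obj C \<Longrightarrow> S \<in> T c \<Longrightarrow> sieve C c S'
                      \<Longrightarrow> (\<And>h. h \<in> S \<Longrightarrow> pull_sieve C h S' \<in> T (Dom C h)) \<Longrightarrow> S' \<in> T c"

record ('o, 'a, 'r) rpsh =
  rsect :: "'o \<Rightarrow> 'r ring"
  rres :: "'a \<Rightarrow> 'r \<Rightarrow> 'r"

definition ring_presheaf ::
  "'u rel \<Rightarrow> ('o, 'a) cat \<Rightarrow> ('o, 'a, 'r) rpsh \<Rightarrow> bool" where
  "ring_presheaf \<mu> C R \<longleftrightarrow>
     (\<forall>c \<in> Obj C. ring (rsect R c) \<and> small \<mu> (carrier (rsect R c))) \<and>
     (\<forall>f \<in> Arr C. rres R f \<in> ring_hom (rsect R (Cod C f)) (rsect R (Dom C f))) \<and>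
     (\<forall>c \<in> Obj C. \<forall>x \<in> carrier (rsect R c). rres R (Idn C c) x = x) \<and>
     (\<forall>f \<in> Arr C. \<forall>g \<in> Arr C. Dom C g = Cod C f \<longrightarrow>
        (\<forall>x \<in> carrier (rsect R (Cod C g)). rres R (g \<cdot>\<^bsub>C\<^esub> f) x = rres R f (rres R g x)))"

definition matching_family ::
  "('o, 'a) cat \<Rightarrow> ('o, 'a, 'r) rpsh \<Rightarrow> 'a set \<Rightarrow> ('a \<Rightarrow> 'r) \<Rightarrow> bool" where
  "matching_family C R S s \<longleftrightarrow>
     (\<forall>f \<in> S. s f \<in> carrier (rsect R (Dom C f))) \<and>
     (\<forall>f \<in> S. \<forall>g \<in> Arr C. Cod C g = Dom C f \<longrightarrow> s (f \<cdot>\<^bsub>C\<^esub> g) = rres R g (s f))"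

definition sheaf_of_rings ::
  "'u rel \<Rightarrow> ('o, 'a) cat \<Rightarrow> ('o \<Rightarrow> 'a set set) \<Rightarrow> ('o, 'a, 'r) rpsh \<Rightarrow> bool" where
  "sheaf_of_rings \<mu> C T R \<longleftrightarrow> ring_presheaf \<mu> C R \<and>
     (\<forall>c \<in> Obj C. \<forall>S \<in> T c. \<forall>s. matching_family C R S s \<longrightarrow>
        (\<exists>!x. x \<in> carrier (rsect R c) \<and> (\<forall>f \<in> S. rres R f x = s f)))"


section \<open>Presheaves of left modules\<close>

text \<open>
  \<open>HOL-Algebra\<close>'s locale \<open>module\<close> is restricted to commutative rings. Its record type is reused;
  the fields \<open>mult\<close> and \<open>one\<close> inherited from rings are ignored throughout.
\<close>

locale left_module = R?: ring R + M?: abelian_group M for R (structure) and M (structure) +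
  assumes smult_closed: "\<lbrakk>a \<in> carrier R; x \<in> carrier M\<rbrakk> \<Longrightarrow> a \<odot>\<^bsub>M\<^esub> x \<in> carrier M"
    and smult_l_distr: "\<lbrakk>a \<in> carrier R; b \<in> carrier R; x \<in> carrier M\<rbrakk> \<Longrightarrow>
      (a \<oplus>\<^bsub>R\<^esub> b) \<odot>\<^bsub>M\<^esub> x = a \<odot>\<^bsub>M\<^esub> x \<oplus>\<^bsub>M\<^esub> b \<odot>\<^bsub>M\<^esub> x"
    and smult_r_distr: "\<lbrakk>a \<in> carrier R; x \<in> carrier M; y \<in> carrier M\<rbrakk> \<Longrightarrow>
      a \<odot>\<^bsub>M\<^esub> (x \<oplus>\<^bsub>M\<^esub> y) = a \<odot>\<^bsub>M\<^esub> x \<oplus>\<^bsub>M\<^esub> a \<odot>\<^bsub>M\<^esub> y"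
    and smult_assoc: "\<lbrakk>a \<in> carrier R; b \<in> carrier R; x \<in> carrier M\<rbrakk> \<Longrightarrow>
      (a \<otimes>\<^bsub>R\<^esub> b) \<odot>\<^bsub>M\<^esub> x = a \<odot>\<^bsub>M\<^esub> (b \<odot>\<^bsub>M\<^esub> x)"
    and smult_one: "x \<in> carrier M \<Longrightarrow> \<one>\<^bsub>R\<^esub> \<odot>\<^bsub>M\<^esub> x = x"

definition semilinear ::
  "'r ring \<Rightarrow> ('r \<Rightarrow> 's) \<Rightarrow> ('r, 'u) module \<Rightarrow> ('s, 'v) module \<Rightarrow> ('u \<Rightarrow> 'v) \<Rightarrow> bool" where
  "semilinear R \<rho> M N f \<longleftrightarrow>
     f \<in> carrier M \<rightarrow> carrier N \<and>
     (\<forall>x \<in> carrier M. \<forall>y \<in> carrier M. f (x \<oplus>\<^bsub>M\<^esub> y) = f x \<oplus>\<^bsub>N\<^esub> f y) \<and>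
     (\<forall>a \<in> carrier R. \<forall>x \<in> carrier M. f (a \<odot>\<^bsub>M\<^esub> x) = \<rho> a \<odot>\<^bsub>N\<^esub> f x)"

record ('o, 'a, 'r, 'u) psh =
  sect :: "'o \<Rightarrow> ('r, 'u) module"
  res :: "'a \<Rightarrow> 'u \<Rightarrow> 'u"

definition module_presheaf ::
  "'k rel \<Rightarrow> ('o, 'a) cat \<Rightarrow> ('o, 'a, 'r) rpsh \<Rightarrow> ('o, 'a, 'r, 'u) psh \<Rightarrow> bool" where
  "module_presheaf \<mu> C R X \<longleftrightarrow>
     (\<forall>c \<in> Obj C. left_module (rsect R c) (sect X c) \<and> small \<mu> (carrier (sect X c))) \<and>
     (\<forall>f \<in> Arr C. semilinear (rsect R (Cod C f)) (rres R f)
        (sect X (Cod C f)) (sect X (Dom C f)) (res X f)) \<and>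
     (\<forall>c \<in> Obj C. \<forall>x \<in> carrier (sect X c). res X (Idn C c) x = x) \<and>
     (\<forall>f \<in> Arr C. \<forall>g \<in> Arr C. Dom C g = Cod C f \<longrightarrow>
        (\<forall>x \<in> carrier (sect X (Cod C g)). res X (g \<cdot>\<^bsub>C\<^esub> f) x = res X f (res X g x)))"

text \<open>
  Maps of presheaves are extensional, so that parallel arrows are equal if and only if they agree
  on all sections.
\<close>

definition module_presheaf_map ::
  "('o, 'a) cat \<Rightarrow> ('o, 'a, 'r) rpsh \<Rightarrow> ('o, 'a, 'r, 'u) psh \<Rightarrow> ('o, 'a, 'r, 'u) psh
   \<Rightarrow> ('o \<Rightarrow> 'u \<Rightarrow> 'u) \<Rightarrow> bool" where
  "module_presheaf_map C R X Y \<phi> \<longleftrightarrow>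
     \<phi> \<in> extensional (Obj C) \<and>
     (\<forall>c \<in> Obj C. \<phi> c \<in> extensional (carrier (sect X c)) \<and>
        semilinear (rsect R c) (\<lambda>a. a) (sect X c) (sect Y c) (\<phi> c)) \<and>
     (\<forall>f \<in> Arr C. \<forall>x \<in> carrier (sect X (Cod C f)).
        \<phi> (Dom C f) (res X f x) = res Y f (\<phi> (Cod C f) x))"

type_synonym ('o, 'a, 'r, 'u) psh_arr =
  "('o, 'a, 'r, 'u) psh \<times> ('o, 'a, 'r, 'u) psh \<times> ('o \<Rightarrow> 'u \<Rightarrow> 'u)"

text \<open>The category \<open>\<N>\<close>.\<close>

definition psh_cat ::
  "'k rel \<Rightarrow> ('o, 'a) cat \<Rightarrow> ('o, 'a, 'r) rpsh
   \<Rightarrow> (('o, 'a, 'r, 'u) psh, ('o, 'a, 'r, 'u) psh_arr) cat" where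
  "psh_cat \<mu> C R = \<lparr>
     Obj = {X. module_presheaf \<mu> C R X},
     Arr = {(X, Y, \<phi>). module_presheaf \<mu> C R X \<and> module_presheaf \<mu> C R Y \<and>
              module_presheaf_map C R X Y \<phi>},
     Dom = (\<lambda>(X, Y, \<phi>). X),
     Cod = (\<lambda>(X, Y, \<phi>). Y),
     Idn = (\<lambda>X. (X, X, \<lambda>c \<in> Obj C. \<lambda>x \<in> carrier (sect X c). x)),
     Cmp = (\<lambda>(Y', Z, \<psi>) (X, Y, \<phi>).
              (X, Z, \<lambda>c \<in> Obj C. compose (carrier (sect X c)) (\<psi> c) (\<phi> c)))\<rparr>"

definition app :: "('o, 'a, 'r, 'u) psh_arr \<Rightarrow> 'o \<Rightarrow> 'u \<Rightarrow> 'u" where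
  "app f = snd (snd f)"

definition zero_arr ::
  "('o, 'a) cat \<Rightarrow> ('o, 'a, 'r, 'u) psh \<Rightarrow> ('o, 'a, 'r, 'u) psh \<Rightarrow> ('o, 'a, 'r, 'u) psh_arr" where
  "zero_arr C X Y = (X, Y, \<lambda>c \<in> Obj C. \<lambda>x \<in> carrier (sect X c). \<zero>\<^bsub>sect Y c\<^esub>)"

definition zero_psh :: "('o, 'a, 'r, 'u) psh" where
  "zero_psh = \<lparr>
     sect = (\<lambda>c. \<lparr>carrier = {undefined}, mult = (\<lambda>x y. undefined), one = undefined,
                zero = undefined, add = (\<lambda>x y. undefined), smult = (\<lambda>a x. undefined)\<rparr>),
     res = (\<lambda>f x. undefined)\<rparr>"


subsection \<open>Free presheaves\<close>

text \<open>
  The sections over \<open>d\<close> of the free presheaf generated by \<open>c\<close> are the free \<open>R(d)\<close>-module on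
  \<open>Hom(d, c)\<close>, that is, the finitely supported functions \<open>Hom(d, c) \<rightarrow> R(d)\<close>. Restriction along
  \<open>f\<close> sends a formal sum of terms \<open>a [g]\<close> to the sum of the terms \<open>f\<^sup>*(a) [g f]\<close>.
\<close>

definition free_module :: "'r ring \<Rightarrow> 'b set \<Rightarrow> ('r, 'b \<Rightarrow> 'r) module" where
  "free_module R B = \<lparr>
     carrier = {s \<in> B \<rightarrow>\<^sub>E carrier R. finite {b \<in> B. s b \<noteq> \<zero>\<^bsub>R\<^esub>}},
     mult = (\<lambda>s t. undefined), one = undefined,
     zero = (\<lambda>b \<in> B. \<zero>\<^bsub>R\<^esub>),
     add = (\<lambda>s t. \<lambda>b \<in> B. s b \<oplus>\<^bsub>R\<^esub> t b),
     smult = (\<lambda>a s. \<lambda>b \<in> B. a \<otimes>\<^bsub>R\<^esub> s b)\<rparr>"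

definition free_psh_fun ::
  "('o, 'a) cat \<Rightarrow> ('o, 'a, 'r) rpsh \<Rightarrow> 'o \<Rightarrow> ('o, 'a, 'r, 'a \<Rightarrow> 'r) psh" where
  "free_psh_fun C R c = \<lparr>
     sect = (\<lambda>d. free_module (rsect R d) (Hom C d c)),
     res = (\<lambda>f s. \<lambda>h \<in> Hom C (Dom C f) c.
              finsum (rsect R (Dom C f)) (\<lambda>g. rres R f (s g))
                {g \<in> Hom C (Cod C f) c. s g \<noteq> \<zero>\<^bsub>rsect R (Cod C f)\<^esub> \<and> g \<cdot>\<^bsub>C\<^esub> f = h})\<rparr>"

text \<open>
  To become an object of \<open>\<N>\<close>, a presheaf with small sections in another type is transported along
  (arbitrarily chosen) injections of its sections into \<open>'u\<close>.
\<close>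

definition transport_module :: "('v \<Rightarrow> 'u) \<Rightarrow> ('r, 'v) module \<Rightarrow> ('r, 'u) module" where
  "transport_module e M = (let e' = inv_into (carrier M) e in \<lparr>
     carrier = e ` carrier M, mult = (\<lambda>x y. undefined), one = undefined,
     zero = e \<zero>\<^bsub>M\<^esub>,
     add = (\<lambda>x y. e (e' x \<oplus>\<^bsub>M\<^esub> e' y)),
     smult = (\<lambda>a x. e (a \<odot>\<^bsub>M\<^esub> e' x))\<rparr>)"

definition sect_embedding :: "('o, 'a, 'r, 'v) psh \<Rightarrow> 'o \<Rightarrow> 'v \<Rightarrow> 'u" where
  "sect_embedding P c = (SOME e. inj_on e (carrier (sect P c)))"

definition transport_psh ::
  "('o, 'a) cat \<Rightarrow> ('o, 'a, 'r, 'v) psh \<Rightarrow> ('o, 'a, 'r, 'u) psh" where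
  "transport_psh C P = \<lparr>
     sect = (\<lambda>c. transport_module (sect_embedding P c) (sect P c)),
     res = (\<lambda>f x. sect_embedding P (Dom C f)
              (res P f (inv_into (carrier (sect P (Cod C f))) (sect_embedding P (Cod C f)) x)))\<rparr>"

definition free_psh ::
  "('o, 'a) cat \<Rightarrow> ('o, 'a, 'r) rpsh \<Rightarrow> 'o \<Rightarrow> ('o, 'a, 'r, 'u) psh" where
  "free_psh C R c = transport_psh C (free_psh_fun C R c)"


section \<open>Chain complexes\<close>

record ('o, 'm) cplx =
  deg :: "int \<Rightarrow> 'o"
  bdry :: "int \<Rightarrow> 'm"

text \<open>Chain complexes in a category \<open>N\<close> with zero arrows \<open>z X Y\<close>.\<close>

definition is_complex :: "('o, 'm) cat \<Rightarrow> ('o \<Rightarrow> 'o \<Rightarrow> 'm) \<Rightarrow> ('o, 'm) cplx \<Rightarrow> bool" where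
  "is_complex N z X \<longleftrightarrow> (\<forall>n. deg X n \<in> Obj N \<and> bdry X n \<in> Hom N (deg X n) (deg X (n - 1)) \<and>
     bdry X (n - 1) \<cdot>\<^bsub>N\<^esub> bdry X n = z (deg X n) (deg X (n - 2)))"

type_synonym ('o, 'm) cplx_arr = "('o, 'm) cplx \<times> ('o, 'm) cplx \<times> (int \<Rightarrow> 'm)"

definition is_chain_map ::
  "('o, 'm) cat \<Rightarrow> ('o, 'm) cplx \<Rightarrow> ('o, 'm) cplx \<Rightarrow> (int \<Rightarrow> 'm) \<Rightarrow> bool" where
  "is_chain_map N X Y \<phi> \<longleftrightarrow> (\<forall>n. \<phi> n \<in> Hom N (deg X n) (deg Y n) \<and>
     \<phi> (n - 1) \<cdot>\<^bsub>N\<^esub> bdry X n = bdry Y n \<cdot>\<^bsub>N\<^esub> \<phi> n)"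

definition ch_cat ::
  "('o, 'm) cat \<Rightarrow> ('o \<Rightarrow> 'o \<Rightarrow> 'm) \<Rightarrow> (('o, 'm) cplx, ('o, 'm) cplx_arr) cat" where
  "ch_cat N z = \<lparr>
     Obj = {X. is_complex N z X},
     Arr = {(X, Y, \<phi>). is_complex N z X \<and> is_complex N z Y \<and> is_chain_map N X Y \<phi>},
     Dom = (\<lambda>(X, Y, \<phi>). X),
     Cod = (\<lambda>(X, Y, \<phi>). Y),
     Idn = (\<lambda>X. (X, X, \<lambda>n. Idn N (deg X n))),
     Cmp = (\<lambda>(Y', Z, \<psi>) (X, Y, \<phi>). (X, Z, \<lambda>n. \<psi> n \<cdot>\<^bsub>N\<^esub> \<phi> n))\<rparr>"

type_synonym ('o, 'a, 'r, 'u) psh_cplx =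
  "(('o, 'a, 'r, 'u) psh, ('o, 'a, 'r, 'u) psh_arr) cplx"

type_synonym ('o, 'a, 'r, 'u) psh_cplx_arr =
  "(('o, 'a, 'r, 'u) psh, ('o, 'a, 'r, 'u) psh_arr) cplx_arr"

definition ch_psh ::
  "'u rel \<Rightarrow> ('o, 'a) cat \<Rightarrow> ('o, 'a, 'r) rpsh
   \<Rightarrow> (('o, 'a, 'r, 'u) psh_cplx, ('o, 'a, 'r, 'u) psh_cplx_arr) cat" where
  "ch_psh \<mu> C R = ch_cat (psh_cat \<mu> C R) (zero_arr C)"


subsection \<open>Homology presheaves\<close>

definition cycles :: "('o, 'a, 'r, 'u) psh_cplx \<Rightarrow> int \<Rightarrow> 'o \<Rightarrow> 'u set" where
  "cycles X n c = {x \<in> carrier (sect (deg X n) c).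
     app (bdry X n) c x = \<zero>\<^bsub>sect (deg X (n - 1)) c\<^esub>}"

definition boundaries :: "('o, 'a, 'r, 'u) psh_cplx \<Rightarrow> int \<Rightarrow> 'o \<Rightarrow> 'u set" where
  "boundaries X n c = app (bdry X (n + 1)) c ` carrier (sect (deg X (n + 1)) c)"

text \<open>
  Elements of homology are cosets of the boundaries. The unions below yield the coset of the image
  of any representative.
\<close>

definition homology_psh ::
  "('o, 'a) cat \<Rightarrow> int \<Rightarrow> ('o, 'a, 'r, 'u) psh_cplx \<Rightarrow> ('o, 'a, 'r, 'u set) psh" where
  "homology_psh C n X = \<lparr>
     sect = (\<lambda>c. let M = sect (deg X n) c; B = boundaries X n c in \<lparr>
       carrier = (\<lambda>x. B +>\<^bsub>M\<^esub> x) ` cycles X n c,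
       mult = (\<lambda>p q. undefined), one = undefined,
       zero = B,
       add = (\<lambda>p q. p <+>\<^bsub>M\<^esub> q),
       smult = (\<lambda>a p. \<Union>x \<in> p. B +>\<^bsub>M\<^esub> (a \<odot>\<^bsub>M\<^esub> x))\<rparr>),
     res = (\<lambda>f p. \<Union>x \<in> p. boundaries X n (Dom C f) +>\<^bsub>sect (deg X n) (Dom C f)\<^esub> res (deg X n) f x)\<rparr>"

definition homology_map ::
  "('o, 'a) cat \<Rightarrow> int \<Rightarrow> ('o, 'a, 'r, 'u) psh_cplx_arr \<Rightarrow> ('o, 'a, 'r, 'u set) psh_arr" where
  "homology_map C n = (\<lambda>(X, Y, \<phi>). (homology_psh C n X, homology_psh C n Y,
     \<lambda>c \<in> Obj C. \<lambda>p \<in> carrier (sect (homology_psh C n X) c).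
       \<Union>x \<in> p. boundaries Y n c +>\<^bsub>sect (deg Y n) c\<^esub> app (\<phi> n) c x))"

definition homology_isos ::
  "'u rel \<Rightarrow> ('o, 'a) cat \<Rightarrow> ('o, 'a, 'r) rpsh \<Rightarrow> ('o, 'a, 'r, 'u) psh_cplx_arr set" where
  "homology_isos \<mu> C R = {f \<in> Arr (ch_psh \<mu> C R).
     \<forall>n. is_iso (psh_cat \<mu> C R) (homology_map C n f)}"

definition levelwise_surjections ::
  "'u rel \<Rightarrow> ('o, 'a) cat \<Rightarrow> ('o, 'a, 'r) rpsh \<Rightarrow> ('o, 'a, 'r, 'u) psh_cplx_arr set" where
  "levelwise_surjections \<mu> C R = {(X, Y, \<phi>). (X, Y, \<phi>) \<in> Arr (ch_psh \<mu> C R) \<and>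
     (\<forall>n. \<forall>c \<in> Obj C. app (\<phi> n) c ` carrier (sect (deg X n) c) = carrier (sect (deg Y n) c))}"


subsection \<open>Generating maps\<close>

definition zero_complex :: "('o, 'a) cat \<Rightarrow> ('o, 'a, 'r, 'u) psh_cplx" where
  "zero_complex C = \<lparr>deg = (\<lambda>k. zero_psh), bdry = (\<lambda>k. zero_arr C zero_psh zero_psh)\<rparr>"

definition sphere_complex ::
  "('o, 'a) cat \<Rightarrow> ('o, 'a, 'r, 'u) psh \<Rightarrow> int \<Rightarrow> ('o, 'a, 'r, 'u) psh_cplx" where
  "sphere_complex C P n = (let D = (\<lambda>k. if k = n then P else zero_psh) in
     \<lparr>deg = D, bdry = (\<lambda>k. zero_arr C (D k) (D (k - 1)))\<rparr>)"

definition disk_complex ::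
  "'u rel \<Rightarrow> ('o, 'a) cat \<Rightarrow> ('o, 'a, 'r) rpsh \<Rightarrow> ('o, 'a, 'r, 'u) psh \<Rightarrow> int
   \<Rightarrow> ('o, 'a, 'r, 'u) psh_cplx" where
  "disk_complex \<mu> C R P n = (let D = (\<lambda>k. if k = n + 1 \<or> k = n then P else zero_psh) in
     \<lparr>deg = D,
      bdry = (\<lambda>k. if k = n + 1 then Idn (psh_cat \<mu> C R) P else zero_arr C (D k) (D (k - 1)))\<rparr>)"

definition gen_i ::
  "'u rel \<Rightarrow> ('o, 'a) cat \<Rightarrow> ('o, 'a, 'r) rpsh \<Rightarrow> 'o \<Rightarrow> int \<Rightarrow> ('o, 'a, 'r, 'u) psh_cplx_arr" where
  "gen_i \<mu> C R c n = (let P = free_psh C R c; A = sphere_complex C P n; B = disk_complex \<mu> C R P n in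
     (A, B, \<lambda>k. if k = n then Idn (psh_cat \<mu> C R) P else zero_arr C (deg A k) (deg B k)))"

definition gen_j ::
  "'u rel \<Rightarrow> ('o, 'a) cat \<Rightarrow> ('o, 'a, 'r) rpsh \<Rightarrow> 'o \<Rightarrow> int \<Rightarrow> ('o, 'a, 'r, 'u) psh_cplx_arr" where
  "gen_j \<mu> C R c n = (let P = free_psh C R c; B = disk_complex \<mu> C R P n in
     (zero_complex C, B, \<lambda>k. zero_arr C zero_psh (deg B k)))"

definition gen_I ::
  "'u rel \<Rightarrow> ('o, 'a) cat \<Rightarrow> ('o, 'a, 'r) rpsh \<Rightarrow> 'o set \<Rightarrow> ('o, 'a, 'r, 'u) psh_cplx_arr set" where
  "gen_I \<mu> C R S = {gen_i \<mu> C R c n | c n. c \<in> S}"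

definition gen_J ::
  "'u rel \<Rightarrow> ('o, 'a) cat \<Rightarrow> ('o, 'a, 'r) rpsh \<Rightarrow> 'o set \<Rightarrow> ('o, 'a, 'r, 'u) psh_cplx_arr set" where
  "gen_J \<mu> C R S = {gen_j \<mu> C R c n | c n. c \<in> S}"

end

theory Submission
  imports Defs "HOL-Library.Countable_Set"
begin

text \<open>
  Sections of complexes are handled elementwise, and objects of \<open>\<N>\<close> are built from sections modulo
  an equivalence relation. The disk on \<open>c\<close> represents sections over \<open>c\<close> and the sphere represents cycles,
  so the maps injective with respect to \<open>J\<close> are the levelwise surjections, and those injective with respect
  to \<open>I\<close> are the surjections that are also homology isomorphisms. The small object argument takes only
  \<open>\<omega>\<close> steps, because spheres map into the colimit of a sequence through a stage: all cells are obtained as formal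
  terms, and the middle object of a factorization is presented by generators and relations. Attaching the
  same cells one at a time, in a well-order refining their rank, exhibits its first map as a relative
  \<open>I\<close>-cell complex up to an isomorphism. Maps with the left lifting property against the surjections
  are homology isomorphisms by lifting against the path and cone complexes. Right and left properness
  are diagram chases with the sections of a pullback and of a pushout along an injection.
\<close>

text \<open>Two constraints shape the constructions. The cardinal \<mu> is closed under small unions
  but need not be closed under power sets or infinite products, and \<open>C\<close> is only
  skeletally small, so the arrows out of an object may be too many; every object must therefore be
  built with explicit control of its sections. Moreover, factorizations have to be strictly
  functorial: the induced maps preserve identities and composites on the nose. Both needs are met by
  treating cells as pieces of syntax. A term records the attaching cycle, a label records the
  prescribed image, and a square between maps acts by relabelling, which is strictly functorial.
  Syntax also explains why countably many rounds are enough: a cycle, together with a derivation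
  that its boundary vanishes, mentions finitely many cells and is present after finitely many
  rounds. A relative cell complex, however, attaches a single generating map per step; this forces a
  second, linear description of the same object.\<close>

context fixes \<mu> :: "'u rel" assumes U: "universe \<mu>" begin

section \<open>Sets of cardinality below \<mu>\<close>

lemma universe_stable: "stable \<mu>"
proof (rule regularCard_stable)
 show "Card_order \<mu>" "regularCard \<mu>" using U by (auto simp: universe_def)
 show "infinite (Field \<mu>)"
 proof -
  have "natLeq \<le>o |Field \<mu>|"
   using U card_of_Field_ordIso ordIso_symmetric ordLeq_ordIso_trans ordLess_imp_ordLeq
   unfolding universe_def by blast
  then show ?thesis using infinite_iff_natLeq_ordLeq by blast
 qed
qed

lemma small_mono: "small \<mu> B ==> A \<subseteq> B ==> small \<mu> A"
 unfolding small_def by (meson card_of_mono1 ordLeq_ordLess_trans)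

lemma small_image: "small \<mu> A ==> small \<mu> (f ` A)"
 unfolding small_def by (meson card_of_image ordLeq_ordLess_trans)

lemma small_inj_on: "inj_on f A ==> f ` A \<subseteq> B ==> small \<mu> B ==> small \<mu> A"
 unfolding small_def by (metis card_of_ordLeq ordLeq_ordLess_trans)

text \<open>Uncountability of \<mu> enters here; it admits generators in all integer degrees and
  countably many rounds of attachments.\<close>

lemma small_countable: "countable A ==> small \<mu> A"
proof -
 assume "countable A"
 then have "|A| \<le>o natLeq"
  by (meson countable_def card_of_nat card_of_ordLeqI ordLeq_ordIso_trans UNIV_I)
 then show ?thesis using U unfolding small_def universe_def by (metis ordLeq_ordLess_trans)
qed

lemma small_finite: "finite A ==> small \<mu> A"
 by (simp add: small_countable countable_finite)

lemma small_UN: "small \<mu> I ==> (\<And>i. i \<in> I ==> small \<mu> (A i)) ==> small \<mu> (\<Union>i\<in>I. A i)"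
 unfolding small_def by (rule stable_UNION[OF universe_stable])

lemma small_Un: "small \<mu> A ==> small \<mu> B ==> small \<mu> (A \<union> B)"
 using small_UN[of "UNIV :: bool set" "\<lambda>b. if b then A else B"]
 by (simp add: UNIV_bool small_finite Un_commute)

lemma small_Sigma: "small \<mu> I ==> (\<And>i. i \<in> I ==> small \<mu> (A i)) ==> small \<mu> (Sigma I A)"
 unfolding small_def by (rule stable_elim[OF universe_stable])

lemma small_image2:
 "small \<mu> A ==> small \<mu> B ==> small \<mu> {f a b | a b. a \<in> A & b \<in> B}"
 by (rule small_mono[OF small_image[OF small_Sigma[of A "\<lambda>_. B"], of "\<lambda>(a, b). f a b"]]) auto

text \<open>The cardinal is a well-order on a subset of \<open>'u\<close>, so a small set of any
  type fits into \<open>'u\<close>. This is how sections constructed in other types become sections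
  of objects of the category.\<close>

lemma small_embeds: "small \<mu> (A :: 'b set) ==> \<exists>e :: 'b => 'u. inj_on e A"
proof -
 assume "small \<mu> A"
 then have "|A| \<le>o \<mu>" by (simp add: small_def ordLess_imp_ordLeq)
 moreover have "\<mu> =o |Field \<mu>|"
  using U by (simp add: universe_def card_of_Field_ordIso ordIso_symmetric)
 ultimately have "|A| \<le>o |Field \<mu>|" by (rule ordLeq_ordIso_trans)
 then show ?thesis by (metis card_of_ordLeq)
qed

text \<open>
 The colimits of the small object argument live on sets of terms; these are exhausted by countably
 many layers.
\<close>

lemma small_inductive_closure:
 fixes m :: "'b => nat"
 assumes B: "small \<mu> B" and "small \<mu> P"
  and step: "\<And>x. x \<in> T ==> x \<in> B \<or> (\<exists>f\<in>P. \<exists>y\<in>T. \<exists>z\<in>T. m y < m x & m z < m x & x = f y z)"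
 shows "small \<mu> T"
proof -
 define L where "L = rec_nat B (\<lambda>_ L. L \<union> (\<Union>f\<in>P. \<Union>y\<in>L. f y ` L))"
 have L0: "L 0 = B" and LS: "L (Suc n) = L n \<union> (\<Union>f\<in>P. \<Union>y\<in>L n. f y ` L n)" for n
  by (simp_all add: L_def)
 have sm: "small \<mu> (L n)" for n
  by (induction n) (auto simp: L0 LS assms intro!: small_Un small_UN small_image)
 have mono: "L n \<subseteq> L k" if "n \<le> k" for n k
  using that by (induction k) (auto simp: LS le_Suc_eq)
 \<comment> \<open>Constituents have smaller measure, so an element of measure below
   \<open>n\<close> needs at most \<open>n\<close> rounds.\<close>
 have "x \<in> T ==> m x < n ==> x \<in> L n" for n x
 proof (induction n arbitrary: x)
  case (Suc n)
  from step[OF Suc.prems(1)] show ?case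
  proof
   assume "x \<in> B" then show ?thesis using mono[of 0 "Suc n"] L0 by auto
  next
   assume "\<exists>f\<in>P. \<exists>y\<in>T. \<exists>z\<in>T. m y < m x & m z < m x & x = f y z"
   then obtain f y z where *: "f \<in> P" "y \<in> T" "z \<in> T" "m y < m x" "m z < m x" "x = f y z"
    by blast
   then have "y \<in> L n" "z \<in> L n" using Suc.IH Suc.prems(2) by auto
   then show ?thesis using * by (auto simp: LS)
  qed
 qed simp
 then have "T \<subseteq> (\<Union>n. L n)" by (metis UN_iff UNIV_I lessI subsetI)
 then show ?thesis by (rule small_mono[OF small_UN, rotated 2]) (auto simp: sm small_countable)
qed

text \<open>Nonempty finite sets arise by inserting an element into a smaller finite set; the
  measure is the cardinality, and the second argument of the binary operation is a dummy.\<close>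

lemma small_finite_subsets: assumes A: "small \<mu> A" shows "small \<mu> {F. F \<subseteq> A & finite F}"
proof (rule small_inductive_closure[where m = card])
 show "small \<mu> {{} :: 'b set}" by (simp add: small_finite)
 show "small \<mu> ((\<lambda>a. \<lambda>y z. insert a y) ` A)" by (rule small_image[OF A])
 fix F assume F: "F \<in> {F. F \<subseteq> A & finite F}"
 show "F \<in> {{}} \<or> (\<exists>f\<in>(\<lambda>a. \<lambda>y z. insert a y) ` A. \<exists>y\<in>{F. F \<subseteq> A & finite F}. \<exists>z\<in>{F. F \<subseteq> A & finite F}.
   card y < card F & card z < card F & F = f y z)"
 proof (cases "F = {}")
  case False
  then obtain a where a: "a \<in> F" by blast
  have "card (F - {a}) < card F" using F a by (intro card_Diff1_less) auto
  then have 1: "card (F - {a}) < card F & card (F - {a}) < card F & F = (\<lambda>y z. insert a y) (F - {a}) (F - {a})"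
   using a by auto
  have 2: "F - {a} \<in> {F. F \<subseteq> A & finite F}" "a \<in> A" using F a by auto
  show ?thesis
   by (rule disjI2, rule bexI[OF _ imageI[OF 2(2)]], rule bexI[OF _ 2(1)], rule bexI[OF _ 2(1)], rule 1)
 qed simp
qed

end

section \<open>Lifting properties\<close>

definition llp :: "('o, 'm, 'z) cat_scheme => 'm set => 'm set" where
 "llp C P = {i \<in> Arr C. \<forall>p \<in> P. has_lifts C i p}"

lemma HomD: "f \<in> Hom C X Y ==> f \<in> Arr C & Dom C f = X & Cod C f = Y"
 by (simp add: Hom_def)

context category begin

lemma Hom_Dom_Cod: "f \<in> Arr C ==> f \<in> Hom C (Dom C f) (Cod C f)"
 by (simp add: Hom_def)

lemma Hom_Obj: "f \<in> Hom C X Y ==> X \<in> Obj C & Y \<in> Obj C"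
 using Dom_closed Cod_closed by (auto simp: Hom_def)

lemma has_liftsD:
 assumes "has_lifts C i p" "i \<in> Hom C A B" "p \<in> Hom C X Y" "u \<in> Hom C A X" "v \<in> Hom C B Y"
  "p \<cdot> u = v \<cdot> i"
 shows "\<exists>h \<in> Hom C B X. h \<cdot> i = u & p \<cdot> h = v"
 using assms unfolding has_lifts_def by (auto simp: Hom_def)

lemma has_liftsI:
 assumes "i \<in> Hom C A B" "p \<in> Hom C X Y"
  "\<And>u v. u \<in> Hom C A X ==> v \<in> Hom C B Y ==> p \<cdot> u = v \<cdot> i ==>
   \<exists>h \<in> Hom C B X. h \<cdot> i = u & p \<cdot> h = v"
 shows "has_lifts C i p"
 using assms unfolding has_lifts_def by (auto simp: Hom_def)

lemma llp_subset_Arr: "llp C P \<subseteq> Arr C" by (auto simp: llp_def)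

lemma llp_antimono: "P \<subseteq> Q ==> llp C Q \<subseteq> llp C P" by (auto simp: llp_def)

lemma Idn_in_llp: assumes "X \<in> Obj C" and P: "P \<subseteq> Arr C" shows "Idn C X \<in> llp C P"
 unfolding llp_def
proof (safe)
 show "Idn C X \<in> Arr C" using HomD[OF Idn_in_Hom[OF assms(1)]] by simp
 fix p assume "p \<in> P"
 then have p: "p \<in> Hom C (Dom C p) (Cod C p)" using P Hom_Dom_Cod by blast
 show "has_lifts C (Idn C X) p"
 proof (rule has_liftsI[OF Idn_in_Hom[OF assms(1)] p])
  fix u v assume u: "u \<in> Hom C X (Dom C p)" and v: "v \<in> Hom C X (Cod C p)"
   and e: "p \<cdot> u = v \<cdot> Idn C X"
  show "\<exists>h\<in>Hom C X (Dom C p). h \<cdot> Idn C X = u & p \<cdot> h = v"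
   using u e Cmp_Idn_right[OF u] Cmp_Idn_right[OF v] by auto
 qed
qed

lemma Cmp_in_llp:
 assumes f: "f \<in> llp C P" and g: "g \<in> llp C P" and fg: "Dom C g = Cod C f" and P: "P \<subseteq> Arr C"
 shows "g \<cdot> f \<in> llp C P"
proof -
 have fH: "f \<in> Hom C (Dom C f) (Cod C f)" and gH: "g \<in> Hom C (Cod C f) (Cod C g)"
  using f g fg by (auto simp: llp_def Hom_def)
 note gf = Cmp_in_Hom[OF fH gH]
 have "has_lifts C (g \<cdot> f) p" if "p \<in> P" for p
 proof (rule has_liftsI[OF gf])
  have lf: "has_lifts C f p" and lg: "has_lifts C g p" using f g that by (auto simp: llp_def)
  show pH: "p \<in> Hom C (Dom C p) (Cod C p)" using that P Hom_Dom_Cod by blast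
  fix u v assume u: "u \<in> Hom C (Dom C f) (Dom C p)" and v: "v \<in> Hom C (Cod C g) (Cod C p)"
   and e: "p \<cdot> u = v \<cdot> (g \<cdot> f)"
  have "p \<cdot> u = (v \<cdot> g) \<cdot> f" using e Cmp_assoc[OF fH gH v] by simp
  from has_liftsD[OF lf fH pH u Cmp_in_Hom[OF gH v] this]
  obtain h where h: "h \<in> Hom C (Cod C f) (Dom C p)" "h \<cdot> f = u" "p \<cdot> h = v \<cdot> g" by blast
  from has_liftsD[OF lg gH pH h(1) v h(3)]
  obtain k where k: "k \<in> Hom C (Cod C g) (Dom C p)" "k \<cdot> g = h" "p \<cdot> k = v" by blast
  then show "\<exists>h\<in>Hom C (Cod C g) (Dom C p). h \<cdot> (g \<cdot> f) = u & p \<cdot> h = v"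
   using Cmp_assoc[OF fH gH k(1)] h(2) by auto
 qed
 then show ?thesis using gf by (auto simp: llp_def Hom_def)
qed

text \<open>A square for \<open>f\<close> is transported to one for \<open>g\<close> along the
  retraction, and the lift found there is restricted along \<open>i'\<close>.\<close>

lemma retract_in_llp:
 assumes g: "g \<in> llp C P" and r: "is_retract C f g" and P: "P \<subseteq> Arr C"
 shows "f \<in> llp C P"
proof -
 from r obtain i s i' s' where f: "f \<in> Arr C" "g \<in> Arr C"
  and i: "i \<in> Hom C (Dom C f) (Dom C g)" and s: "s \<in> Hom C (Dom C g) (Dom C f)"
  and i': "i' \<in> Hom C (Cod C f) (Cod C g)" and s': "s' \<in> Hom C (Cod C g) (Cod C f)"
  and si: "s \<cdot> i = Idn C (Dom C f)" and si': "s' \<cdot> i' = Idn C (Cod C f)"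
  and gi: "g \<cdot> i = i' \<cdot> f" and fs: "f \<cdot> s = s' \<cdot> g"
  unfolding is_retract_def by auto
 note fH = Hom_Dom_Cod[OF f(1)] and gH = Hom_Dom_Cod[OF f(2)]
 have "has_lifts C f p" if "p \<in> P" for p
 proof (rule has_liftsI[OF fH])
  show pH: "p \<in> Hom C (Dom C p) (Cod C p)" using that P Hom_Dom_Cod by blast
  fix u v assume u: "u \<in> Hom C (Dom C f) (Dom C p)" and v: "v \<in> Hom C (Cod C f) (Cod C p)"
   and e: "p \<cdot> u = v \<cdot> f"
  have "p \<cdot> (u \<cdot> s) = (v \<cdot> s') \<cdot> g"
   using Cmp_assoc[OF s u pH] Cmp_assoc[OF s fH v] Cmp_assoc[OF gH s' v] e fs by simp
  moreover have "has_lifts C g p" using g that by (simp add: llp_def)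
  ultimately obtain h where h: "h \<in> Hom C (Cod C g) (Dom C p)" "h \<cdot> g = u \<cdot> s" "p \<cdot> h = v \<cdot> s'"
   using has_liftsD[OF _ gH pH Cmp_in_Hom[OF s u] Cmp_in_Hom[OF s' v]] by blast
  have "(h \<cdot> i') \<cdot> f = u"
   using Cmp_assoc[OF fH i' h(1)] Cmp_assoc[OF i gH h(1)] gi h(2) Cmp_assoc[OF i s u] si
    Cmp_Idn_right[OF u] by simp
  moreover have "p \<cdot> (h \<cdot> i') = v"
   using Cmp_assoc[OF i' h(1) pH] h(3) Cmp_assoc[OF i' s' v] si' Cmp_Idn_right[OF v] by simp
  ultimately show "\<exists>h\<in>Hom C (Cod C f) (Dom C p). h \<cdot> f = u & p \<cdot> h = v"
   using Cmp_in_Hom[OF i' h(1)] by blast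
 qed
 then show ?thesis using f by (auto simp: llp_def)
qed

text \<open>Lift the square with top side \<open>i\<close> and bottom side the identity: the lift
  \<open>h\<close> is a section of \<open>p\<close>, and the retraction leaves the source
  fixed.\<close>

lemma retract_argument:
 assumes i: "i \<in> Hom C X Z" and p: "p \<in> Hom C Z Y" and l: "has_lifts C (p \<cdot> i) p"
 shows "is_retract C (p \<cdot> i) i"
proof -
 note pi = Cmp_in_Hom[OF i p]
 have XY: "X \<in> Obj C" "Y \<in> Obj C" "Z \<in> Obj C" using Hom_Obj i p by auto
 obtain h where h: "h \<in> Hom C Y Z" "h \<cdot> (p \<cdot> i) = i" "p \<cdot> h = Idn C Y"
  using has_liftsD[OF l pi p i Idn_in_Hom[OF XY(2)]] Cmp_Idn_left[OF pi] by auto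
 have d: "Dom C i = X" "Dom C (p \<cdot> i) = X" "Cod C i = Z" "Cod C (p \<cdot> i) = Y" "i \<in> Arr C" "p \<cdot> i \<in> Arr C"
  using i pi by (auto simp: Hom_def)
 show ?thesis
  unfolding is_retract_def d using d h p Idn_in_Hom[OF XY(1)] Cmp_Idn_right[OF i]
   Cmp_Idn_right[OF pi] Cmp_Idn_right[OF Idn_in_Hom[OF XY(1)]]
  by (intro conjI bexI[of _ "Idn C X"] bexI[of _ h] bexI[of _ p]) simp_all
qed

text \<open>A lift along \<open>f\<close> and the given map on \<open>Cod C u\<close> glue to a map
  out of the pushout. The lower triangle follows from uniqueness, since both candidates agree after
  \<open>v\<close> and after \<open>q\<close>.\<close>

lemma pushout_in_llp:
 assumes f: "f \<in> llp C P" and po: "is_pushout C f u v q" and P: "P \<subseteq> Arr C"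
 shows "q \<in> llp C P"
proof -
 from po have A: "f \<in> Arr C" "u \<in> Arr C" "v \<in> Arr C" "q \<in> Arr C"
  and D: "Dom C u = Dom C f" "Dom C v = Cod C f" "Dom C q = Cod C u" "Cod C v = Cod C q"
   "v \<cdot> f = q \<cdot> u"
  and univ: "\<And>v' q'. v' \<in> Arr C ==> q' \<in> Arr C ==>
    Dom C v' = Cod C f ==> Dom C q' = Cod C u ==> Cod C v' = Cod C q' ==> v' \<cdot> f = q' \<cdot> u ==>
    (\<exists>!h. h \<in> Hom C (Cod C q) (Cod C q') & h \<cdot> v = v' & h \<cdot> q = q')"
  unfolding is_pushout_def by auto
 have fH: "f \<in> Hom C (Dom C f) (Cod C f)" and uH: "u \<in> Hom C (Dom C f) (Cod C u)"
  and vH: "v \<in> Hom C (Cod C f) (Cod C q)" and qH: "q \<in> Hom C (Cod C u) (Cod C q)"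
  using A D by (auto simp: Hom_def)
 have "has_lifts C q p" if "p \<in> P" for p
 proof (rule has_liftsI[OF qH])
  have lf: "has_lifts C f p" using f that by (simp add: llp_def)
  show pH: "p \<in> Hom C (Dom C p) (Cod C p)" using that P Hom_Dom_Cod by blast
  fix a b assume a: "a \<in> Hom C (Cod C u) (Dom C p)" and b: "b \<in> Hom C (Cod C q) (Cod C p)"
   and e: "p \<cdot> a = b \<cdot> q"
  have "p \<cdot> (a \<cdot> u) = (b \<cdot> v) \<cdot> f"
   using Cmp_assoc[OF uH a pH] Cmp_assoc[OF uH qH b] Cmp_assoc[OF fH vH b] e D by simp
  from has_liftsD[OF lf fH pH Cmp_in_Hom[OF uH a] Cmp_in_Hom[OF vH b] this]
  obtain k where k: "k \<in> Hom C (Cod C f) (Dom C p)" "k \<cdot> f = a \<cdot> u" "p \<cdot> k = b \<cdot> v" by blast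
  obtain h where h: "h \<in> Hom C (Cod C q) (Dom C p)" "h \<cdot> v = k" "h \<cdot> q = a"
   using univ[of k a] k a by (auto simp: Hom_def)
  have pa: "p \<cdot> a \<in> Hom C (Cod C u) (Cod C p)" and pk: "p \<cdot> k \<in> Hom C (Cod C f) (Cod C p)"
   using Cmp_in_Hom[OF a pH] Cmp_in_Hom[OF k(1) pH] by auto
  have e1: "(p \<cdot> h) \<cdot> v = p \<cdot> k" "(p \<cdot> h) \<cdot> q = p \<cdot> a"
   using Cmp_assoc[OF vH h(1) pH] Cmp_assoc[OF qH h(1) pH] h by auto
  have "(p \<cdot> k) \<cdot> f = (p \<cdot> a) \<cdot> u"
   using Cmp_assoc[OF fH k(1) pH] Cmp_assoc[OF uH a pH] k by simp
  then have "\<exists>!h. h \<in> Hom C (Cod C q) (Cod C p) & h \<cdot> v = p \<cdot> k & h \<cdot> q = p \<cdot> a"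
   using univ[of "p \<cdot> k" "p \<cdot> a"] pa pk by (auto simp: Hom_def)
  moreover have "p \<cdot> h \<in> Hom C (Cod C q) (Cod C p)" using Cmp_in_Hom[OF h(1) pH] .
  ultimately have "p \<cdot> h = b" using e1 b e k by auto
  then show "\<exists>h\<in>Hom C (Cod C q) (Dom C p). h \<cdot> q = a & p \<cdot> h = b" using h by auto
 qed
 then show ?thesis using A by (auto simp: llp_def)
qed

end

section \<open>Ordinals and transfinite compositions\<close>

lemma Obj_ord_cat [simp]: "Obj (ord_cat r) = Field r" and Arr_ord_cat [simp]: "Arr (ord_cat r) = r"
 and Dom_ord_cat [simp]: "Dom (ord_cat r) = fst" and Cod_ord_cat [simp]: "Cod (ord_cat r) = snd"
 and Idn_ord_cat [simp]: "Idn (ord_cat r) i = (i, i)"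
 and Cmp_ord_cat [simp]: "Cmp (ord_cat r) v u = (fst u, snd v)"
 by (simp_all add: ord_cat_def)

lemma colimit_cocone_ex:
 assumes "colimit_cocone J C Fo Fa L \<iota>" "cocone J C Fo Fa L' \<iota>'"
 shows "\<exists>h \<in> Hom C L L'. \<forall>j \<in> Obj J. h \<cdot>\<^bsub>C\<^esub> \<iota> j = \<iota>' j"
proof -
 have "\<exists>!h. h \<in> Hom C L L' & (\<forall>j \<in> Obj J. h \<cdot>\<^bsub>C\<^esub> \<iota> j = \<iota>' j)"
  using assms unfolding colimit_cocone_def by blast
 then show ?thesis by (rule ex1E) blast
qed

lemma colimit_cocone_eq:
 assumes "colimit_cocone J C Fo Fa L \<iota>" "cocone J C Fo Fa L' \<iota>'"
  and "h \<in> Hom C L L'" "\<And>j. j \<in> Obj J ==> h \<cdot>\<^bsub>C\<^esub> \<iota> j = \<iota>' j"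
  and "k \<in> Hom C L L'" "\<And>j. j \<in> Obj J ==> k \<cdot>\<^bsub>C\<^esub> \<iota> j = \<iota>' j"
 shows "h = k"
proof -
 have "\<exists>!h. h \<in> Hom C L L' & (\<forall>j \<in> Obj J. h \<cdot>\<^bsub>C\<^esub> \<iota> j = \<iota>' j)"
  using assms(1,2) unfolding colimit_cocone_def by blast
 then show ?thesis by (rule ex1E) (use assms(3-) in metis)
qed

lemma Well_order_facts:
 assumes "Well_order r"
 shows "i \<in> Field r ==> (i, i) \<in> r" "(i, j) \<in> r ==> (j, k) \<in> r ==> (i, k) \<in> r"
  "(i, j) \<in> r ==> (j, i) \<in> r ==> i = j" "i \<in> Field r ==> j \<in> Field r ==> (i, j) \<in> r \<or> (j, i) \<in> r"
  "wf (r - Id)"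
 using assms unfolding order_on_defs refl_on_def antisym_def trans_def total_on_def
 by (blast, blast, blast, metis, blast)

lemma Field_Restr_underS:
 assumes "Well_order r" shows "Field (Restr r (underS r j)) = underS r j"
proof -
 have "underS r j \<subseteq> Field r" by (auto simp: underS_def Field_def)
 then show ?thesis using Well_order_facts(1)[OF assms] by (auto simp: Field_def underS_def)
qed

lemma is_least_below:
 assumes "Well_order r" "is_least r b" "i \<in> Field r" shows "(b, i) \<in> r"
proof -
 have b: "b \<in> Field r" "underS r b = {}" using assms(2) by (simp_all add: is_least_def)
 show ?thesis
 proof (cases "i = b")
  case True then show ?thesis using Well_order_facts(1)[OF assms(1) b(1)] by simp
 next
  case False
  then have "(i, b) \<notin> r" using b(2) unfolding underS_def by blast
  then show ?thesis using Well_order_facts(4)[OF assms(1) b(1) assms(3)] by blast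
 qed
qed

lemma well_order_cases:
 assumes "Well_order r" "j \<in> Field r" "is_least r b"
 obtains "j = b" | i where "is_succ r i j" | "is_limit_elem r j" "j \<noteq> b"
proof (cases "underS r j = {}")
 case True
 then have "j = b" using assms is_least_below[of r b j] by (auto simp: underS_def)
 then show ?thesis using that by blast
next
 case False
 then show ?thesis using that assms unfolding is_limit_elem_def is_least_def by blast
qed

text \<open>A lift is built along the well-order: successor stages use the lifting property, limit
  stages the colimit. Lifts are not unique, so the stages are obtained by dependent choice along the
  well-founded order.\<close>

lemma (in category) transfinite_composition_in_llp:
 fixes \<mu> :: "'k rel"
 assumes f: "f \<in> transfinite_compositions \<mu> C K" and K: "K \<subseteq> llp C P" and P: "P \<subseteq> Arr C"
 shows "f \<in> llp C P"
proof -
 from f obtain r :: "'k rel" and Fo Fa L \<iota> b where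
  seq: "sequence_in C K r Fo Fa" and col: "colimit_cocone (ord_cat r) C Fo Fa L \<iota>"
  and b: "is_least r b" and fb: "f = \<iota> b"
  unfolding transfinite_compositions_def by blast
 have wo: "Well_order r" and dg: "diagram (ord_cat r) C Fo Fa"
  and lim: "\<And>j. is_limit_elem r j ==>
    colimit_cocone (ord_cat (Restr r (underS r j))) C Fo Fa (Fo j) (\<lambda>i. Fa (i, j))"
  and suc: "\<And>i j. is_succ r i j ==> Fa (i, j) \<in> K"
  using seq unfolding sequence_in_def by auto
 note W = Well_order_facts[OF wo]
 have FaH: "Fa (i, j) \<in> Hom C (Fo i) (Fo j)" if "(i, j) \<in> r" for i j
  using dg that unfolding diagram_def by force
 have Fa_comp: "Fa (i, k) = Fa (j, k) \<cdot> Fa (i, j)" if "(i, j) \<in> r" "(j, k) \<in> r" for i j k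
  using dg that unfolding diagram_def by force
 have \<iota>H: "\<iota> i \<in> Hom C (Fo i) L" if "i \<in> Field r" for i
  using col that unfolding colimit_cocone_def cocone_def by auto
 have \<iota>_comp: "\<iota> j \<cdot> Fa (i, j) = \<iota> i" if "(i, j) \<in> r" for i j
  using col that unfolding colimit_cocone_def cocone_def by force
 have bF: "b \<in> Field r" using b by (simp add: is_least_def)
 have ub: "underS r b = {}" using b by (simp add: is_least_def)
 have uF: "i \<in> Field r" "(i, j) \<in> r" "i \<noteq> j" if "i \<in> underS r j" for i j
  using that by (auto simp: underS_def Field_def)
 have "has_lifts C f p" if p: "p \<in> P" for p
  unfolding fb
 proof (rule has_liftsI[OF \<iota>H[OF bF]])
  show pH: "p \<in> Hom C (Dom C p) (Cod C p)" using p P Hom_Dom_Cod by blast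
  fix u v assume u: "u \<in> Hom C (Fo b) (Dom C p)" and v: "v \<in> Hom C L (Cod C p)"
   and e: "p \<cdot> u = v \<cdot> \<iota> b"
  \<comment> \<open>\<open>g\<close> is an admissible choice at stage \<open>j\<close>, given the
    choices \<open>h\<close> below: it starts with \<open>u\<close>, lies over \<open>v\<close> and
    restricts to all earlier choices. Outside \<open>Field r\<close> nothing is required, so that
    the recursion can be total.\<close>
  define Q where "Q h j g \<longleftrightarrow> (j \<in> Field r --> (j = b --> g = u) & g \<in> Hom C (Fo j) (Dom C p) &
   p \<cdot> g = v \<cdot> \<iota> j & (\<forall>i \<in> underS r j. g \<cdot> Fa (i, j) = h i))" for h :: "'k => 'a" and j g
  have "\<exists>h. \<forall>j. Q h j (h j)"
  proof (rule dependent_wf_choice[OF W(5)])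
   fix f g :: "'k => 'a" and x y assume "\<And>z. (z, x) \<in> r - Id ==> f z = g z"
   then have "\<And>i. i \<in> underS r x ==> f i = g i" by (auto simp: underS_def)
   then show "Q f x y = Q g x y" unfolding Q_def by auto
  next
   fix j and h :: "'k => 'a" assume IH: "\<And>i. (i, j) \<in> r - Id ==> Q h i (h i)"
   have hQ: "h i \<in> Hom C (Fo i) (Dom C p)" "p \<cdot> h i = v \<cdot> \<iota> i"
    "\<And>k. k \<in> underS r i ==> h i \<cdot> Fa (k, i) = h k" if "i \<in> underS r j" for i
    using IH[of i] that uF(1)[OF that] unfolding Q_def by (auto simp: underS_def)
   show "\<exists>g. Q h j g"
   proof (cases "j \<in> Field r")
    case True
    from wo True b show ?thesis
    proof (cases rule: well_order_cases)
     case 1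
     then show ?thesis unfolding Q_def using u e ub by auto
    next
     case (2 i)
     then have i: "i \<in> underS r j" and imax: "\<And>k. k \<in> underS r j ==> (k, i) \<in> r"
      by (auto simp: is_succ_def)
     note ij = uF(2)[OF i]
     have l: "has_lifts C (Fa (i, j)) p" using suc[OF 2] K p by (auto simp: llp_def)
     have "p \<cdot> h i = (v \<cdot> \<iota> j) \<cdot> Fa (i, j)"
      using hQ(2)[OF i] Cmp_assoc[OF FaH[OF ij] \<iota>H[OF True] v] \<iota>_comp[OF ij] by simp
     from has_liftsD[OF l FaH[OF ij] pH hQ(1)[OF i] Cmp_in_Hom[OF \<iota>H[OF True] v] this]
     obtain g where g: "g \<in> Hom C (Fo j) (Dom C p)" "g \<cdot> Fa (i, j) = h i" "p \<cdot> g = v \<cdot> \<iota> j"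
      by blast
     \<comment> \<open>\<open>i\<close> is the largest element below \<open>j\<close>, so
       compatibility with earlier stages factors through \<open>h i\<close>.\<close>
     have "g \<cdot> Fa (k, j) = h k" if k: "k \<in> underS r j" for k
     proof -
      note ki = imax[OF k]
      have "g \<cdot> Fa (k, j) = h i \<cdot> Fa (k, i)"
       using Fa_comp[OF ki ij] Cmp_assoc[OF FaH[OF ki] FaH[OF ij] g(1)] g(2) by simp
      also have "\<dots> = h k"
      proof (cases "k = i")
       case True
       have "Fa (i, i) = Idn C (Fo i)" using dg uF(1)[OF i] unfolding diagram_def by simp
       then show ?thesis using True Cmp_Idn_right[OF hQ(1)[OF i]] by simp
      next
       case False
       then have "k \<in> underS r i" using ki by (simp add: underS_def)
       then show ?thesis using hQ(3)[OF i] by simp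
      qed
      finally show ?thesis .
     qed
     moreover have "j \<noteq> b" using i ub by auto
     ultimately show ?thesis unfolding Q_def using g by blast
    next
     case 3
     let ?r = "Restr r (underS r j)"
     note c = lim[OF 3(1)]
     have cc: "cocone (ord_cat ?r) C Fo Fa (Dom C p) h"
      unfolding cocone_def using Hom_Obj[OF pH] hQ Field_Restr_underS[OF wo, of j]
     proof (intro conjI ballI)
      fix uu assume "uu \<in> Arr (ord_cat ?r)"
      then obtain k i where ki: "uu = (k, i)" "(k, i) \<in> r" "k \<in> underS r j" "i \<in> underS r j"
       by auto
      show "h (Cod (ord_cat ?r) uu) \<cdot> Fa uu = h (Dom (ord_cat ?r) uu)"
      proof (cases "k = i")
       case True
       have "Fa (i, i) = Idn C (Fo i)" using dg uF(1)[OF ki(4)] unfolding diagram_def by simp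
       then show ?thesis using True Cmp_Idn_right[OF hQ(1)[OF ki(4)]] ki by simp
      next
       case False
       then have "k \<in> underS r i" using ki by (simp add: underS_def)
       then show ?thesis using hQ(3)[OF ki(4)] ki(1) by simp
      qed
     qed auto
     from colimit_cocone_ex[OF c cc] obtain g where g0: "g \<in> Hom C (Fo j) (Dom C p)"
      "\<forall>i \<in> Obj (ord_cat ?r). g \<cdot> Fa (i, j) = h i" by (rule bexE)
     then have g: "g \<in> Hom C (Fo j) (Dom C p)" "\<And>i. i \<in> underS r j ==> g \<cdot> Fa (i, j) = h i"
      unfolding Obj_ord_cat Field_Restr_underS[OF wo, of j] by simp_all
     have cc2: "cocone (ord_cat ?r) C Fo Fa (Cod C p) (\<lambda>i. v \<cdot> \<iota> i)"
      unfolding cocone_def using Hom_Obj[OF pH] Field_Restr_underS[OF wo, of j]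
      by (auto intro!: Cmp_in_Hom[OF \<iota>H v] simp: uF Cmp_assoc[OF FaH \<iota>H v] \<iota>_comp)
     \<comment> \<open>Both sides agree on all earlier stages, and the limit stage is their
       colimit.\<close>
     have "p \<cdot> g = v \<cdot> \<iota> j"
     proof (rule colimit_cocone_eq[OF c cc2])
      show "p \<cdot> g \<in> Hom C (Fo j) (Cod C p)" using Cmp_in_Hom[OF g(1) pH] .
      show "v \<cdot> \<iota> j \<in> Hom C (Fo j) (Cod C p)" using Cmp_in_Hom[OF \<iota>H[OF True] v] .
      fix i assume "i \<in> Obj (ord_cat ?r)"
      then have i: "i \<in> underS r j" using Field_Restr_underS[OF wo, of j] by auto
      show "(p \<cdot> g) \<cdot> Fa (i, j) = v \<cdot> \<iota> i"
       using Cmp_assoc[OF FaH[OF uF(2)[OF i]] g(1) pH] g(2)[OF i] hQ(2)[OF i] by simp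
      show "(v \<cdot> \<iota> j) \<cdot> Fa (i, j) = v \<cdot> \<iota> i"
       using Cmp_assoc[OF FaH[OF uF(2)[OF i]] \<iota>H[OF True] v] \<iota>_comp[OF uF(2)[OF i]] by simp
     qed
     then show ?thesis unfolding Q_def using g 3 by blast
    qed
   qed (simp add: Q_def)
  qed
  then obtain h where h: "\<And>j. Q h j (h j)" by blast
  then have hQ: "h i \<in> Hom C (Fo i) (Dom C p)" "p \<cdot> h i = v \<cdot> \<iota> i"
    "\<And>k. k \<in> underS r i ==> h i \<cdot> Fa (k, i) = h k" if "i \<in> Field r" for i
   using that unfolding Q_def by auto
  have hb: "h b = u" using h[of b] bF unfolding Q_def by auto
  have cc: "cocone (ord_cat r) C Fo Fa (Dom C p) h"
   unfolding cocone_def using Hom_Obj[OF pH] hQ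
  proof (intro conjI ballI)
   fix uu assume "uu \<in> Arr (ord_cat r)"
   then obtain k i where ki: "uu = (k, i)" "(k, i) \<in> r" "k \<in> Field r" "i \<in> Field r"
    by (cases uu) (auto simp: Field_def)
   show "h (Cod (ord_cat r) uu) \<cdot> Fa uu = h (Dom (ord_cat r) uu)"
   proof (cases "k = i")
    case True
    have "Fa (i, i) = Idn C (Fo i)" using dg ki(4) unfolding diagram_def by simp
    then show ?thesis using True Cmp_Idn_right[OF hQ(1)[OF ki(4)]] ki by simp
   next
    case False
    then have "k \<in> underS r i" using ki by (simp add: underS_def)
    then show ?thesis using hQ(3)[OF ki(4)] ki(1) by simp
   qed
  qed auto
  from colimit_cocone_ex[OF col cc] obtain g where g0: "g \<in> Hom C L (Dom C p)"
   "\<forall>i \<in> Obj (ord_cat r). g \<cdot> \<iota> i = h i" by (rule bexE)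
  then have g: "g \<in> Hom C L (Dom C p)" "\<And>i. i \<in> Field r ==> g \<cdot> \<iota> i = h i" by simp_all
  have cc2: "cocone (ord_cat r) C Fo Fa (Cod C p) (\<lambda>i. v \<cdot> \<iota> i)"
   unfolding cocone_def using Hom_Obj[OF pH]
   by (auto intro!: Cmp_in_Hom[OF \<iota>H v] simp: FieldI1 FieldI2 Cmp_assoc[OF FaH \<iota>H v] \<iota>_comp)
  have "p \<cdot> g = v"
  proof (rule colimit_cocone_eq[OF col cc2 _ _ v])
   show "p \<cdot> g \<in> Hom C L (Cod C p)" using Cmp_in_Hom[OF g(1) pH] .
   fix i assume "i \<in> Obj (ord_cat r)"
   then have i: "i \<in> Field r" by simp
   show "(p \<cdot> g) \<cdot> \<iota> i = v \<cdot> \<iota> i"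
    using g(2)[OF i] hQ(2)[OF i] Cmp_assoc[OF \<iota>H[OF i] g(1) pH] by simp
  qed simp
  then show "\<exists>h\<in>Hom C L (Dom C p). h \<cdot> \<iota> b = u & p \<cdot> h = v" using g bF hb by auto
 qed
 then show ?thesis using \<iota>H[OF bF] fb by (auto simp: llp_def Hom_def)
qed

lemma (in category) rel_cell_in_llp:
 assumes "f \<in> rel_cell \<mu> C I" "I \<subseteq> Arr C" shows "f \<in> llp C (injectives C I)"
proof -
 have P: "injectives C I \<subseteq> Arr C" by (auto simp: injectives_def)
 have "pushouts_of C I \<subseteq> llp C (injectives C I)"
 proof
  fix q assume "q \<in> pushouts_of C I"
  then obtain f u v where "f \<in> I" and po: "is_pushout C f u v q" unfolding pushouts_of_def by blast
  moreover then have "f \<in> llp C (injectives C I)" using assms(2) by (auto simp: llp_def injectives_def)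
  ultimately show "q \<in> llp C (injectives C I)" using pushout_in_llp P by blast
 qed
 then show ?thesis
  using transfinite_composition_in_llp P assms(1) unfolding rel_cell_def by blast
qed


lemma (in category) is_retract_trans:
 assumes fg: "is_retract C f g" and gh: "is_retract C g h" shows "is_retract C f h"
proof -
 have A: "f \<in> Hom C (Dom C f) (Cod C f)" "g \<in> Hom C (Dom C g) (Cod C g)" "h \<in> Hom C (Dom C h) (Cod C h)"
  using fg gh by (simp_all add: is_retract_def Hom_def)
 obtain i r i' r' where 1: "i \<in> Hom C (Dom C f) (Dom C g)" "r \<in> Hom C (Dom C g) (Dom C f)"
   "i' \<in> Hom C (Cod C f) (Cod C g)" "r' \<in> Hom C (Cod C g) (Cod C f)"
   "r \<cdot> i = Idn C (Dom C f)" "r' \<cdot> i' = Idn C (Cod C f)" "g \<cdot> i = i' \<cdot> f" "f \<cdot> r = r' \<cdot> g"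
  using fg unfolding is_retract_def by blast
 obtain k s k' s' where 2: "k \<in> Hom C (Dom C g) (Dom C h)" "s \<in> Hom C (Dom C h) (Dom C g)"
   "k' \<in> Hom C (Cod C g) (Cod C h)" "s' \<in> Hom C (Cod C h) (Cod C g)"
   "s \<cdot> k = Idn C (Dom C g)" "s' \<cdot> k' = Idn C (Cod C g)" "h \<cdot> k = k' \<cdot> g" "g \<cdot> s = s' \<cdot> h"
  using gh unfolding is_retract_def by blast
 have "(r \<cdot> s) \<cdot> (k \<cdot> i) = Idn C (Dom C f)"
  using Cmp_assoc[OF Cmp_in_Hom[OF 1(1) 2(1)] 2(2) 1(2)] Cmp_assoc[OF 1(1) 2(1) 2(2)] Cmp_Idn_left[OF 1(1)] 1(5) 2(5) by simp
 moreover have "(r' \<cdot> s') \<cdot> (k' \<cdot> i') = Idn C (Cod C f)"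
  using Cmp_assoc[OF Cmp_in_Hom[OF 1(3) 2(3)] 2(4) 1(4)] Cmp_assoc[OF 1(3) 2(3) 2(4)] Cmp_Idn_left[OF 1(3)] 1(6) 2(6) by simp
 moreover have "h \<cdot> (k \<cdot> i) = (k' \<cdot> i') \<cdot> f"
  using Cmp_assoc[OF 1(1) 2(1) A(3)] Cmp_assoc[OF 1(1) A(2) 2(3)] Cmp_assoc[OF A(1) 1(3) 2(3)] 1(7) 2(7) by simp
 moreover have "f \<cdot> (r \<cdot> s) = (r' \<cdot> s') \<cdot> h"
  using Cmp_assoc[OF 2(2) 1(2) A(1)] Cmp_assoc[OF 2(2) A(2) 1(4)] Cmp_assoc[OF A(3) 2(4) 1(4)] 1(8) 2(8) by simp
 moreover note Cmp_in_Hom[OF 1(1) 2(1)] Cmp_in_Hom[OF 2(2) 1(2)] Cmp_in_Hom[OF 1(3) 2(3)] Cmp_in_Hom[OF 2(4) 1(4)]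
 ultimately show ?thesis using fg gh unfolding is_retract_def by blast
qed

text \<open>In particular, cofibrations may be precomposed with isomorphisms.\<close>

lemma (in category) iso_precomp_retract:
 assumes f: "f \<in> Hom C Y Z" and \<phi>: "\<phi> \<in> Hom C X Y" "\<phi>' \<in> Hom C Y X" "\<phi> \<cdot> \<phi>' = Idn C Y" "\<phi>' \<cdot> \<phi> = Idn C X"
 shows "is_retract C (f \<cdot> \<phi>) f"
proof -
 note c = Cmp_in_Hom[OF \<phi>(1) f]
 have Z: "Idn C Z \<in> Hom C Z Z" "Idn C Z \<cdot> Idn C Z = Idn C Z" using Hom_Obj[OF f] Idn_in_Hom Cmp_Idn_left by blast+
 have "(f \<cdot> \<phi>) \<cdot> \<phi>' = Idn C Z \<cdot> f" "f \<cdot> \<phi> = Idn C Z \<cdot> (f \<cdot> \<phi>)"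
  using Cmp_assoc[OF \<phi>(2,1) f] \<phi>(3) Cmp_Idn_right[OF f] Cmp_Idn_left[OF f] Cmp_Idn_left[OF c] by simp_all
 then show ?thesis unfolding is_retract_def using HomD[OF f] HomD[OF c] \<phi> Z by auto
qed

section \<open>Complexes of presheaves, elementwise\<close>

lemma Hom_psh_cat:
 "f \<in> Hom (psh_cat \<mu> C R) P Q \<longleftrightarrow> module_presheaf \<mu> C R P & module_presheaf \<mu> C R Q &
  module_presheaf_map C R P Q (app f) & f = (P, Q, app f)"
 by (cases f) (auto simp: Hom_def psh_cat_def app_def)

lemma Obj_psh_cat [simp]: "P \<in> Obj (psh_cat \<mu> C R) \<longleftrightarrow> module_presheaf \<mu> C R P"
 by (simp add: psh_cat_def)

lemma psh_map_eqI:
 assumes f: "f \<in> Hom (psh_cat \<mu> C R) P Q" and g: "g \<in> Hom (psh_cat \<mu> C R) P Q"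
  and e: "\<And>c x. c \<in> Obj C ==> x \<in> carrier (sect P c) ==> app f c x = app g c x"
 shows "f = g"
proof -
 have "app f = app g"
 proof (rule extensionalityI)
  show "app f \<in> extensional (Obj C)" "app g \<in> extensional (Obj C)"
   using f g by (auto simp: Hom_psh_cat module_presheaf_map_def)
  fix c assume c: "c \<in> Obj C"
  show "app f c = app g c"
   by (rule extensionalityI[of _ "carrier (sect P c)"])
    (use f g c e in \<open>auto simp: Hom_psh_cat module_presheaf_map_def\<close>)
 qed
 then show ?thesis using f g unfolding Hom_psh_cat by metis
qed

lemma Cmp_psh_cat:
 assumes "f \<in> Hom (psh_cat \<mu> C R) P Q" "g \<in> Hom (psh_cat \<mu> C R) Q Q'"
 shows "g \<cdot>\<^bsub>psh_cat \<mu> C R\<^esub> f = (P, Q', \<lambda>c\<in>Obj C. \<lambda>x\<in>carrier (sect P c). app g c (app f c x))"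
proof -
 obtain \<phi> \<psi> where "f = (P, Q, \<phi>)" "g = (Q, Q', \<psi>)" using assms unfolding Hom_psh_cat by metis
 then show ?thesis by (simp add: psh_cat_def app_def compose_def)
qed

lemma app_Cmp:
 assumes "f \<in> Hom (psh_cat \<mu> C R) P Q" "g \<in> Hom (psh_cat \<mu> C R) Q Q'" "c \<in> Obj C" "x \<in> carrier (sect P c)"
 shows "app (g \<cdot>\<^bsub>psh_cat \<mu> C R\<^esub> f) c x = app g c (app f c x)"
 unfolding Cmp_psh_cat[OF assms(1,2)] using assms(3,4) by (simp add: app_def)

lemma app_Idn: "c \<in> Obj C ==> x \<in> carrier (sect P c) ==> app (Idn (psh_cat \<mu> C R) P) c x = x"
 by (simp add: psh_cat_def app_def)

lemma app_zero_arr: "c \<in> Obj C ==> x \<in> carrier (sect P c) ==> app (zero_arr C P Q) c x = \<zero>\<^bsub>sect Q c\<^esub>"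
 by (simp add: zero_arr_def app_def)

text \<open>Sections of a complex, with one name per operation, indexed by degree and object. This
  vocabulary keeps records and extensional functions out of the later diagram chases.\<close>

definition K :: "('o, 'a, 'r, 'u) psh_cplx => int => 'o => 'u set" where
 "K X n c = carrier (sect (deg X n) c)"
definition pl where "pl X n c x y = x \<oplus>\<^bsub>sect (deg X n) c\<^esub> y"
definition zr where "zr X n c = \<zero>\<^bsub>sect (deg X n) c\<^esub>"
definition ng where "ng X n c x = \<ominus>\<^bsub>sect (deg X n) c\<^esub> x"
definition sm where "sm X n c a x = a \<odot>\<^bsub>sect (deg X n) c\<^esub> x"
definition rs where "rs X n f x = res (deg X n) f x"
definition bd :: "('o, 'a, 'r, 'u) psh_cplx => int => 'o => 'u => 'u" where
 "bd X n c x = app (bdry X n) c x"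
definition ev :: "('o, 'a, 'r, 'u) psh_cplx_arr => int => 'o => 'u => 'u" where
 "ev f n c x = app (snd (snd f) n) c x"

text \<open>\<open>S\<close> indexes the generators. \<open>S_rep\<close> is what later reduces
  conditions at all objects to conditions at the objects in \<open>S\<close>.\<close>

locale psh_setup = category C for C :: "('o, 'a) cat" (structure) +
 fixes \<mu> :: "'u rel" and R :: "('o, 'a, 'r) rpsh" and S :: "'o set"
 assumes U: "universe \<mu>" and rings: "ring_presheaf \<mu> C R"
  and small_Hom: "\<And>X Y. X \<in> Obj C ==> Y \<in> Obj C ==> small \<mu> (Hom C X Y)"
  and S_Obj: "S \<subseteq> Obj C" and S_small: "small \<mu> S"
  and S_rep: "\<And>X. X \<in> Obj C ==> \<exists>Y \<in> S. isomorphic C X Y"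
begin

abbreviation N where "N \<equiv> (psh_cat \<mu> C R :: (('o, 'a, 'r, 'u) psh, ('o, 'a, 'r, 'u) psh_arr) cat)"
abbreviation ch where "ch \<equiv> (ch_psh \<mu> C R :: (('o, 'a, 'r, 'u) psh_cplx, ('o, 'a, 'r, 'u) psh_cplx_arr) cat)"
abbreviation ch_comp (infixl "\<star>" 70) where "g \<star> f \<equiv> g \<cdot>\<^bsub>ch\<^esub> f"
abbreviation \<R> where "\<R> c \<equiv> carrier (rsect R c)"

lemma Obj_ch: "X \<in> Obj ch \<longleftrightarrow> (\<forall>n. module_presheaf \<mu> C R (deg X n) & bdry X n \<in> Hom N (deg X n) (deg X (n - 1)) &
  (\<forall>c \<in> Obj C. \<forall>x \<in> K X n c. bd X (n - 1) c (bd X n c x) = zr X (n - 2) c))" (is "?l \<longleftrightarrow> ?r")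
proof -
 have "bdry X (n - 1) \<cdot>\<^bsub>N\<^esub> bdry X n = zero_arr C (deg X n) (deg X (n - 2)) \<longleftrightarrow>
  (\<forall>c \<in> Obj C. \<forall>x \<in> K X n c. bd X (n - 1) c (bd X n c x) = zr X (n - 2) c)" (is "?a = ?b \<longleftrightarrow> _")
  if H: "\<forall>n. module_presheaf \<mu> C R (deg X n) & bdry X n \<in> Hom N (deg X n) (deg X (n - 1))" for n
 proof -
  have b1: "bdry X n \<in> Hom N (deg X n) (deg X (n - 1))" and b2: "bdry X (n - 1) \<in> Hom N (deg X (n - 1)) (deg X (n - 2))"
   using H spec[OF H, of "n - 1"] by auto
  show ?thesis unfolding Cmp_psh_cat[OF b1 b2] zero_arr_def K_def bd_def zr_def
   by (simp add: fun_eq_iff restrict_def) metis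
 qed
 note key = this
 have "?l \<longleftrightarrow> (\<forall>n. module_presheaf \<mu> C R (deg X n) & bdry X n \<in> Hom N (deg X n) (deg X (n - 1)) &
   bdry X (n - 1) \<cdot>\<^bsub>N\<^esub> bdry X n = zero_arr C (deg X n) (deg X (n - 2)))"
  by (simp add: ch_psh_def ch_cat_def is_complex_def)
 then show ?thesis using key by blast
qed

lemma Obj_ch_mod:
 assumes "X \<in> Obj ch" shows "module_presheaf \<mu> C R (deg X n)"
 using assms by (simp add: Obj_ch)

lemma Obj_ch_bdry:
 assumes "X \<in> Obj ch" shows "bdry X n \<in> Hom N (deg X n) (deg X (n - 1))"
 using assms by (simp add: Obj_ch)

lemma sect_left_module:
 assumes "X \<in> Obj ch" "c \<in> Obj C" shows "left_module (rsect R c) (sect (deg X n) c)"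
 using Obj_ch_mod[OF assms(1)] assms(2) by (simp add: module_presheaf_def)

lemma sect_group: "X \<in> Obj ch ==> c \<in> Obj C ==> abelian_group (sect (deg X n) c)"
 using sect_left_module left_module.axioms(2) by blast

lemma ring_R: "c \<in> Obj C ==> ring (rsect R c)"
 using rings by (simp add: ring_presheaf_def)

lemma small_R: "c \<in> Obj C ==> small \<mu> (\<R> c)"
 using rings by (simp add: ring_presheaf_def)

lemma rres_closed: "f \<in> Arr C ==> a \<in> \<R> (Cod C f) ==> rres R f a \<in> \<R> (Dom C f)"
 using rings unfolding ring_presheaf_def by (meson ring_hom_closed)

lemma small_K: "X \<in> Obj ch ==> c \<in> Obj C ==> small \<mu> (K X n c)"
 using Obj_ch_mod unfolding module_presheaf_def K_def by blast

context
 fixes X c assumes X: "X \<in> Obj ch" and c: "c \<in> Obj C"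
begin

interpretation left_module "rsect R c" "sect (deg X n) c" for n
 by (rule sect_left_module[OF X c])

lemma K_group:
 shows pl_closed [simp, intro]: "x \<in> K X n c ==> y \<in> K X n c ==> pl X n c x y \<in> K X n c"
  and zr_closed [simp, intro]: "zr X n c \<in> K X n c"
  and ng_closed [simp, intro]: "x \<in> K X n c ==> ng X n c x \<in> K X n c"
  and sm_closed [simp, intro]: "a \<in> \<R> c ==> x \<in> K X n c ==> sm X n c a x \<in> K X n c"
  and pl_assoc: "x \<in> K X n c ==> y \<in> K X n c ==> z \<in> K X n c ==> pl X n c (pl X n c x y) z = pl X n c x (pl X n c y z)"
  and pl_comm: "x \<in> K X n c ==> y \<in> K X n c ==> pl X n c x y = pl X n c y x"
  and pl_lcomm: "x \<in> K X n c ==> y \<in> K X n c ==> z \<in> K X n c ==> pl X n c x (pl X n c y z) = pl X n c y (pl X n c x z)"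
  and pl_zr [simp]: "x \<in> K X n c ==> pl X n c x (zr X n c) = x" "x \<in> K X n c ==> pl X n c (zr X n c) x = x"
  and pl_ng [simp]: "x \<in> K X n c ==> pl X n c x (ng X n c x) = zr X n c" "x \<in> K X n c ==> pl X n c (ng X n c x) x = zr X n c"
  and pl_cancel: "x \<in> K X n c ==> y \<in> K X n c ==> z \<in> K X n c ==> pl X n c x y = pl X n c x z \<longleftrightarrow> y = z"
  and ng_ng [simp]: "x \<in> K X n c ==> ng X n c (ng X n c x) = x"
  and ng_zr [simp]: "ng X n c (zr X n c) = zr X n c"
  and ng_pl: "x \<in> K X n c ==> y \<in> K X n c ==> ng X n c (pl X n c x y) = pl X n c (ng X n c x) (ng X n c y)"
  and sm_pl: "a \<in> \<R> c ==> x \<in> K X n c ==> y \<in> K X n c ==> sm X n c a (pl X n c x y) = pl X n c (sm X n c a x) (sm X n c a y)"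
  and sm_add: "a \<in> \<R> c ==> b \<in> \<R> c ==> x \<in> K X n c ==> sm X n c (a \<oplus>\<^bsub>rsect R c\<^esub> b) x = pl X n c (sm X n c a x) (sm X n c b x)"
  and sm_mult: "a \<in> \<R> c ==> b \<in> \<R> c ==> x \<in> K X n c ==> sm X n c (a \<otimes>\<^bsub>rsect R c\<^esub> b) x = sm X n c a (sm X n c b x)"
  and sm_one [simp]: "x \<in> K X n c ==> sm X n c \<one>\<^bsub>rsect R c\<^esub> x = x"
 unfolding K_def pl_def zr_def ng_def sm_def
 by (simp_all add: smult_closed smult_r_distr smult_l_distr smult_assoc smult_one
   M.a_assoc M.a_comm M.a_lcomm M.minus_add M.l_neg M.r_neg M.r_neg1 M.r_neg2)
 
lemma pl_ng_l [simp]: "x \<in> K X n c ==> y \<in> K X n c ==> pl X n c x (pl X n c (ng X n c x) y) = y"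
   "x \<in> K X n c ==> y \<in> K X n c ==> pl X n c (ng X n c x) (pl X n c x y) = y"
 by (simp_all add: pl_assoc[symmetric])

lemma pl_self_zr: "x \<in> K X n c ==> pl X n c x x = x ==> x = zr X n c"
 using pl_cancel[of x n x "zr X n c"] by simp

lemma eq_of_pl_ng: "x \<in> K X n c ==> y \<in> K X n c ==> pl X n c x (ng X n c y) = zr X n c ==> x = y"
 by (metis ng_closed pl_assoc pl_ng(2) pl_zr(1,2))

lemma ng_unique: "x \<in> K X n c ==> y \<in> K X n c ==> pl X n c x y = zr X n c ==> y = ng X n c x"
 by (metis ng_closed pl_cancel pl_ng(1))

end

lemma rs_laws:
 assumes X: "X \<in> Obj ch" and f: "f \<in> Arr C"
 shows rs_closed [simp, intro]: "x \<in> K X n (Cod C f) ==> d = Dom C f ==> rs X n f x \<in> K X n d"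
  and rs_pl: "x \<in> K X n (Cod C f) ==> y \<in> K X n (Cod C f) ==>
    rs X n f (pl X n (Cod C f) x y) = pl X n (Dom C f) (rs X n f x) (rs X n f y)"
  and rs_sm: "a \<in> \<R> (Cod C f) ==> x \<in> K X n (Cod C f) ==>
    rs X n f (sm X n (Cod C f) a x) = sm X n (Dom C f) (rres R f a) (rs X n f x)"
  and rs_rs: "g \<in> Arr C ==> Dom C g = Cod C f ==> x \<in> K X n (Cod C g) ==> rs X n (g \<cdot> f) x = rs X n f (rs X n g x)"
 using Obj_ch_mod[OF X, of n] f
 unfolding module_presheaf_def semilinear_def K_def rs_def pl_def sm_def by (auto simp: Pi_iff)

lemma rs_Idn [simp]: "X \<in> Obj ch ==> c \<in> Obj C ==> x \<in> K X n c ==> rs X n (Idn C c) x = x"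
 using Obj_ch_mod[of X n] unfolding module_presheaf_def K_def rs_def by auto

lemma bd_laws:
 assumes X: "X \<in> Obj ch"
 shows bd_closed [simp, intro]: "c \<in> Obj C ==> x \<in> K X n c ==> m = n - 1 ==> bd X n c x \<in> K X m c"
  and bd_pl: "c \<in> Obj C ==> x \<in> K X n c ==> y \<in> K X n c ==> bd X n c (pl X n c x y) = pl X (n - 1) c (bd X n c x) (bd X n c y)"
  and bd_sm: "c \<in> Obj C ==> a \<in> \<R> c ==> x \<in> K X n c ==> bd X n c (sm X n c a x) = sm X (n - 1) c a (bd X n c x)"
  and bd_rs: "f \<in> Arr C ==> x \<in> K X n (Cod C f) ==> bd X n (Dom C f) (rs X n f x) = rs X (n - 1) f (bd X n (Cod C f) x)"
  and bd_bd': "c \<in> Obj C ==> x \<in> K X n c ==> bd X (n - 1) c (bd X n c x) = zr X (n - 2) c"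
 using Obj_ch_bdry[OF X, of n] X
 unfolding Hom_psh_cat module_presheaf_map_def semilinear_def K_def rs_def pl_def sm_def bd_def zr_def Obj_ch
 by (auto simp: Pi_iff)

lemma bd_bd [simp]: "X \<in> Obj ch ==> c \<in> Obj C ==> x \<in> K X n c ==> m = n - 1 ==> bd X m c (bd X n c x) = zr X (m - 1) c"
 using bd_bd'[of X c x n] by simp

lemma bd_zr [simp]: "X \<in> Obj ch ==> c \<in> Obj C ==> bd X n c (zr X n c) = zr X (n - 1) c"
 using bd_pl[of X c "zr X n c" n "zr X n c"] pl_self_zr[of X c "bd X n c (zr X n c)" "n - 1"] by simp

lemma bd_ng: "X \<in> Obj ch ==> c \<in> Obj C ==> x \<in> K X n c ==> bd X n c (ng X n c x) = ng X (n - 1) c (bd X n c x)"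
 using bd_pl[of X c x n "ng X n c x"] ng_unique[of X c "bd X n c x" "n - 1" "bd X n c (ng X n c x)"] by simp

lemma rs_zr [simp]: "X \<in> Obj ch ==> f \<in> Arr C ==> rs X n f (zr X n (Cod C f)) = zr X n (Dom C f)"
 using rs_pl[of X f "zr X n (Cod C f)" n "zr X n (Cod C f)"]
  pl_self_zr[of X "Dom C f" "rs X n f (zr X n (Cod C f))" n] Dom_closed Cod_closed by simp

lemma rs_ng: "X \<in> Obj ch ==> f \<in> Arr C ==> x \<in> K X n (Cod C f) ==>
  rs X n f (ng X n (Cod C f) x) = ng X n (Dom C f) (rs X n f x)"
 using rs_pl[of X f x n "ng X n (Cod C f) x"]
  ng_unique[of X "Dom C f" "rs X n f x" n "rs X n f (ng X n (Cod C f) x)"] Dom_closed Cod_closed by simp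

lemma sm_zr [simp]: "X \<in> Obj ch ==> c \<in> Obj C ==> a \<in> \<R> c ==> sm X n c a (zr X n c) = zr X n c"
 using sm_pl[of X c a "zr X n c" n "zr X n c"] pl_self_zr[of X c "sm X n c a (zr X n c)" n] by simp

lemma sm_ng: "X \<in> Obj ch ==> c \<in> Obj C ==> a \<in> \<R> c ==> x \<in> K X n c ==>
  sm X n c a (ng X n c x) = ng X n c (sm X n c a x)"
 using sm_pl[of X c a x n "ng X n c x"] ng_unique[of X c "sm X n c a x" n "sm X n c a (ng X n c x)"] by simp

subsection \<open>Maps\<close>

text \<open>Chain maps as plain families of functions: no extensionality is asked for, since
  \<open>mk\<close> restricts a family to sections before packaging it as an arrow.\<close>

definition hm :: "('o, 'a, 'r, 'u) psh_cplx => ('o, 'a, 'r, 'u) psh_cplx => (int => 'o => 'u => 'u) => bool" where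
 "hm X Y \<phi> \<longleftrightarrow>
  (\<forall>n. \<forall>c \<in> Obj C. \<forall>x \<in> K X n c. \<phi> n c x \<in> K Y n c &
    (\<forall>y \<in> K X n c. \<phi> n c (pl X n c x y) = pl Y n c (\<phi> n c x) (\<phi> n c y)) &
    (\<forall>a \<in> \<R> c. \<phi> n c (sm X n c a x) = sm Y n c a (\<phi> n c x)) &
    \<phi> (n - 1) c (bd X n c x) = bd Y n c (\<phi> n c x)) &
  (\<forall>n. \<forall>f \<in> Arr C. \<forall>x \<in> K X n (Cod C f). \<phi> n (Dom C f) (rs X n f x) = rs Y n f (\<phi> n (Cod C f) x))"

lemma hmI:
 assumes "!!n c x. c \<in> Obj C ==> x \<in> K X n c ==> \<phi> n c x \<in> K Y n c"
  "!!n c x y. c \<in> Obj C ==> x \<in> K X n c ==> y \<in> K X n c ==> \<phi> n c (pl X n c x y) = pl Y n c (\<phi> n c x) (\<phi> n c y)"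
  "!!n c x a. c \<in> Obj C ==> x \<in> K X n c ==> a \<in> \<R> c ==> \<phi> n c (sm X n c a x) = sm Y n c a (\<phi> n c x)"
  "!!n c x. c \<in> Obj C ==> x \<in> K X n c ==> \<phi> (n - 1) c (bd X n c x) = bd Y n c (\<phi> n c x)"
  "!!n f x. f \<in> Arr C ==> x \<in> K X n (Cod C f) ==> \<phi> n (Dom C f) (rs X n f x) = rs Y n f (\<phi> n (Cod C f) x)"
 shows "hm X Y \<phi>"
 using assms unfolding hm_def by blast

definition mk :: "('o, 'a, 'r, 'u) psh_cplx => ('o, 'a, 'r, 'u) psh_cplx => (int => 'o => 'u => 'u) => ('o, 'a, 'r, 'u) psh_cplx_arr" where
 "mk X Y \<phi> = (X, Y, \<lambda>n. (deg X n, deg Y n, \<lambda>c\<in>Obj C. \<lambda>x\<in>K X n c. \<phi> n c x))"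

lemma Hom_ch: "f \<in> Hom ch X Y \<longleftrightarrow> X \<in> Obj ch & Y \<in> Obj ch & f = (X, Y, snd (snd f)) &
 is_chain_map N X Y (snd (snd f))"
 by (cases f) (auto simp: Hom_def ch_psh_def ch_cat_def)

lemma ev_mk [simp]: "c \<in> Obj C ==> x \<in> K X n c ==> ev (mk X Y \<phi>) n c x = \<phi> n c x"
 by (simp add: ev_def mk_def app_def)

lemma hm_ev: assumes "f \<in> Hom ch X Y" shows "hm X Y (ev f)"
proof -
 let ?\<phi> = "snd (snd f)"
 have XY: "X \<in> Obj ch" "Y \<in> Obj ch" and H: "!!n. ?\<phi> n \<in> Hom N (deg X n) (deg Y n)"
  and Cm: "!!n. ?\<phi> (n - 1) \<cdot>\<^bsub>N\<^esub> bdry X n = bdry Y n \<cdot>\<^bsub>N\<^esub> ?\<phi> n"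
  using assms by (auto simp: Hom_ch is_chain_map_def)
 have "ev f (n - 1) c (bd X n c x) = bd Y n c (ev f n c x)" if "c \<in> Obj C" "x \<in> K X n c" for n c x
  using app_Cmp[OF Obj_ch_bdry[OF XY(1)] H that(1), of x n] app_Cmp[OF H Obj_ch_bdry[OF XY(2)] that(1), of x n]
   Cm[of n] that(2) by (simp add: K_def ev_def bd_def)
 then show ?thesis
  using H unfolding hm_def Hom_psh_cat module_presheaf_map_def semilinear_def K_def rs_def pl_def sm_def ev_def
  by (auto simp: Pi_iff)
qed

lemma mk_in_Hom [intro]:
 assumes X: "X \<in> Obj ch" and Y: "Y \<in> Obj ch" and \<phi>: "hm X Y \<phi>" shows "mk X Y \<phi> \<in> Hom ch X Y"
proof -
 let ?f = "\<lambda>n. (deg X n, deg Y n, \<lambda>c\<in>Obj C. \<lambda>x\<in>K X n c. \<phi> n c x)"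
 have H: "?f n \<in> Hom N (deg X n) (deg Y n)" for n
 proof -
  have "module_presheaf_map C R (deg X n) (deg Y n) (\<lambda>c\<in>Obj C. \<lambda>x\<in>K X n c. \<phi> n c x)"
   unfolding module_presheaf_map_def semilinear_def
  proof (intro conjI ballI)
   fix c assume c: "c \<in> Obj C"
   show "(\<lambda>c\<in>Obj C. \<lambda>x\<in>K X n c. \<phi> n c x) c \<in> carrier (sect (deg X n) c) \<rightarrow> carrier (sect (deg Y n) c)"
    using c \<phi> by (auto simp: K_def hm_def)
   fix x assume x: "x \<in> carrier (sect (deg X n) c)"
   show "(\<lambda>c\<in>Obj C. \<lambda>x\<in>K X n c. \<phi> n c x) c (x \<oplus>\<^bsub>sect (deg X n) c\<^esub> y) =
     (\<lambda>c\<in>Obj C. \<lambda>x\<in>K X n c. \<phi> n c x) c x \<oplus>\<^bsub>sect (deg Y n) c\<^esub> (\<lambda>c\<in>Obj C. \<lambda>x\<in>K X n c. \<phi> n c x) c y"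
    if y: "y \<in> carrier (sect (deg X n) c)" for y
    using c x y \<phi> pl_closed[OF X c, of x n y] by (auto simp: K_def hm_def pl_def)
   show "(\<lambda>c\<in>Obj C. \<lambda>x\<in>K X n c. \<phi> n c x) c (a \<odot>\<^bsub>sect (deg X n) c\<^esub> x) =
     a \<odot>\<^bsub>sect (deg Y n) c\<^esub> (\<lambda>c\<in>Obj C. \<lambda>x\<in>K X n c. \<phi> n c x) c x" if a: "a \<in> \<R> c" for a
    using c x a \<phi> sm_closed[OF X c a, of x n] by (auto simp: K_def hm_def sm_def)
  next
   fix f x assume f: "f \<in> Arr C" and x: "x \<in> carrier (sect (deg X n) (Cod C f))"
   show "(\<lambda>c\<in>Obj C. \<lambda>x\<in>K X n c. \<phi> n c x) (Dom C f) (res (deg X n) f x) =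
     res (deg Y n) f ((\<lambda>c\<in>Obj C. \<lambda>x\<in>K X n c. \<phi> n c x) (Cod C f) x)"
    using f x \<phi> rs_closed[OF X f, of x n] Dom_closed[OF f] Cod_closed[OF f]
    by (auto simp: K_def hm_def rs_def)
  qed (auto simp: K_def)
  then show ?thesis using Obj_ch_mod X Y by (auto simp: Hom_psh_cat app_def)
 qed
 have "?f (n - 1) \<cdot>\<^bsub>N\<^esub> bdry X n = bdry Y n \<cdot>\<^bsub>N\<^esub> ?f n" for n
 proof -
  have *: "app (?f (n - 1)) c (app (bdry X n) c x) = app (bdry Y n) c (app (?f n) c x)"
   if c: "c \<in> Obj C" and x: "x \<in> K X n c" for c x
  proof -
   have "bd X n c x \<in> K X (n - 1) c" using X c x by simp
   then show ?thesis using \<phi> c x by (auto simp: hm_def bd_def app_def)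
  qed
  show ?thesis
   unfolding Cmp_psh_cat[OF Obj_ch_bdry[OF X] H] Cmp_psh_cat[OF H Obj_ch_bdry[OF Y]]
   using * by (simp add: K_def fun_eq_iff restrict_def)
 qed
 then show ?thesis using X Y H by (simp add: Hom_ch mk_def is_chain_map_def)
qed

lemma arr_eqI:
 assumes "f \<in> Hom ch X Y" "g \<in> Hom ch X Y"
  "!!n c x. c \<in> Obj C ==> x \<in> K X n c ==> ev f n c x = ev g n c x"
 shows "f = g"
proof -
 have "snd (snd f) n = snd (snd g) n" for n
  by (rule psh_map_eqI) (use assms in \<open>auto simp: Hom_ch is_chain_map_def K_def ev_def\<close>)
 then have "snd (snd f) = snd (snd g)" by blast
 then show ?thesis using assms(1,2) unfolding Hom_ch by metis
qed

lemma ev_Cmp [simp]: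
 assumes "f \<in> Hom ch X Y" "g \<in> Hom ch Y Z" "c \<in> Obj C" "x \<in> K X n c"
 shows "ev (g \<star> f) n c x = ev g n c (ev f n c x)"
proof -
 have "snd (snd (g \<star> f)) n = snd (snd g) n \<cdot>\<^bsub>N\<^esub> snd (snd f) n"
  by (cases f; cases g) (simp add: ch_psh_def ch_cat_def)
 then show ?thesis
  using app_Cmp[of "snd (snd f) n" \<mu> C R "deg X n" "deg Y n" "snd (snd g) n" "deg Z n" c x] assms
  by (auto simp: Hom_ch is_chain_map_def K_def ev_def)
qed

lemma ev_Idn [simp]: "c \<in> Obj C ==> x \<in> K X n c ==> ev (Idn ch X) n c x = x"
 by (simp add: ev_def ch_psh_def ch_cat_def app_Idn K_def)

lemma ev_laws:
 assumes f: "f \<in> Hom ch X Y"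
 shows ev_closed [simp, intro]: "c \<in> Obj C ==> x \<in> K X n c ==> ev f n c x \<in> K Y n c"
  and ev_pl: "c \<in> Obj C ==> x \<in> K X n c ==> y \<in> K X n c ==> ev f n c (pl X n c x y) = pl Y n c (ev f n c x) (ev f n c y)"
  and ev_sm: "c \<in> Obj C ==> a \<in> \<R> c ==> x \<in> K X n c ==> ev f n c (sm X n c a x) = sm Y n c a (ev f n c x)"
  and ev_bd: "c \<in> Obj C ==> x \<in> K X n c ==> ev f (n - 1) c (bd X n c x) = bd Y n c (ev f n c x)"
  and ev_rs: "h \<in> Arr C ==> x \<in> K X n (Cod C h) ==> ev f n (Dom C h) (rs X n h x) = rs Y n h (ev f n (Cod C h) x)"
 using hm_ev[OF f] unfolding hm_def by auto

lemma hm_zr: assumes "X \<in> Obj ch" "Y \<in> Obj ch" "hm X Y \<phi>" "c \<in> Obj C" shows "\<phi> n c (zr X n c) = zr Y n c"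
proof -
 have "\<phi> n c (zr X n c) \<in> K Y n c" using assms by (auto simp: hm_def)
 moreover have "\<phi> n c (pl X n c (zr X n c) (zr X n c)) = pl Y n c (\<phi> n c (zr X n c)) (\<phi> n c (zr X n c))"
  using assms(3,4) zr_closed[OF assms(1,4)] unfolding hm_def by blast
 ultimately show ?thesis using pl_self_zr[OF assms(2,4)] assms by simp
qed

lemma hm_ng: assumes "X \<in> Obj ch" "Y \<in> Obj ch" "hm X Y \<phi>" "c \<in> Obj C" "x \<in> K X n c"
 shows "\<phi> n c (ng X n c x) = ng Y n c (\<phi> n c x)"
proof -
 have "\<phi> n c (ng X n c x) \<in> K Y n c" "\<phi> n c x \<in> K Y n c" using assms by (auto simp: hm_def)
 moreover have "\<phi> n c (pl X n c x (ng X n c x)) = pl Y n c (\<phi> n c x) (\<phi> n c (ng X n c x))"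
  using assms(3-5) ng_closed[OF assms(1,4,5)] unfolding hm_def by blast
 ultimately show ?thesis using ng_unique[OF assms(2,4)] hm_zr[OF assms(1-4)] assms by simp
qed

lemma Hom_ObjD: "f \<in> Hom ch X Y ==> X \<in> Obj ch & Y \<in> Obj ch" by (simp add: Hom_ch)

lemma ev_zr [simp]: "f \<in> Hom ch X Y ==> c \<in> Obj C ==> ev f n c (zr X n c) = zr Y n c"
 using hm_zr hm_ev Hom_ObjD by blast

lemma ev_ng: "f \<in> Hom ch X Y ==> c \<in> Obj C ==> x \<in> K X n c ==> ev f n c (ng X n c x) = ng Y n c (ev f n c x)"
 using hm_ng hm_ev Hom_ObjD by blast

lemma Cmp_in_Hom_ch [intro]:
 assumes f: "f \<in> Hom ch X Y" and g: "g \<in> Hom ch Y Z" shows "g \<star> f \<in> Hom ch X Z"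
proof -
 have "hm X Z (\<lambda>n c x. ev g n c (ev f n c x))"
  by (rule hmI) (use f g in \<open>auto simp: ev_pl[OF f] ev_pl[OF g] ev_sm[OF f] ev_sm[OF g]
   ev_bd[OF f] ev_bd[OF g] ev_rs[OF f] ev_rs[OF g] ev_closed[OF f] Dom_closed Cod_closed\<close>)
 then have m: "mk X Z (\<lambda>n c x. ev g n c (ev f n c x)) \<in> Hom ch X Z" using Hom_ObjD[OF f] Hom_ObjD[OF g] by blast
 have "g \<star> f = mk X Z (\<lambda>n c x. ev g n c (ev f n c x))"
 proof -
  have e: "snd (snd f) n \<in> Hom N (deg X n) (deg Y n)" "snd (snd g) n \<in> Hom N (deg Y n) (deg Z n)" for n
   using f g by (simp_all add: Hom_ch is_chain_map_def)
  have "g \<star> f = (X, Z, \<lambda>n. snd (snd g) n \<cdot>\<^bsub>N\<^esub> snd (snd f) n)"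
   using f g unfolding Hom_ch by (cases f; cases g) (simp add: ch_psh_def ch_cat_def)
  also have "\<dots> = mk X Z (\<lambda>n c x. ev g n c (ev f n c x))"
   unfolding mk_def ev_def K_def Cmp_psh_cat[OF e(1) e(2)] ..
  finally show ?thesis .
 qed
 then show ?thesis using m by simp
qed

lemma Idn_in_Hom_ch [intro]: assumes X: "X \<in> Obj ch" shows "Idn ch X \<in> Hom ch X X"
proof -
 have "Idn ch X = mk X X (\<lambda>n c x. x)"
  by (simp add: ch_psh_def ch_cat_def mk_def psh_cat_def K_def)
 then show ?thesis using mk_in_Hom[OF X X] by (simp add: hm_def)
qed

sublocale ch: category ch
proof
 fix f X Y assume f: "f \<in> Hom ch X Y"
 note o = Hom_ObjD[OF f]
 show "f \<star> Idn ch X = f"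
  by (rule arr_eqI[OF _ f]) (use f o ev_Cmp[OF Idn_in_Hom_ch f] in auto)
 show "Idn ch Y \<star> f = f"
  by (rule arr_eqI[OF _ f]) (use f o ev_Cmp[OF f Idn_in_Hom_ch] in auto)
next
 fix f g h W X Y Z assume f: "f \<in> Hom ch W X" and g: "g \<in> Hom ch X Y" and h: "h \<in> Hom ch Y Z"
 show "(h \<star> g) \<star> f = h \<star> (g \<star> f)"
  by (rule arr_eqI) (use ev_Cmp[OF f Cmp_in_Hom_ch[OF g h]] ev_Cmp[OF Cmp_in_Hom_ch[OF f g] h]
   ev_Cmp[OF f g] ev_Cmp[OF g h] ev_closed[OF f] f g h in auto)
next
 fix f assume "f \<in> Arr ch"
 then have f: "f \<in> Hom ch (Dom ch f) (Cod ch f)" by (simp add: Hom_def)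
 from Hom_ObjD[OF f] show "Dom ch f \<in> Obj ch" "Cod ch f \<in> Obj ch" by auto
qed auto

end

section \<open>Complexes from sections modulo an equivalence relation\<close>

record ('o, 'a, 'r, 'v) sd =
 EQ :: "int => 'o => 'v => 'v => bool"
 AD :: "int => 'o => 'v => 'v => 'v"
 ZR :: "int => 'o => 'v"
 NG :: "int => 'o => 'v => 'v"
 SM :: "int => 'o => 'r => 'v => 'v"
 RS :: "int => 'a => 'v => 'v"
 BD :: "int => 'o => 'v => 'v"

definition cls :: "('o, 'a, 'r, 'v) sd => int => 'o => 'v => 'v set" where
 "cls A n c x = {y. EQ A n c x y}"

text \<open>One injection into \<open>'u\<close> is chosen for the whole set of classes at a given
  degree and object, so that equality of values amounts to \<open>EQ\<close> on admissible
  elements.\<close>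

definition emb :: "('o, 'a, 'r, 'v) sd => int => 'o => 'v => 'u" where
 "emb A n c x = (SOME e. inj_on e (cls A n c ` {x. EQ A n c x x})) (cls A n c x)"

definition rp :: "('o, 'a, 'r, 'v) sd => int => 'o => 'u => 'v" where
 "rp A n c u = (SOME x. EQ A n c x x & emb A n c x = u)"

definition ob_sect :: "('o, 'a, 'r, 'v) sd => int => 'o => ('r, 'u) module" where
 "ob_sect A n c = \<lparr>carrier = emb A n c ` {x. EQ A n c x x}, mult = (\<lambda>x y. undefined), one = undefined,
  zero = emb A n c (ZR A n c), add = (\<lambda>u v. emb A n c (AD A n c (rp A n c u) (rp A n c v))),
  smult = (\<lambda>a u. emb A n c (SM A n c a (rp A n c u)))\<rparr>"

definition ob_deg :: "('o, 'a) cat => ('o, 'a, 'r, 'v) sd => int => ('o, 'a, 'r, 'u) psh" where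
 "ob_deg C A n = \<lparr>sect = ob_sect A n,
  res = (\<lambda>f u. emb A n (Dom C f) (RS A n f (rp A n (Cod C f) u)))\<rparr>"

definition ob :: "('o, 'a) cat => ('o, 'a, 'r, 'v) sd => ('o, 'a, 'r, 'u) psh_cplx" where
 "ob C A = \<lparr>deg = ob_deg C A, bdry = (\<lambda>n. (ob_deg C A n, ob_deg C A (n - 1),
  \<lambda>c\<in>Obj C. \<lambda>u\<in>carrier (ob_sect A n c). emb A (n - 1) c (BD A n c (rp A n c u))))\<rparr>"

text \<open>\<open>EQ\<close> is a partial equivalence relation; the admissible elements are those
  related to themselves, and all laws hold up to \<open>EQ\<close>. Smallness is asked of the set of
  classes only: in a presentation the representatives themselves may be too many.\<close>

locale sdata = psh_setup C \<mu> R S for C :: "('o, 'a) cat" (structure) and \<mu> :: "'u rel"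
  and R :: "('o, 'a, 'r) rpsh" and S :: "'o set" +
 fixes A :: "('o, 'a, 'r, 'v) sd"
 assumes sym: "EQ A n c x y ==> EQ A n c y x"
  and trans: "EQ A n c x y ==> EQ A n c y z ==> EQ A n c x z"
  and small_cls: "c \<in> Obj C ==> small \<mu> (cls A n c ` {x. EQ A n c x x})"
  and AD_cong: "c \<in> Obj C ==> EQ A n c x x' ==> EQ A n c y y' ==> EQ A n c (AD A n c x y) (AD A n c x' y')"
  and ZR_refl: "c \<in> Obj C ==> EQ A n c (ZR A n c) (ZR A n c)"
  and NG_cong: "c \<in> Obj C ==> EQ A n c x x' ==> EQ A n c (NG A n c x) (NG A n c x')"
  and SM_cong: "c \<in> Obj C ==> a \<in> carrier (rsect R c) ==> EQ A n c x x' ==> EQ A n c (SM A n c a x) (SM A n c a x')"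
  and RS_cong: "f \<in> Arr C ==> EQ A n (Cod C f) x x' ==> EQ A n (Dom C f) (RS A n f x) (RS A n f x')"
  and BD_cong: "c \<in> Obj C ==> EQ A n c x x' ==> EQ A (n - 1) c (BD A n c x) (BD A n c x')"
  and AD_assoc: "c \<in> Obj C ==> EQ A n c x x ==> EQ A n c y y ==> EQ A n c z z ==>
   EQ A n c (AD A n c (AD A n c x y) z) (AD A n c x (AD A n c y z))"
  and AD_comm: "c \<in> Obj C ==> EQ A n c x x ==> EQ A n c y y ==> EQ A n c (AD A n c x y) (AD A n c y x)"
  and AD_ZR: "c \<in> Obj C ==> EQ A n c x x ==> EQ A n c (AD A n c (ZR A n c) x) x"
  and AD_NG: "c \<in> Obj C ==> EQ A n c x x ==> EQ A n c (AD A n c (NG A n c x) x) (ZR A n c)"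
  and SM_add: "c \<in> Obj C ==> a \<in> carrier (rsect R c) ==> b \<in> carrier (rsect R c) ==> EQ A n c x x ==>
   EQ A n c (SM A n c (a \<oplus>\<^bsub>rsect R c\<^esub> b) x) (AD A n c (SM A n c a x) (SM A n c b x))"
  and SM_AD: "c \<in> Obj C ==> a \<in> carrier (rsect R c) ==> EQ A n c x x ==> EQ A n c y y ==>
   EQ A n c (SM A n c a (AD A n c x y)) (AD A n c (SM A n c a x) (SM A n c a y))"
  and SM_mult: "c \<in> Obj C ==> a \<in> carrier (rsect R c) ==> b \<in> carrier (rsect R c) ==> EQ A n c x x ==>
   EQ A n c (SM A n c (a \<otimes>\<^bsub>rsect R c\<^esub> b) x) (SM A n c a (SM A n c b x))"
  and SM_one: "c \<in> Obj C ==> EQ A n c x x ==> EQ A n c (SM A n c \<one>\<^bsub>rsect R c\<^esub> x) x"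
  and RS_AD: "f \<in> Arr C ==> EQ A n (Cod C f) x x ==> EQ A n (Cod C f) y y ==>
   EQ A n (Dom C f) (RS A n f (AD A n (Cod C f) x y)) (AD A n (Dom C f) (RS A n f x) (RS A n f y))"
  and RS_SM: "f \<in> Arr C ==> a \<in> carrier (rsect R (Cod C f)) ==> EQ A n (Cod C f) x x ==>
   EQ A n (Dom C f) (RS A n f (SM A n (Cod C f) a x)) (SM A n (Dom C f) (rres R f a) (RS A n f x))"
  and RS_Idn: "c \<in> Obj C ==> EQ A n c x x ==> EQ A n c (RS A n (Idn C c) x) x"
  and RS_Cmp: "f \<in> Arr C ==> g \<in> Arr C ==> Dom C g = Cod C f ==> EQ A n (Cod C g) x x ==>
   EQ A n (Dom C f) (RS A n (g \<cdot> f) x) (RS A n f (RS A n g x))"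
  and BD_AD: "c \<in> Obj C ==> EQ A n c x x ==> EQ A n c y y ==>
   EQ A (n - 1) c (BD A n c (AD A n c x y)) (AD A (n - 1) c (BD A n c x) (BD A n c y))"
  and BD_SM: "c \<in> Obj C ==> a \<in> carrier (rsect R c) ==> EQ A n c x x ==>
   EQ A (n - 1) c (BD A n c (SM A n c a x)) (SM A (n - 1) c a (BD A n c x))"
  and BD_RS: "f \<in> Arr C ==> EQ A n (Cod C f) x x ==>
   EQ A (n - 1) (Dom C f) (BD A n (Dom C f) (RS A n f x)) (RS A (n - 1) f (BD A n (Cod C f) x))"
  and BD_BD: "c \<in> Obj C ==> EQ A n c x x ==> EQ A (n - 2) c (BD A (n - 1) c (BD A n c x)) (ZR A (n - 2) c)"
begin

abbreviation obj :: "('o, 'a, 'r, 'u) psh_cplx" where "obj \<equiv> ob C A"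
abbreviation em :: "int => 'o => 'v => 'u" where "em \<equiv> emb A"

lemma refl: "EQ A n c x y ==> EQ A n c x x" "EQ A n c x y ==> EQ A n c y y"
 using sym trans by blast+

lemma cls_eq: "EQ A n c x x ==> cls A n c x = cls A n c y \<longleftrightarrow> EQ A n c x y"
 unfolding cls_def using sym trans by blast

lemma em_eq:
 assumes c: "c \<in> Obj C" and x: "EQ A n c x x" and y: "EQ A n c y y"
 shows "em n c x = em n c y \<longleftrightarrow> EQ A n c x y"
proof -
 have "\<exists>e :: 'v set => 'u. inj_on e (cls A n c ` {x. EQ A n c x x})"
  by (rule small_embeds[OF U small_cls[OF c]])
 then have "inj_on (SOME e :: 'v set => 'u. inj_on e (cls A n c ` {x. EQ A n c x x})) (cls A n c ` {x. EQ A n c x x})"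
  by (rule someI_ex)
 then have "em n c x = em n c y \<longleftrightarrow> cls A n c x = cls A n c y"
  unfolding emb_def by (rule inj_on_eq_iff) (use x y in auto)
 then show ?thesis using cls_eq[OF x] by simp
qed

lemma K_obj: "K obj n c = em n c ` {x. EQ A n c x x}"
 by (simp add: K_def ob_def ob_deg_def ob_sect_def)

lemma em_in_K [simp]: "EQ A n c x x ==> em n c x \<in> K obj n c" by (simp add: K_obj)

lemma K_objD: "u \<in> K obj n c ==> \<exists>x. EQ A n c x x & u = em n c x"
 by (auto simp: K_obj)

lemma carrier_objD: "u \<in> carrier (sect (deg obj n) c) ==> \<exists>x. EQ A n c x x & u = em n c x"
 using K_objD by (simp add: K_def)

lemma rp_em:
 assumes "c \<in> Obj C" "EQ A n c x x" shows "EQ A n c (rp A n c (em n c x)) x"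
proof -
 let ?P = "\<lambda>y. EQ A n c y y & em n c y = em n c x"
 have "?P (rp A n c (em n c x))" unfolding rp_def by (rule someI[of ?P x]) (use assms in simp)
 then show ?thesis using em_eq[OF assms(1) _ assms(2)] by blast
qed

lemma em_cong: "c \<in> Obj C ==> EQ A n c x y ==> em n c x = em n c y"
 using em_eq refl by blast

lemma obj_ops:
 assumes c: "c \<in> Obj C"
 shows pl_em: "EQ A n c x x ==> EQ A n c y y ==> pl obj n c (em n c x) (em n c y) = em n c (AD A n c x y)"
  and zr_em: "zr obj n c = em n c (ZR A n c)"
  and sm_em: "a \<in> \<R> c ==> EQ A n c x x ==> sm obj n c a (em n c x) = em n c (SM A n c a x)"
  and bd_em: "EQ A n c x x ==> bd obj n c (em n c x) = em (n - 1) c (BD A n c x)"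
proof -
 show "pl obj n c (em n c x) (em n c y) = em n c (AD A n c x y)" if "EQ A n c x x" "EQ A n c y y" for x y
  using em_cong[OF c AD_cong[OF c rp_em[OF c that(1)] rp_em[OF c that(2)]]]
  by (simp add: pl_def ob_def ob_deg_def ob_sect_def)
 show "zr obj n c = em n c (ZR A n c)" by (simp add: zr_def ob_def ob_deg_def ob_sect_def)
 show "sm obj n c a (em n c x) = em n c (SM A n c a x)" if "a \<in> \<R> c" "EQ A n c x x" for a x
  using em_cong[OF c SM_cong[OF c that(1) rp_em[OF c that(2)]]]
  by (simp add: sm_def ob_def ob_deg_def ob_sect_def)
 show "bd obj n c (em n c x) = em (n - 1) c (BD A n c x)" if "EQ A n c x x" for x
  using em_cong[OF c BD_cong[OF c rp_em[OF c that]]] that c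
  by (simp add: bd_def ob_def ob_deg_def ob_sect_def app_def)
qed

lemma rs_em:
 assumes f: "f \<in> Arr C" and x: "EQ A n (Cod C f) x x"
 shows "rs obj n f (em n (Cod C f) x) = em n (Dom C f) (RS A n f x)"
 using em_cong[OF Dom_closed[OF f] RS_cong[OF f rp_em[OF Cod_closed[OF f] x]]]
 by (simp add: rs_def ob_def ob_deg_def)

lemma em_closure [simp]:
 "c \<in> Obj C ==> EQ A n c x x ==> EQ A n c y y ==> EQ A n c (AD A n c x y) (AD A n c x y)"
 "c \<in> Obj C ==> EQ A n c (ZR A n c) (ZR A n c)"
 "c \<in> Obj C ==> EQ A n c x x ==> EQ A n c (NG A n c x) (NG A n c x)"
 "c \<in> Obj C ==> a \<in> \<R> c ==> EQ A n c x x ==> EQ A n c (SM A n c a x) (SM A n c a x)"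
 "f \<in> Arr C ==> EQ A n (Cod C f) x x ==> d = Dom C f ==> EQ A n d (RS A n f x) (RS A n f x)"
 "c \<in> Obj C ==> EQ A n c x x ==> m = n - 1 ==> EQ A m c (BD A n c x) (BD A n c x)"
 using AD_cong ZR_refl NG_cong SM_cong RS_cong BD_cong by simp_all

lemma left_module_obj: assumes c: "c \<in> Obj C" shows "left_module (rsect R c) (ob_sect A n c :: ('r, 'u) module)"
proof -
 have sect: "ob_sect A n c = sect (deg obj n) c" by (simp add: ob_def ob_deg_def)
 have "abelian_group (ob_sect A n c :: ('r, 'u) module)"
  unfolding sect
 proof (rule abelian_groupI)
  fix u v assume "u \<in> carrier (sect (deg obj n) c)" "v \<in> carrier (sect (deg obj n) c)"
  then obtain x y where *: "EQ A n c x x" "u = em n c x" "EQ A n c y y" "v = em n c y"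
   using carrier_objD by blast
  show "u \<oplus>\<^bsub>sect (deg obj n) c\<^esub> v \<in> carrier (sect (deg obj n) c)"
   using * c by (simp add: K_def[symmetric] pl_def[symmetric] pl_em)
  show "(u \<oplus>\<^bsub>sect (deg obj n) c\<^esub> v) \<oplus>\<^bsub>sect (deg obj n) c\<^esub> w = u \<oplus>\<^bsub>sect (deg obj n) c\<^esub> (v \<oplus>\<^bsub>sect (deg obj n) c\<^esub> w)"
   if w: "w \<in> carrier (sect (deg obj n) c)" for w
  proof -
   obtain z where z: "EQ A n c z z" "w = em n c z" using carrier_objD[OF w] by blast
   then show ?thesis
    using * c em_cong[OF c AD_assoc[OF c *(1,3) z(1)]] by (simp add: pl_def[symmetric] pl_em)
  qed
  show "u \<oplus>\<^bsub>sect (deg obj n) c\<^esub> v = v \<oplus>\<^bsub>sect (deg obj n) c\<^esub> u"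
   using pl_em[OF c *(1,3)] pl_em[OF c *(3,1)] em_cong[OF c AD_comm[OF c *(1,3)]]
   unfolding *(2,4) pl_def by argo
 next
  show "\<zero>\<^bsub>sect (deg obj n) c\<^esub> \<in> carrier (sect (deg obj n) c)"
   using c by (simp add: K_def[symmetric] zr_def[symmetric] zr_em)
 next
  fix u assume "u \<in> carrier (sect (deg obj n) c)"
  then obtain x where *: "EQ A n c x x" "u = em n c x"
   using carrier_objD by blast
  show "\<zero>\<^bsub>sect (deg obj n) c\<^esub> \<oplus>\<^bsub>sect (deg obj n) c\<^esub> u = u"
   using * c em_cong[OF c AD_ZR[OF c *(1)]] by (simp add: pl_def[symmetric] zr_def[symmetric] pl_em zr_em)
  show "\<exists>v\<in>carrier (sect (deg obj n) c). v \<oplus>\<^bsub>sect (deg obj n) c\<^esub> u = \<zero>\<^bsub>sect (deg obj n) c\<^esub>"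
   using * c em_cong[OF c AD_NG[OF c *(1)]]
   by (intro bexI[of _ "em n c (NG A n c x)"]) (simp_all add: K_def[symmetric] pl_def[symmetric] zr_def[symmetric] pl_em zr_em)
 qed
 moreover have "left_module_axioms (rsect R c) (ob_sect A n c :: ('r, 'u) module)"
  unfolding sect
 proof
  fix a u assume a: "a \<in> \<R> c" and u: "u \<in> carrier (sect (deg obj n) c)"
  then obtain x where *: "EQ A n c x x" "u = em n c x"
   using carrier_objD by blast
  show "a \<odot>\<^bsub>sect (deg obj n) c\<^esub> u \<in> carrier (sect (deg obj n) c)"
   using * c a by (simp add: K_def[symmetric] sm_def[symmetric] sm_em)
  show "(a \<oplus>\<^bsub>rsect R c\<^esub> b) \<odot>\<^bsub>sect (deg obj n) c\<^esub> u =
    a \<odot>\<^bsub>sect (deg obj n) c\<^esub> u \<oplus>\<^bsub>sect (deg obj n) c\<^esub> b \<odot>\<^bsub>sect (deg obj n) c\<^esub> u" if b: "b \<in> \<R> c" for b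
   using * c a b em_cong[OF c SM_add[OF c a b *(1)]] ring.ring_simprules(1)[OF ring_R[OF c]]
   by (simp add: pl_def[symmetric] sm_def[symmetric] sm_em pl_em)
  show "a \<odot>\<^bsub>sect (deg obj n) c\<^esub> (u \<oplus>\<^bsub>sect (deg obj n) c\<^esub> v) =
    a \<odot>\<^bsub>sect (deg obj n) c\<^esub> u \<oplus>\<^bsub>sect (deg obj n) c\<^esub> a \<odot>\<^bsub>sect (deg obj n) c\<^esub> v"
   if v: "v \<in> carrier (sect (deg obj n) c)" for v
  proof -
   from v obtain y where y: "EQ A n c y y" "v = em n c y"
    using carrier_objD by blast
   then show ?thesis using * c a em_cong[OF c SM_AD[OF c a *(1) y(1)]]
    by (simp add: pl_def[symmetric] sm_def[symmetric] sm_em pl_em)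
  qed
  show "(a \<otimes>\<^bsub>rsect R c\<^esub> b) \<odot>\<^bsub>sect (deg obj n) c\<^esub> u = a \<odot>\<^bsub>sect (deg obj n) c\<^esub> (b \<odot>\<^bsub>sect (deg obj n) c\<^esub> u)"
   if b: "b \<in> \<R> c" for b
   using * c a b em_cong[OF c SM_mult[OF c a b *(1)]] ring.ring_simprules(5)[OF ring_R[OF c]]
   by (simp add: sm_def[symmetric] sm_em)
 next
  fix u assume u: "u \<in> carrier (sect (deg obj n) c)"
  then obtain x where *: "EQ A n c x x" "u = em n c x"
   using carrier_objD by blast
  show "\<one>\<^bsub>rsect R c\<^esub> \<odot>\<^bsub>sect (deg obj n) c\<^esub> u = u"
   using * c em_cong[OF c SM_one[OF c *(1)]] ring.ring_simprules(6)[OF ring_R[OF c]]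
   by (simp add: sm_def[symmetric] sm_em)
 qed
 ultimately show ?thesis using ring_R[OF c] by (simp add: left_module_def)
qed

lemma small_em: assumes c: "c \<in> Obj C" shows "small \<mu> (K obj n c)"
proof -
 have "K obj n c = (SOME e :: 'v set => 'u. inj_on e (cls A n c ` {x. EQ A n c x x})) ` (cls A n c ` {x. EQ A n c x x})"
  unfolding K_obj emb_def by (simp add: image_image)
 then show ?thesis using small_image[OF U small_cls[OF c]] by simp
qed

text \<open>Each law of a complex is checked on representatives, where it is an assumption of the
  locale, and carried to values by \<open>em_cong\<close>.\<close>

lemma obj_in_Obj [simp]: "obj \<in> Obj ch"
proof -
 have mp: "module_presheaf \<mu> C R (deg obj n)" for n
  unfolding module_presheaf_def semilinear_def
 proof (intro conjI ballI impI)
  fix c assume c: "c \<in> Obj C"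
  show "left_module (rsect R c) (sect (deg obj n) c)"
   using left_module_obj[OF c] by (simp add: ob_def ob_deg_def)
  show "small \<mu> (carrier (sect (deg obj n) c))" using small_em[OF c] by (simp add: K_def)
  fix u assume "u \<in> carrier (sect (deg obj n) c)"
  then obtain x where *: "EQ A n c x x" "u = em n c x" using carrier_objD by blast
  then show "res (deg obj n) (Idn C c) u = u"
   using HomD[OF Idn_in_Hom[OF c]] rs_em[of "Idn C c" n x] em_cong[OF c RS_Idn[OF c *(1)]]
   by (simp add: rs_def[symmetric])
 next
  fix f assume f: "f \<in> Arr C"
  note c = Cod_closed[OF f] and d = Dom_closed[OF f]
  show "res (deg obj n) f \<in> carrier (sect (deg obj n) (Cod C f)) \<rightarrow> carrier (sect (deg obj n) (Dom C f))"
  proof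
   fix u assume "u \<in> carrier (sect (deg obj n) (Cod C f))"
   then obtain x where *: "EQ A n (Cod C f) x x" "u = em n (Cod C f) x" using carrier_objD by blast
   then show "res (deg obj n) f u \<in> carrier (sect (deg obj n) (Dom C f))"
    using f by (simp add: K_def[symmetric] rs_def[symmetric] rs_em)
  qed
  fix u assume u: "u \<in> carrier (sect (deg obj n) (Cod C f))"
  then obtain x where x: "EQ A n (Cod C f) x x" "u = em n (Cod C f) x" using carrier_objD by blast
  show "res (deg obj n) f (u \<oplus>\<^bsub>sect (deg obj n) (Cod C f)\<^esub> v) =
   res (deg obj n) f u \<oplus>\<^bsub>sect (deg obj n) (Dom C f)\<^esub> res (deg obj n) f v"
   if v: "v \<in> carrier (sect (deg obj n) (Cod C f))" for v
  proof -
   from v obtain y where y: "EQ A n (Cod C f) y y" "v = em n (Cod C f) y"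
    using carrier_objD by blast
   then show ?thesis using x c d f em_cong[OF d RS_AD[OF f x(1) y(1)]]
    by (simp add: pl_def[symmetric] rs_def[symmetric] rs_em pl_em)
  qed
  show "res (deg obj n) f (a \<odot>\<^bsub>sect (deg obj n) (Cod C f)\<^esub> u) =
   rres R f a \<odot>\<^bsub>sect (deg obj n) (Dom C f)\<^esub> res (deg obj n) f u" if a: "a \<in> \<R> (Cod C f)" for a
   using x c d f a rres_closed[OF f a] em_cong[OF d RS_SM[OF f a x(1)]]
   by (simp add: sm_def[symmetric] rs_def[symmetric] rs_em sm_em)
 next
  fix f g u assume f: "f \<in> Arr C" and g: "g \<in> Arr C" and fg: "Dom C g = Cod C f"
   and u: "u \<in> carrier (sect (deg obj n) (Cod C g))"
  then obtain x where x: "EQ A n (Cod C g) x x" "u = em n (Cod C g) x" using carrier_objD by blast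
  have gf: "g \<cdot> f \<in> Arr C" "Dom C (g \<cdot> f) = Dom C f" "Cod C (g \<cdot> f) = Cod C g"
   using Cmp_in_Hom[of f "Dom C f" "Cod C f" g "Cod C g"] f g fg by (auto simp: Hom_def)
  have "EQ A n (Cod C f) (RS A n g x) (RS A n g x)" using RS_cong[OF g x(1)] fg by simp
  then show "res (deg obj n) (g \<cdot> f) u = res (deg obj n) f (res (deg obj n) g u)"
   using x f g fg gf em_cong[OF Dom_closed[OF f] RS_Cmp[OF f g fg x(1)]] rs_em[of "g \<cdot> f" n x]
    rs_em[of f n "RS A n g x"] rs_em[of g n x]
   by (simp add: rs_def[symmetric])
 qed
 show ?thesis
  unfolding Obj_ch Hom_psh_cat module_presheaf_map_def semilinear_def
 proof (intro allI conjI ballI mp)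
  fix n
  show "bdry obj n = (deg obj n, deg obj (n - 1), app (bdry obj n))" by (simp add: ob_def app_def)
  show "app (bdry obj n) \<in> extensional (Obj C)" by (simp add: ob_def app_def)
  fix c assume c: "c \<in> Obj C"
  show "app (bdry obj n) c \<in> extensional (carrier (sect (deg obj n) c))"
   using c by (simp add: ob_def app_def ob_deg_def)
  show "app (bdry obj n) c \<in> carrier (sect (deg obj n) c) \<rightarrow> carrier (sect (deg obj (n - 1)) c)"
  proof (rule Pi_I)
   fix u assume "u \<in> carrier (sect (deg obj n) c)"
   then obtain x where "EQ A n c x x" "u = em n c x" using carrier_objD by blast
   then show "app (bdry obj n) c u \<in> carrier (sect (deg obj (n - 1)) c)"
    using c by (simp add: bd_def[symmetric] K_def[symmetric] bd_em)
  qed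
  fix u assume "u \<in> carrier (sect (deg obj n) c)"
  then obtain x where x: "EQ A n c x x" "u = em n c x" using carrier_objD by blast
  show "app (bdry obj n) c (u \<oplus>\<^bsub>sect (deg obj n) c\<^esub> v) =
   app (bdry obj n) c u \<oplus>\<^bsub>sect (deg obj (n - 1)) c\<^esub> app (bdry obj n) c v"
   if v: "v \<in> carrier (sect (deg obj n) c)" for v
  proof -
   from v obtain y where y: "EQ A n c y y" "v = em n c y" using carrier_objD by blast
   then show ?thesis using x c em_cong[OF c BD_AD[OF c x(1) y(1)]]
    by (simp add: pl_def[symmetric] bd_def[symmetric] pl_em bd_em)
  qed
  show "app (bdry obj n) c (a \<odot>\<^bsub>sect (deg obj n) c\<^esub> u) = a \<odot>\<^bsub>sect (deg obj (n - 1)) c\<^esub> app (bdry obj n) c u"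
   if a: "a \<in> \<R> c" for a
   using x c a em_cong[OF c BD_SM[OF c a x(1)]] by (simp add: sm_def[symmetric] bd_def[symmetric] sm_em bd_em)
 next
  fix n c u assume c: "c \<in> Obj C" and u: "u \<in> K obj n c"
  from u obtain x where x: "EQ A n c x x" "u = em n c x" using K_objD by blast
  then show "bd obj (n - 1) c (bd obj n c u) = zr obj (n - 2) c"
   using c em_cong[OF c BD_BD[OF c x(1)]] by (simp add: bd_em zr_em)
 next
  fix n f u assume f: "f \<in> Arr C" and u: "u \<in> carrier (sect (deg obj n) (Cod C f))"
  then obtain x where x: "EQ A n (Cod C f) x x" "u = em n (Cod C f) x" using carrier_objD by blast
  show "app (bdry obj n) (Dom C f) (res (deg obj n) f u) = res (deg obj (n - 1)) f (app (bdry obj n) (Cod C f) u)"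
   using x f Dom_closed[OF f] Cod_closed[OF f] em_cong[OF Dom_closed[OF f] BD_RS[OF f x(1)]]
   by (simp add: rs_def[symmetric] bd_def[symmetric] rs_em bd_em)
 qed
qed

lemma ng_em:
 assumes c: "c \<in> Obj C" and x: "EQ A n c x x" shows "ng obj n c (em n c x) = em n c (NG A n c x)"
proof -
 have "pl obj n c (em n c (NG A n c x)) (em n c x) = zr obj n c"
  using c x em_cong[OF c AD_NG[OF c x]] by (simp add: pl_em zr_em)
 then show ?thesis
  using ng_unique[OF obj_in_Obj c, of "em n c x" n "em n c (NG A n c x)"]
   pl_comm[OF obj_in_Obj c, of "em n c x" n "em n c (NG A n c x)"] c x by simp
qed

text \<open>Maps out are given on representatives; once the family respects \<open>EQ\<close>, the
  representative picked by \<open>rp\<close> does not matter.\<close>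

definition out :: "('o, 'a, 'r, 'u) psh_cplx => (int => 'o => 'v => 'u) => ('o, 'a, 'r, 'u) psh_cplx_arr" where
 "out Q \<phi> = mk obj Q (\<lambda>n c u. \<phi> n c (rp A n c u))"

lemma out_map:
 assumes Q: "Q \<in> Obj ch"
  and \<phi>: "!!n c x y. c \<in> Obj C ==> EQ A n c x y ==> \<phi> n c x = \<phi> n c y"
  "!!n c x. c \<in> Obj C ==> EQ A n c x x ==> \<phi> n c x \<in> K Q n c"
  "!!n c x y. c \<in> Obj C ==> EQ A n c x x ==> EQ A n c y y ==> \<phi> n c (AD A n c x y) = pl Q n c (\<phi> n c x) (\<phi> n c y)"
  "!!n c x a. c \<in> Obj C ==> EQ A n c x x ==> a \<in> \<R> c ==> \<phi> n c (SM A n c a x) = sm Q n c a (\<phi> n c x)"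
  "!!n c x. c \<in> Obj C ==> EQ A n c x x ==> \<phi> (n - 1) c (BD A n c x) = bd Q n c (\<phi> n c x)"
  "!!n f x. f \<in> Arr C ==> EQ A n (Cod C f) x x ==> \<phi> n (Dom C f) (RS A n f x) = rs Q n f (\<phi> n (Cod C f) x)"
 shows "out Q \<phi> \<in> Hom ch obj Q"
  and "!!n c x. c \<in> Obj C ==> EQ A n c x x ==> ev (out Q \<phi>) n c (em n c x) = \<phi> n c x"
proof -
 have e: "\<phi> n c (rp A n c (em n c x)) = \<phi> n c x" if "c \<in> Obj C" "EQ A n c x x" for n c x
  using \<phi>(1)[OF that(1) rp_em[OF that]] .
 have "hm obj Q (\<lambda>n c u. \<phi> n c (rp A n c u))"
 proof (rule hmI)
  fix n c u assume c: "c \<in> Obj C" and u: "u \<in> K obj n c"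
  then obtain x where x: "EQ A n c x x" "u = em n c x" using K_objD by blast
  show "\<phi> n c (rp A n c u) \<in> K Q n c" using x c \<phi>(2) e by simp
  show "\<phi> n c (rp A n c (sm obj n c a u)) = sm Q n c a (\<phi> n c (rp A n c u))" if "a \<in> \<R> c" for a
   using x c e that \<phi>(4) by (simp add: sm_em)
  show "\<phi> (n - 1) c (rp A (n - 1) c (bd obj n c u)) = bd Q n c (\<phi> n c (rp A n c u))"
   using x c e \<phi>(5) by (simp add: bd_em)
  show "\<phi> n c (rp A n c (pl obj n c u v)) = pl Q n c (\<phi> n c (rp A n c u)) (\<phi> n c (rp A n c v))"
   if v: "v \<in> K obj n c" for v
  proof -
   obtain y where y: "EQ A n c y y" "v = em n c y" using K_objD[OF v] by blast
   then show ?thesis using x c e \<phi>(3) by (simp add: pl_em)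
  qed
 next
  fix n f u assume f: "f \<in> Arr C" and u: "u \<in> K obj n (Cod C f)"
  then obtain x where x: "EQ A n (Cod C f) x x" "u = em n (Cod C f) x" using K_objD by blast
  then show "\<phi> n (Dom C f) (rp A n (Dom C f) (rs obj n f u)) = rs Q n f (\<phi> n (Cod C f) (rp A n (Cod C f) u))"
   using f e \<phi>(6) Dom_closed[OF f] Cod_closed[OF f] by (simp add: rs_em)
 qed
 then show "out Q \<phi> \<in> Hom ch obj Q" unfolding out_def by (rule mk_in_Hom[OF obj_in_Obj Q])
 show "ev (out Q \<phi>) n c (em n c x) = \<phi> n c x" if "c \<in> Obj C" "EQ A n c x x" for n c x
  unfolding out_def using that e by simp
qed

definition into :: "('o, 'a, 'r, 'u) psh_cplx => (int => 'o => 'u => 'v) => ('o, 'a, 'r, 'u) psh_cplx_arr" where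
 "into Q \<phi> = mk Q obj (\<lambda>n c x. em n c (\<phi> n c x))"

lemma into_map:
 assumes Q: "Q \<in> Obj ch"
  and \<phi>: "!!n c x. c \<in> Obj C ==> x \<in> K Q n c ==> EQ A n c (\<phi> n c x) (\<phi> n c x)"
  "!!n c x y. c \<in> Obj C ==> x \<in> K Q n c ==> y \<in> K Q n c ==> EQ A n c (\<phi> n c (pl Q n c x y)) (AD A n c (\<phi> n c x) (\<phi> n c y))"
  "!!n c x a. c \<in> Obj C ==> x \<in> K Q n c ==> a \<in> \<R> c ==> EQ A n c (\<phi> n c (sm Q n c a x)) (SM A n c a (\<phi> n c x))"
  "!!n c x. c \<in> Obj C ==> x \<in> K Q n c ==> EQ A (n - 1) c (\<phi> (n - 1) c (bd Q n c x)) (BD A n c (\<phi> n c x))"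
  "!!n f x. f \<in> Arr C ==> x \<in> K Q n (Cod C f) ==> EQ A n (Dom C f) (\<phi> n (Dom C f) (rs Q n f x)) (RS A n f (\<phi> n (Cod C f) x))"
 shows "into Q \<phi> \<in> Hom ch Q obj"
  and "!!n c x. c \<in> Obj C ==> x \<in> K Q n c ==> ev (into Q \<phi>) n c x = em n c (\<phi> n c x)"
proof -
 have "hm Q obj (\<lambda>n c x. em n c (\<phi> n c x))"
  by (rule hmI) (simp_all add: \<phi>(1) pl_em sm_em bd_em rs_em em_cong[OF _ \<phi>(2)] em_cong[OF _ \<phi>(3)]
    em_cong[OF _ \<phi>(4)] em_cong[OF Dom_closed \<phi>(5)] Cod_closed)
 then show "into Q \<phi> \<in> Hom ch Q obj" unfolding into_def by (rule mk_in_Hom[OF Q obj_in_Obj])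
 show "ev (into Q \<phi>) n c x = em n c (\<phi> n c x)" if "c \<in> Obj C" "x \<in> K Q n c" for n c x
  unfolding into_def using that by simp
qed

end

text \<open>
 Colimits and cell attachments are constructed as complexes presented by generators and relations.
 \<open>Gn j n c x\<close> stands for the element \<open>x\<close> of the \<open>j\<close>-th given complex, and \<open>Cl n c t y\<close> for a free
 generator of degree \<open>n + 1\<close> at \<open>c\<close>; the term \<open>t\<close> is its intended boundary, and \<open>y\<close> the intended image
 in the target of a factorization.
\<close>

datatype ('j, 'o, 'a, 'r, 'u) tm =
  Gn 'j int 'o 'u | Cl int 'o "('j, 'o, 'a, 'r, 'u) tm" 'u | Zr
 | Ad "('j, 'o, 'a, 'r, 'u) tm" "('j, 'o, 'a, 'r, 'u) tm" | Ng "('j, 'o, 'a, 'r, 'u) tm"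
 | Sm 'r "('j, 'o, 'a, 'r, 'u) tm" | Rs 'a "('j, 'o, 'a, 'r, 'u) tm" | Bd "('j, 'o, 'a, 'r, 'u) tm"

text \<open>Every element has a flat representative, and there are only few flat terms.\<close>

primrec flat :: "('j, 'o, 'a, 'r, 'u) tm => bool" where
 "flat (Gn j n c x) = True"
| "flat (Cl n c t y) = True"
| "flat Zr = True"
| "flat (Ad s t) = (flat s & flat t)"
| "flat (Ng t) = flat t"
| "flat (Sm a t) = flat t"
| "flat (Rs f t) = (\<exists>n c s y. t = Cl n c s y)"
| "flat (Bd t) = flat t"

section \<open>Presentations by generators and relations\<close>

context psh_setup begin

text \<open>Typing of terms by degree and object. \<open>Zr\<close> has every type over an object of
  \<open>C\<close>, so this is a relation and not a function. A cell lies one degree above its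
  boundary term, and membership in \<open>D\<close> is what is checked: the boundary term is not
  inspected.\<close>

primrec ok :: "'j set => ('j => ('o, 'a, 'r, 'u) psh_cplx) => ('j, 'o, 'a, 'r, 'u) tm set =>
  ('j, 'o, 'a, 'r, 'u) tm => int => 'o => bool" where
 "ok Jo X D (Gn j m d x) = (\<lambda>n c. m = n & d = c & c \<in> Obj C & j \<in> Jo & x \<in> K (X j) n c)"
| "ok Jo X D (Cl m d t y) = (\<lambda>n c. Cl m d t y \<in> D & n = m + 1 & d = c & c \<in> Obj C)"
| "ok Jo X D Zr = (\<lambda>n c. c \<in> Obj C)"
| "ok Jo X D (Ad s t) = (\<lambda>n c. ok Jo X D s n c & ok Jo X D t n c)"
| "ok Jo X D (Ng t) = ok Jo X D t"
| "ok Jo X D (Sm a t) = (\<lambda>n c. a \<in> \<R> c & ok Jo X D t n c)"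
| "ok Jo X D (Rs f t) = (\<lambda>n c. f \<in> Arr C & Dom C f = c & ok Jo X D t n (Cod C f))"
| "ok Jo X D (Bd t) = (\<lambda>n c. ok Jo X D t (n + 1) c)"

lemma ok_Obj: "ok Jo X D t n c ==> c \<in> Obj C"
 by (induction t arbitrary: n c) (auto simp: Dom_closed)

lemma ok_mono: "ok Jo X D t n c ==> D \<subseteq> D' ==> ok Jo X D' t n c"
 by (induction t arbitrary: n c) auto

text \<open>Provable equality: the congruence generated by the laws of complexes of presheaves, by
  the relations that make each \<open>Gn j\<close> a map, and by the extra relations
  \<open>E\<close>. Derivations are finite trees, which later confines each of them to finitely many
  rounds of attachments.\<close>

inductive teq :: "'j set => ('j => ('o, 'a, 'r, 'u) psh_cplx) => ('j, 'o, 'a, 'r, 'u) tm set =>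
  (int => 'o => ('j, 'o, 'a, 'r, 'u) tm => ('j, 'o, 'a, 'r, 'u) tm => bool) =>
  int => 'o => ('j, 'o, 'a, 'r, 'u) tm => ('j, 'o, 'a, 'r, 'u) tm => bool"
 for Jo X D E where
 te_refl: "ok Jo X D t n c ==> teq Jo X D E n c t t"
| te_sym: "teq Jo X D E n c t s ==> teq Jo X D E n c s t"
| te_trans: "teq Jo X D E n c t s ==> teq Jo X D E n c s u ==> teq Jo X D E n c t u"
| te_ext: "E n c t s ==> ok Jo X D t n c ==> ok Jo X D s n c ==> teq Jo X D E n c t s"
| te_gn_pl: "j \<in> Jo ==> c \<in> Obj C ==> x \<in> K (X j) n c ==> y \<in> K (X j) n c ==>
  teq Jo X D E n c (Gn j n c (pl (X j) n c x y)) (Ad (Gn j n c x) (Gn j n c y))"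
| te_gn_sm: "j \<in> Jo ==> c \<in> Obj C ==> a \<in> \<R> c ==> x \<in> K (X j) n c ==>
  teq Jo X D E n c (Gn j n c (sm (X j) n c a x)) (Sm a (Gn j n c x))"
| te_gn_rs: "j \<in> Jo ==> f \<in> Arr C ==> x \<in> K (X j) n (Cod C f) ==>
  teq Jo X D E n (Dom C f) (Gn j n (Dom C f) (rs (X j) n f x)) (Rs f (Gn j n (Cod C f) x))"
| te_gn_bd: "j \<in> Jo ==> c \<in> Obj C ==> x \<in> K (X j) n c ==>
  teq Jo X D E (n - 1) c (Gn j (n - 1) c (bd (X j) n c x)) (Bd (Gn j n c x))"
| te_ad: "teq Jo X D E n c t t' ==> teq Jo X D E n c s s' ==> teq Jo X D E n c (Ad t s) (Ad t' s')"
| te_ng: "teq Jo X D E n c t t' ==> teq Jo X D E n c (Ng t) (Ng t')"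
| te_sm: "a \<in> \<R> c ==> teq Jo X D E n c t t' ==> teq Jo X D E n c (Sm a t) (Sm a t')"
| te_rs: "f \<in> Arr C ==> teq Jo X D E n (Cod C f) t t' ==> teq Jo X D E n (Dom C f) (Rs f t) (Rs f t')"
| te_bd: "teq Jo X D E n c t t' ==> teq Jo X D E (n - 1) c (Bd t) (Bd t')"
| te_assoc: "ok Jo X D s n c ==> ok Jo X D t n c ==> ok Jo X D u n c ==>
  teq Jo X D E n c (Ad (Ad s t) u) (Ad s (Ad t u))"
| te_comm: "ok Jo X D s n c ==> ok Jo X D t n c ==> teq Jo X D E n c (Ad s t) (Ad t s)"
| te_zr: "ok Jo X D t n c ==> teq Jo X D E n c (Ad Zr t) t"
| te_inv: "ok Jo X D t n c ==> teq Jo X D E n c (Ad (Ng t) t) Zr"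
| te_sm_add: "a \<in> \<R> c ==> b \<in> \<R> c ==> ok Jo X D t n c ==>
  teq Jo X D E n c (Sm (a \<oplus>\<^bsub>rsect R c\<^esub> b) t) (Ad (Sm a t) (Sm b t))"
| te_sm_ad: "a \<in> \<R> c ==> ok Jo X D s n c ==> ok Jo X D t n c ==>
  teq Jo X D E n c (Sm a (Ad s t)) (Ad (Sm a s) (Sm a t))"
| te_sm_mult: "a \<in> \<R> c ==> b \<in> \<R> c ==> ok Jo X D t n c ==>
  teq Jo X D E n c (Sm (a \<otimes>\<^bsub>rsect R c\<^esub> b) t) (Sm a (Sm b t))"
| te_sm_one: "ok Jo X D t n c ==> teq Jo X D E n c (Sm \<one>\<^bsub>rsect R c\<^esub> t) t"
| te_rs_ad: "f \<in> Arr C ==> ok Jo X D s n (Cod C f) ==> ok Jo X D t n (Cod C f) ==>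
  teq Jo X D E n (Dom C f) (Rs f (Ad s t)) (Ad (Rs f s) (Rs f t))"
| te_rs_sm: "f \<in> Arr C ==> a \<in> \<R> (Cod C f) ==> ok Jo X D t n (Cod C f) ==>
  teq Jo X D E n (Dom C f) (Rs f (Sm a t)) (Sm (rres R f a) (Rs f t))"
| te_rs_zr: "f \<in> Arr C ==> teq Jo X D E n (Dom C f) (Rs f Zr) Zr"
| te_rs_ng: "f \<in> Arr C ==> ok Jo X D t n (Cod C f) ==>
  teq Jo X D E n (Dom C f) (Rs f (Ng t)) (Ng (Rs f t))"
| te_rs_id: "ok Jo X D t n c ==> teq Jo X D E n c (Rs (Idn C c) t) t"
| te_rs_cmp: "f \<in> Arr C ==> g \<in> Arr C ==> Dom C g = Cod C f ==> ok Jo X D t n (Cod C g) ==>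
  teq Jo X D E n (Dom C f) (Rs (g \<cdot> f) t) (Rs f (Rs g t))"
| te_bd_ad: "ok Jo X D s n c ==> ok Jo X D t n c ==>
  teq Jo X D E (n - 1) c (Bd (Ad s t)) (Ad (Bd s) (Bd t))"
| te_bd_sm: "a \<in> \<R> c ==> ok Jo X D t n c ==> teq Jo X D E (n - 1) c (Bd (Sm a t)) (Sm a (Bd t))"
| te_bd_rs: "f \<in> Arr C ==> ok Jo X D t n (Cod C f) ==>
  teq Jo X D E (n - 1) (Dom C f) (Bd (Rs f t)) (Rs f (Bd t))"
| te_bd_bd: "ok Jo X D t n c ==> teq Jo X D E (n - 2) c (Bd (Bd t)) Zr"

lemma Cmp_Arr: "f \<in> Arr C ==> g \<in> Arr C ==> Dom C g = Cod C f ==>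
  g \<cdot> f \<in> Arr C & Dom C (g \<cdot> f) = Dom C f & Cod C (g \<cdot> f) = Cod C g"
 using Cmp_in_Hom[of f "Dom C f" "Cod C f" g "Cod C g"] by (auto simp: Hom_def)

lemma Idn_Arr [simp]: "c \<in> Obj C ==> Idn C c \<in> Arr C" "c \<in> Obj C ==> Dom C (Idn C c) = c"
  "c \<in> Obj C ==> Cod C (Idn C c) = c"
 using Idn_in_Hom[of c] by (auto simp: Hom_def)

lemma R_closed [simp]: "c \<in> Obj C ==> a \<in> \<R> c ==> b \<in> \<R> c ==> a \<oplus>\<^bsub>rsect R c\<^esub> b \<in> \<R> c"
 "c \<in> Obj C ==> a \<in> \<R> c ==> b \<in> \<R> c ==> a \<otimes>\<^bsub>rsect R c\<^esub> b \<in> \<R> c"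
 "c \<in> Obj C ==> \<one>\<^bsub>rsect R c\<^esub> \<in> \<R> c" "c \<in> Obj C ==> \<zero>\<^bsub>rsect R c\<^esub> \<in> \<R> c"
 using ring.ring_simprules[OF ring_R[of c]] by auto

lemma teq_mono:
 assumes "teq Jo X D E n c t s" "D \<subseteq> D'" "!!n c t s. E n c t s ==> E' n c t s"
 shows "teq Jo X D' E' n c t s"
 using assms(1)
proof (induction rule: teq.induct)
 case te_sym then show ?case by (blast intro: teq.te_sym)
next
 case te_trans then show ?case by (blast intro: teq.te_trans)
qed (auto intro: teq.intros ok_mono[OF _ assms(2)] assms(3))

text \<open>Interpretation of terms in \<open>Q\<close>, with values \<open>\<kappa>\<close> for
  generators and cells. Degree and object are passed along, since \<open>Zr\<close> does not carry
  them.\<close>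

primrec evt :: "('o, 'a, 'r, 'u) psh_cplx => (int => 'o => ('j, 'o, 'a, 'r, 'u) tm => 'u) =>
  ('j, 'o, 'a, 'r, 'u) tm => int => 'o => 'u" where
 "evt Q \<kappa> (Gn j m d x) = (\<lambda>n c. \<kappa> n c (Gn j m d x))"
| "evt Q \<kappa> (Cl m d t y) = (\<lambda>n c. \<kappa> n c (Cl m d t y))"
| "evt Q \<kappa> Zr = zr Q"
| "evt Q \<kappa> (Ad s t) = (\<lambda>n c. pl Q n c (evt Q \<kappa> s n c) (evt Q \<kappa> t n c))"
| "evt Q \<kappa> (Ng t) = (\<lambda>n c. ng Q n c (evt Q \<kappa> t n c))"
| "evt Q \<kappa> (Sm a t) = (\<lambda>n c. sm Q n c a (evt Q \<kappa> t n c))"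
| "evt Q \<kappa> (Rs f t) = (\<lambda>n c. rs Q n f (evt Q \<kappa> t n (Cod C f)))"
| "evt Q \<kappa> (Bd t) = (\<lambda>n c. bd Q (n + 1) c (evt Q \<kappa> t (n + 1) c))"

definition psd :: "'j set => ('j => ('o, 'a, 'r, 'u) psh_cplx) => ('j, 'o, 'a, 'r, 'u) tm set =>
  (int => 'o => ('j, 'o, 'a, 'r, 'u) tm => ('j, 'o, 'a, 'r, 'u) tm => bool) =>
  ('o, 'a, 'r, ('j, 'o, 'a, 'r, 'u) tm) sd" where
 "psd Jo X D E = \<lparr>EQ = teq Jo X D E, AD = (\<lambda>n c. Ad), ZR = (\<lambda>n c. Zr), NG = (\<lambda>n c. Ng), SM = (\<lambda>n c. Sm),
  RS = (\<lambda>n. Rs), BD = (\<lambda>n c. Bd)\<rparr>"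

end

locale pres = psh_setup C \<mu> R S for C :: "('o, 'a) cat" (structure) and \<mu> :: "'u rel"
  and R :: "('o, 'a, 'r) rpsh" and S :: "'o set" +
 fixes Jo :: "'j set" and X :: "'j => ('o, 'a, 'r, 'u) psh_cplx" and D :: "('j, 'o, 'a, 'r, 'u) tm set"
  and E :: "int => 'o => ('j, 'o, 'a, 'r, 'u) tm => ('j, 'o, 'a, 'r, 'u) tm => bool"
 assumes XO: "!!j. j \<in> Jo ==> X j \<in> Obj ch" and Jo_small: "small \<mu> Jo" and D_small: "small \<mu> D"
begin

abbreviation okk where "okk \<equiv> ok Jo X D"
abbreviation te where "te \<equiv> teq Jo X D E"

lemma te_ok: "te n c t s ==> okk t n c & okk s n c"
proof (induction rule: teq.induct)
 case (te_rs_id t n c)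
 then show ?case using ok_Obj[OF te_rs_id] by simp
qed (auto simp: XO Dom_closed Cod_closed rres_closed Cmp_Arr dest: ok_Obj)

lemma te_iff: "te n c t t \<longleftrightarrow> okk t n c"
 using te_ok te_refl by blast

text \<open>Restrictions are pushed inwards: they pass through the operations, are absorbed by
  sections of the given complexes, and compose with other restrictions until only cells carry them.
  Intermediate objects of \<open>C\<close> disappear on the way.\<close>

lemma flat_rs:
 assumes "okk t n c" "f \<in> Arr C" "Cod C f = c"
 shows "\<exists>s. flat s & te n (Dom C f) (Rs f t) s"
 using assms
proof (induction t arbitrary: n c f)
 case (Gn j m d x)
 then show ?case using te_sym[OF te_gn_rs[of j Jo f x X n D E]] by (intro exI[of _ "Gn j n (Dom C f) (rs (X j) n f x)"]) auto
next
 case (Cl m d t y)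
 then show ?case by (intro exI[of _ "Rs f (Cl m d t y)"]) (auto intro!: te_refl)
next
 case Zr
 then show ?case using te_rs_zr by (intro exI[of _ Zr]) auto
next
 case (Ad s t)
 then obtain s' t' where "flat s'" "te n (Dom C f) (Rs f s) s'" "flat t'" "te n (Dom C f) (Rs f t) t'"
  by (metis ok.simps(4))
 moreover have "te n (Dom C f) (Rs f (Ad s t)) (Ad (Rs f s) (Rs f t))"
  using Ad.prems te_rs_ad by auto
 ultimately show ?case using te_trans te_ad by (intro exI[of _ "Ad s' t'"]) (simp, blast)
next
 case (Ng t)
 then obtain t' where "flat t'" "te n (Dom C f) (Rs f t) t'" by (metis ok.simps(5))
 moreover have "te n (Dom C f) (Rs f (Ng t)) (Ng (Rs f t))" using Ng.prems te_rs_ng by auto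
 ultimately show ?case using te_trans te_ng by (intro exI[of _ "Ng t'"]) (simp, blast)
next
 case (Sm a t)
 then obtain t' where "flat t'" "te n (Dom C f) (Rs f t) t'" by (metis ok.simps(6))
 moreover have "te n (Dom C f) (Rs f (Sm a t)) (Sm (rres R f a) (Rs f t))" using Sm.prems te_rs_sm by auto
 moreover have "rres R f a \<in> \<R> (Dom C f)" using Sm.prems rres_closed by auto
 ultimately show ?case using te_trans te_sm by (intro exI[of _ "Sm (rres R f a) t'"]) (simp, blast)
next
 case (Rs g t)
 then have g: "g \<in> Arr C" "Dom C g = Cod C f" "okk t n (Cod C g)" by auto
 from Rs.IH[OF g(3), of "g \<cdot> f"] Cmp_Arr[OF Rs.prems(2) g(1,2)]
 obtain t' where "flat t'" "te n (Dom C f) (Rs (g \<cdot> f) t) t'" by auto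
 then show ?case using te_trans te_sym te_rs_cmp[OF Rs.prems(2) g(1,2,3)] by blast
next
 case (Bd t)
 then obtain t' where "flat t'" "te (n + 1) (Dom C f) (Rs f t) t'" by (metis ok.simps(8))
 moreover have "te n (Dom C f) (Bd (Rs f t)) (Rs f (Bd t))"
  using Bd.prems te_bd_rs[of f Jo X D t "n + 1" E] by auto
 moreover have "te n (Dom C f) (Bd (Rs f t)) (Bd t')"
  using te_bd[of Jo X D E "n + 1" "Dom C f" "Rs f t" t'] calculation by simp
 ultimately show ?case using te_trans te_sym by (intro exI[of _ "Bd t'"]) (simp, blast)
qed

lemma flat_repr: assumes "okk t n c" shows "\<exists>s. flat s & te n c t s"
proof -
 \<comment> \<open>A restriction along the identity is inserted only to be pushed inwards.\<close>
 obtain s where s: "flat s" "te n c (Rs (Idn C c) t) s"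
  using flat_rs[OF assms, of "Idn C c"] ok_Obj[OF assms] by auto
 then show ?thesis using te_trans[OF te_sym[OF te_rs_id[OF assms]] s(2)] by blast
qed

text \<open>The arrows out of \<open>c\<close> need not form a small set, but in a flat term
  restrictions act on cells only, and a cell fixes the target of the arrow. The leaves of flat terms
  at \<open>c\<close> therefore come from a small set, and terms are built from leaves by finitely
  many operations and scalars.\<close>

lemma small_flat:
 assumes c: "c \<in> Obj C" shows "small \<mu> {t. flat t & (\<exists>n. okk t n c)}"
proof (rule small_inductive_closure[OF U, where m = size])
 let ?B = "insert Zr ((\<Union>j\<in>Jo. \<Union>n. Gn j n c ` K (X j) n c) \<union> D \<union>
  (\<Union>e\<in>D. \<Union>d\<in>{d \<in> Obj C. \<exists>m t y. e = Cl m d t y}. (\<lambda>f. Rs f e) ` Hom C c d))"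
 show "small \<mu> ?B"
 proof -
  \<comment> \<open>The cell \<open>e\<close> determines \<open>d\<close>, so there is at most
    one.\<close>
  have "small \<mu> {d \<in> Obj C. \<exists>m t y. e = Cl m d t y}" for e
   by (rule small_finite[OF U]) (cases e, auto)
  then have "small \<mu> (\<Union>e\<in>D. \<Union>d\<in>{d \<in> Obj C. \<exists>m t y. e = Cl m d t y}. (\<lambda>f. Rs f e) ` Hom C c d)"
   using c by (intro small_UN[OF U D_small] small_UN[OF U] small_image[OF U] small_Hom) auto
  moreover have "small \<mu> (\<Union>j\<in>Jo. \<Union>n. Gn j n c ` K (X j) n c)"
   using c XO by (intro small_UN[OF U Jo_small] small_UN[OF U] small_image[OF U] small_K) (auto intro: small_countable[OF U])
  ultimately show ?thesis
   using small_Un[OF U small_finite[OF U, of "{Zr}"]] small_Un[OF U _ D_small] small_Un[OF U] by auto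
 qed
 let ?P = "{\<lambda>y z. Ad y z, \<lambda>y z. Ng y, \<lambda>y z. Bd y} \<union> (\<lambda>a. \<lambda>y z. Sm a y) ` \<R> c"
 show "small \<mu> ?P" by (rule small_Un[OF U small_finite[OF U] small_image[OF U small_R[OF c]]]) simp
 fix x assume x: "x \<in> {t. flat t & (\<exists>n. okk t n c)}"
 show "x \<in> ?B \<or> (\<exists>f\<in>?P. \<exists>y\<in>{t. flat t & (\<exists>n. okk t n c)}. \<exists>z\<in>{t. flat t & (\<exists>n. okk t n c)}.
   size y < size x & size z < size x & x = f y z)"
 proof (cases x)
  case (Rs f t)
  then obtain m d s y where t: "t = Cl m d s y" "t \<in> D" "d \<in> Obj C" "f \<in> Hom C c d"
   using x by (auto simp: Hom_def)
  then have "x \<in> (\<Union>e\<in>D. \<Union>d\<in>{d \<in> Obj C. \<exists>m t y. e = Cl m d t y}. (\<lambda>f. Rs f e) ` Hom C c d)"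
   unfolding Rs by blast
  then show ?thesis by blast
 next
  case (Ad s t)
  then show ?thesis using x by (intro disjI2 bexI[of _ "\<lambda>y z. Ad y z"] bexI[of _ s] bexI[of _ t]) auto
 next
  case (Ng t)
  then show ?thesis using x by (intro disjI2 bexI[of _ "\<lambda>y z. Ng y"] bexI[of _ t]) auto
 next
  case (Bd t)
  then show ?thesis using x by (intro disjI2 bexI[of _ "\<lambda>y z. Bd y"] bexI[of _ t]) auto
 next
  case (Sm a t)
  then show ?thesis using x by (intro disjI2 bexI[of _ "\<lambda>y z. Sm a y"] bexI[of _ t]) auto
 qed (use x in auto)
qed

sublocale sdata C \<mu> R S "psd Jo X D E"
proof
 fix c n assume c: "c \<in> Obj C"
 have "cls (psd Jo X D E) n c ` {x. EQ (psd Jo X D E) n c x x} \<subseteq> cls (psd Jo X D E) n c ` {t. flat t & (\<exists>n. okk t n c)}"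
 proof (clarify)
  fix t assume "EQ (psd Jo X D E) n c t t"
  then have "okk t n c" by (simp add: psd_def te_iff)
  from flat_repr[OF this] obtain s where s: "flat s" "te n c t s" by blast
  then have "cls (psd Jo X D E) n c t = cls (psd Jo X D E) n c s"
   unfolding cls_def psd_def using te_sym te_trans by (auto; blast)
  then show "cls (psd Jo X D E) n c t \<in> cls (psd Jo X D E) n c ` {t. flat t & (\<exists>n. okk t n c)}"
   using s te_ok by blast
 qed
 then show "small \<mu> (cls (psd Jo X D E) n c ` {x. EQ (psd Jo X D E) n c x x})"
  by (rule small_mono[OF U small_image[OF U small_flat[OF c]]])
qed (unfold psd_def sd.simps te_iff,
  ((rule te_sym te_ad te_ng te_sm te_rs te_bd te_assoc te_comm te_zr te_inv te_sm_add te_sm_ad te_sm_mult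
   te_sm_one te_rs_ad te_rs_sm te_rs_id te_rs_cmp te_bd_ad te_bd_sm te_bd_rs te_bd_bd; assumption)
  | (erule te_trans; assumption) | (simp; fail))+)

lemma EQ_psd: "EQ (psd Jo X D E) = te" "AD (psd Jo X D E) = (\<lambda>n c. Ad)" "ZR (psd Jo X D E) = (\<lambda>n c. Zr)"
 "NG (psd Jo X D E) = (\<lambda>n c. Ng)" "SM (psd Jo X D E) = (\<lambda>n c. Sm)" "RS (psd Jo X D E) = (\<lambda>n. Rs)"
 "BD (psd Jo X D E) = (\<lambda>n c. Bd)"
 by (simp_all add: psd_def)

text \<open>The data of a map from the presented complex to \<open>Q\<close>: a chain map on each
  given complex and a value for each cell. The value of a cell is tied to its boundary term only as
  far as \<open>E\<close> says so.\<close>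

definition model :: "('o, 'a, 'r, 'u) psh_cplx => (int => 'o => ('j, 'o, 'a, 'r, 'u) tm => 'u) => bool" where
 "model Q \<kappa> \<longleftrightarrow> Q \<in> Obj ch & (\<forall>j\<in>Jo. hm (X j) Q (\<lambda>n c x. \<kappa> n c (Gn j n c x))) &
  (\<forall>m d t y. Cl m d t y \<in> D --> d \<in> Obj C --> \<kappa> (m + 1) d (Cl m d t y) \<in> K Q (m + 1) d) &
  (\<forall>n c t s. E n c t s --> okk t n c --> okk s n c --> evt Q \<kappa> t n c = evt Q \<kappa> s n c)"

lemma evt_closed:
 assumes "model Q \<kappa>" "okk t n c" shows "evt Q \<kappa> t n c \<in> K Q n c"
 using assms(2)
proof (induction t arbitrary: n c)
 case (Bd t)
 then show ?case using assms(1) ok_Obj[OF Bd.prems] by (auto simp: model_def)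
qed (use assms(1) in \<open>auto simp: model_def hm_def dest: ok_Obj\<close>)

text \<open>Soundness by induction on the derivation: every rule holds in the complex
  \<open>Q\<close>, and the relations \<open>E\<close> hold by the definition of a model.\<close>

lemma evt_sound:
 assumes M: "model Q \<kappa>" and "te n c t s" shows "evt Q \<kappa> t n c = evt Q \<kappa> s n c"
proof -
 have Q: "Q \<in> Obj ch" using M by (simp add: model_def)
 note cl = evt_closed[OF M]
 from assms(2) show ?thesis
 proof (induction rule: teq.induct)
  case (te_ext n c t s) then show ?case using M by (auto simp: model_def)
 next
  case (te_gn_pl j c x n y) then show ?case using M by (auto simp: model_def hm_def)
 next
  case (te_gn_sm j c a x n) then show ?case using M by (auto simp: model_def hm_def)
 next
  case (te_gn_rs j f x n) then show ?case using M by (auto simp: model_def hm_def)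
 next
  case (te_gn_bd j c x n) then show ?case using M by (auto simp: model_def hm_def)
 next
  case (te_assoc s n c t u) then show ?case using pl_assoc[OF Q ok_Obj cl cl cl] by simp
 next
  case (te_comm s n c t) then show ?case using pl_comm[OF Q ok_Obj cl cl] by simp
 next
  case (te_zr t n c) then show ?case using cl[OF te_zr] ok_Obj[OF te_zr] Q by simp
 next
  case (te_inv t n c) then show ?case using cl[OF te_inv] ok_Obj[OF te_inv] Q by simp
 next
  case (te_sm_add a c b t n) then show ?case using sm_add[OF Q ok_Obj _ _ cl] by simp
 next
  case (te_sm_ad a c s n t) then show ?case using sm_pl[OF Q ok_Obj _ cl cl] by simp
 next
  case (te_sm_mult a c b t n) then show ?case using sm_mult[OF Q ok_Obj _ _ cl] by simp
 next
  case (te_sm_one t n c) then show ?case using cl[OF te_sm_one] ok_Obj[OF te_sm_one] Q by simp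
 next
  case (te_rs_ad f s n t) then show ?case using rs_pl[OF Q _ cl cl] by simp
 next
  case (te_rs_sm f a t n) then show ?case using rs_sm[OF Q _ _ cl] by simp
 next
  case (te_rs_zr f n) then show ?case using Q by simp
 next
  case (te_rs_ng f t n) then show ?case using rs_ng[OF Q _ cl] by simp
 next
  case (te_rs_id t n c) then show ?case using cl[OF te_rs_id] ok_Obj[OF te_rs_id] Q by simp
 next
  case (te_rs_cmp f g t n) then show ?case using rs_rs[OF Q _ _ _ cl] Cmp_Arr by simp
 next
  case (te_bd_ad s n c t) then show ?case using bd_pl[OF Q ok_Obj cl cl] by simp
 next
  case (te_bd_sm a c t n) then show ?case using bd_sm[OF Q ok_Obj _ cl] by simp
 next
  case (te_bd_rs f t n) then show ?case using bd_rs[OF Q _ cl] by simp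
 next
  case (te_bd_bd t n c) then show ?case using cl[OF te_bd_bd] ok_Obj[OF te_bd_bd] bd_bd'[OF Q, of c "evt Q \<kappa> t n c" n] by simp
 qed auto
qed

definition ind :: "('o, 'a, 'r, 'u) psh_cplx => (int => 'o => ('j, 'o, 'a, 'r, 'u) tm => 'u) => ('o, 'a, 'r, 'u) psh_cplx_arr" where
 "ind Q \<kappa> = out Q (\<lambda>n c t. evt Q \<kappa> t n c)"

text \<open>The existence half of the universal property of a presentation.\<close>

lemma ind_map:
 assumes M: "model Q \<kappa>"
 shows "ind Q \<kappa> \<in> Hom ch obj Q" and "!!n c t. okk t n c ==> ev (ind Q \<kappa>) n c (em n c t) = evt Q \<kappa> t n c"
proof -
 have Q: "Q \<in> Obj ch" using M by (simp add: model_def)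
 note m = out_map[OF Q, of "\<lambda>n c t. evt Q \<kappa> t n c"]
 show "ind Q \<kappa> \<in> Hom ch obj Q"
  unfolding ind_def by (rule m(1)) (auto simp: EQ_psd te_iff evt_sound[OF M] evt_closed[OF M])
 show "ev (ind Q \<kappa>) n c (em n c t) = evt Q \<kappa> t n c" if "okk t n c" for n c t
  unfolding ind_def by (rule m(2)) (auto simp: EQ_psd te_iff evt_sound[OF M] evt_closed[OF M] ok_Obj[OF that] that)
qed

lemma obj_ops_em:
 "okk s n c ==> okk t n c ==> em n c (Ad s t) = pl obj n c (em n c s) (em n c t)"
 "c \<in> Obj C ==> em n c Zr = zr obj n c"
 "okk t n c ==> em n c (Ng t) = ng obj n c (em n c t)"
 "okk t n c ==> a \<in> \<R> c ==> em n c (Sm a t) = sm obj n c a (em n c t)"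
 "f \<in> Arr C ==> okk t n (Cod C f) ==> em n (Dom C f) (Rs f t) = rs obj n f (em n (Cod C f) t)"
 "okk t n c ==> em (n - 1) c (Bd t) = bd obj n c (em n c t)"
 by (((frule ok_Obj)?, simp add: pl_em zr_em ng_em sm_em rs_em bd_em EQ_psd te_iff)+)

lemma em_in_K' [simp]: "okk t n c ==> em n c t \<in> K obj n c" by (simp add: EQ_psd te_iff)

lemma em_eq': "okk t n c ==> okk s n c ==> em n c t = em n c s \<longleftrightarrow> te n c t s"
 using em_eq[OF ok_Obj] by (simp add: EQ_psd te_iff)

lemma em_teq: "te n c t s ==> em n c t = em n c s"
 using em_eq' te_ok by blast

lemma K_obj_ok: "u \<in> K obj n c ==> \<exists>t. okk t n c & u = em n c t"
 using K_objD by (simp add: EQ_psd te_iff)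

lemma K_obj_flat: "u \<in> K obj n c ==> \<exists>t. okk t n c & flat t & u = em n c t"
 using K_obj_ok flat_repr em_teq te_ok by metis

text \<open>The uniqueness half of the universal property: sections of the given complexes and cells
  generate everything under the operations, which arrows preserve.\<close>

lemma hom_eq_on_leaves:
 assumes f: "f \<in> Hom ch obj Q" and g: "g \<in> Hom ch obj Q"
  and gn: "!!j n c x. j \<in> Jo ==> c \<in> Obj C ==> x \<in> K (X j) n c ==> ev f n c (em n c (Gn j n c x)) = ev g n c (em n c (Gn j n c x))"
  and cl: "!!n c t y. Cl n c t y \<in> D ==> c \<in> Obj C ==> ev f (n + 1) c (em (n + 1) c (Cl n c t y)) = ev g (n + 1) c (em (n + 1) c (Cl n c t y))"
 shows "f = g"
proof (rule arr_eqI[OF f g])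
 have *: "ev f n c (em n c t) = ev g n c (em n c t)" if "okk t n c" for t n c
  using that
 proof (induction t arbitrary: n c)
  case (Bd t)
  then show ?case
   using obj_ops_em(6)[of t "n + 1" c] ev_bd[OF f, of c "em (n + 1) c t" "n + 1"] ev_bd[OF g, of c "em (n + 1) c t" "n + 1"]
    ok_Obj[OF Bd.prems] by simp
 next
  case (Rs h t)
  then show ?case using obj_ops_em(5)[of h t n] ev_rs[OF f, of h] ev_rs[OF g, of h] by auto
 next
  case (Ng t)
  then show ?case using ev_ng[OF f, of c "em n c t" n] ev_ng[OF g, of c "em n c t" n] ok_Obj[OF Ng.prems] by (simp add: obj_ops_em)
 next
  case (Sm a t)
  then show ?case using ev_sm[OF f, of c a "em n c t" n] ev_sm[OF g, of c a "em n c t" n] ok_Obj[OF Sm.prems] by (simp add: obj_ops_em)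
 next
  case (Ad s t)
  then show ?case using ev_pl[OF f, of c "em n c s" n "em n c t"] ev_pl[OF g, of c "em n c s" n "em n c t"] ok_Obj[OF Ad.prems]
   by (simp add: obj_ops_em)
 next
  case Zr
  then show ?case using f g by (simp add: obj_ops_em)
 qed (use gn cl in auto)
 fix n c u assume "c \<in> Obj C" "u \<in> K obj n c"
 then show "ev f n c u = ev g n c u" using K_obj_ok * by metis
qed

definition inj_gn :: "'j => ('o, 'a, 'r, 'u) psh_cplx_arr" where
 "inj_gn j = into (X j) (\<lambda>n c x. Gn j n c x)"

lemma inj_gn_map:
 assumes j: "j \<in> Jo"
 shows "inj_gn j \<in> Hom ch (X j) obj" and "!!n c x. c \<in> Obj C ==> x \<in> K (X j) n c ==> ev (inj_gn j) n c x = em n c (Gn j n c x)"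
proof -
 note m = into_map[OF XO[OF j], of "\<lambda>n c x. Gn j n c x"]
 show "inj_gn j \<in> Hom ch (X j) obj"
  unfolding inj_gn_def by (rule m(1)) (use j in \<open>auto simp: EQ_psd te_iff intro: teq.intros\<close>)
 show "ev (inj_gn j) n c x = em n c (Gn j n c x)" if "c \<in> Obj C" "x \<in> K (X j) n c" for n c x
  unfolding inj_gn_def by (rule m(2)) (use j that in \<open>auto simp: EQ_psd te_iff intro: teq.intros\<close>)
qed

end

section \<open>Limits and colimits of complexes\<close>

context psh_setup begin

lemma cocomplete_ch: "cocomplete \<mu> ch"
 unfolding cocomplete_def
proof (intro allI impI, elim conjE)
 fix J :: "('u, 'u) cat" and Fo and Fa
 assume J: "category J" and sO: "small \<mu> (Obj J)" and sA: "small \<mu> (Arr J)" and dg: "diagram J ch Fo Fa"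
 interpret J: category J by (rule J)
 have Fo: "j \<in> Obj J ==> Fo j \<in> Obj ch" for j using dg by (simp add: diagram_def)
 have Fa: "u \<in> Arr J ==> Fa u \<in> Hom ch (Fo (Dom J u)) (Fo (Cod J u))" for u using dg by (simp add: diagram_def)
 \<comment> \<open>The relations identify a section with its images along the diagram; no cells are
   attached.\<close>
 define E where "E n c t s \<longleftrightarrow> (\<exists>u\<in>Arr J. \<exists>x\<in>K (Fo (Dom J u)) n c. t = Gn (Dom J u) n c x &
   s = Gn (Cod J u) n c (ev (Fa u) n c x))" for n c and t s :: "('u, 'o, 'a, 'r, 'u) tm"
 interpret P: pres C \<mu> R S "Obj J" Fo "{}" E
  by unfold_locales (auto simp: Fo sO intro: small_finite[OF U])
 have "colimit_cocone J ch Fo Fa P.obj P.inj_gn"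
  unfolding colimit_cocone_def
 proof (intro conjI allI impI)
  show "cocone J ch Fo Fa P.obj P.inj_gn"
   unfolding cocone_def
  proof (intro conjI ballI P.obj_in_Obj P.inj_gn_map(1))
   fix u assume u: "u \<in> Arr J"
   note d = J.Dom_closed[OF u] and c = J.Cod_closed[OF u]
   show "P.inj_gn (Cod J u) \<star> Fa u = P.inj_gn (Dom J u)"
   proof (rule arr_eqI)
    show "P.inj_gn (Cod J u) \<star> Fa u \<in> Hom ch (Fo (Dom J u)) P.obj"
     using P.inj_gn_map(1)[OF c] Fa[OF u] by blast
    show "P.inj_gn (Dom J u) \<in> Hom ch (Fo (Dom J u)) P.obj" by (rule P.inj_gn_map(1)[OF d])
    fix n e x assume e: "e \<in> Obj C" and x: "x \<in> K (Fo (Dom J u)) n e"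
    have "P.te n e (Gn (Dom J u) n e x) (Gn (Cod J u) n e (ev (Fa u) n e x))"
     by (rule te_ext) (use u d c e x Fa in \<open>auto simp: E_def\<close>)
    from P.em_teq[OF this]
    show "ev (P.inj_gn (Cod J u) \<star> Fa u) n e x = ev (P.inj_gn (Dom J u)) n e x"
     using ev_Cmp[OF Fa[OF u] P.inj_gn_map(1)[OF c] e x] P.inj_gn_map(2)[OF c e] P.inj_gn_map(2)[OF d e x]
      ev_closed[OF Fa[OF u] e x] by simp
   qed
  qed
  fix L' \<iota>' assume cc: "cocone J ch Fo Fa L' \<iota>'"
  have \<iota>': "j \<in> Obj J ==> \<iota>' j \<in> Hom ch (Fo j) L'" for j using cc by (simp add: cocone_def)
  define \<kappa> where "\<kappa> n c t = (case t of Gn j m d x => ev (\<iota>' j) n c x | _ => undefined)" for n c and t :: "('u, 'o, 'a, 'r, 'u) tm"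
  have M: "P.model L' \<kappa>"
   unfolding P.model_def
  proof (intro conjI ballI allI impI)
   show "L' \<in> Obj ch" using cc by (simp add: cocone_def)
   fix j assume "j \<in> Obj J" then show "hm (Fo j) L' (\<lambda>n c x. \<kappa> n c (Gn j n c x))"
    using hm_ev[OF \<iota>'] by (simp add: \<kappa>_def)
  next
   fix n c t s assume "E n c t s" "P.okk t n c"
   then obtain u x where u: "u \<in> Arr J" and x: "x \<in> K (Fo (Dom J u)) n c" and e: "t = Gn (Dom J u) n c x"
    "s = Gn (Cod J u) n c (ev (Fa u) n c x)" and c: "c \<in> Obj C" unfolding E_def by auto
   have "\<iota>' (Cod J u) \<star> Fa u = \<iota>' (Dom J u)" using cc u by (simp add: cocone_def)
   then show "evt L' \<kappa> t n c = evt L' \<kappa> s n c"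
    using ev_Cmp[OF Fa[OF u] \<iota>'[OF J.Cod_closed[OF u]] c x] by (simp add: e \<kappa>_def)
  qed auto
  note im = P.ind_map[OF M]
  show "\<exists>!h. h \<in> Hom ch P.obj L' & (\<forall>j\<in>Obj J. h \<star> P.inj_gn j = \<iota>' j)"
  proof (rule ex1I[of _ "P.ind L' \<kappa>"])
   have "P.ind L' \<kappa> \<star> P.inj_gn j = \<iota>' j" if j: "j \<in> Obj J" for j
   proof (rule arr_eqI[OF Cmp_in_Hom_ch[OF P.inj_gn_map(1)[OF j] im(1)] \<iota>'[OF j]])
    fix n c x assume c: "c \<in> Obj C" and x: "x \<in> K (Fo j) n c"
    show "ev (P.ind L' \<kappa> \<star> P.inj_gn j) n c x = ev (\<iota>' j) n c x"
     using ev_Cmp[OF P.inj_gn_map(1)[OF j] im(1) c x] P.inj_gn_map(2)[OF j c x] im(2)[of "Gn j n c x" n c] j c x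
     by (simp add: \<kappa>_def)
   qed
   then show "P.ind L' \<kappa> \<in> Hom ch P.obj L' & (\<forall>j\<in>Obj J. P.ind L' \<kappa> \<star> P.inj_gn j = \<iota>' j)"
    using im(1) by blast
   fix h assume h: "h \<in> Hom ch P.obj L' & (\<forall>j\<in>Obj J. h \<star> P.inj_gn j = \<iota>' j)"
   show "h = P.ind L' \<kappa>"
   proof (rule P.hom_eq_on_leaves)
    show hH: "h \<in> Hom ch P.obj L'" using h by blast
    show "P.ind L' \<kappa> \<in> Hom ch P.obj L'" by (rule im(1))
    fix j n c x assume j: "j \<in> Obj J" and c: "c \<in> Obj C" and x: "x \<in> K (Fo j) n c"
    show "ev h n c (P.em n c (Gn j n c x)) = ev (P.ind L' \<kappa>) n c (P.em n c (Gn j n c x))"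
     using ev_Cmp[OF P.inj_gn_map(1)[OF j] hH c x] P.inj_gn_map(2)[OF j c x] im(2)[of "Gn j n c x" n c] j c x h
     by (simp add: \<kappa>_def)
   qed auto
  qed
 qed
 then show "\<exists>L \<iota>. colimit_cocone J ch Fo Fa L \<iota>" by blast
qed

definition lim_elem :: "('j, 'i) cat => ('j => ('o, 'a, 'r, 'u) psh_cplx) => ('i => ('o, 'a, 'r, 'u) psh_cplx_arr) =>
  int => 'o => ('j => 'u) => bool" where
 "lim_elem J Fo Fa n c s \<longleftrightarrow> s \<in> extensional (Obj J) & (\<forall>j\<in>Obj J. s j \<in> K (Fo j) n c) &
  (\<forall>u\<in>Arr J. ev (Fa u) n c (s (Dom J u)) = s (Cod J u))"

definition lim_sd :: "('j, 'i) cat => ('j => ('o, 'a, 'r, 'u) psh_cplx) => ('i => ('o, 'a, 'r, 'u) psh_cplx_arr) =>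
  ('o, 'a, 'r, 'j => 'u) sd" where
 "lim_sd J Fo Fa = \<lparr>EQ = (\<lambda>n c s t. s = t & lim_elem J Fo Fa n c s),
  AD = (\<lambda>n c s t. \<lambda>j\<in>Obj J. pl (Fo j) n c (s j) (t j)), ZR = (\<lambda>n c. \<lambda>j\<in>Obj J. zr (Fo j) n c),
  NG = (\<lambda>n c s. \<lambda>j\<in>Obj J. ng (Fo j) n c (s j)), SM = (\<lambda>n c a s. \<lambda>j\<in>Obj J. sm (Fo j) n c a (s j)),
  RS = (\<lambda>n f s. \<lambda>j\<in>Obj J. rs (Fo j) n f (s j)), BD = (\<lambda>n c s. \<lambda>j\<in>Obj J. bd (Fo j) n c (s j))\<rparr>"

lemma complete_ch: "complete \<mu> ch"
 unfolding complete_def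
proof (intro allI impI, elim conjE)
 fix J :: "('u, 'u) cat" and Fo and Fa
 assume J: "category J" and sO: "small \<mu> (Obj J)" and sA: "small \<mu> (Arr J)"
  and exp: "\<forall>A :: 'u set. small \<mu> A --> small \<mu> (Arr J \<rightarrow>\<^sub>E A)" and dg: "diagram J ch Fo Fa"
 interpret J: category J by (rule J)
 have Fo [simp]: "j \<in> Obj J ==> Fo j \<in> Obj ch" for j using dg by (simp add: diagram_def)
 have Fa: "u \<in> Arr J ==> Fa u \<in> Hom ch (Fo (Dom J u)) (Fo (Cod J u))" for u using dg by (simp add: diagram_def)
 let ?L = "lim_elem J Fo Fa"
 have L_arb: "?L n c s ==> j \<notin> Obj J ==> s j = undefined" for n c s j
  by (auto simp: lim_elem_def extensional_def)
 have L_K: "?L n c s ==> j \<in> Obj J ==> s j \<in> K (Fo j) n c" for n c s j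
  by (auto simp: lim_elem_def)
 have L_u: "?L n c s ==> u \<in> Arr J ==> ev (Fa u) n c (s (Dom J u)) = s (Cod J u)" for n c s u
  by (auto simp: lim_elem_def)
 note JD [simp] = J.Dom_closed J.Cod_closed
 have limI: "?L n c (\<lambda>j\<in>Obj J. g j)" if "!!j. j \<in> Obj J ==> g j \<in> K (Fo j) n c"
  "!!u. u \<in> Arr J ==> ev (Fa u) n c (g (Dom J u)) = g (Cod J u)" for n c g
  using that by (simp add: lim_elem_def)
 have cl1: "?L n c (\<lambda>j\<in>Obj J. pl (Fo j) n c (s j) (t j))" if "c \<in> Obj C" "?L n c s" "?L n c t" for n c s t
  by (rule limI) (use that in \<open>simp_all add: lim_elem_def[of _ _ _ n c s] lim_elem_def[of _ _ _ n c t] ev_pl[OF Fa]\<close>)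
 have cl2: "?L n c (\<lambda>j\<in>Obj J. zr (Fo j) n c)" if "c \<in> Obj C" for n c
  by (rule limI) (use that in \<open>simp_all add: ev_zr[OF Fa]\<close>)
 have cl3: "?L n c (\<lambda>j\<in>Obj J. ng (Fo j) n c (s j))" if "c \<in> Obj C" "?L n c s" for n c s
  by (rule limI) (use that in \<open>simp_all add: lim_elem_def[of _ _ _ n c s] ev_ng[OF Fa]\<close>)
 have cl4: "?L n c (\<lambda>j\<in>Obj J. sm (Fo j) n c a (s j))" if "c \<in> Obj C" "a \<in> \<R> c" "?L n c s" for n c a s
  by (rule limI) (use that in \<open>simp_all add: lim_elem_def[of _ _ _ n c s] ev_sm[OF Fa]\<close>)
 have cl5: "?L n d (\<lambda>j\<in>Obj J. rs (Fo j) n f (s j))" if "f \<in> Arr C" "?L n (Cod C f) s" "d = Dom C f" for n f s d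
  unfolding that(3) by (rule limI) (use that in \<open>simp_all add: lim_elem_def[of _ _ _ n "Cod C f" s] ev_rs[OF Fa]\<close>)
 have cl6: "?L m c (\<lambda>j\<in>Obj J. bd (Fo j) n c (s j))" if "c \<in> Obj C" "?L n c s" "m = n - 1" for n m c s
  unfolding that(3) by (rule limI) (use that in \<open>simp_all add: lim_elem_def[of _ _ _ n c s] ev_bd[OF Fa]\<close>)
 note cl = cl1 cl2 cl3 cl4 cl5 cl6
 have eqI: "(\<lambda>j\<in>Obj J. g j) = s" if "?L n c s" "!!j. j \<in> Obj J ==> g j = s j" for n c g s
  using that by (auto simp: fun_eq_iff L_arb[OF that(1)])
 have eqI2: "(\<lambda>j\<in>Obj J. g j) = (\<lambda>j\<in>Obj J. h j)" if "!!j. j \<in> Obj J ==> g j = h j" for g h :: "'u => 'u"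
  using that by (auto simp: fun_eq_iff)
 interpret P: sdata C \<mu> R S "lim_sd J Fo Fa"
 proof
  fix c n assume c: "c \<in> Obj C"
  have sm: "small \<mu> (\<Union>j\<in>Obj J. K (Fo j) n c)"
   using c by (intro small_UN[OF U sO] small_K) auto
  \<comment> \<open>The available bound concerns function spaces indexed by \<open>Arr J\<close>, so
    a compatible family is reindexed by the sources of arrows; the identities show that nothing is
    lost.\<close>
  have "inj_on (\<lambda>s. \<lambda>u\<in>Arr J. s (Dom J u)) {s. ?L n c s}"
  proof (rule inj_onI)
   fix s t assume s: "s \<in> {s. ?L n c s}" and t: "t \<in> {s. ?L n c s}"
    and e: "(\<lambda>u\<in>Arr J. s (Dom J u)) = (\<lambda>u\<in>Arr J. t (Dom J u))"
   show "s = t"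
   proof
    fix j
    show "s j = t j"
    proof (cases "j \<in> Obj J")
     case True
     then have "Idn J j \<in> Arr J" "Dom J (Idn J j) = j" using J.Idn_in_Hom[OF True] by (auto simp: Hom_def)
     then show ?thesis using fun_cong[OF e, of "Idn J j"] by simp
    qed (use s t L_arb[of n c s j] L_arb[of n c t j] in auto)
   qed
  qed
  moreover have "(\<lambda>s. \<lambda>u\<in>Arr J. s (Dom J u)) ` {s. ?L n c s} \<subseteq> Arr J \<rightarrow>\<^sub>E (\<Union>j\<in>Obj J. K (Fo j) n c)"
   by (intro image_subsetI PiE_I) (auto simp: lim_elem_def intro!: bexI[of _ "Dom J _"])
  ultimately have "small \<mu> {s. ?L n c s}" using small_inj_on[OF U] exp sm by blast
  then show "small \<mu> (cls (lim_sd J Fo Fa) n c ` {x. EQ (lim_sd J Fo Fa) n c x x})"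
   by (intro small_image[OF U]) (simp add: lim_sd_def)
 next
  note [simp] = Dom_closed Cod_closed rres_closed Cmp_Arr
  show "EQ (lim_sd J Fo Fa) n c x y ==> EQ (lim_sd J Fo Fa) n c y x" for n c x y by (auto simp: lim_sd_def)
  show "EQ (lim_sd J Fo Fa) n c x y ==> EQ (lim_sd J Fo Fa) n c y z ==> EQ (lim_sd J Fo Fa) n c x z" for n c x y z by (auto simp: lim_sd_def)
 qed (unfold lim_sd_def sd.simps, (((clarify)?, rule conjI,
   ((((rule eqI2) | (rule eqI, assumption));
    ((simp add: lim_elem_def Dom_closed Cod_closed rres_closed Cmp_Arr sm_add sm_pl sm_mult rs_pl rs_sm rs_rs bd_pl bd_sm bd_rs bd_bd'; fail)
    | (simp add: lim_elem_def pl_assoc; fail) | (simp add: lim_elem_def pl_comm; fail)))),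
   (((intro cl); (assumption | (simp add: Dom_closed Cod_closed rres_closed Cmp_Arr; fail)))))+)?)
 have EQ: "EQ (lim_sd J Fo Fa) n c s t \<longleftrightarrow> s = t & ?L n c s"
  "AD (lim_sd J Fo Fa) n c s t = (\<lambda>j\<in>Obj J. pl (Fo j) n c (s j) (t j))"
  "SM (lim_sd J Fo Fa) n c a s = (\<lambda>j\<in>Obj J. sm (Fo j) n c a (s j))"
  "RS (lim_sd J Fo Fa) n f s = (\<lambda>j\<in>Obj J. rs (Fo j) n f (s j))"
  "BD (lim_sd J Fo Fa) n c s = (\<lambda>j\<in>Obj J. bd (Fo j) n c (s j))" for n c s t a f
  by (simp_all add: lim_sd_def)
 define \<pi> where "\<pi> j = P.out (Fo j) (\<lambda>n c s. s j)" for j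
 have \<pi>: "\<pi> j \<in> Hom ch P.obj (Fo j)" and ev_\<pi>: "!!n c s. c \<in> Obj C ==> ?L n c s ==> ev (\<pi> j) n c (P.em n c s) = s j"
  if j: "j \<in> Obj J" for j
 proof -
  note m = P.out_map[OF Fo[OF j], of "\<lambda>n c s. s j"]
  show "\<pi> j \<in> Hom ch P.obj (Fo j)"
   unfolding \<pi>_def by (rule m(1)) (use j in \<open>auto simp: EQ L_K\<close>)
  show "ev (\<pi> j) n c (P.em n c s) = s j" if "c \<in> Obj C" "?L n c s" for n c s
   unfolding \<pi>_def by (rule m(2)) (use j that in \<open>auto simp: EQ L_K\<close>)
 qed
 have "limit_cone J ch Fo Fa P.obj \<pi>"
  unfolding limit_cone_def
 proof (intro conjI allI impI)
  show "cone J ch Fo Fa P.obj \<pi>"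
   unfolding cone_def
  proof (intro conjI ballI \<pi> P.obj_in_Obj)
   fix u assume u: "u \<in> Arr J"
   note d = J.Dom_closed[OF u] and e = J.Cod_closed[OF u]
   show "Fa u \<star> \<pi> (Dom J u) = \<pi> (Cod J u)"
   proof (rule arr_eqI[OF Cmp_in_Hom_ch[OF \<pi>[OF d] Fa[OF u]] \<pi>[OF e]])
    fix n c x assume c: "c \<in> Obj C" and x: "x \<in> K P.obj n c"
    then obtain s where s: "?L n c s" "x = P.em n c s" using P.K_objD[OF x] by (auto simp: EQ)
    then show "ev (Fa u \<star> \<pi> (Dom J u)) n c x = ev (\<pi> (Cod J u)) n c x"
     using ev_Cmp[OF \<pi>[OF d] Fa[OF u] c x] ev_\<pi>[OF d c s(1)] ev_\<pi>[OF e c s(1)] L_u[OF s(1) u] by simp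
   qed
  qed
  fix M \<rho> assume cn: "cone J ch Fo Fa M \<rho>"
  have \<rho>: "j \<in> Obj J ==> \<rho> j \<in> Hom ch M (Fo j)" and M: "M \<in> Obj ch"
   and \<rho>u: "u \<in> Arr J ==> Fa u \<star> \<rho> (Dom J u) = \<rho> (Cod J u)" for j u using cn by (auto simp: cone_def)
  define g where "g n c x = (\<lambda>j\<in>Obj J. ev (\<rho> j) n c x)" for n c x
  have gL: "?L n c (g n c x)" if "c \<in> Obj C" "x \<in> K M n c" for n c x
   unfolding g_def
  proof (rule limI)
   show "j \<in> Obj J ==> ev (\<rho> j) n c x \<in> K (Fo j) n c" for j using ev_closed[OF \<rho> that] .
   fix u assume u: "u \<in> Arr J"
   show "ev (Fa u) n c (ev (\<rho> (Dom J u)) n c x) = ev (\<rho> (Cod J u)) n c x"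
    using ev_Cmp[OF \<rho>[OF J.Dom_closed[OF u]] Fa[OF u] that] \<rho>u[OF u] by simp
  qed
  note m = P.into_map[OF M, of g]
  have into: "P.into M g \<in> Hom ch M P.obj" "!!n c x. c \<in> Obj C ==> x \<in> K M n c ==> ev (P.into M g) n c x = P.em n c (g n c x)"
   by (rule m(1) m(2); (unfold EQ)?; (simp add: gL M Dom_closed Cod_closed)?;
    (simp add: g_def ev_pl[OF \<rho>] ev_sm[OF \<rho>] ev_bd[OF \<rho>] ev_rs[OF \<rho>] cong: restrict_cong)?)+
  show "\<exists>!h. h \<in> Hom ch M P.obj & (\<forall>j\<in>Obj J. \<pi> j \<star> h = \<rho> j)"
  proof (rule ex1I[of _ "P.into M g"])
   have "\<pi> j \<star> P.into M g = \<rho> j" if j: "j \<in> Obj J" for j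
   proof (rule arr_eqI[OF Cmp_in_Hom_ch[OF into(1) \<pi>[OF j]] \<rho>[OF j]])
    fix n c x assume c: "c \<in> Obj C" and x: "x \<in> K M n c"
    show "ev (\<pi> j \<star> P.into M g) n c x = ev (\<rho> j) n c x"
     using ev_Cmp[OF into(1) \<pi>[OF j] c x] into(2)[OF c x] ev_\<pi>[OF j c gL[OF c x]] j by (simp add: g_def)
   qed
   then show "P.into M g \<in> Hom ch M P.obj & (\<forall>j\<in>Obj J. \<pi> j \<star> P.into M g = \<rho> j)" using into(1) by blast
   fix h assume h: "h \<in> Hom ch M P.obj & (\<forall>j\<in>Obj J. \<pi> j \<star> h = \<rho> j)"
   then have hH: "h \<in> Hom ch M P.obj" by blast
   show "h = P.into M g"
   proof (rule arr_eqI[OF hH into(1)])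
    fix n c x assume c: "c \<in> Obj C" and x: "x \<in> K M n c"
    obtain s where s: "?L n c s" "ev h n c x = P.em n c s"
     using P.K_objD[OF ev_closed[OF hH c x]] by (auto simp: EQ)
    have "g n c x = s"
     unfolding g_def
    proof (rule eqI[OF s(1)])
     fix j assume j: "j \<in> Obj J"
     then have e: "\<pi> j \<star> h = \<rho> j" using h by blast
     show "ev (\<rho> j) n c x = s j"
      using ev_Cmp[OF hH \<pi>[OF j] c x] s(2) ev_\<pi>[OF j c s(1)] unfolding e by simp
    qed
    then show "ev h n c x = ev (P.into M g) n c x" using s(2) into(2)[OF c x] by simp
   qed
  qed
 qed
 then show "\<exists>L \<pi>. limit_cone J ch Fo Fa L \<pi>" by blast
qed

end

section \<open>Free modules and linear extension\<close>

definition single :: "'r ring => 'b set => 'b => 'r => 'b => 'r" where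
 "single Q B b a = (\<lambda>x\<in>B. if x = b then a else \<zero>\<^bsub>Q\<^esub>)"

lemma carrier_free_module: "s \<in> carrier (free_module Q B) \<longleftrightarrow>
  (\<forall>b\<in>B. s b \<in> carrier Q) & s \<in> extensional B & finite {b \<in> B. s b \<noteq> \<zero>\<^bsub>Q\<^esub>}"
 by (simp add: free_module_def PiE_iff)

lemma free_module_simps:
 "add (free_module Q B) s t = (\<lambda>b\<in>B. s b \<oplus>\<^bsub>Q\<^esub> t b)" "zero (free_module Q B) = (\<lambda>b\<in>B. \<zero>\<^bsub>Q\<^esub>)"
 "smult (free_module Q B) a s = (\<lambda>b\<in>B. a \<otimes>\<^bsub>Q\<^esub> s b)"
 by (simp_all add: free_module_def)

context fixes Q :: "'r ring" and B :: "'b set" assumes Q: "ring Q"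
begin

interpretation Q: ring Q by (rule Q)

lemma single_closed: "b \<in> B ==> a \<in> carrier Q ==> single Q B b a \<in> carrier (free_module Q B)"
 unfolding carrier_free_module single_def
 by (auto intro: finite_subset[of _ "{b}"])

lemma free_add_closed: "s \<in> carrier (free_module Q B) ==> t \<in> carrier (free_module Q B) ==>
  s \<oplus>\<^bsub>free_module Q B\<^esub> t \<in> carrier (free_module Q B)"
 unfolding carrier_free_module free_module_simps
 by (auto intro!: finite_subset[of "{b \<in> B. s b \<oplus>\<^bsub>Q\<^esub> t b \<noteq> \<zero>\<^bsub>Q\<^esub>}" "{b \<in> B. s b \<noteq> \<zero>\<^bsub>Q\<^esub>} \<union> {b \<in> B. t b \<noteq> \<zero>\<^bsub>Q\<^esub>}"]
   split: if_splits cong: conj_cong)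

lemma free_smult_closed: "a \<in> carrier Q ==> s \<in> carrier (free_module Q B) ==>
  a \<odot>\<^bsub>free_module Q B\<^esub> s \<in> carrier (free_module Q B)"
 unfolding carrier_free_module free_module_simps
 by (auto intro!: finite_subset[of "{b \<in> B. a \<otimes>\<^bsub>Q\<^esub> s b \<noteq> \<zero>\<^bsub>Q\<^esub>}" "{b \<in> B. s b \<noteq> \<zero>\<^bsub>Q\<^esub>}"] cong: conj_cong)

lemma left_module_free: "left_module Q (free_module Q B)"
proof -
 have "abelian_group (free_module Q B)"
 proof (rule abelian_groupI)
  show "\<exists>y\<in>carrier (free_module Q B). y \<oplus>\<^bsub>free_module Q B\<^esub> s = \<zero>\<^bsub>free_module Q B\<^esub>"
   if s: "s \<in> carrier (free_module Q B)" for s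
  proof
   have "{b \<in> B. \<ominus>\<^bsub>Q\<^esub> s b \<noteq> \<zero>\<^bsub>Q\<^esub>} \<subseteq> {b \<in> B. s b \<noteq> \<zero>\<^bsub>Q\<^esub>}" by auto
   then show "(\<lambda>b\<in>B. \<ominus>\<^bsub>Q\<^esub> s b) \<in> carrier (free_module Q B)"
    using s finite_subset by (auto simp: carrier_free_module cong: conj_cong)
   show "(\<lambda>b\<in>B. \<ominus>\<^bsub>Q\<^esub> s b) \<oplus>\<^bsub>free_module Q B\<^esub> s = \<zero>\<^bsub>free_module Q B\<^esub>"
    using s by (auto simp: free_module_simps carrier_free_module Q.l_neg intro!: restrict_ext)
  qed
 qed (auto simp: free_add_closed, auto simp: free_module_simps carrier_free_module Q.a_ac
   intro!: restrict_ext, auto simp: extensional_def fun_eq_iff)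
 moreover have "left_module_axioms Q (free_module Q B)"
  by (standard, auto simp: free_smult_closed,
   auto simp: free_module_simps carrier_free_module Q.l_distr Q.r_distr Q.m_assoc intro!: restrict_ext,
   auto simp: extensional_def fun_eq_iff)
 ultimately show ?thesis using Q by (simp add: left_module_def)
qed

text \<open>Induction on the size of the support, splitting off one coefficient.\<close>

lemma free_module_closure_induct:
 assumes s: "s \<in> carrier (free_module Q B)" and z: "P \<zero>\<^bsub>free_module Q B\<^esub>"
  and si: "!!b a. b \<in> B ==> a \<in> carrier Q ==> P (single Q B b a)"
  and ad: "!!s t. s \<in> carrier (free_module Q B) ==> t \<in> carrier (free_module Q B) ==> P s ==> P t ==>
   P (s \<oplus>\<^bsub>free_module Q B\<^esub> t)"
 shows "P s"
 using s
proof (induction "card {b \<in> B. s b \<noteq> \<zero>\<^bsub>Q\<^esub>}" arbitrary: s)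
 case 0
 then have "!!b. b \<in> B ==> s b = \<zero>\<^bsub>Q\<^esub>" by (auto simp: carrier_free_module)
 then have "s = \<zero>\<^bsub>free_module Q B\<^esub>"
  using 0 by (auto simp: free_module_simps carrier_free_module extensional_def fun_eq_iff)
 then show ?case using z by simp
next
 case (Suc n)
 then have "{b \<in> B. s b \<noteq> \<zero>\<^bsub>Q\<^esub>} \<noteq> {}" by (metis card.empty nat.distinct(1))
 then obtain b where b: "b \<in> B" "s b \<noteq> \<zero>\<^bsub>Q\<^esub>" by blast
 define t where "t = s(b := \<zero>\<^bsub>Q\<^esub>)"
 have sb: "s b \<in> carrier Q" using Suc.prems b by (auto simp: carrier_free_module)
 have supp: "{x \<in> B. t x \<noteq> \<zero>\<^bsub>Q\<^esub>} = {x \<in> B. s x \<noteq> \<zero>\<^bsub>Q\<^esub>} - {b}" by (auto simp: t_def)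
 have t: "t \<in> carrier (free_module Q B)"
  using Suc.prems b unfolding carrier_free_module supp by (auto simp: t_def extensional_def Pi_def)
 have "card {x \<in> B. t x \<noteq> \<zero>\<^bsub>Q\<^esub>} = n"
  unfolding supp using Suc b by (simp add: carrier_free_module)
 then have "P t" using Suc.hyps(1) t by blast
 moreover have "s = t \<oplus>\<^bsub>free_module Q B\<^esub> single Q B b (s b)"
 proof
  fix x
  show "s x = (t \<oplus>\<^bsub>free_module Q B\<^esub> single Q B b (s b)) x"
  proof (cases "x \<in> B")
   case True
   then have "s x \<in> carrier Q" using Suc.prems by (auto simp: carrier_free_module)
   then show ?thesis using True sb by (simp add: free_module_simps single_def t_def)
  next
   case False
   then show ?thesis using Suc.prems by (auto simp: free_module_simps carrier_free_module extensional_def)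
  qed
 qed
 ultimately show ?case using ad[OF t single_closed[OF b(1) sb]] si[OF b(1) sb] by simp
qed

text \<open>\<open>p b a\<close> is the value assigned to the formal term \<open>a [b]\<close>.
  Additivity in \<open>a\<close> is the law assumed of it below, so that the same sum serves for
  linear maps and for semilinear restrictions.\<close>

definition linsum :: "('v, 's) ring_scheme => ('b => 'r => 'v) => ('b => 'r) => 'v" where
 "linsum M p s = finsum M (\<lambda>b. p b (s b)) {b \<in> B. s b \<noteq> \<zero>\<^bsub>Q\<^esub>}"

context
 fixes M :: "('v, 's) ring_scheme" and p :: "'b => 'r => 'v"
 assumes M: "abelian_group M" and p: "!!b a. b \<in> B ==> a \<in> carrier Q ==> p b a \<in> carrier M"
  and p_add: "!!b a a'. b \<in> B ==> a \<in> carrier Q ==> a' \<in> carrier Q ==> p b (a \<oplus>\<^bsub>Q\<^esub> a') = p b a \<oplus>\<^bsub>M\<^esub> p b a'"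
begin

interpretation M: abelian_group M by (rule M)

lemma p_zero: "b \<in> B ==> p b \<zero>\<^bsub>Q\<^esub> = \<zero>\<^bsub>M\<^esub>"
 using p_add[of b "\<zero>\<^bsub>Q\<^esub>" "\<zero>\<^bsub>Q\<^esub>"] p[of b "\<zero>\<^bsub>Q\<^esub>"] M.add.r_cancel_one' by fastforce

lemma linsum_superset:
 assumes s: "s \<in> carrier (free_module Q B)" and A: "finite A" "{b \<in> B. s b \<noteq> \<zero>\<^bsub>Q\<^esub>} \<subseteq> A" "A \<subseteq> B"
 shows "linsum M p s = finsum M (\<lambda>b. p b (s b)) A"
 unfolding linsum_def
 by (rule M.add.finprod_mono_neutral_cong_left)
  (use s A p p_zero in \<open>auto simp: carrier_free_module\<close>)

lemma linsum_closed: "s \<in> carrier (free_module Q B) ==> linsum M p s \<in> carrier M"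
 unfolding linsum_def by (rule M.finsum_closed) (auto simp: carrier_free_module p)

lemma linsum_add:
 assumes s: "s \<in> carrier (free_module Q B)" and t: "t \<in> carrier (free_module Q B)"
 shows "linsum M p (s \<oplus>\<^bsub>free_module Q B\<^esub> t) = linsum M p s \<oplus>\<^bsub>M\<^esub> linsum M p t"
proof -
 let ?A = "{b \<in> B. s b \<noteq> \<zero>\<^bsub>Q\<^esub>} \<union> {b \<in> B. t b \<noteq> \<zero>\<^bsub>Q\<^esub>}"
 have fin: "finite ?A" using s t by (auto simp: carrier_free_module)
 have C: "b \<in> B ==> s b \<in> carrier Q" "b \<in> B ==> t b \<in> carrier Q" for b
  using s t by (auto simp: carrier_free_module)
 have sub: "{b \<in> B. (s \<oplus>\<^bsub>free_module Q B\<^esub> t) b \<noteq> \<zero>\<^bsub>Q\<^esub>} \<subseteq> ?A" using C by (auto simp: free_module_simps)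
 have "linsum M p (s \<oplus>\<^bsub>free_module Q B\<^esub> t) = finsum M (\<lambda>b. p b ((s \<oplus>\<^bsub>free_module Q B\<^esub> t) b)) ?A"
  by (rule linsum_superset[OF free_add_closed[OF s t] fin sub]) auto
 also have "\<dots> = finsum M (\<lambda>b. p b (s b) \<oplus>\<^bsub>M\<^esub> p b (t b)) ?A"
  by (rule M.finsum_cong') (use C p p_add in \<open>auto simp: free_module_simps\<close>)
 also have "\<dots> = finsum M (\<lambda>b. p b (s b)) ?A \<oplus>\<^bsub>M\<^esub> finsum M (\<lambda>b. p b (t b)) ?A"
  by (rule M.finsum_addf) (use C p in auto)
 also have "\<dots> = linsum M p s \<oplus>\<^bsub>M\<^esub> linsum M p t"
  using linsum_superset[OF s fin] linsum_superset[OF t fin] by auto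
 finally show ?thesis .
qed

lemma linsum_single:
 assumes b: "b \<in> B" and a: "a \<in> carrier Q" shows "linsum M p (single Q B b a) = p b a"
proof -
 have "linsum M p (single Q B b a) = finsum M (\<lambda>x. p x (single Q B b a x)) {b}"
  by (rule linsum_superset[OF single_closed[OF b a]]) (use b in \<open>auto simp: single_def\<close>)
 then show ?thesis using b a p[OF b a] by (simp add: single_def)
qed

lemma linsum_zero: "linsum M p \<zero>\<^bsub>free_module Q B\<^esub> = \<zero>\<^bsub>M\<^esub>"
 unfolding linsum_def by (simp add: free_module_simps cong: conj_cong)

end

end

lemmas free_module_induct = free_module_closure_induct[consumes 2, case_names zero single add]

text \<open>A finitely supported function is recovered from its graph over the support, a finite
  subset of a small set.\<close>

lemma small_free_module:
 assumes U: "universe \<mu>" and B: "small \<mu> B" and Q: "small \<mu> (carrier Q)"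
 shows "small \<mu> (carrier (free_module Q B))"
proof (rule small_inj_on[OF U])
 show "inj_on (\<lambda>s. {(b, s b) |b. b \<in> B & s b \<noteq> \<zero>\<^bsub>Q\<^esub>}) (carrier (free_module Q B))"
 proof (rule inj_onI)
  fix s t assume s: "s \<in> carrier (free_module Q B)" and t: "t \<in> carrier (free_module Q B)"
   and e: "{(b, s b) |b. b \<in> B & s b \<noteq> \<zero>\<^bsub>Q\<^esub>} = {(b, t b) |b. b \<in> B & t b \<noteq> \<zero>\<^bsub>Q\<^esub>}"
  show "s = t"
  proof
   fix b
   show "s b = t b"
   proof (cases "b \<in> B")
    case True
    then show ?thesis
     using e[THEN eqset_imp_iff, of "(b, s b)"] e[THEN eqset_imp_iff, of "(b, t b)"] by auto
   next
    case False
    then show ?thesis using s t by (auto simp: carrier_free_module extensional_def)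
   qed
  qed
 qed
 show "(\<lambda>s. {(b, s b) |b. b \<in> B & s b \<noteq> \<zero>\<^bsub>Q\<^esub>}) ` carrier (free_module Q B) \<subseteq> {F. F \<subseteq> B \<times> carrier Q & finite F}"
  by (auto simp: carrier_free_module setcompr_eq_image)
 show "small \<mu> {F. F \<subseteq> B \<times> carrier Q & finite F}"
  by (rule small_finite_subsets[OF U small_Sigma[OF U B Q]])
qed

section \<open>Free presheaves and the Yoneda lemma\<close>

context psh_setup begin

text \<open>The copy of a presheaf in \<open>'u\<close> is handled through these rules, which move
  the chosen injections past the operations.\<close>

lemma transport_psh_module:
 fixes P :: "('o, 'a, 'r, 'v) psh"
 assumes P: "module_presheaf \<mu> C R P"
 defines "e \<equiv> (sect_embedding P :: 'o => 'v => 'u)" and "T \<equiv> (transport_psh C P :: ('o, 'a, 'r, 'u) psh)"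
 shows "module_presheaf \<mu> C R T"
  and "!!c. c \<in> Obj C ==> carrier (sect T c) = e c ` carrier (sect P c)"
  and "!!c. c \<in> Obj C ==> inj_on (e c) (carrier (sect P c))"
  and "!!c x y. c \<in> Obj C ==> x \<in> carrier (sect P c) ==> y \<in> carrier (sect P c) ==> e c x \<oplus>\<^bsub>sect T c\<^esub> e c y = e c (x \<oplus>\<^bsub>sect P c\<^esub> y)"
  and "!!c x a. c \<in> Obj C ==> x \<in> carrier (sect P c) ==> a \<odot>\<^bsub>sect T c\<^esub> e c x = e c (a \<odot>\<^bsub>sect P c\<^esub> x)"
  and "!!f x. f \<in> Arr C ==> x \<in> carrier (sect P (Cod C f)) ==> res T f (e (Cod C f) x) = e (Dom C f) (res P f x)"
proof -
 show inj: "inj_on (e c) (carrier (sect P c))" if "c \<in> Obj C" for c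
  unfolding e_def sect_embedding_def
  by (rule someI_ex[OF small_embeds[OF U]]) (use P that in \<open>simp add: module_presheaf_def\<close>)
 have sect: "sect T c = transport_module (e c) (sect P c)" for c by (simp add: T_def transport_psh_def e_def)
 show car: "carrier (sect T c) = e c ` carrier (sect P c)" if "c \<in> Obj C" for c
  by (simp add: sect transport_module_def Let_def)
 show ad: "e c x \<oplus>\<^bsub>sect T c\<^esub> e c y = e c (x \<oplus>\<^bsub>sect P c\<^esub> y)"
  if "c \<in> Obj C" "x \<in> carrier (sect P c)" "y \<in> carrier (sect P c)" for c x y
  using that inj by (simp add: sect transport_module_def Let_def)
 show sml: "a \<odot>\<^bsub>sect T c\<^esub> e c x = e c (a \<odot>\<^bsub>sect P c\<^esub> x)" if "c \<in> Obj C" "x \<in> carrier (sect P c)" for c x a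
  using that inj by (simp add: sect transport_module_def Let_def)
 have ze: "\<zero>\<^bsub>sect T c\<^esub> = e c \<zero>\<^bsub>sect P c\<^esub>" for c by (simp add: sect transport_module_def Let_def)
 show re: "res T f (e (Cod C f) x) = e (Dom C f) (res P f x)" if "f \<in> Arr C" "x \<in> carrier (sect P (Cod C f))" for f x
  using that inj[OF Cod_closed] by (simp add: T_def transport_psh_def e_def)
 show "module_presheaf \<mu> C R T"
  unfolding module_presheaf_def semilinear_def
 proof (intro conjI ballI impI)
  fix c assume c: "c \<in> Obj C"
  interpret M: left_module "rsect R c" "sect P c" using P c by (simp add: module_presheaf_def)
  have "abelian_group (sect T c)"
   by (rule abelian_groupI) (auto simp: car[OF c] ad[OF c] ze M.M.a_assoc M.M.a_comm M.M.a_lcomm M.M.l_neg M.M.r_neg intro!: bexI[of _ "\<ominus>\<^bsub>sect P c\<^esub> _"])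
  moreover have "left_module_axioms (rsect R c) (sect T c)"
   by standard (auto simp: car[OF c] ad[OF c] sml[OF c] M.smult_closed M.smult_l_distr M.smult_r_distr M.smult_assoc M.smult_one)
  ultimately show "left_module (rsect R c) (sect T c)" using M.R.ring_axioms by (simp add: left_module_def)
  show "small \<mu> (carrier (sect T c))"
   unfolding car[OF c] by (rule small_image[OF U]) (use P c in \<open>simp add: module_presheaf_def\<close>)
  show "x \<in> carrier (sect T c) ==> res T (Idn C c) x = x" for x
   using P c re[of "Idn C c"] by (auto simp: car module_presheaf_def)
 next
  fix f assume f: "f \<in> Arr C"
  note d = Dom_closed[OF f] and c = Cod_closed[OF f]
  have sl: "semilinear (rsect R (Cod C f)) (rres R f) (sect P (Cod C f)) (sect P (Dom C f)) (res P f)"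
   using P f by (simp add: module_presheaf_def)
  interpret M: left_module "rsect R (Cod C f)" "sect P (Cod C f)" using P c by (simp add: module_presheaf_def)
  show "res T f \<in> carrier (sect T (Cod C f)) \<rightarrow> carrier (sect T (Dom C f))"
   using sl f by (auto simp: car[OF c] car[OF d] re semilinear_def Pi_iff)
  fix x assume "x \<in> carrier (sect T (Cod C f))"
  then obtain x' where x: "x = e (Cod C f) x'" "x' \<in> carrier (sect P (Cod C f))" by (auto simp: car[OF c])
  then have rx: "res P f x' \<in> carrier (sect P (Dom C f))" using sl by (auto simp: semilinear_def)
  show "res T f (x \<oplus>\<^bsub>sect T (Cod C f)\<^esub> y) = res T f x \<oplus>\<^bsub>sect T (Dom C f)\<^esub> res T f y"
   if y: "y \<in> carrier (sect T (Cod C f))" for y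
  proof -
   from y obtain y' where y: "y = e (Cod C f) y'" "y' \<in> carrier (sect P (Cod C f))" by (auto simp: car[OF c])
   then have ry: "res P f y' \<in> carrier (sect P (Dom C f))" using sl by (auto simp: semilinear_def)
   have "res P f (x' \<oplus>\<^bsub>sect P (Cod C f)\<^esub> y') = res P f x' \<oplus>\<^bsub>sect P (Dom C f)\<^esub> res P f y'"
    using sl x(2) y(2) by (auto simp: semilinear_def)
   then show ?thesis using x y by (simp add: ad[OF c] ad[OF d] re[OF f] rx ry)
  qed
  show "res T f (a \<odot>\<^bsub>sect T (Cod C f)\<^esub> x) = rres R f a \<odot>\<^bsub>sect T (Dom C f)\<^esub> res T f x" if a: "a \<in> \<R> (Cod C f)" for a
  proof -
   have "res P f (a \<odot>\<^bsub>sect P (Cod C f)\<^esub> x') = rres R f a \<odot>\<^bsub>sect P (Dom C f)\<^esub> res P f x'"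
    using sl x(2) a by (auto simp: semilinear_def)
   then show ?thesis using x a by (simp add: sml[OF c] sml[OF d] re[OF f] rx M.smult_closed)
  qed
 next
  fix f g x assume f: "f \<in> Arr C" and g: "g \<in> Arr C" and fg: "Dom C g = Cod C f" and x: "x \<in> carrier (sect T (Cod C g))"
  then obtain x' where x: "x = e (Cod C g) x'" "x' \<in> carrier (sect P (Cod C g))" by (auto simp: car[OF Cod_closed[OF g]])
  have "semilinear (rsect R (Cod C g)) (rres R g) (sect P (Cod C g)) (sect P (Dom C g)) (res P g)"
   using P g by (simp add: module_presheaf_def)
  then have rx: "res P g x' \<in> carrier (sect P (Cod C f))" using x fg by (auto simp: semilinear_def)
  have "res P (g \<cdot> f) x' = res P f (res P g x')" using P f g fg x by (simp add: module_presheaf_def)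
  then show "res T (g \<cdot> f) x = res T f (res T g x)"
   using re[OF f rx] re[OF g x(2)] re[of "g \<cdot> f" x'] Cmp_Arr[OF f g fg] x fg by simp
 qed
qed

end

lemma (in left_module) smult_r_null: "a \<in> carrier R ==> a \<odot>\<^bsub>M\<^esub> \<zero>\<^bsub>M\<^esub> = \<zero>\<^bsub>M\<^esub>"
 using smult_r_distr[of a "\<zero>\<^bsub>M\<^esub>" "\<zero>\<^bsub>M\<^esub>"] smult_closed[of a "\<zero>\<^bsub>M\<^esub>"] M.add.r_cancel_one'[of "a \<odot>\<^bsub>M\<^esub> \<zero>\<^bsub>M\<^esub>" "a \<odot>\<^bsub>M\<^esub> \<zero>\<^bsub>M\<^esub>"]
 by auto

lemma semilinear_zero:
 assumes "semilinear Q \<rho> M M' f" "abelian_group M" "abelian_group M'" shows "f \<zero>\<^bsub>M\<^esub> = \<zero>\<^bsub>M'\<^esub>"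
proof -
 interpret M: abelian_group M by (rule assms)
 interpret M': abelian_group M' by (rule assms)
 have "f (\<zero>\<^bsub>M\<^esub> \<oplus>\<^bsub>M\<^esub> \<zero>\<^bsub>M\<^esub>) = f \<zero>\<^bsub>M\<^esub> \<oplus>\<^bsub>M'\<^esub> f \<zero>\<^bsub>M\<^esub>" and c: "f \<zero>\<^bsub>M\<^esub> \<in> carrier M'"
  using assms(1) M.zero_closed unfolding semilinear_def by blast+
 then show ?thesis using M'.add.r_cancel_one'[OF c c] by auto
qed

lemma smult_single:
 "ring Q ==> a \<in> carrier Q ==> b \<in> carrier Q ==> a \<odot>\<^bsub>free_module Q B\<^esub> single Q B g b = single Q B g (a \<otimes>\<^bsub>Q\<^esub> b)"
 using ring.ring_simprules(25)[of Q a]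
 by (auto simp: free_module_simps single_def semiring.r_null ring_def intro!: restrict_ext)

context psh_setup begin

abbreviation FF where "FF c \<equiv> free_psh_fun C R c"
abbreviation FM where "FM d c \<equiv> free_module (rsect R d) (Hom C d c)"
abbreviation sg where "sg d c g a \<equiv> single (rsect R d) (Hom C d c) g a"

lemma sect_FF [simp]: "sect (FF c) d = FM d c" by (simp add: free_psh_fun_def)

lemma rres_hom: "f \<in> Arr C ==> rres R f \<in> ring_hom (rsect R (Cod C f)) (rsect R (Dom C f))"
 using rings by (simp add: ring_presheaf_def)

lemma rres_zero [simp]: "f \<in> Arr C ==> rres R f \<zero>\<^bsub>rsect R (Cod C f)\<^esub> = \<zero>\<^bsub>rsect R (Dom C f)\<^esub>"
 using ring_hom_zero[OF rres_hom ring_R[OF Cod_closed] ring_R[OF Dom_closed]] .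

lemma R_group: "c \<in> Obj C ==> abelian_group (rsect R c)"
 using ring_R ring.is_abelian_group by blast

context fixes c f assumes c: "c \<in> Obj C" and f: "f \<in> Arr C" begin

private lemma D: "Dom C f \<in> Obj C" "Cod C f \<in> Obj C" using f Dom_closed Cod_closed by auto

text \<open>The contribution of \<open>a [g]\<close> to the coefficient of \<open>h\<close> in a
  restriction. It turns that coefficient into a \<open>linsum\<close>, whose additivity is already
  known.\<close>

private definition pp where "pp h g a = (if g \<cdot> f = h then rres R f a else \<zero>\<^bsub>rsect R (Dom C f)\<^esub>)"

private lemma pp: "g \<in> Hom C (Cod C f) c ==> a \<in> \<R> (Cod C f) ==> pp h g a \<in> \<R> (Dom C f)"
 "g \<in> Hom C (Cod C f) c ==> a \<in> \<R> (Cod C f) ==> a' \<in> \<R> (Cod C f) ==>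
  pp h g (a \<oplus>\<^bsub>rsect R (Cod C f)\<^esub> a') = pp h g a \<oplus>\<^bsub>rsect R (Dom C f)\<^esub> pp h g a'"
 using ring_hom_add[OF rres_hom[OF f]] rres_closed[OF f] ring.ring_simprules[OF ring_R[OF D(1)]]
 by (auto simp: pp_def D)

private abbreviation "LS h \<equiv> linsum (rsect R (Cod C f)) (Hom C (Cod C f) c) (rsect R (Dom C f)) (pp h)"

private lemma ls: "s \<in> carrier (FM (Cod C f) c) ==> LS h s \<in> \<R> (Dom C f)"
 "s \<in> carrier (FM (Cod C f) c) ==> t \<in> carrier (FM (Cod C f) c) ==>
  LS h (s \<oplus>\<^bsub>FM (Cod C f) c\<^esub> t) = LS h s \<oplus>\<^bsub>rsect R (Dom C f)\<^esub> LS h t"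
 "g \<in> Hom C (Cod C f) c ==> a \<in> \<R> (Cod C f) ==> LS h (sg (Cod C f) c g a) = pp h g a"
 by (rule linsum_closed[OF ring_R[OF D(2)] R_group[OF D(1)]] linsum_add[OF ring_R[OF D(2)] R_group[OF D(1)]]
   linsum_single[OF ring_R[OF D(2)] R_group[OF D(1)]]; (simp add: pp)?)+

private lemma res_FF:
 assumes s: "s \<in> carrier (FM (Cod C f) c)" and h: "h \<in> Hom C (Dom C f) c"
 shows "res (FF c) f s h = linsum (rsect R (Cod C f)) (Hom C (Cod C f) c) (rsect R (Dom C f)) (pp h) s"
proof -
 interpret M: abelian_group "rsect R (Dom C f)" by (rule R_group[OF D(1)])
 show ?thesis
  unfolding linsum_def[OF ring_R[OF D(2)]] free_psh_fun_def psh.simps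
  using h by simp (rule M.add.finprod_mono_neutral_cong_left, use s in \<open>auto simp: carrier_free_module pp_def rres_closed[OF f] D\<close>)
qed

lemma res_FF_closed:
 assumes s: "s \<in> carrier (FM (Cod C f) c)" shows "res (FF c) f s \<in> carrier (FM (Dom C f) c)"
 unfolding carrier_free_module
proof (intro conjI ballI)
 show "res (FF c) f s h \<in> \<R> (Dom C f)" if "h \<in> Hom C (Dom C f) c" for h
  unfolding res_FF[OF s that] by (rule ls(1)[OF s])
 show "res (FF c) f s \<in> extensional (Hom C (Dom C f) c)" by (simp add: free_psh_fun_def)
 \<comment> \<open>A coefficient can be nonzero only at a composite \<open>g \<cdot> f\<close> with
   \<open>g\<close> in the support of \<open>s\<close>.\<close>
 have "{h \<in> Hom C (Dom C f) c. res (FF c) f s h \<noteq> \<zero>\<^bsub>rsect R (Dom C f)\<^esub>} \<subseteq>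
   (\<lambda>g. g \<cdot> f) ` {g \<in> Hom C (Cod C f) c. s g \<noteq> \<zero>\<^bsub>rsect R (Cod C f)\<^esub>}"
 proof
  fix h assume h: "h \<in> {h \<in> Hom C (Dom C f) c. res (FF c) f s h \<noteq> \<zero>\<^bsub>rsect R (Dom C f)\<^esub>}"
  show "h \<in> (\<lambda>g. g \<cdot> f) ` {g \<in> Hom C (Cod C f) c. s g \<noteq> \<zero>\<^bsub>rsect R (Cod C f)\<^esub>}"
  proof (rule ccontr)
   assume "\<not> ?thesis"
   then have e: "{g \<in> Hom C (Cod C f) c. s g \<noteq> \<zero>\<^bsub>rsect R (Cod C f)\<^esub> & g \<cdot> f = h} = {}" by auto
   have "res (FF c) f s h = finsum (rsect R (Dom C f)) (\<lambda>g. rres R f (s g))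
     {g \<in> Hom C (Cod C f) c. s g \<noteq> \<zero>\<^bsub>rsect R (Cod C f)\<^esub> & g \<cdot> f = h}"
    using h unfolding free_psh_fun_def by simp
   then have "res (FF c) f s h = \<zero>\<^bsub>rsect R (Dom C f)\<^esub>"
    unfolding e abelian_monoid.finsum_empty[OF abelian_group.axioms(1)[OF R_group[OF D(1)]]] .
   then show False using h by simp
  qed
 qed
 then show "finite {h \<in> Hom C (Dom C f) c. res (FF c) f s h \<noteq> \<zero>\<^bsub>rsect R (Dom C f)\<^esub>}"
  by (rule finite_subset) (use s in \<open>auto simp: carrier_free_module\<close>)
qed

lemma res_FF_add:
 assumes s: "s \<in> carrier (FM (Cod C f) c)" and t: "t \<in> carrier (FM (Cod C f) c)"
 shows "res (FF c) f (s \<oplus>\<^bsub>FM (Cod C f) c\<^esub> t) = res (FF c) f s \<oplus>\<^bsub>FM (Dom C f) c\<^esub> res (FF c) f t"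
proof
 fix h
 show "res (FF c) f (s \<oplus>\<^bsub>FM (Cod C f) c\<^esub> t) h = (res (FF c) f s \<oplus>\<^bsub>FM (Dom C f) c\<^esub> res (FF c) f t) h"
 proof (cases "h \<in> Hom C (Dom C f) c")
  case True
  then show ?thesis
   using res_FF[OF free_add_closed[OF ring_R[OF D(2)] s t] True] res_FF[OF s True] res_FF[OF t True]
    ls(2)[OF s t] by (simp add: free_module_simps)
 next
  case False
  then show ?thesis by (simp add: free_module_simps) (simp add: free_psh_fun_def)
 qed
qed

lemma res_FF_single:
 assumes g: "g \<in> Hom C (Cod C f) c" and a: "a \<in> \<R> (Cod C f)"
 shows "res (FF c) f (sg (Cod C f) c g a) = sg (Dom C f) c (g \<cdot> f) (rres R f a)"
proof
 fix h
 show "res (FF c) f (sg (Cod C f) c g a) h = sg (Dom C f) c (g \<cdot> f) (rres R f a) h"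
 proof (cases "h \<in> Hom C (Dom C f) c")
  case True
  then show ?thesis
   using res_FF[OF single_closed[OF ring_R[OF D(2)] g a] True] ls(3)[OF g a] by (auto simp: pp_def single_def)
 qed (simp add: single_def free_psh_fun_def)
qed

lemma semilinear_FF: "semilinear (rsect R (Cod C f)) (rres R f) (FM (Cod C f) c) (FM (Dom C f) c) (res (FF c) f)"
proof -
 interpret M: left_module "rsect R (Cod C f)" "FM (Cod C f) c" by (rule left_module_free[OF ring_R[OF D(2)]])
 interpret M': left_module "rsect R (Dom C f)" "FM (Dom C f) c" by (rule left_module_free[OF ring_R[OF D(1)]])
 have z: "res (FF c) f \<zero>\<^bsub>FM (Cod C f) c\<^esub> = \<zero>\<^bsub>FM (Dom C f) c\<^esub>"
  using res_FF_add[of "\<zero>\<^bsub>FM (Cod C f) c\<^esub>" "\<zero>\<^bsub>FM (Cod C f) c\<^esub>"] res_FF_closed[of "\<zero>\<^bsub>FM (Cod C f) c\<^esub>"]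
   M'.M.add.r_cancel_one' by fastforce
 have "res (FF c) f (a \<odot>\<^bsub>FM (Cod C f) c\<^esub> s) = rres R f a \<odot>\<^bsub>FM (Dom C f) c\<^esub> res (FF c) f s"
  if a: "a \<in> \<R> (Cod C f)" and s: "s \<in> carrier (FM (Cod C f) c)" for a s
  using ring_R[OF D(2)] s
 proof (induction s rule: free_module_induct)
  case zero
  then show ?case using a z M.smult_r_null M'.smult_r_null rres_closed[OF f] by simp
 next
  case (single g b)
  then show ?case
   using a D by (simp add: smult_single[OF ring_R] res_FF_single rres_closed[OF f] ring_hom_mult[OF rres_hom[OF f]])
 next
  case (add s t)
  then show ?case
   using a M.smult_r_distr M'.smult_r_distr res_FF_add M.smult_closed res_FF_closed rres_closed[OF f] by simp
 qed
 then show ?thesis unfolding semilinear_def using res_FF_closed res_FF_add by auto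
qed

end

lemma module_presheaf_FF: assumes c: "c \<in> Obj C" shows "module_presheaf \<mu> C R (FF c)"
 unfolding module_presheaf_def sect_FF
proof (intro conjI ballI impI semilinear_FF[OF c])
 fix d assume d: "d \<in> Obj C"
 show "left_module (rsect R d) (FM d c)" by (rule left_module_free[OF ring_R[OF d]])
 show "small \<mu> (carrier (FM d c))" by (rule small_free_module[OF U small_Hom[OF d c] small_R[OF d]])
 have sl: "semilinear (rsect R d) (rres R (Idn C d)) (FM d c) (FM d c) (res (FF c) (Idn C d))"
  using semilinear_FF[OF c Idn_Arr(1)[OF d]] d by simp
 fix s assume "s \<in> carrier (FM d c)"
 with ring_R[OF d] show "res (FF c) (Idn C d) s = s"
 proof (induction s rule: free_module_induct)
  case zero
  show ?case by (rule semilinear_zero[OF sl]) (use left_module.axioms(2)[OF left_module_free[OF ring_R[OF d]]] in auto)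
 next
  case (single g a)
  have "rres R (Idn C d) a = a" using rings d single(2) by (simp add: ring_presheaf_def)
  then show ?case using res_FF_single[OF c Idn_Arr(1)[OF d]] single d Cmp_Idn_right[OF single(1)] by simp
 next
  case (add s t) then show ?case using sl by (simp add: semilinear_def)
 qed
next
 fix f g s assume f: "f \<in> Arr C" and g: "g \<in> Arr C" and fg: "Dom C g = Cod C f" and s: "s \<in> carrier (FM (Cod C g) c)"
 note gf = Cmp_Arr[OF f g fg]
 have sl: "semilinear (rsect R (Cod C g)) (rres R (g \<cdot> f)) (FM (Cod C g) c) (FM (Dom C f) c) (res (FF c) (g \<cdot> f))"
  using semilinear_FF[OF c, of "g \<cdot> f"] gf by simp
 have sf: "semilinear (rsect R (Cod C f)) (rres R f) (FM (Cod C f) c) (FM (Dom C f) c) (res (FF c) f)" by (rule semilinear_FF[OF c f])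
 have sgg: "semilinear (rsect R (Cod C g)) (rres R g) (FM (Cod C g) c) (FM (Cod C f) c) (res (FF c) g)"
  using semilinear_FF[OF c g] fg by simp
 have ag: "abelian_group (FM d c)" if "d \<in> Obj C" for d by (rule left_module.axioms(2)[OF left_module_free[OF ring_R[OF that]]])
 note o = Dom_closed[OF f] Cod_closed[OF f] Cod_closed[OF g]
 from ring_R[OF o(3)] s show "res (FF c) (g \<cdot> f) s = res (FF c) f (res (FF c) g s)"
 proof (induction s rule: free_module_induct)
  case zero
  show ?case using semilinear_zero[OF sl ag ag] semilinear_zero[OF sf ag ag] semilinear_zero[OF sgg ag ag] o by simp
 next
  case (single h a)
  have hg: "h \<cdot> g \<in> Hom C (Cod C f) c" using Cmp_in_Hom[OF Hom_Dom_Cod[OF g] single(1)] fg by simp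
  have "rres R (g \<cdot> f) a = rres R f (rres R g a)" using rings f g fg single(2) by (simp add: ring_presheaf_def)
  moreover have "h \<cdot> (g \<cdot> f) = (h \<cdot> g) \<cdot> f"
   using Cmp_assoc[OF Hom_Dom_Cod[OF f] _ single(1), of g] g fg by (simp add: Hom_def)
  ultimately show ?case
   using res_FF_single[OF c, of "g \<cdot> f" h a] gf single res_FF_single[OF c g single] fg
    res_FF_single[OF c f hg, of "rres R g a"] rres_closed[OF g single(2)] by simp
 next
  case (add s t)
  then show ?case using sl sf sgg by (simp add: semilinear_def Pi_iff)
 qed
qed

abbreviation PP :: "'o => ('o, 'a, 'r, 'u) psh" where "PP c \<equiv> free_psh C R c"

text \<open>The universal element \<open>1 [id]\<close> of the free presheaf on \<open>c\<close>, in
  its transported copy: maps out of the free presheaf are determined by their value here, and every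
  value occurs.\<close>

definition \<eta> :: "'o => 'u" where
 "\<eta> c = sect_embedding (FF c) c (sg c c (Idn C c) \<one>\<^bsub>rsect R c\<^esub>)"

text \<open>Maps from the free presheaf on \<open>c\<close> to the presheaf in degree
  \<open>n\<close> of \<open>X\<close>. The differential is left aside, so that the Yoneda lemma
  applies degree by degree.\<close>

definition pmap :: "('o, 'a, 'r, 'u) psh_cplx => int => 'o => ('o => 'u => 'u) => bool" where
 "pmap X n c \<phi> \<longleftrightarrow>
  (\<forall>d\<in>Obj C. \<forall>u\<in>carrier (sect (PP c) d). \<phi> d u \<in> K X n d &
    (\<forall>v\<in>carrier (sect (PP c) d). \<phi> d (u \<oplus>\<^bsub>sect (PP c) d\<^esub> v) = pl X n d (\<phi> d u) (\<phi> d v)) &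
    (\<forall>a\<in>\<R> d. \<phi> d (a \<odot>\<^bsub>sect (PP c) d\<^esub> u) = sm X n d a (\<phi> d u))) &
  (\<forall>f\<in>Arr C. \<forall>u\<in>carrier (sect (PP c) (Cod C f)). \<phi> (Dom C f) (res (PP c) f u) = rs X n f (\<phi> (Cod C f) u))"

context fixes c assumes c: "c \<in> Obj C" begin

private lemmas tr = transport_psh_module[OF module_presheaf_FF[OF c], folded free_psh_def, unfolded sect_FF]

lemma module_presheaf_PP: "module_presheaf \<mu> C R (PP c)" by (rule tr(1))

lemma \<eta>_closed: "\<eta> c \<in> carrier (sect (PP c) c)"
 unfolding tr(2)[OF c] \<eta>_def using single_closed[OF ring_R[OF c] Idn_in_Hom[OF c] R_closed(3)[OF c]] by blast

text \<open>Every section is a sum of terms \<open>a [g]\<close>, and \<open>a [g]\<close> is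
  \<open>a\<close> times the restriction of \<open>\<eta> c\<close> along \<open>g\<close>.\<close>

lemma pmap_unique:
 assumes X: "X \<in> Obj ch" and p: "pmap X n c \<phi>" and q: "pmap X n c \<psi>" and e: "\<phi> c (\<eta> c) = \<psi> c (\<eta> c)"
  and d: "d \<in> Obj C" and u: "u \<in> carrier (sect (PP c) d)"
 shows "\<phi> d u = \<psi> d u"
proof -
 let ?e = "sect_embedding (FF c) d :: _ => 'u"
 obtain s where s: "s \<in> carrier (FM d c)" "u = ?e s" using u tr(2)[OF d] by auto
 have z: "\<phi> d (?e \<zero>\<^bsub>FM d c\<^esub>) = zr X n d" if "pmap X n c \<phi>" for \<phi>
 proof -
  interpret M: left_module "rsect R d" "FM d c" by (rule left_module_free[OF ring_R[OF d]])
  have "?e \<zero>\<^bsub>FM d c\<^esub> \<in> carrier (sect (PP c) d)" using tr(2)[OF d] M.M.zero_closed by blast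
  moreover have "?e \<zero>\<^bsub>FM d c\<^esub> \<oplus>\<^bsub>sect (PP c) d\<^esub> ?e \<zero>\<^bsub>FM d c\<^esub> = ?e \<zero>\<^bsub>FM d c\<^esub>"
   using tr(4)[OF d M.M.zero_closed M.M.zero_closed] by simp
  ultimately show ?thesis using that d pl_self_zr[OF X d, of "\<phi> d (?e \<zero>\<^bsub>FM d c\<^esub>)" n] unfolding pmap_def by metis
 qed
 from ring_R[OF d] s(1) have "\<phi> d (?e s) = \<psi> d (?e s)"
 proof (induction s rule: free_module_induct)
  case zero
  show ?case using z[OF p] z[OF q] by simp
 next
  case (single g a)
  have g: "g \<in> Arr C" "Dom C g = d" "Cod C g = c" using single(1) by (auto simp: Hom_def)
  have i: "sg c c (Idn C c) \<one>\<^bsub>rsect R c\<^esub> \<in> carrier (FM c c)"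
   by (rule single_closed[OF ring_R[OF c] Idn_in_Hom[OF c] R_closed(3)[OF c]])
  \<comment> \<open>Restriction of \<open>1 [id]\<close> along \<open>g\<close> is
    \<open>1 [g]\<close>.\<close>
  have "res (FF c) g (sg c c (Idn C c) \<one>\<^bsub>rsect R c\<^esub>) = sg d c g \<one>\<^bsub>rsect R d\<^esub>"
   using res_FF_single[OF c g(1), of "Idn C c" "\<one>\<^bsub>rsect R c\<^esub>"] g Idn_in_Hom[OF c] R_closed(3)[OF c] Cmp_Idn_left[OF single(1)]
    ring_hom_one[OF rres_hom[OF g(1)]] by simp
  then have 1: "res (PP c) g (\<eta> c) = ?e (sg d c g \<one>\<^bsub>rsect R d\<^esub>)"
   using tr(6)[OF g(1), of "sg c c (Idn C c) \<one>\<^bsub>rsect R c\<^esub>"] i g by (simp add: \<eta>_def)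
  have 2: "a \<odot>\<^bsub>sect (PP c) d\<^esub> ?e (sg d c g \<one>\<^bsub>rsect R d\<^esub>) = ?e (sg d c g a)"
   using tr(5)[OF d single_closed[OF ring_R[OF d] single(1) R_closed(3)[OF d]], of a]
    smult_single[OF ring_R[OF d] single(2) R_closed(3)[OF d], of "Hom C d c" g] ring.ring_simprules(11,12)[OF ring_R[OF d]] single(2)
    monoid.r_one[OF ring.is_monoid[OF ring_R[OF d]]] by simp
  have 3: "?e (sg d c g \<one>\<^bsub>rsect R d\<^esub>) \<in> carrier (sect (PP c) d)"
   using tr(2)[OF d] single_closed[OF ring_R[OF d] single(1) R_closed(3)[OF d]] by blast
  have H: "\<phi> d (?e (sg d c g a)) = sm X n d a (rs X n g (\<phi> c (\<eta> c)))" if "pmap X n c \<phi>" for \<phi>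
  proof -
   have "\<phi> d (a \<odot>\<^bsub>sect (PP c) d\<^esub> res (PP c) g (\<eta> c)) = sm X n d a (\<phi> d (res (PP c) g (\<eta> c)))"
    using that d 3 single(2) unfolding 1 pmap_def by blast
   moreover have "\<phi> d (res (PP c) g (\<eta> c)) = rs X n g (\<phi> c (\<eta> c))"
    using that g \<eta>_closed unfolding pmap_def by metis
   ultimately show ?thesis using 1 2 by simp
  qed
  show ?case unfolding H[OF p] H[OF q] e ..
 next
  case (add s t)
  have H: "\<phi> d (?e (s \<oplus>\<^bsub>FM d c\<^esub> t)) = pl X n d (\<phi> d (?e s)) (\<phi> d (?e t))" if "pmap X n c \<phi>" for \<phi>
  proof -
   have "?e s \<in> carrier (sect (PP c) d)" "?e t \<in> carrier (sect (PP c) d)" using add(1,2) tr(2)[OF d] by auto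
   then show ?thesis using that d tr(4)[OF d add(1,2)] unfolding pmap_def by metis
  qed
  show ?case unfolding H[OF p] H[OF q] add(3,4) ..
 qed
 then show ?thesis using s by simp
qed

text \<open>The map sends \<open>a [g]\<close> to \<open>a\<close> times the restriction of
  \<open>x\<close> along \<open>g\<close>, extended by \<open>linsum\<close>.\<close>

lemma pmap_exists:
 assumes X: "X \<in> Obj ch" and x: "x \<in> K X n c"
 shows "\<exists>\<phi>. pmap X n c \<phi> & \<phi> c (\<eta> c) = x"
proof -
 define p where "p d g a = sm X n d a (rs X n g x)" for d g a
 define L where "L d = linsum (rsect R d) (Hom C d c) (sect (deg X n) d) (p d)" for d
 have gx: "rs X n g x \<in> K X n d" if "g \<in> Hom C d c" for d g using that X x by (auto simp: Hom_def)
 have p: "p d g a \<in> carrier (sect (deg X n) d)" if "d \<in> Obj C" "g \<in> Hom C d c" "a \<in> \<R> d" for d g a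
  using that X gx by (simp add: p_def K_def[symmetric])
 have p_add: "p d g (a \<oplus>\<^bsub>rsect R d\<^esub> b) = p d g a \<oplus>\<^bsub>sect (deg X n) d\<^esub> p d g b"
  if "d \<in> Obj C" "g \<in> Hom C d c" "a \<in> \<R> d" "b \<in> \<R> d" for d g a b
  using that X gx by (simp add: p_def pl_def[symmetric] sm_add)
 have Lc: "L d s \<in> K X n d" if "d \<in> Obj C" "s \<in> carrier (FM d c)" for d s
  unfolding L_def K_def by (rule linsum_closed[OF ring_R[OF that(1)] sect_group[OF X that(1)] p[OF that(1)] p_add[OF that(1)] that(2)])
 have La: "L d (s \<oplus>\<^bsub>FM d c\<^esub> t) = pl X n d (L d s) (L d t)" if "d \<in> Obj C" "s \<in> carrier (FM d c)" "t \<in> carrier (FM d c)" for d s t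
  unfolding L_def pl_def by (rule linsum_add[OF ring_R[OF that(1)] sect_group[OF X that(1)] p[OF that(1)] p_add[OF that(1)] that(2,3)])
 have Ls: "L d (sg d c g a) = sm X n d a (rs X n g x)" if "d \<in> Obj C" "g \<in> Hom C d c" "a \<in> \<R> d" for d g a
 proof -
  have "linsum (rsect R d) (Hom C d c) (sect (deg X n) d) (p d) (sg d c g a) = p d g a"
   by (rule linsum_single[OF ring_R[OF that(1)] sect_group[OF X that(1)] _ _ that(2,3)])
    (use p[OF that(1)] p_add[OF that(1)] in auto)
  then show ?thesis by (simp add: L_def p_def)
 qed
 have Lz: "L d \<zero>\<^bsub>FM d c\<^esub> = zr X n d" if "d \<in> Obj C" for d
  unfolding L_def zr_def
  by (rule linsum_zero[OF ring_R[OF that] sect_group[OF X that]]) (use p[OF that] p_add[OF that] in auto)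
 have Lm: "L d (a \<odot>\<^bsub>FM d c\<^esub> s) = sm X n d a (L d s)" if d: "d \<in> Obj C" and a: "a \<in> \<R> d" and s: "s \<in> carrier (FM d c)" for d a s
 proof -
  interpret M: left_module "rsect R d" "FM d c" by (rule left_module_free[OF ring_R[OF d]])
  from ring_R[OF d] s show ?thesis
  proof (induction s rule: free_module_induct)
   case zero then show ?case using Lz[OF d] M.smult_r_null[OF a] X d a by simp
  next
   case (single g b)
   then show ?case using X d a by (simp add: smult_single[OF ring_R] Ls gx sm_mult)
  next
   case (add s t)
   then show ?case using M.smult_r_distr[OF a] La[OF d] M.smult_closed[OF a] X d a Lc[OF d] sm_pl by simp
  qed
 qed
 have Lr: "L (Dom C f) (res (FF c) f s) = rs X n f (L (Cod C f) s)" if f: "f \<in> Arr C" and s: "s \<in> carrier (FM (Cod C f) c)" for f s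
 proof -
  note o = Dom_closed[OF f] Cod_closed[OF f]
  have ag: "abelian_group (FM d c)" if "d \<in> Obj C" for d by (rule left_module.axioms(2)[OF left_module_free[OF ring_R[OF that]]])
  from ring_R[OF o(2)] s show ?thesis
  proof (induction s rule: free_module_induct)
   case zero then show ?case using semilinear_zero[OF semilinear_FF[OF c f] ag ag] o Lz X f by simp
  next
   case (single g b)
   have gf: "g \<cdot> f \<in> Hom C (Dom C f) c" using Cmp_in_Hom[OF Hom_Dom_Cod[OF f] single(1)] .
   have "rs X n (g \<cdot> f) x = rs X n f (rs X n g x)" using rs_rs[OF X f, of g x n] single(1) x by (auto simp: Hom_def)
   then show ?case
    using res_FF_single[OF c f single] Ls[OF o(1) gf rres_closed[OF f single(2)]] Ls[OF o(2) single]
     rs_sm[OF X f single(2) gx[OF single(1)]] by simp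
  next
   case (add s t)
   then show ?case using res_FF_add[OF c f add(1,2)] La[OF o(2) add(1,2)] La[OF o(1) res_FF_closed[OF c f add(1)] res_FF_closed[OF c f add(2)]]
    rs_pl[OF X f Lc[OF o(2) add(1)] Lc[OF o(2) add(2)]] by simp
  qed
 qed
 let ?e = "\<lambda>d. sect_embedding (FF c) d :: _ => 'u"
 define \<phi> where "\<phi> d u = L d (inv_into (carrier (FM d c)) (?e d) u)" for d u
 have \<phi>: "\<phi> d (?e d s) = L d s" if "d \<in> Obj C" "s \<in> carrier (FM d c)" for d s
  unfolding \<phi>_def using tr(3)[OF that(1)] that(2) by simp
 have car: "\<exists>s\<in>carrier (FM d c). u = ?e d s" if "d \<in> Obj C" "u \<in> carrier (sect (PP c) d)" for d u
  using that tr(2)[OF that(1)] by auto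
 have "pmap X n c \<phi>"
  unfolding pmap_def
 proof (intro conjI ballI)
  fix d u assume d: "d \<in> Obj C" and u: "u \<in> carrier (sect (PP c) d)"
  then obtain s where s: "s \<in> carrier (FM d c)" "u = ?e d s" using car by blast
  interpret M: left_module "rsect R d" "FM d c" by (rule left_module_free[OF ring_R[OF d]])
  show "\<phi> d u \<in> K X n d" using s \<phi>[OF d] Lc[OF d] by simp
  show "\<phi> d (u \<oplus>\<^bsub>sect (PP c) d\<^esub> v) = pl X n d (\<phi> d u) (\<phi> d v)" if v: "v \<in> carrier (sect (PP c) d)" for v
  proof -
   obtain t where t: "t \<in> carrier (FM d c)" "v = ?e d t" using car[OF d v] by blast
   then show ?thesis using s \<phi>[OF d] La[OF d] tr(4)[OF d s(1) t(1)] M.M.a_closed by simp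
  qed
  show "\<phi> d (a \<odot>\<^bsub>sect (PP c) d\<^esub> u) = sm X n d a (\<phi> d u)" if a: "a \<in> \<R> d" for a
   using s \<phi>[OF d] Lm[OF d a] tr(5)[OF d s(1)] M.smult_closed[OF a] by simp
 next
  fix f u assume f: "f \<in> Arr C" and u: "u \<in> carrier (sect (PP c) (Cod C f))"
  note o = Dom_closed[OF f] Cod_closed[OF f]
  obtain s where s: "s \<in> carrier (FM (Cod C f) c)" "u = ?e (Cod C f) s" using car[OF o(2) u] by blast
  show "\<phi> (Dom C f) (res (PP c) f u) = rs X n f (\<phi> (Cod C f) u)"
   using s \<phi> o tr(6)[OF f s(1)] Lr[OF f s(1)] res_FF_closed[OF c f s(1)] by simp
 qed
 moreover have "\<phi> c (\<eta> c) = x"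
  unfolding \<eta>_def using \<phi>[OF c single_closed[OF ring_R[OF c] Idn_in_Hom[OF c] R_closed(3)[OF c]]]
   Ls[OF c Idn_in_Hom[OF c] R_closed(3)[OF c]] X c x by simp
 ultimately show ?thesis by blast
qed

end

end

section \<open>Spheres, disks and their lifting problems\<close>

context psh_setup begin

lemma module_presheaf_zero: "module_presheaf \<mu> C R (zero_psh :: ('o, 'a, 'r, 'v) psh)"
 unfolding module_presheaf_def semilinear_def
proof (intro conjI ballI impI)
 fix c assume c: "c \<in> Obj C"
 have "abelian_group (sect (zero_psh :: ('o, 'a, 'r, 'v) psh) c)"
  by (rule abelian_groupI) (auto simp: zero_psh_def)
 moreover have "left_module_axioms (rsect R c) (sect (zero_psh :: ('o, 'a, 'r, 'v) psh) c)"
  by standard (auto simp: zero_psh_def)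
 ultimately show "left_module (rsect R c) (sect (zero_psh :: ('o, 'a, 'r, 'v) psh) c)"
  using ring_R[OF c] by (simp add: left_module_def)
 show "small \<mu> (carrier (sect (zero_psh :: ('o, 'a, 'r, 'v) psh) c))"
  by (rule small_finite[OF U]) (simp add: zero_psh_def)
qed (auto simp: zero_psh_def)

lemma zero_arr_in_Hom:
 assumes P: "module_presheaf \<mu> C R P" and Q: "module_presheaf \<mu> C R Q"
 shows "zero_arr C P Q \<in> Hom N P Q"
proof -
 have "module_presheaf_map C R P Q (app (zero_arr C P Q))"
  unfolding module_presheaf_map_def semilinear_def
 proof (intro conjI ballI)
  show "app (zero_arr C P Q) \<in> extensional (Obj C)" by (simp add: zero_arr_def app_def)
 next
  fix c assume c: "c \<in> Obj C"
  interpret M: left_module "rsect R c" "sect P c" using P c by (simp add: module_presheaf_def)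
  interpret M': left_module "rsect R c" "sect Q c" using Q c by (simp add: module_presheaf_def)
  show "app (zero_arr C P Q) c \<in> extensional (carrier (sect P c))" using c by (simp add: zero_arr_def app_def)
  show "app (zero_arr C P Q) c \<in> carrier (sect P c) \<rightarrow> carrier (sect Q c)"
   using c by (auto simp: zero_arr_def app_def)
  show "app (zero_arr C P Q) c (x \<oplus>\<^bsub>sect P c\<^esub> y) = app (zero_arr C P Q) c x \<oplus>\<^bsub>sect Q c\<^esub> app (zero_arr C P Q) c y"
   if "x \<in> carrier (sect P c)" "y \<in> carrier (sect P c)" for x y
   using c that M.M.a_closed by (simp add: zero_arr_def app_def)
  show "app (zero_arr C P Q) c (a \<odot>\<^bsub>sect P c\<^esub> x) = a \<odot>\<^bsub>sect Q c\<^esub> app (zero_arr C P Q) c x"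
   if "a \<in> \<R> c" "x \<in> carrier (sect P c)" for a x
   using c that M.smult_closed M'.smult_r_null by (simp add: zero_arr_def app_def)
 next
  fix f x assume f: "f \<in> Arr C" and x: "x \<in> carrier (sect P (Cod C f))"
  note o = Dom_closed[OF f] Cod_closed[OF f]
  have "res P f x \<in> carrier (sect P (Dom C f))"
   using P f x by (auto simp: module_presheaf_def semilinear_def)
  moreover have "res Q f \<zero>\<^bsub>sect Q (Cod C f)\<^esub> = \<zero>\<^bsub>sect Q (Dom C f)\<^esub>"
   by (rule semilinear_zero) (use Q f o left_module.axioms(2) in \<open>auto simp: module_presheaf_def\<close>)
  ultimately show "app (zero_arr C P Q) (Dom C f) (res P f x) = res Q f (app (zero_arr C P Q) (Cod C f) x)"
   using x o by (simp add: app_zero_arr)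
 qed
 then show ?thesis using P Q by (simp add: Hom_psh_cat) (simp add: zero_arr_def app_def)
qed

lemma Idn_in_Hom_psh: assumes P: "module_presheaf \<mu> C R P" shows "Idn N P \<in> Hom N P P"
proof -
 have "module_presheaf_map C R P P (app (Idn N P))"
  unfolding module_presheaf_map_def semilinear_def
 proof (intro conjI ballI)
  show "app (Idn N P) \<in> extensional (Obj C)" by (simp add: psh_cat_def app_def)
 next
  fix c assume c: "c \<in> Obj C"
  interpret M: left_module "rsect R c" "sect P c" using P c by (simp add: module_presheaf_def)
  show "app (Idn N P) c \<in> extensional (carrier (sect P c))" using c by (simp add: psh_cat_def app_def)
  show "app (Idn N P) c \<in> carrier (sect P c) \<rightarrow> carrier (sect P c)" using c by (auto simp: app_Idn)
  show "app (Idn N P) c (x \<oplus>\<^bsub>sect P c\<^esub> y) = app (Idn N P) c x \<oplus>\<^bsub>sect P c\<^esub> app (Idn N P) c y"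
   if "x \<in> carrier (sect P c)" "y \<in> carrier (sect P c)" for x y
   using c that M.M.a_closed by (simp add: app_Idn)
  show "app (Idn N P) c (a \<odot>\<^bsub>sect P c\<^esub> x) = a \<odot>\<^bsub>sect P c\<^esub> app (Idn N P) c x"
   if "a \<in> \<R> c" "x \<in> carrier (sect P c)" for a x
   using c that M.smult_closed by (simp add: app_Idn)
 next
  fix f x assume f: "f \<in> Arr C" and x: "x \<in> carrier (sect P (Cod C f))"
  have "res P f x \<in> carrier (sect P (Dom C f))"
   using P f x by (auto simp: module_presheaf_def semilinear_def)
  then show "app (Idn N P) (Dom C f) (res P f x) = res P f (app (Idn N P) (Cod C f) x)"
   using x Dom_closed[OF f] Cod_closed[OF f] by (simp add: app_Idn)
 qed
 then show ?thesis using P by (simp add: Hom_psh_cat) (simp add: psh_cat_def app_def)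
qed

abbreviation Zc :: "('o, 'a, 'r, 'u) psh_cplx" where "Zc \<equiv> zero_complex C"
abbreviation Sp :: "'o => int => ('o, 'a, 'r, 'u) psh_cplx" where "Sp c n \<equiv> sphere_complex C (PP c) n"
abbreviation Dk :: "'o => int => ('o, 'a, 'r, 'u) psh_cplx" where "Dk c n \<equiv> disk_complex \<mu> C R (PP c) n"
abbreviation gi :: "'o => int => ('o, 'a, 'r, 'u) psh_cplx_arr" where "gi c n \<equiv> gen_i \<mu> C R c n"
abbreviation gj :: "'o => int => ('o, 'a, 'r, 'u) psh_cplx_arr" where "gj c n \<equiv> gen_j \<mu> C R c n"

lemma deg_Zc [simp]: "deg Zc k = zero_psh" by (simp add: zero_complex_def)
lemma deg_Sp: "deg (Sp c n) k = (if k = n then PP c else zero_psh)" by (simp add: sphere_complex_def Let_def)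
lemma deg_Dk: "deg (Dk c n) k = (if k = n + 1 \<or> k = n then PP c else zero_psh)" by (simp add: disk_complex_def Let_def)

lemma K_Zc [simp]: "K Zc k d = {undefined}" by (simp add: K_def zero_psh_def)
lemma K_Sp: "K (Sp c n) k d = (if k = n then carrier (sect (PP c) d) else {undefined})"
 by (simp add: K_def deg_Sp zero_psh_def)
lemma K_Dk: "K (Dk c n) k d = (if k = n + 1 \<or> k = n then carrier (sect (PP c) d) else {undefined})"
 by (simp add: K_def deg_Dk zero_psh_def)

lemma bd_Zc: "d \<in> Obj C ==> u \<in> K Zc k d ==> bd Zc k d u = zr Zc (k - 1) d"
 by (simp add: bd_def zero_complex_def app_def zero_arr_def zr_def K_def)

lemma bd_Sp: "d \<in> Obj C ==> u \<in> K (Sp c n) k d ==> bd (Sp c n) k d u = zr (Sp c n) (k - 1) d"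
 by (simp add: bd_def sphere_complex_def Let_def app_def zero_arr_def zr_def K_def)

lemma bd_Dk: "d \<in> Obj C ==> u \<in> K (Dk c n) k d ==> bd (Dk c n) k d u = (if k = n + 1 then u else zr (Dk c n) (k - 1) d)"
 by (cases "k = n + 1"; cases "k = n") (simp_all add: bd_def disk_complex_def Let_def app_def zero_arr_def zr_def K_def psh_cat_def)

lemma Zc_Obj [simp]: "Zc \<in> Obj ch"
 unfolding Obj_ch
proof (intro allI conjI ballI)
 fix n show "module_presheaf \<mu> C R (deg Zc n)" by (simp add: module_presheaf_zero)
 show "bdry Zc n \<in> Hom N (deg Zc n) (deg Zc (n - 1))"
  using zero_arr_in_Hom[OF module_presheaf_zero module_presheaf_zero] by (simp add: zero_complex_def)
 fix c x assume "c \<in> Obj C" "x \<in> K Zc n c"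
 then show "bd Zc (n - 1) c (bd Zc n c x) = zr Zc (n - 2) c" by (simp add: bd_Zc zr_def zero_psh_def)
qed

lemma Sp_Obj [simp]: assumes c: "c \<in> Obj C" shows "Sp c n \<in> Obj ch"
 unfolding Obj_ch
proof (intro allI conjI ballI)
 fix k
 have mp: "module_presheaf \<mu> C R (deg (Sp c n) k)" for k
  by (simp add: deg_Sp module_presheaf_zero module_presheaf_PP[OF c])
 then show "module_presheaf \<mu> C R (deg (Sp c n) k)" .
 have "bdry (Sp c n) k = zero_arr C (deg (Sp c n) k) (deg (Sp c n) (k - 1))" by (simp add: sphere_complex_def Let_def)
 then show b: "bdry (Sp c n) k \<in> Hom N (deg (Sp c n) k) (deg (Sp c n) (k - 1))" using zero_arr_in_Hom[OF mp mp] by simp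
 fix d u assume d: "d \<in> Obj C" and u: "u \<in> K (Sp c n) k d"
 have "zr (Sp c n) (k - 1) d \<in> K (Sp c n) (k - 1) d"
 proof -
  have "left_module (rsect R d) (sect (deg (Sp c n) (k - 1)) d)" using mp d by (simp add: module_presheaf_def)
  then interpret M: left_module "rsect R d" "sect (deg (Sp c n) (k - 1)) d" .
  show ?thesis by (simp add: zr_def K_def)
 qed
 then show "bd (Sp c n) (k - 1) d (bd (Sp c n) k d u) = zr (Sp c n) (k - 2) d"
  using bd_Sp[OF d u] bd_Sp[OF d, of "zr (Sp c n) (k - 1) d" c n "k - 1"] by simp
qed

lemma Dk_Obj [simp]: assumes c: "c \<in> Obj C" shows "Dk c n \<in> Obj ch"
 unfolding Obj_ch
proof (intro allI conjI ballI)
 fix k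
 have mp: "module_presheaf \<mu> C R (deg (Dk c n) k)" for k
  by (simp add: deg_Dk module_presheaf_zero module_presheaf_PP[OF c])
 then show "module_presheaf \<mu> C R (deg (Dk c n) k)" .
 have "bdry (Dk c n) k = (if k = n + 1 then Idn N (PP c) else zero_arr C (deg (Dk c n) k) (deg (Dk c n) (k - 1)))"
  by (simp add: disk_complex_def Let_def)
 then show b: "bdry (Dk c n) k \<in> Hom N (deg (Dk c n) k) (deg (Dk c n) (k - 1))"
  by (auto simp: deg_Dk zero_arr_in_Hom module_presheaf_zero module_presheaf_PP[OF c] Idn_in_Hom_psh)
 fix d u assume d: "d \<in> Obj C" and u: "u \<in> K (Dk c n) k d"
 have z: "zr (Dk c n) (k - 1) d \<in> K (Dk c n) (k - 1) d"
 proof -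
  have "left_module (rsect R d) (sect (deg (Dk c n) (k - 1)) d)" using mp d by (simp add: module_presheaf_def)
  then interpret M: left_module "rsect R d" "sect (deg (Dk c n) (k - 1)) d" .
  show ?thesis by (simp add: zr_def K_def)
 qed
 show "bd (Dk c n) (k - 1) d (bd (Dk c n) k d u) = zr (Dk c n) (k - 2) d"
 proof (cases "k = n + 1")
  case True
  then have "u \<in> K (Dk c n) (k - 1) d" using u by (simp add: K_Dk)
  then show ?thesis using bd_Dk[OF d u] bd_Dk[OF d, of u c n "k - 1"] True by simp
 next
  case False
  then show ?thesis using bd_Dk[OF d u] bd_Dk[OF d z] by (simp add: zr_def deg_Dk)
 qed
qed

lemma ev_pmap:
 assumes h: "h \<in> Hom ch A X" and c: "c \<in> Obj C" and e: "deg A k = PP c" shows "pmap X k c (ev h k)"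
 unfolding pmap_def
proof (intro conjI ballI)
 have KA: "K A k d = carrier (sect (PP c) d)" "pl A k d = add (sect (PP c) d)" "sm A k d = smult (sect (PP c) d)"
  "rs A k = res (PP c)" for d by (simp_all add: K_def pl_def sm_def rs_def e fun_eq_iff)
 fix d u assume d: "d \<in> Obj C" and u: "u \<in> carrier (sect (PP c) d)"
 show "ev h k d u \<in> K X k d" using h d u KA by (metis ev_closed)
 show "v \<in> carrier (sect (PP c) d) ==> ev h k d (u \<oplus>\<^bsub>sect (PP c) d\<^esub> v) = pl X k d (ev h k d u) (ev h k d v)" for v
  using ev_pl[OF h d, of u k v] u KA by metis
 show "a \<in> \<R> d ==> ev h k d (a \<odot>\<^bsub>sect (PP c) d\<^esub> u) = sm X k d a (ev h k d u)" for a
  using ev_sm[OF h d, of a u k] u KA by metis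
next
 fix f u assume f: "f \<in> Arr C" and u: "u \<in> carrier (sect (PP c) (Cod C f))"
 show "ev h k (Dom C f) (res (PP c) f u) = rs X k f (ev h k (Cod C f) u)"
  using ev_rs[OF h f, of u k] u by (simp add: K_def rs_def e)
qed

lemma \<eta>_K: assumes "c \<in> Obj C" shows "\<eta> c \<in> K (Sp c n) n c" "\<eta> c \<in> K (Dk c n) n c" "\<eta> c \<in> K (Dk c n) (n + 1) c"
 using \<eta>_closed[OF assms] by (simp_all add: K_Sp K_Dk)

lemma disk_map:
 assumes c: "c \<in> Obj C" and X: "X \<in> Obj ch" and x: "x \<in> K X (n + 1) c"
 shows "\<exists>h\<in>Hom ch (Dk c n) X. ev h (n + 1) c (\<eta> c) = x"
proof -
 obtain \<phi> where \<phi>: "pmap X (n + 1) c \<phi>" "\<phi> c (\<eta> c) = x" using pmap_exists[OF c X x] by blast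
 \<comment> \<open>The identity differential of the disk forces the value in degree \<open>n\<close>
   to be the boundary of the value in degree \<open>n + 1\<close>; in all other degrees the disk is
   zero.\<close>
 define g where "g k d u = (if k = n + 1 then \<phi> d u else if k = n then bd X (n + 1) d (\<phi> d u) else zr X k d)" for k d u
 have p: "\<phi> d u \<in> K X (n + 1) d" "v \<in> carrier (sect (PP c) d) ==> \<phi> d (u \<oplus>\<^bsub>sect (PP c) d\<^esub> v) = pl X (n + 1) d (\<phi> d u) (\<phi> d v)"
  "a \<in> \<R> d ==> \<phi> d (a \<odot>\<^bsub>sect (PP c) d\<^esub> u) = sm X (n + 1) d a (\<phi> d u)"
  if "d \<in> Obj C" "u \<in> carrier (sect (PP c) d)" for d u v a using \<phi>(1) that by (auto simp: pmap_def)
 have pr: "\<phi> (Dom C f) (res (PP c) f u) = rs X (n + 1) f (\<phi> (Cod C f) u)"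
  if "f \<in> Arr C" "u \<in> carrier (sect (PP c) (Cod C f))" for f u using \<phi>(1) that by (auto simp: pmap_def)
 have p': "bd X (n + 1) d (\<phi> d u) \<in> K X n d" if "d \<in> Obj C" "u \<in> carrier (sect (PP c) d)" for d u
  using p(1)[OF that] that X by simp
 have pz: "\<phi> d \<zero>\<^bsub>sect (PP c) d\<^esub> = zr X (n + 1) d" if d: "d \<in> Obj C" for d
 proof -
  interpret M: left_module "rsect R d" "sect (PP c) d" using module_presheaf_PP[OF c] d by (simp add: module_presheaf_def)
  show ?thesis using pl_self_zr[OF X d, of "\<phi> d \<zero>\<^bsub>sect (PP c) d\<^esub>" "n + 1"] p(1)[OF d M.M.zero_closed]
   p(2)[OF d M.M.zero_closed M.M.zero_closed] by simp
 qed
 have "hm (Dk c n) X g"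
 proof (rule hmI)
  fix k d u assume d: "d \<in> Obj C" and u: "u \<in> K (Dk c n) k d"
  show "g k d u \<in> K X k d" using d u X p(1) p' by (auto simp: g_def K_Dk)
  show "g k d (pl (Dk c n) k d u v) = pl X k d (g k d u) (g k d v)" if v: "v \<in> K (Dk c n) k d" for v
   using d u v X p bd_pl[OF X d, of _ "n + 1"] by (auto simp: g_def K_Dk pl_def[of "Dk c n"] deg_Dk)
  show "g k d (sm (Dk c n) k d a u) = sm X k d a (g k d u)" if a: "a \<in> \<R> d" for a
   using d u a X p bd_sm[OF X d a, of _ "n + 1"] by (auto simp: g_def K_Dk sm_def[of "Dk c n"] deg_Dk)
  show "g (k - 1) d (bd (Dk c n) k d u) = bd X k d (g k d u)"
   using d u X p p' pz bd_bd'[OF X d, of _ "n + 1"] bd_Dk[OF d u] by (auto simp: add.commute[of 1 n] g_def K_Dk zr_def[of "Dk c n"] deg_Dk)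
 next
  fix k f u assume f: "f \<in> Arr C" and u: "u \<in> K (Dk c n) k (Cod C f)"
  show "g k (Dom C f) (rs (Dk c n) k f u) = rs X k f (g k (Cod C f) u)"
   using f u X pr p(1) bd_rs[OF X f, of _ "n + 1"] Cod_closed[OF f] by (auto simp: g_def K_Dk rs_def[of "Dk c n"] deg_Dk)
 qed
 then have "mk (Dk c n) X g \<in> Hom ch (Dk c n) X" by (rule mk_in_Hom[OF Dk_Obj[OF c] X])
 moreover have "ev (mk (Dk c n) X g) (n + 1) c (\<eta> c) = x" using \<eta>_K(3)[OF c] c \<phi>(2) by (simp add: g_def)
 ultimately show ?thesis by blast
qed

lemma disk_eq:
 assumes c: "c \<in> Obj C" and h: "h \<in> Hom ch (Dk c n) X" and h': "h' \<in> Hom ch (Dk c n) X"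
  and e: "ev h (n + 1) c (\<eta> c) = ev h' (n + 1) c (\<eta> c)"
 shows "h = h'"
proof (rule arr_eqI[OF h h'])
 note X = conjunct2[OF Hom_ObjD[OF h]]
 have top: "ev h (n + 1) d u = ev h' (n + 1) d u" if "d \<in> Obj C" "u \<in> carrier (sect (PP c) d)" for d u
  by (rule pmap_unique[OF c X ev_pmap[OF h c] ev_pmap[OF h' c] e that]) (simp_all add: deg_Dk)
 fix k d u assume d: "d \<in> Obj C" and u: "u \<in> K (Dk c n) k d"
 consider "k = n + 1" | "k = n" | "k \<noteq> n + 1" "k \<noteq> n" by blast
 then show "ev h k d u = ev h' k d u"
 proof cases
  case 1
  then show ?thesis using top[OF d] u by (simp add: K_Dk)
 next
  case 2
  then have u': "u \<in> K (Dk c n) (n + 1) d" "u \<in> carrier (sect (PP c) d)" using u by (simp_all add: K_Dk)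
  \<comment> \<open>A section in degree \<open>n\<close> is the boundary of the same section in
    degree \<open>n + 1\<close>, so the top degree decides.\<close>
  have "bd (Dk c n) (n + 1) d u = u" using bd_Dk[OF d u'(1)] by simp
  then show ?thesis using ev_bd[OF h d u'(1)] ev_bd[OF h' d u'(1)] top[OF d u'(2)] 2 by simp
 next
  case 3
  then have "u = zr (Dk c n) k d" using u by (simp add: K_Dk zr_def deg_Dk zero_psh_def)
  then show ?thesis using ev_zr[OF h d] ev_zr[OF h' d] by simp
 qed
qed

lemma sphere_eq:
 assumes c: "c \<in> Obj C" and h: "h \<in> Hom ch (Sp c n) X" and h': "h' \<in> Hom ch (Sp c n) X"
  and e: "ev h n c (\<eta> c) = ev h' n c (\<eta> c)"
 shows "h = h'"
proof (rule arr_eqI[OF h h'])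
 note X = conjunct2[OF Hom_ObjD[OF h]]
 fix k d u assume d: "d \<in> Obj C" and u: "u \<in> K (Sp c n) k d"
 show "ev h k d u = ev h' k d u"
 proof (cases "k = n")
  case True
  show ?thesis unfolding True
   by (rule pmap_unique[OF c X ev_pmap[OF h c] ev_pmap[OF h' c] e d]) (use u True in \<open>simp_all add: deg_Sp K_Sp\<close>)
 next
  case False
  then have "u = zr (Sp c n) k d" using u by (simp add: K_Sp zr_def deg_Sp zero_psh_def)
  then show ?thesis using ev_zr[OF h d] ev_zr[OF h' d] by simp
 qed
qed

lemma sphere_cycle:
 assumes c: "c \<in> Obj C" and h: "h \<in> Hom ch (Sp c n) X" shows "bd X n c (ev h n c (\<eta> c)) = zr X (n - 1) c"
 using ev_bd[OF h c \<eta>_K(1)[OF c]] bd_Sp[OF c \<eta>_K(1)[OF c]] ev_zr[OF h c] by simp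

lemma sphere_map:
 assumes c: "c \<in> Obj C" and X: "X \<in> Obj ch" and x: "x \<in> K X n c" "bd X n c x = zr X (n - 1) c"
 shows "\<exists>h\<in>Hom ch (Sp c n) X. ev h n c (\<eta> c) = x"
proof -
 obtain \<phi> where \<phi>: "pmap X n c \<phi>" "\<phi> c (\<eta> c) = x" using pmap_exists[OF c X x(1)] by blast
 define g where "g k d u = (if k = n then \<phi> d u else zr X k d)" for k d u
 have p: "\<phi> d u \<in> K X n d" "v \<in> carrier (sect (PP c) d) ==> \<phi> d (u \<oplus>\<^bsub>sect (PP c) d\<^esub> v) = pl X n d (\<phi> d u) (\<phi> d v)"
  "a \<in> \<R> d ==> \<phi> d (a \<odot>\<^bsub>sect (PP c) d\<^esub> u) = sm X n d a (\<phi> d u)"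
  if "d \<in> Obj C" "u \<in> carrier (sect (PP c) d)" for d u v a using \<phi>(1) that by (auto simp: pmap_def)
 have pr: "\<phi> (Dom C f) (res (PP c) f u) = rs X n f (\<phi> (Cod C f) u)"
  if "f \<in> Arr C" "u \<in> carrier (sect (PP c) (Cod C f))" for f u using \<phi>(1) that by (auto simp: pmap_def)
 \<comment> \<open>The boundary after \<open>\<phi>\<close> and the zero map agree at
   \<open>\<eta> c\<close>, because \<open>x\<close> is a cycle; by uniqueness they agree
   everywhere, so all values of \<open>\<phi>\<close> are cycles.\<close>
 have "pmap X (n - 1) c (\<lambda>d u. bd X n d (\<phi> d u))"
  unfolding pmap_def
 proof (intro conjI ballI)
  fix d u assume d: "d \<in> Obj C" and u: "u \<in> carrier (sect (PP c) d)"
  show "bd X n d (\<phi> d u) \<in> K X (n - 1) d" using p(1)[OF d u] d X by simp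
  show "v \<in> carrier (sect (PP c) d) ==> bd X n d (\<phi> d (u \<oplus>\<^bsub>sect (PP c) d\<^esub> v)) =
    pl X (n - 1) d (bd X n d (\<phi> d u)) (bd X n d (\<phi> d v))" for v
   using p(2)[OF d u] bd_pl[OF X d p(1)[OF d u] p(1)[OF d]] by simp
  show "a \<in> \<R> d ==> bd X n d (\<phi> d (a \<odot>\<^bsub>sect (PP c) d\<^esub> u)) = sm X (n - 1) d a (bd X n d (\<phi> d u))" for a
   using p(3)[OF d u] bd_sm[OF X d _ p(1)[OF d u]] by simp
 next
  fix f u assume f: "f \<in> Arr C" and u: "u \<in> carrier (sect (PP c) (Cod C f))"
  show "bd X n (Dom C f) (\<phi> (Dom C f) (res (PP c) f u)) = rs X (n - 1) f (bd X n (Cod C f) (\<phi> (Cod C f) u))"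
   using pr[OF f u] bd_rs[OF X f p(1)[OF Cod_closed[OF f] u]] by simp
 qed
 moreover have "pmap X (n - 1) c (\<lambda>d u. zr X (n - 1) d)" using X by (auto simp: pmap_def)
 ultimately have pz: "bd X n d (\<phi> d u) = zr X (n - 1) d" if "d \<in> Obj C" "u \<in> carrier (sect (PP c) d)" for d u
  using pmap_unique[OF c X _ _ _ that] \<phi>(2) x(2) by blast
 have pz0: "\<phi> d \<zero>\<^bsub>sect (PP c) d\<^esub> = zr X n d" if d: "d \<in> Obj C" for d
 proof -
  interpret M: left_module "rsect R d" "sect (PP c) d" using module_presheaf_PP[OF c] d by (simp add: module_presheaf_def)
  show ?thesis using pl_self_zr[OF X d, of "\<phi> d \<zero>\<^bsub>sect (PP c) d\<^esub>" n] p(1)[OF d M.M.zero_closed]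
   p(2)[OF d M.M.zero_closed M.M.zero_closed] by simp
 qed
 have "hm (Sp c n) X g"
 proof (rule hmI)
  fix k d u assume d: "d \<in> Obj C" and u: "u \<in> K (Sp c n) k d"
  show "g k d u \<in> K X k d" using d u X p(1) by (auto simp: g_def K_Sp)
  show "g k d (pl (Sp c n) k d u v) = pl X k d (g k d u) (g k d v)" if v: "v \<in> K (Sp c n) k d" for v
   using d u v X p by (auto simp: g_def K_Sp pl_def[of "Sp c n"] deg_Sp)
  show "g k d (sm (Sp c n) k d a u) = sm X k d a (g k d u)" if a: "a \<in> \<R> d" for a
   using d u a X p by (auto simp: g_def K_Sp sm_def[of "Sp c n"] deg_Sp)
  show "g (k - 1) d (bd (Sp c n) k d u) = bd X k d (g k d u)"
   using d u X p pz pz0 bd_Sp[OF d u] by (auto simp: g_def K_Sp zr_def[of "Sp c n"] deg_Sp)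
 next
  fix k f u assume f: "f \<in> Arr C" and u: "u \<in> K (Sp c n) k (Cod C f)"
  show "g k (Dom C f) (rs (Sp c n) k f u) = rs X k f (g k (Cod C f) u)"
   using f u X pr p(1) by (auto simp: g_def K_Sp rs_def[of "Sp c n"] deg_Sp)
 qed
 then have "mk (Sp c n) X g \<in> Hom ch (Sp c n) X" by (rule mk_in_Hom[OF Sp_Obj[OF c] X])
 moreover have "ev (mk (Sp c n) X g) n c (\<eta> c) = x" using \<eta>_K(1)[OF c] c \<phi>(2) by (simp add: g_def)
 ultimately show ?thesis by blast
qed

lemma gi_mk: "gi c n = mk (Sp c n) (Dk c n) (\<lambda>k d u. if k = n then u else zr (Dk c n) k d)"
proof -
 have "(if k = n then Idn (psh_cat \<mu> C R) (PP c) else zero_arr C (deg (Sp c n) k) (deg (Dk c n) k)) =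
  (deg (Sp c n) k, deg (Dk c n) k, \<lambda>d\<in>Obj C. \<lambda>x\<in>K (Sp c n) k d. if k = n then x else zr (Dk c n) k d)" for k
  by (simp add: psh_cat_def zero_arr_def K_def zr_def deg_Sp deg_Dk)
 then show ?thesis unfolding gen_i_def Let_def mk_def by simp
qed

lemma gi_Hom: assumes c: "c \<in> Obj C" shows "gi c n \<in> Hom ch (Sp c n) (Dk c n)"
 unfolding gi_mk
proof (rule mk_in_Hom[OF Sp_Obj[OF c] Dk_Obj[OF c]])
 have eqs: "pl (Sp c n) n = pl (Dk c n) n" "sm (Sp c n) n = sm (Dk c n) n" "rs (Sp c n) n = rs (Dk c n) n"
  by (simp_all add: pl_def sm_def rs_def deg_Sp deg_Dk fun_eq_iff)
 show "hm (Sp c n) (Dk c n) (\<lambda>k d u. if k = n then u else zr (Dk c n) k d)"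
 proof (rule hmI, goal_cases)
  case (4 k d u)
  show ?case
  proof (cases "k = n")
   case True
   then have "u \<in> K (Dk c n) k d" using 4 by (simp add: K_Sp K_Dk)
   then show ?thesis using True bd_Dk[of d u c n k] 4(1) by simp
  next
   case False
   have "zr (Sp c n) n d = zr (Dk c n) n d" by (simp add: zr_def deg_Sp deg_Dk)
   then show ?thesis using False bd_Sp[OF 4] bd_zr[OF Dk_Obj[OF c, of n] 4(1), of k] by auto
  qed
 next
  case (1 k d u)
  then show ?case using zr_closed[OF Dk_Obj[OF c, of n] 1(1), of k] by (auto simp: K_Sp K_Dk)
 next
  case (2 k d u v)
  then show ?case using eqs pl_zr(1)[OF Dk_Obj[OF c, of n] 2(1) zr_closed[OF Dk_Obj[OF c, of n] 2(1)], of k] by auto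
 next
  case (3 k d u a)
  then show ?case using eqs sm_zr[OF Dk_Obj[OF c, of n] 3(1,3), of k] by auto
 next
  case (5 k f u)
  then show ?case using eqs rs_zr[OF Dk_Obj[OF c, of n] 5(1), of k] by auto
 qed
qed

lemma ev_gi: "c \<in> Obj C ==> ev (gi c n) n c (\<eta> c) = \<eta> c"
 unfolding gi_mk using \<eta>_K(1) by simp

lemma gj_mk: "gj c n = mk Zc (Dk c n) (\<lambda>k d u. zr (Dk c n) k d)"
 unfolding gen_j_def Let_def mk_def zero_arr_def K_def zr_def by simp

lemma zero_map: assumes X: "X \<in> Obj ch" shows "mk Zc X (\<lambda>k d u. zr X k d) \<in> Hom ch Zc X"
 by (rule mk_in_Hom[OF Zc_Obj X]) (rule hmI; use X in \<open>simp\<close>)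

lemma zero_map_unique: "h \<in> Hom ch Zc X ==> h' \<in> Hom ch Zc X ==> h = h'"
proof (rule arr_eqI)
 fix k d u assume h: "h \<in> Hom ch Zc X" "h' \<in> Hom ch Zc X" and d: "d \<in> Obj C" and "u \<in> K Zc k d"
 then have "u = zr Zc k d" by (simp add: zr_def zero_psh_def)
 then show "ev h k d u = ev h' k d u" using h d by simp
qed

lemma gj_Hom: "c \<in> Obj C ==> gj c n \<in> Hom ch Zc (Dk c n)"
 unfolding gj_mk by (rule zero_map) simp

text \<open>A map out of the zero complex carries no information, so a square is a section of
  \<open>Y\<close> and a lift is a preimage of it. The relevant degree is the top one of the disk,
  \<open>n + 1\<close>.\<close>

lemma gj_lifts:
 assumes c: "c \<in> Obj C" and p: "p \<in> Hom ch X Y"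
 shows "has_lifts ch (gj c n) p \<longleftrightarrow> (\<forall>y\<in>K Y (n + 1) c. \<exists>x\<in>K X (n + 1) c. ev p (n + 1) c x = y)" (is "?l \<longleftrightarrow> ?r")
proof
 note XY = Hom_ObjD[OF p]
 note eH = \<eta>_K(3)[OF c, of n]
 assume l: ?l
 show ?r
 proof
  fix y assume y: "y \<in> K Y (n + 1) c"
  obtain v where v: "v \<in> Hom ch (Dk c n) Y" "ev v (n + 1) c (\<eta> c) = y" using disk_map[OF c _ y] XY by blast
  let ?z = "mk Zc X (\<lambda>k d u. zr X k d)"
  have z: "?z \<in> Hom ch Zc X" using zero_map XY by blast
  have "p \<star> ?z = v \<star> gj c n"
   using zero_map_unique[OF Cmp_in_Hom_ch[OF z p] Cmp_in_Hom_ch[OF gj_Hom[OF c] v(1)]] .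
  from ch.has_liftsD[OF l gj_Hom[OF c] p z v(1) this]
  obtain h where h: "h \<in> Hom ch (Dk c n) X" "p \<star> h = v" by blast
  then show "\<exists>x\<in>K X (n + 1) c. ev p (n + 1) c x = y"
   using ev_closed[OF h(1) c eH] ev_Cmp[OF h(1) p c eH] v(2) by auto
 qed
next
 note XY = Hom_ObjD[OF p]
 note eH = \<eta>_K(3)[OF c, of n]
 assume r: ?r
 show ?l
 proof (rule ch.has_liftsI[OF gj_Hom[OF c] p])
  fix u v assume u: "u \<in> Hom ch Zc X" and v: "v \<in> Hom ch (Dk c n) Y"
  obtain x where x: "x \<in> K X (n + 1) c" "ev p (n + 1) c x = ev v (n + 1) c (\<eta> c)" using r ev_closed[OF v c eH] by blast
  obtain h where h: "h \<in> Hom ch (Dk c n) X" "ev h (n + 1) c (\<eta> c) = x" using disk_map[OF c _ x(1)] XY by blast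
  have "p \<star> h = v" by (rule disk_eq[OF c Cmp_in_Hom_ch[OF h(1) p] v]) (use ev_Cmp[OF h(1) p c eH] h x in simp)
  moreover have "h \<star> gj c n = u" using zero_map_unique[OF Cmp_in_Hom_ch[OF gj_Hom[OF c] h(1)] u] .
  ultimately show "\<exists>h\<in>Hom ch (Dk c n) X. h \<star> gj c n = u & p \<star> h = v" using h(1) by blast
 qed
qed

lemma ev_disk_eta: assumes c: "c \<in> Obj C" and h: "h \<in> Hom ch (Dk c n) X"
 shows "ev h n c (\<eta> c) = bd X (n + 1) c (ev h (n + 1) c (\<eta> c))"
 using ev_bd[OF h c \<eta>_K(3)[OF c]] bd_Dk[OF c \<eta>_K(3)[OF c, of n]] by simp

lemma ev_disk_gi: assumes c: "c \<in> Obj C" and h: "h \<in> Hom ch (Dk c n) X"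
 shows "ev (h \<star> gi c n) n c (\<eta> c) = bd X (n + 1) c (ev h (n + 1) c (\<eta> c))"
 using ev_Cmp[OF gi_Hom[OF c] h c \<eta>_K(1)[OF c]] ev_gi[OF c] ev_disk_eta[OF c h] by simp

text \<open>A square consists of a cycle of \<open>X\<close> and a section of \<open>Y\<close>
  bounding its image: restricting a disk map to the sphere takes the boundary of the section that
  the disk map represents.\<close>

lemma gi_lifts:
 assumes c: "c \<in> Obj C" and p: "p \<in> Hom ch X Y"
 shows "has_lifts ch (gi c n) p \<longleftrightarrow> (\<forall>x\<in>K X n c. \<forall>y\<in>K Y (n + 1) c. bd X n c x = zr X (n - 1) c -->
  ev p n c x = bd Y (n + 1) c y --> (\<exists>w\<in>K X (n + 1) c. bd X (n + 1) c w = x & ev p (n + 1) c w = y))" (is "?l \<longleftrightarrow> ?r")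
proof
 note XY = Hom_ObjD[OF p]
 note eH = \<eta>_K[OF c, of n]
 assume l: ?l
 show ?r
 proof (intro ballI impI)
  fix x y assume x: "x \<in> K X n c" and y: "y \<in> K Y (n + 1) c" and z: "bd X n c x = zr X (n - 1) c" and e: "ev p n c x = bd Y (n + 1) c y"
  obtain v where v: "v \<in> Hom ch (Dk c n) Y" "ev v (n + 1) c (\<eta> c) = y" using disk_map[OF c _ y] XY by blast
  obtain u where u: "u \<in> Hom ch (Sp c n) X" "ev u n c (\<eta> c) = x" using sphere_map[OF c _ x z] XY by blast
  have "p \<star> u = v \<star> gi c n"
   by (rule sphere_eq[OF c Cmp_in_Hom_ch[OF u(1) p] Cmp_in_Hom_ch[OF gi_Hom[OF c] v(1)]])
    (use ev_disk_gi[OF c v(1)] v(2) ev_Cmp[OF u(1) p c eH(1)] u(2) e in simp)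
  from ch.has_liftsD[OF l gi_Hom[OF c] p u(1) v(1) this]
  obtain h where h: "h \<in> Hom ch (Dk c n) X" "h \<star> gi c n = u" "p \<star> h = v" by blast
  show "\<exists>w\<in>K X (n + 1) c. bd X (n + 1) c w = x & ev p (n + 1) c w = y"
   using ev_closed[OF h(1) c eH(3)] ev_Cmp[OF h(1) p c eH(3)] v(2) u(2) ev_disk_gi[OF c h(1)] h(2,3) by auto
 qed
next
 note XY = Hom_ObjD[OF p]
 note eH = \<eta>_K[OF c, of n]
 assume r: ?r
 show ?l
 proof (rule ch.has_liftsI[OF gi_Hom[OF c] p])
  fix u v assume u: "u \<in> Hom ch (Sp c n) X" and v: "v \<in> Hom ch (Dk c n) Y" and e: "p \<star> u = v \<star> gi c n"
  have "ev p n c (ev u n c (\<eta> c)) = bd Y (n + 1) c (ev v (n + 1) c (\<eta> c))"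
   using ev_Cmp[OF u p c eH(1)] ev_disk_gi[OF c v] e by simp
  then obtain x where x: "x \<in> K X (n + 1) c" "bd X (n + 1) c x = ev u n c (\<eta> c)" "ev p (n + 1) c x = ev v (n + 1) c (\<eta> c)"
   using r ev_closed[OF v c eH(3)] ev_closed[OF u c eH(1)] sphere_cycle[OF c u] by blast
  obtain h where h: "h \<in> Hom ch (Dk c n) X" "ev h (n + 1) c (\<eta> c) = x" using disk_map[OF c _ x(1)] XY by blast
  have "p \<star> h = v" by (rule disk_eq[OF c Cmp_in_Hom_ch[OF h(1) p] v]) (use ev_Cmp[OF h(1) p c eH(3)] h x in simp)
  moreover have "h \<star> gi c n = u"
   by (rule sphere_eq[OF c Cmp_in_Hom_ch[OF gi_Hom[OF c] h(1)] u]) (use ev_disk_gi[OF c h(1)] h x in simp)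
  ultimately show "\<exists>h\<in>Hom ch (Dk c n) X. h \<star> gi c n = u & p \<star> h = v" using h(1) by blast
 qed
qed

end

section \<open>Fibrations and homology in terms of sections\<close>

context psh_setup begin

lemma S_retract: "c \<in> Obj C ==> \<exists>s\<in>S. \<exists>f\<in>Hom C c s. \<exists>g\<in>Hom C s c. g \<cdot> f = Idn C c"
 using S_rep[of c] unfolding isomorphic_def is_iso_def by (fastforce simp: Hom_def)

lemma Hom_ch_Arr: "f \<in> Arr ch ==> f \<in> Hom ch (Dom ch f) (Cod ch f)" by (simp add: Hom_def)

lemma levelwise_iff:
 assumes p: "p \<in> Hom ch X Y"
 shows "p \<in> levelwise_surjections \<mu> C R \<longleftrightarrow> (\<forall>n. \<forall>c\<in>Obj C. \<forall>y\<in>K Y n c. \<exists>x\<in>K X n c. ev p n c x = y)"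
proof -
 obtain \<phi> where pe: "p = (X, Y, \<phi>)" using p by (auto simp: Hom_ch)
 have "p \<in> Arr ch" using p by (simp add: Hom_def)
 then have "p \<in> levelwise_surjections \<mu> C R \<longleftrightarrow> (\<forall>n. \<forall>c\<in>Obj C. ev p n c ` K X n c = K Y n c)"
  unfolding levelwise_surjections_def pe ev_def K_def by simp
 also have "\<dots> \<longleftrightarrow> (\<forall>n. \<forall>c\<in>Obj C. \<forall>y\<in>K Y n c. \<exists>x\<in>K X n c. ev p n c x = y)"
  using ev_closed[OF p] by (auto simp: image_iff set_eq_iff) metis+
 finally show ?thesis .
qed

lemma Arr_levelwise: "levelwise_surjections \<mu> C R \<subseteq> Arr ch" by (auto simp: levelwise_surjections_def)

lemma gen_J_Arr: "gen_J \<mu> C R S \<subseteq> Arr ch" and gen_I_Arr: "gen_I \<mu> C R S \<subseteq> Arr ch"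
 using gj_Hom gi_Hom S_Obj unfolding gen_J_def gen_I_def Hom_def by auto

text \<open>Restrict \<open>y\<close> to a representative \<open>s\<close>, find a preimage there
  and restrict back; the composite of the two arrows is the identity of \<open>c\<close>.\<close>

lemma surj_transfer:
 assumes p: "p \<in> Hom ch X Y" and l: "!!s. s \<in> S ==> \<forall>y\<in>K Y n s. \<exists>x\<in>K X n s. ev p n s x = y"
  and c: "c \<in> Obj C" and y: "y \<in> K Y n c"
 shows "\<exists>x\<in>K X n c. ev p n c x = y"
proof -
 note XY = Hom_ObjD[OF p]
 obtain s f g where s: "s \<in> S" and f: "f \<in> Arr C" "Dom C f = c" "Cod C f = s"
  and g: "g \<in> Arr C" "Dom C g = s" "Cod C g = c" and gf: "g \<cdot> f = Idn C c"
  using S_retract[OF c] by (auto simp: Hom_def)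
 have "rs Y n g y \<in> K Y n s" using XY g y by auto
 then obtain x where x: "x \<in> K X n s" "ev p n s x = rs Y n g y" using l[OF s] by blast
 have "ev p n c (rs X n f x) = rs Y n f (rs Y n g y)" using ev_rs[OF p f(1), of x n] f x by simp
 also have "\<dots> = y" using rs_rs[of Y f g y n] XY f g gf y c by simp
 finally show ?thesis using x XY f by (intro bexI[of _ "rs X n f x"]) auto
qed

lemma Fib_injectives: "levelwise_surjections \<mu> C R = injectives ch (gen_J \<mu> C R S)"
proof (rule Set.set_eqI)
 fix p
 show "p \<in> levelwise_surjections \<mu> C R \<longleftrightarrow> p \<in> injectives ch (gen_J \<mu> C R S)"
 proof (cases "p \<in> Arr ch")
  case True
  then have p: "p \<in> Hom ch (Dom ch p) (Cod ch p)" by (rule Hom_ch_Arr)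
  have "p \<in> injectives ch (gen_J \<mu> C R S) \<longleftrightarrow> (\<forall>s\<in>S. \<forall>n. \<forall>y\<in>K (Cod ch p) (n + 1) s. \<exists>x\<in>K (Dom ch p) (n + 1) s. ev p (n + 1) s x = y)"
  proof -
   have "p \<in> injectives ch (gen_J \<mu> C R S) \<longleftrightarrow> (\<forall>s\<in>S. \<forall>n. has_lifts ch (gj s n) p)"
    using True unfolding injectives_def gen_J_def by blast
   moreover have "s \<in> S ==> s \<in> Obj C" for s using S_Obj by blast
   ultimately show ?thesis using gj_lifts[OF _ p] by simp
  qed
  also have "\<dots> \<longleftrightarrow> (\<forall>n. \<forall>c\<in>Obj C. \<forall>y\<in>K (Cod ch p) n c. \<exists>x\<in>K (Dom ch p) n c. ev p n c x = y)"
  proof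
   assume l: "\<forall>s\<in>S. \<forall>n. \<forall>y\<in>K (Cod ch p) (n + 1) s. \<exists>x\<in>K (Dom ch p) (n + 1) s. ev p (n + 1) s x = y"
   \<comment> \<open>Lifting against \<open>gj s n\<close> speaks of degree \<open>n + 1\<close>, so
     degree \<open>n\<close> is the instance \<open>n - 1\<close>.\<close>
   have "\<forall>y\<in>K (Cod ch p) n s. \<exists>x\<in>K (Dom ch p) n s. ev p n s x = y" if "s \<in> S" for n s
    using bspec[OF l that, THEN spec, of "n - 1"] by simp
   then show "\<forall>n. \<forall>c\<in>Obj C. \<forall>y\<in>K (Cod ch p) n c. \<exists>x\<in>K (Dom ch p) n c. ev p n c x = y"
    using surj_transfer[OF p] by blast
  qed (use S_Obj in blast)
  finally show ?thesis using levelwise_iff[OF p] by blast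
 next
  case False
  then show ?thesis using Arr_levelwise unfolding injectives_def by blast
 qed
qed

lemma small_gens: "small \<mu> (gen_I \<mu> C R S)" "small \<mu> (gen_J \<mu> C R S)"
proof -
 have "small \<mu> (UNIV :: int set)" by (rule small_countable[OF U]) simp
 from small_image2[OF U S_small this, of "gen_i \<mu> C R"] small_image2[OF U S_small this, of "gen_j \<mu> C R"]
 show "small \<mu> (gen_I \<mu> C R S)" "small \<mu> (gen_J \<mu> C R S)"
  unfolding gen_I_def gen_J_def by simp_all
qed

text \<open>Bijectivity on homology without quotients: first injectivity in kernel form, then
  surjectivity modulo boundaries. The diagram chases use the weak equivalences in this form.\<close>

definition wq :: "('o, 'a, 'r, 'u) psh_cplx => ('o, 'a, 'r, 'u) psh_cplx => ('o, 'a, 'r, 'u) psh_cplx_arr => bool" where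
 "wq X Y f \<longleftrightarrow> (\<forall>n. \<forall>c\<in>Obj C.
  (\<forall>x\<in>K X n c. bd X n c x = zr X (n - 1) c --> (\<exists>y\<in>K Y (n + 1) c. ev f n c x = bd Y (n + 1) c y) -->
    (\<exists>w\<in>K X (n + 1) c. x = bd X (n + 1) c w)) &
  (\<forall>y\<in>K Y n c. bd Y n c y = zr Y (n - 1) c -->
    (\<exists>x\<in>K X n c. bd X n c x = zr X (n - 1) c & (\<exists>w\<in>K Y (n + 1) c. y = pl Y n c (bd Y (n + 1) c w) (ev f n c x)))))"

text \<open>The coset modulo boundaries, which is the homology class if \<open>x\<close> is a
  cycle.\<close>

definition cs :: "('o, 'a, 'r, 'u) psh_cplx => int => 'o => 'u => 'u set" where
 "cs X n c x = boundaries X n c +>\<^bsub>sect (deg X n) c\<^esub> x"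

lemma cs_iff: "y \<in> cs X n c x \<longleftrightarrow> (\<exists>w\<in>K X (n + 1) c. y = pl X n c (bd X (n + 1) c w) x)"
 by (auto simp: cs_def a_r_coset_def' boundaries_def K_def pl_def bd_def)

context
 fixes X assumes X: "X \<in> Obj ch"
begin

lemma bd1 [simp]: "c \<in> Obj C ==> w \<in> K X (n + 1) c ==> bd X (n + 1) c w \<in> K X n c" using X by simp

lemma cs_self: "c \<in> Obj C ==> x \<in> K X n c ==> x \<in> cs X n c x"
 unfolding cs_iff using X by (intro bexI[of _ "zr X (n + 1) c"]) simp_all

lemma cs_subset:
 assumes c: "c \<in> Obj C" and y: "y \<in> K X n c" and w: "w \<in> K X (n + 1) c"
 shows "cs X n c (pl X n c (bd X (n + 1) c w) y) \<subseteq> cs X n c y"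
proof
 fix z assume "z \<in> cs X n c (pl X n c (bd X (n + 1) c w) y)"
 then obtain v where v: "v \<in> K X (n + 1) c" "z = pl X n c (bd X (n + 1) c v) (pl X n c (bd X (n + 1) c w) y)"
  by (auto simp: cs_iff)
 then have "z = pl X n c (bd X (n + 1) c (pl X (n + 1) c v w)) y"
  using X c y w bd_pl[OF X c v(1) w] by (simp add: pl_assoc)
 then show "z \<in> cs X n c y" using X c v(1) w unfolding cs_iff by blast
qed

lemma cs_eq:
 assumes c: "c \<in> Obj C" and x: "x \<in> K X n c" and y: "y \<in> K X n c"
 shows "cs X n c x = cs X n c y \<longleftrightarrow> (\<exists>w\<in>K X (n + 1) c. x = pl X n c (bd X (n + 1) c w) y)"
proof
 assume "cs X n c x = cs X n c y"
 then show "\<exists>w\<in>K X (n + 1) c. x = pl X n c (bd X (n + 1) c w) y" using cs_self[OF c x] by (simp add: cs_iff)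
next
 assume "\<exists>w\<in>K X (n + 1) c. x = pl X n c (bd X (n + 1) c w) y"
 then obtain w where w: "w \<in> K X (n + 1) c" "x = pl X n c (bd X (n + 1) c w) y" by blast
 have "y = pl X n c (bd X (n + 1) c (ng X (n + 1) c w)) x"
  using w X c y bd_ng[OF X c w(1)] by simp
 then show "cs X n c x = cs X n c y"
  using cs_subset[OF c y w(1)] cs_subset[OF c x, of "ng X (n + 1) c w"] w X c by auto
qed

text \<open>Scalar multiplication, restriction and induced maps on homology are defined as unions
  over a coset; such a union is that of a constant family as soon as its members ignore
  boundaries.\<close>

lemma cs_Union:
 assumes c: "c \<in> Obj C" and x: "x \<in> K X n c"
  and G: "!!w. w \<in> K X (n + 1) c ==> G (pl X n c (bd X (n + 1) c w) x) = T"
 shows "(\<Union>z\<in>cs X n c x. G z) = T"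
proof -
 have "G z = T" if "z \<in> cs X n c x" for z using that G by (auto simp: cs_iff)
 then show ?thesis using cs_self[OF c x] by auto
qed

definition cyc where "cyc n c = {x \<in> K X n c. bd X n c x = zr X (n - 1) c}"

lemma carrier_H: "carrier (sect (homology_psh C n X) c) = cs X n c ` cyc n c"
 by (simp add: homology_psh_def Let_def cs_def cyc_def cycles_def K_def bd_def zr_def)

lemma cyc_K: "x \<in> cyc n c ==> x \<in> K X n c" by (simp add: cyc_def)

lemma cyc_closed:
 assumes c: "c \<in> Obj C"
 shows "x \<in> cyc n c ==> y \<in> cyc n c ==> pl X n c x y \<in> cyc n c" "zr X n c \<in> cyc n c"
  "x \<in> cyc n c ==> ng X n c x \<in> cyc n c" "a \<in> \<R> c ==> x \<in> cyc n c ==> sm X n c a x \<in> cyc n c"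
 using X c by (auto simp: cyc_def bd_pl bd_ng bd_sm)

lemma cyc_rs: "f \<in> Arr C ==> x \<in> cyc n (Cod C f) ==> rs X n f x \<in> cyc n (Dom C f)"
 using X bd_rs[OF X, of f x n] by (auto simp: cyc_def)

lemma add_H:
 assumes c: "c \<in> Obj C" and x: "x \<in> K X n c" and y: "y \<in> K X n c"
 shows "cs X n c x \<oplus>\<^bsub>sect (homology_psh C n X) c\<^esub> cs X n c y = cs X n c (pl X n c x y)"
proof -
 have "cs X n c x \<oplus>\<^bsub>sect (homology_psh C n X) c\<^esub> cs X n c y = {pl X n c u v |u v. u \<in> cs X n c x & v \<in> cs X n c y}"
  by (auto simp: homology_psh_def Let_def set_add_def set_mult_def pl_def)
 also have "\<dots> = cs X n c (pl X n c x y)"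
 proof safe
  fix u v assume "u \<in> cs X n c x" "v \<in> cs X n c y"
  then obtain w w' where w: "w \<in> K X (n + 1) c" "w' \<in> K X (n + 1) c" "u = pl X n c (bd X (n + 1) c w) x" "v = pl X n c (bd X (n + 1) c w') y"
   by (auto simp: cs_iff)
  have "pl X n c u v = pl X n c (bd X (n + 1) c (pl X (n + 1) c w w')) (pl X n c x y)"
   using w X c x y bd_pl[OF X c w(1,2)] by (simp add: pl_assoc pl_lcomm[of X c x])
  then show "pl X n c u v \<in> cs X n c (pl X n c x y)" using w X c unfolding cs_iff by blast
 next
  fix z assume "z \<in> cs X n c (pl X n c x y)"
  then obtain w where w: "w \<in> K X (n + 1) c" "z = pl X n c (bd X (n + 1) c w) (pl X n c x y)" by (auto simp: cs_iff)
  then have "z = pl X n c (pl X n c (bd X (n + 1) c w) x) y" using X c x y by (simp add: pl_assoc)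
  moreover have "pl X n c (bd X (n + 1) c w) x \<in> cs X n c x" using w(1) by (auto simp: cs_iff)
  ultimately show "\<exists>u v. z = pl X n c u v & u \<in> cs X n c x & v \<in> cs X n c y" using cs_self[OF c y] by blast
 qed
 finally show ?thesis .
qed

lemma zero_H: assumes c: "c \<in> Obj C" shows "\<zero>\<^bsub>sect (homology_psh C n X) c\<^esub> = cs X n c (zr X n c)"
proof -
 have "\<zero>\<^bsub>sect (homology_psh C n X) c\<^esub> = bd X (n + 1) c ` K X (n + 1) c"
  by (simp add: homology_psh_def Let_def boundaries_def bd_def K_def)
 then show ?thesis using X c by (auto simp: cs_iff image_iff)
qed

lemma smult_H:
 assumes c: "c \<in> Obj C" and a: "a \<in> \<R> c" and x: "x \<in> K X n c"
 shows "a \<odot>\<^bsub>sect (homology_psh C n X) c\<^esub> cs X n c x = cs X n c (sm X n c a x)"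
proof -
 have "a \<odot>\<^bsub>sect (homology_psh C n X) c\<^esub> cs X n c x = (\<Union>z\<in>cs X n c x. cs X n c (sm X n c a z))"
  by (simp add: homology_psh_def Let_def cs_def sm_def)
 also have "\<dots> = cs X n c (sm X n c a x)"
 proof (rule cs_Union[OF c x])
  fix w assume w: "w \<in> K X (n + 1) c"
  have "sm X n c a (pl X n c (bd X (n + 1) c w) x) = pl X n c (bd X (n + 1) c (sm X (n + 1) c a w)) (sm X n c a x)"
   using X c a x w bd_sm[OF X c a w] by (simp add: sm_pl)
  then show "cs X n c (sm X n c a (pl X n c (bd X (n + 1) c w) x)) = cs X n c (sm X n c a x)"
   using X c a x w by (subst cs_eq) auto
 qed
 finally show ?thesis .
qed

lemma res_H:
 assumes f: "f \<in> Arr C" and x: "x \<in> K X n (Cod C f)"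
 shows "res (homology_psh C n X) f (cs X n (Cod C f) x) = cs X n (Dom C f) (rs X n f x)"
proof -
 note o = Dom_closed[OF f] Cod_closed[OF f]
 have "res (homology_psh C n X) f (cs X n (Cod C f) x) = (\<Union>z\<in>cs X n (Cod C f) x. cs X n (Dom C f) (rs X n f z))"
  by (simp add: homology_psh_def Let_def cs_def rs_def)
 also have "\<dots> = cs X n (Dom C f) (rs X n f x)"
 proof (rule cs_Union[OF o(2) x])
  fix w assume w: "w \<in> K X (n + 1) (Cod C f)"
  have "rs X n f (pl X n (Cod C f) (bd X (n + 1) (Cod C f) w) x) = pl X n (Dom C f) (bd X (n + 1) (Dom C f) (rs X (n + 1) f w)) (rs X n f x)"
   using X o f x w bd_rs[OF X f w] rs_pl[OF X f, of "bd X (n + 1) (Cod C f) w" n x] by simp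
  then show "cs X n (Dom C f) (rs X n f (pl X n (Cod C f) (bd X (n + 1) (Cod C f) w) x)) = cs X n (Dom C f) (rs X n f x)"
   using X o f x w by (subst cs_eq) auto
 qed
 finally show ?thesis .
qed

lemma module_presheaf_H: "module_presheaf \<mu> C R (homology_psh C n X)"
 unfolding module_presheaf_def semilinear_def
proof (intro conjI ballI impI)
 fix c assume c: "c \<in> Obj C"
 note s = carrier_H add_H[OF c cyc_K cyc_K] zero_H[OF c] smult_H[OF c _ cyc_K] cyc_closed[OF c] cyc_K
 have "abelian_group (sect (homology_psh C n X) c)"
 proof (rule abelian_groupI)
  fix x assume "x \<in> carrier (sect (homology_psh C n X) c)"
  then obtain u where u: "u \<in> cyc n c" "x = cs X n c u" by (auto simp: carrier_H)
  then have "cs X n c (ng X n c u) \<oplus>\<^bsub>sect (homology_psh C n X) c\<^esub> x = \<zero>\<^bsub>sect (homology_psh C n X) c\<^esub>"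
   using X c by (simp add: s)
  moreover have "cs X n c (ng X n c u) \<in> carrier (sect (homology_psh C n X) c)" using u by (simp add: s)
  ultimately show "\<exists>y\<in>carrier (sect (homology_psh C n X) c). y \<oplus>\<^bsub>sect (homology_psh C n X) c\<^esub> x = \<zero>\<^bsub>sect (homology_psh C n X) c\<^esub>"
   by blast
 qed (auto simp: s pl_assoc[OF X c] pl_comm[OF X c] pl_lcomm[OF X c] X c)
 moreover have "left_module_axioms (rsect R c) (sect (homology_psh C n X) c)"
  by standard (auto simp: s sm_add[OF X c] sm_pl[OF X c] sm_mult[OF X c] X c)
 ultimately show "left_module (rsect R c) (sect (homology_psh C n X) c)" using ring_R[OF c] by (simp add: left_module_def)
 show "small \<mu> (carrier (sect (homology_psh C n X) c))"
  unfolding carrier_H by (rule small_image[OF U small_mono[OF U small_K[OF X c, of n]]]) (auto simp: cyc_def)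
 show "x \<in> carrier (sect (homology_psh C n X) c) ==> res (homology_psh C n X) (Idn C c) x = x" for x
  using res_H[of "Idn C c" _ n] c X by (auto simp: carrier_H cyc_K)
next
 fix f assume f: "f \<in> Arr C"
 note o = Dom_closed[OF f] Cod_closed[OF f]
 show "res (homology_psh C n X) f \<in> carrier (sect (homology_psh C n X) (Cod C f)) \<rightarrow> carrier (sect (homology_psh C n X) (Dom C f))"
  using res_H[OF f cyc_K] cyc_rs[OF f] by (auto simp: carrier_H)
 fix x assume "x \<in> carrier (sect (homology_psh C n X) (Cod C f))"
 then obtain u where u: "u \<in> cyc n (Cod C f)" "x = cs X n (Cod C f) u" by (auto simp: carrier_H)
 show "res (homology_psh C n X) f (x \<oplus>\<^bsub>sect (homology_psh C n X) (Cod C f)\<^esub> y) =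
   res (homology_psh C n X) f x \<oplus>\<^bsub>sect (homology_psh C n X) (Dom C f)\<^esub> res (homology_psh C n X) f y"
  if y: "y \<in> carrier (sect (homology_psh C n X) (Cod C f))" for y
 proof -
  obtain v where v: "v \<in> cyc n (Cod C f)" "y = cs X n (Cod C f) v" using y by (auto simp: carrier_H)
  then show ?thesis using u f o X rs_pl[OF X f cyc_K[OF u(1)] cyc_K[OF v(1)]] by (simp add: add_H res_H cyc_K cyc_rs)
 qed
 show "res (homology_psh C n X) f (a \<odot>\<^bsub>sect (homology_psh C n X) (Cod C f)\<^esub> x) =
   rres R f a \<odot>\<^bsub>sect (homology_psh C n X) (Dom C f)\<^esub> res (homology_psh C n X) f x" if a: "a \<in> \<R> (Cod C f)" for a
  using u f o X a rs_sm[OF X f a cyc_K[OF u(1)]] by (simp add: smult_H res_H cyc_K cyc_rs rres_closed)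
next
 fix f g x assume f: "f \<in> Arr C" and g: "g \<in> Arr C" and fg: "Dom C g = Cod C f" and x: "x \<in> carrier (sect (homology_psh C n X) (Cod C g))"
 then obtain u where u: "u \<in> cyc n (Cod C g)" "x = cs X n (Cod C g) u" by (auto simp: carrier_H)
 have "rs X n g u \<in> K X n (Cod C f)" using X g fg cyc_K[OF u(1)] by simp
 then show "res (homology_psh C n X) (g \<cdot> f) x = res (homology_psh C n X) f (res (homology_psh C n X) g x)"
  using u Cmp_Arr[OF f g fg] res_H[of "g \<cdot> f" u n] res_H[OF g cyc_K[OF u(1)]] res_H[OF f, of "rs X n g u" n] fg
   rs_rs[OF X f g fg cyc_K[OF u(1)]] cyc_K[OF u(1)] by simp
qed

end

lemma homology_map_app:
 assumes f: "f \<in> Hom ch X Y" and c: "c \<in> Obj C" and x: "x \<in> cyc X n c"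
 shows "app (homology_map C n f) c (cs X n c x) = cs Y n c (ev f n c x)"
proof -
 note XY = Hom_ObjD[OF f]
 obtain \<phi> where fe: "f = (X, Y, \<phi>)" using f by (auto simp: Hom_ch)
 have "app (homology_map C n f) c (cs X n c x) = (\<Union>z\<in>cs X n c x. cs Y n c (ev f n c z))"
  using x c carrier_H[of X n c] XY by (simp add: homology_map_def fe app_def cs_def ev_def)
 also have "\<dots> = cs Y n c (ev f n c x)"
 proof (rule cs_Union[OF _ c])
  show "X \<in> Obj ch" using XY by simp
  show "x \<in> K X n c" using cyc_K XY x by blast
  fix w assume w: "w \<in> K X (n + 1) c"
  have "ev f n c (pl X n c (bd X (n + 1) c w) x) = pl Y n c (bd Y (n + 1) c (ev f (n + 1) c w)) (ev f n c x)"
   using f c w XY cyc_K[of X x n c] x ev_bd[OF f c w] by (simp add: ev_pl[OF f])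
  then show "cs Y n c (ev f n c (pl X n c (bd X (n + 1) c w) x)) = cs Y n c (ev f n c x)"
   using XY f c w cyc_K[of X x n c] x by (subst cs_eq) auto
 qed
 finally show ?thesis .
qed

lemma ev_cyc: "f \<in> Hom ch X Y ==> c \<in> Obj C ==> x \<in> cyc X n c ==> ev f n c x \<in> cyc Y n c"
 using Hom_ObjD[of f X Y] ev_bd[of f X Y c x n] by (auto simp: cyc_def)

lemma homology_map_Hom:
 assumes f: "f \<in> Hom ch X Y"
 shows "homology_map C n f \<in> Hom (psh_cat \<mu> C R) (homology_psh C n X) (homology_psh C n Y)"
proof -
 have X: "X \<in> Obj ch" and Y: "Y \<in> Obj ch" using Hom_ObjD[OF f] by auto
 have "module_presheaf_map C R (homology_psh C n X) (homology_psh C n Y) (app (homology_map C n f))"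
  unfolding module_presheaf_map_def semilinear_def
 proof (intro conjI ballI)
  show "app (homology_map C n f) \<in> extensional (Obj C)" by (simp add: homology_map_def app_def split: prod.splits)
 next
  fix c assume c: "c \<in> Obj C"
  show "app (homology_map C n f) c \<in> extensional (carrier (sect (homology_psh C n X) c))"
   using c f by (auto simp: homology_map_def app_def Hom_ch split: prod.splits)
  show "app (homology_map C n f) c \<in> carrier (sect (homology_psh C n X) c) \<rightarrow> carrier (sect (homology_psh C n Y) c)"
   using homology_map_app[OF f c] ev_cyc[OF f c] by (auto simp: carrier_H X Y)
  fix x assume "x \<in> carrier (sect (homology_psh C n X) c)"
  then obtain u where u: "u \<in> cyc X n c" "x = cs X n c u" by (auto simp: carrier_H X)
  note uK = cyc_K[OF X u(1)]
  show "app (homology_map C n f) c (x \<oplus>\<^bsub>sect (homology_psh C n X) c\<^esub> y) =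
   app (homology_map C n f) c x \<oplus>\<^bsub>sect (homology_psh C n Y) c\<^esub> app (homology_map C n f) c y"
   if y: "y \<in> carrier (sect (homology_psh C n X) c)" for y
  proof -
   obtain v where v: "v \<in> cyc X n c" "y = cs X n c v" using y by (auto simp: carrier_H X)
   note vK = cyc_K[OF X v(1)]
   show ?thesis using u v uK vK c f homology_map_app[OF f c] cyc_closed(1)[OF X c u(1) v(1)] ev_pl[OF f c uK vK]
    by (simp add: add_H X Y)
  qed
  show "app (homology_map C n f) c (a \<odot>\<^bsub>sect (homology_psh C n X) c\<^esub> x) = a \<odot>\<^bsub>sect (homology_psh C n Y) c\<^esub> app (homology_map C n f) c x"
   if a: "a \<in> \<R> c" for a
   using u uK c f a homology_map_app[OF f c] cyc_closed(4)[OF X c a u(1)] ev_sm[OF f c a uK] by (simp add: smult_H X Y)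
 next
  fix g x assume g: "g \<in> Arr C" and "x \<in> carrier (sect (homology_psh C n X) (Cod C g))"
  then obtain u where u: "u \<in> cyc X n (Cod C g)" "x = cs X n (Cod C g) u" by (auto simp: carrier_H X)
  note uK = cyc_K[OF X u(1)]
  show "app (homology_map C n f) (Dom C g) (res (homology_psh C n X) g x) = res (homology_psh C n Y) g (app (homology_map C n f) (Cod C g) x)"
   using u uK f g homology_map_app[OF f Dom_closed[OF g] cyc_rs[OF X g u(1)]] homology_map_app[OF f Cod_closed[OF g] u(1)]
    ev_rs[OF f g uK] Cod_closed[OF g] by (simp add: res_H X Y)
 qed
 moreover have "homology_map C n f = (homology_psh C n X, homology_psh C n Y, app (homology_map C n f))"
  using f by (auto simp: homology_map_def app_def Hom_ch split: prod.splits)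
 ultimately show ?thesis using module_presheaf_H[OF X] module_presheaf_H[OF Y] by (simp add: Hom_psh_cat)
qed

text \<open>The inverse functions of bijective components are again linear and natural. The type of
  elements is general because sections of homology presheaves are sets of elements of
  \<open>'u\<close>.\<close>

lemma is_iso_psh_cat:
 fixes P Q :: "('o, 'a, 'r, 'v) psh"
 assumes f: "f \<in> Hom (psh_cat \<mu> C R) P Q"
 shows "is_iso (psh_cat \<mu> C R) f \<longleftrightarrow> (\<forall>c\<in>Obj C. bij_betw (app f c) (carrier (sect P c)) (carrier (sect Q c)))"
proof
 have fA: "f \<in> Arr (psh_cat \<mu> C R)" "Dom (psh_cat \<mu> C R) f = P" "Cod (psh_cat \<mu> C R) f = Q" using f by (auto simp: Hom_def)
 have fm: "app f c x \<in> carrier (sect Q c)" if "c \<in> Obj C" "x \<in> carrier (sect P c)" for c x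
  using f that by (auto simp: Hom_psh_cat module_presheaf_map_def semilinear_def)
 {
  assume "is_iso (psh_cat \<mu> C R) f"
  then obtain g where g: "g \<in> Hom (psh_cat \<mu> C R) Q P" and gf: "g \<cdot>\<^bsub>psh_cat \<mu> C R\<^esub> f = Idn (psh_cat \<mu> C R) P"
   and fg: "f \<cdot>\<^bsub>psh_cat \<mu> C R\<^esub> g = Idn (psh_cat \<mu> C R) Q" unfolding is_iso_def fA by blast
  show "\<forall>c\<in>Obj C. bij_betw (app f c) (carrier (sect P c)) (carrier (sect Q c))"
  proof
   fix c assume c: "c \<in> Obj C"
   show "bij_betw (app f c) (carrier (sect P c)) (carrier (sect Q c))"
   proof (rule bij_betw_byWitness[where f' = "app g c"])
    show "\<forall>a\<in>carrier (sect P c). app g c (app f c a) = a"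
     using app_Cmp[OF f g c] app_Idn[OF c, of _ P \<mu> R] gf by metis
    show "\<forall>a\<in>carrier (sect Q c). app f c (app g c a) = a"
     using app_Cmp[OF g f c] app_Idn[OF c, of _ Q \<mu> R] fg by metis
    show "app f c ` carrier (sect P c) \<subseteq> carrier (sect Q c)" using fm[OF c] by blast
    show "app g c ` carrier (sect Q c) \<subseteq> carrier (sect P c)"
     using g c by (auto simp: Hom_psh_cat module_presheaf_map_def semilinear_def)
   qed
  qed
 }
 assume b: "\<forall>c\<in>Obj C. bij_betw (app f c) (carrier (sect P c)) (carrier (sect Q c))"
 define h where "h = (\<lambda>c\<in>Obj C. \<lambda>y\<in>carrier (sect Q c). inv_into (carrier (sect P c)) (app f c) y)"
 have hf: "h c (app f c x) = x" if "c \<in> Obj C" "x \<in> carrier (sect P c)" for c x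
  using that fm[OF that] bij_betw_inv_into_left[OF bspec[OF b that(1)] that(2)] by (simp add: h_def)
 have fh: "app f c (h c y) = y" "h c y \<in> carrier (sect P c)" if "c \<in> Obj C" "y \<in> carrier (sect Q c)" for c y
  using that bij_betw_inv_into_right[OF bspec[OF b that(1)] that(2)] bij_betw_imp_surj_on[OF bspec[OF b that(1)]]
   inv_into_into[of y "app f c" "carrier (sect P c)"]
  by (simp_all add: h_def)
 have mf: "module_presheaf_map C R P Q (app f)" and P: "module_presheaf \<mu> C R P" and Q: "module_presheaf \<mu> C R Q"
  using f by (auto simp: Hom_psh_cat)
 have inj: "app f c x = app f c y ==> x = y" if "c \<in> Obj C" "x \<in> carrier (sect P c)" "y \<in> carrier (sect P c)" for c x y
  using hf that by metis
 have "module_presheaf_map C R Q P h"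
  unfolding module_presheaf_map_def semilinear_def
 proof (intro conjI ballI)
  show "h \<in> extensional (Obj C)" by (simp add: h_def)
 next
  fix c assume c: "c \<in> Obj C"
  interpret M: left_module "rsect R c" "sect P c" using P c by (simp add: module_presheaf_def)
  interpret M': left_module "rsect R c" "sect Q c" using Q c by (simp add: module_presheaf_def)
  show "h c \<in> extensional (carrier (sect Q c))" using c by (simp add: h_def)
  show "h c \<in> carrier (sect Q c) \<rightarrow> carrier (sect P c)" using fh(2)[OF c] by blast
  fix x assume x: "x \<in> carrier (sect Q c)"
  show "h c (x \<oplus>\<^bsub>sect Q c\<^esub> y) = h c x \<oplus>\<^bsub>sect P c\<^esub> h c y" if y: "y \<in> carrier (sect Q c)" for y
  proof (rule inj[OF c])
   have "app f c (h c x \<oplus>\<^bsub>sect P c\<^esub> h c y) = app f c (h c x) \<oplus>\<^bsub>sect Q c\<^esub> app f c (h c y)"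
    using mf c fh(2)[OF c x] fh(2)[OF c y] by (simp add: module_presheaf_map_def semilinear_def)
   then show "app f c (h c (x \<oplus>\<^bsub>sect Q c\<^esub> y)) = app f c (h c x \<oplus>\<^bsub>sect P c\<^esub> h c y)"
    using fh(1)[OF c] x y M'.M.a_closed by simp
  qed (use fh(2)[OF c] x y M'.M.a_closed M.M.a_closed in auto)
  show "h c (a \<odot>\<^bsub>sect Q c\<^esub> x) = a \<odot>\<^bsub>sect P c\<^esub> h c x" if a: "a \<in> \<R> c" for a
  proof (rule inj[OF c])
   have "app f c (a \<odot>\<^bsub>sect P c\<^esub> h c x) = a \<odot>\<^bsub>sect Q c\<^esub> app f c (h c x)"
    using mf c fh(2)[OF c x] a by (simp add: module_presheaf_map_def semilinear_def)
   then show "app f c (h c (a \<odot>\<^bsub>sect Q c\<^esub> x)) = app f c (a \<odot>\<^bsub>sect P c\<^esub> h c x)"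
    using fh(1)[OF c] x a M'.smult_closed by simp
  qed (use fh(2)[OF c] x a M'.smult_closed M.smult_closed in auto)
 next
  fix g x assume g: "g \<in> Arr C" and x: "x \<in> carrier (sect Q (Cod C g))"
  note o = Dom_closed[OF g] Cod_closed[OF g]
  have rc: "res Q g x \<in> carrier (sect Q (Dom C g))" "res P g (h (Cod C g) x) \<in> carrier (sect P (Dom C g))"
   using P Q g x fh(2)[OF o(2) x] by (auto simp: module_presheaf_def semilinear_def)
  show "h (Dom C g) (res Q g x) = res P g (h (Cod C g) x)"
  proof (rule inj[OF o(1)])
   have "app f (Dom C g) (res P g (h (Cod C g) x)) = res Q g (app f (Cod C g) (h (Cod C g) x))"
    using mf g fh(2)[OF o(2) x] by (simp add: module_presheaf_map_def)
   then show "app f (Dom C g) (h (Dom C g) (res Q g x)) = app f (Dom C g) (res P g (h (Cod C g) x))"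
    using fh(1)[OF o(1) rc(1)] fh(1)[OF o(2) x] by simp
  qed (use rc fh(2)[OF o(1) rc(1)] in auto)
 qed
 then have g: "(Q, P, h) \<in> Hom (psh_cat \<mu> C R) Q P" using P Q by (simp add: Hom_psh_cat app_def)
 have cl: "(Q, P, h) \<cdot>\<^bsub>psh_cat \<mu> C R\<^esub> f = Idn (psh_cat \<mu> C R) P" "f \<cdot>\<^bsub>psh_cat \<mu> C R\<^esub> (Q, P, h) = Idn (psh_cat \<mu> C R) Q"
  unfolding Cmp_psh_cat[OF f g] Cmp_psh_cat[OF g f]
  using hf fh by (auto simp: psh_cat_def app_def fun_eq_iff)
 show "is_iso (psh_cat \<mu> C R) f" unfolding is_iso_def fA using fA(1) g cl by blast
qed

lemma homology_isos_iff:
 assumes f: "f \<in> Hom ch X Y" shows "f \<in> homology_isos \<mu> C R \<longleftrightarrow> wq X Y f"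
proof -
 have X: "X \<in> Obj ch" and Y: "Y \<in> Obj ch" using Hom_ObjD[OF f] by auto
 have B: "bij_betw (app (homology_map C n f) c) (cs X n c ` cyc X n c) (cs Y n c ` cyc Y n c) \<longleftrightarrow>
  (\<forall>x\<in>cyc X n c. (\<exists>y\<in>K Y (n + 1) c. ev f n c x = bd Y (n + 1) c y) --> (\<exists>w\<in>K X (n + 1) c. x = bd X (n + 1) c w)) &
  (\<forall>y\<in>cyc Y n c. \<exists>x\<in>cyc X n c. \<exists>w\<in>K Y (n + 1) c. y = pl Y n c (bd Y (n + 1) c w) (ev f n c x))"
  (is "?b \<longleftrightarrow> ?i & ?s") if c: "c \<in> Obj C" for n c
 proof -
  note ha = homology_map_app[OF f c]
  have XK: "x \<in> K X n c" "ev f n c x \<in> K Y n c" if "x \<in> cyc X n c" for x using cyc_K[OF X that] f c by auto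
  have "inj_on (app (homology_map C n f) c) (cs X n c ` cyc X n c) \<longleftrightarrow> ?i"
  proof
   assume i: "inj_on (app (homology_map C n f) c) (cs X n c ` cyc X n c)"
   show ?i
   proof (intro ballI impI)
    fix x assume x: "x \<in> cyc X n c" and "\<exists>y\<in>K Y (n + 1) c. ev f n c x = bd Y (n + 1) c y"
    then have "cs Y n c (ev f n c x) = cs Y n c (ev f n c (zr X n c))"
     using cs_eq[OF Y c XK(2)[OF x], of "zr Y n c"] f c Y by (auto simp: ev_zr[OF f c])
    then have "app (homology_map C n f) c (cs X n c x) = app (homology_map C n f) c (cs X n c (zr X n c))"
     using ha[OF x] ha[OF cyc_closed(2)[OF X c]] by simp
    then have "cs X n c x = cs X n c (zr X n c)"
     using inj_onD[OF i] x cyc_closed(2)[OF X c] by blast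
    then show "\<exists>w\<in>K X (n + 1) c. x = bd X (n + 1) c w"
     using cs_eq[OF X c XK(1)[OF x], of "zr X n c"] X c by auto
   qed
  next
   assume i: ?i
   show "inj_on (app (homology_map C n f) c) (cs X n c ` cyc X n c)"
   proof (rule inj_onI, clarify)
    fix x y assume x: "x \<in> cyc X n c" and y: "y \<in> cyc X n c"
     and e: "app (homology_map C n f) c (cs X n c x) = app (homology_map C n f) c (cs X n c y)"
    \<comment> \<open>Injectivity is reduced to its kernel form through the difference of two cycles
      whose image classes agree.\<close>
    let ?d = "pl X n c x (ng X n c y)"
    have d: "?d \<in> cyc X n c" using cyc_closed[OF X c] x y by blast
    have "cs Y n c (ev f n c x) = cs Y n c (ev f n c y)" using e ha[OF x] ha[OF y] by simp
    then obtain w where w: "w \<in> K Y (n + 1) c" "ev f n c x = pl Y n c (bd Y (n + 1) c w) (ev f n c y)"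
     using cs_eq[OF Y c XK(2)[OF x] XK(2)[OF y]] by blast
    have "ev f n c ?d = bd Y (n + 1) c w"
     using w XK[OF x] XK[OF y] X Y c f by (simp add: ev_pl[OF f] ev_ng[OF f] pl_assoc)
    then obtain v where v: "v \<in> K X (n + 1) c" "?d = bd X (n + 1) c v" using i d w(1) by blast
    have "x = pl X n c ?d y" using XK[OF x] XK[OF y] X c by (simp add: pl_assoc)
    then show "cs X n c x = cs X n c y" using v cs_eq[OF X c XK(1)[OF x] XK(1)[OF y]] by auto
   qed
  qed
  moreover have "app (homology_map C n f) c ` cs X n c ` cyc X n c = cs Y n c ` cyc Y n c \<longleftrightarrow> ?s"
  proof -
   have "app (homology_map C n f) c ` cs X n c ` cyc X n c \<subseteq> cs Y n c ` cyc Y n c"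
    using ha ev_cyc[OF f c] by auto
   then have "app (homology_map C n f) c ` cs X n c ` cyc X n c = cs Y n c ` cyc Y n c \<longleftrightarrow>
    (\<forall>y\<in>cyc Y n c. \<exists>x\<in>cyc X n c. cs Y n c y = cs Y n c (ev f n c x))" (is "_ \<longleftrightarrow> ?t")
    using ha by (auto simp: image_iff subset_iff set_eq_iff[of "_ ` _"] Ball_def)
   also have "?t \<longleftrightarrow> ?s" using cs_eq[OF Y c cyc_K[OF Y] XK(2)] by blast
   finally show ?thesis .
  qed
  ultimately show ?thesis by (simp add: bij_betw_def)
 qed
 have "f \<in> homology_isos \<mu> C R \<longleftrightarrow>
   (\<forall>n. \<forall>c\<in>Obj C. bij_betw (app (homology_map C n f) c) (cs X n c ` cyc X n c) (cs Y n c ` cyc Y n c))"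
  using f is_iso_psh_cat[OF homology_map_Hom[OF f]] carrier_H[OF X] carrier_H[OF Y]
  unfolding homology_isos_def by (auto simp: Hom_def)
 also have "\<dots> \<longleftrightarrow> wq X Y f"
  unfolding wq_def
 proof (intro iff_allI ball_cong HOL.refl)
  fix n c assume c: "c \<in> Obj C"
  show "bij_betw (app (homology_map C n f) c) (cs X n c ` cyc X n c) (cs Y n c ` cyc Y n c) \<longleftrightarrow>
   (\<forall>x\<in>K X n c. bd X n c x = zr X (n - 1) c --> (\<exists>y\<in>K Y (n + 1) c. ev f n c x = bd Y (n + 1) c y) -->
    (\<exists>w\<in>K X (n + 1) c. x = bd X (n + 1) c w)) &
   (\<forall>y\<in>K Y n c. bd Y n c y = zr Y (n - 1) c -->
    (\<exists>x\<in>K X n c. bd X n c x = zr X (n - 1) c & (\<exists>w\<in>K Y (n + 1) c. y = pl Y n c (bd Y (n + 1) c w) (ev f n c x))))"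
   unfolding B[OF c] unfolding cyc_def[OF X] cyc_def[OF Y] by blast
 qed
 finally show ?thesis .
qed

end

section \<open>Trivial fibrations\<close>

context psh_setup begin

definition lp :: "('o, 'a, 'r, 'u) psh_cplx => ('o, 'a, 'r, 'u) psh_cplx => ('o, 'a, 'r, 'u) psh_cplx_arr => int => 'o => bool" where
 "lp X Y p n c \<longleftrightarrow> (\<forall>x\<in>K X n c. \<forall>y\<in>K Y (n + 1) c. bd X n c x = zr X (n - 1) c -->
  ev p n c x = bd Y (n + 1) c y --> (\<exists>w\<in>K X (n + 1) c. bd X (n + 1) c w = x & ev p (n + 1) c w = y))"

lemma lpD:
 assumes "lp X Y p n c" "x \<in> K X n c" "y \<in> K Y (n + 1) c" "bd X n c x = zr X (n - 1) c" "ev p n c x = bd Y (n + 1) c y"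
 shows "\<exists>w\<in>K X (n + 1) c. bd X (n + 1) c w = x & ev p (n + 1) c w = y"
 using assms unfolding lp_def by blast

lemma injectives_I_iff_S:
 assumes p: "p \<in> Hom ch X Y"
 shows "p \<in> injectives ch (gen_I \<mu> C R S) \<longleftrightarrow> (\<forall>s\<in>S. \<forall>n. lp X Y p n s)"
proof -
 have "p \<in> injectives ch (gen_I \<mu> C R S) \<longleftrightarrow> (\<forall>s\<in>S. \<forall>n. has_lifts ch (gi s n) p)"
  using p unfolding injectives_def gen_I_def Hom_def by blast
 moreover have "s \<in> S ==> s \<in> Obj C" for s using S_Obj by blast
 ultimately show ?thesis using gi_lifts[OF _ p] by (simp add: lp_def)
qed

text \<open>As for surjections, the problem at \<open>c\<close> is restricted to a representative in
  \<open>S\<close>, solved there and restricted back.\<close>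

lemma injectives_I_iff:
 assumes p: "p \<in> Hom ch X Y"
 shows "p \<in> injectives ch (gen_I \<mu> C R S) \<longleftrightarrow> (\<forall>n. \<forall>c\<in>Obj C. lp X Y p n c)"
proof -
 note XY = Hom_ObjD[OF p]
 have "p \<in> injectives ch (gen_I \<mu> C R S) \<longleftrightarrow> (\<forall>s\<in>S. \<forall>n. lp X Y p n s)" by (rule injectives_I_iff_S[OF p])
 also have "\<dots> \<longleftrightarrow> (\<forall>n. \<forall>c\<in>Obj C. lp X Y p n c)"
 proof
  assume l: "\<forall>s\<in>S. \<forall>n. lp X Y p n s"
  show "\<forall>n. \<forall>c\<in>Obj C. lp X Y p n c"
  proof (intro allI ballI)
   fix n c assume c: "c \<in> Obj C"
   show "lp X Y p n c"
    unfolding lp_def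
   proof (intro ballI impI)
    fix x y assume x: "x \<in> K X n c" and y: "y \<in> K Y (n + 1) c" and z: "bd X n c x = zr X (n - 1) c" and e: "ev p n c x = bd Y (n + 1) c y"
    obtain s f g where s: "s \<in> S" and f: "f \<in> Arr C" "Dom C f = c" "Cod C f = s"
     and g: "g \<in> Arr C" "Dom C g = s" "Cod C g = c" and gf: "g \<cdot> f = Idn C c"
     using S_retract[OF c] by (auto simp: Hom_def)
    have X: "X \<in> Obj ch" and Y: "Y \<in> Obj ch" using XY by auto
    have "bd X n s (rs X n g x) = zr X (n - 1) s" using bd_rs[OF X g(1), of x n] g x z X rs_zr[OF X g(1), of "n - 1"] by simp
    moreover have "ev p n s (rs X n g x) = bd Y (n + 1) s (rs Y (n + 1) g y)"
     using ev_rs[OF p g(1), of x n] g x y e bd_rs[OF Y g(1), of y "n + 1"] by simp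
    moreover have "rs X n g x \<in> K X n s" "rs Y (n + 1) g y \<in> K Y (n + 1) s" using X Y g x y by auto
    ultimately obtain w where w: "w \<in> K X (n + 1) s" "bd X (n + 1) s w = rs X n g x" "ev p (n + 1) s w = rs Y (n + 1) g y"
     using lpD[of X Y p n s] l s by blast
    show "\<exists>w\<in>K X (n + 1) c. bd X (n + 1) c w = x & ev p (n + 1) c w = y"
    proof (intro bexI[of _ "rs X (n + 1) f w"] conjI)
     show "rs X (n + 1) f w \<in> K X (n + 1) c" using X f w by simp
     show "bd X (n + 1) c (rs X (n + 1) f w) = x"
      using bd_rs[OF X f(1), of w "n + 1"] f w rs_rs[OF X f(1) g(1), of x n] g gf X x c by simp
     show "ev p (n + 1) c (rs X (n + 1) f w) = y"
      using ev_rs[OF p f(1), of w "n + 1"] f w rs_rs[OF Y f(1) g(1), of y "n + 1"] g gf Y y c by simp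
    qed
   qed
  qed
 qed (use S_Obj in blast)
 finally show ?thesis .
qed

text \<open>This is the lifting condition one degree lower, applied to the zero cycle.\<close>

lemma lp_cycles:
 assumes p: "p \<in> Hom ch X Y" and l: "!!n. lp X Y p n c" and c: "c \<in> Obj C" and y: "y \<in> K Y n c" and z: "bd Y n c y = zr Y (n - 1) c"
 shows "\<exists>w\<in>K X n c. bd X n c w = zr X (n - 1) c & ev p n c w = y"
 using lpD[OF l[of "n - 1"], of "zr X (n - 1) c" y] Hom_ObjD[OF p] c y z p by simp

text \<open>The boundary of \<open>y\<close> is a cycle and lifts to a cycle; that cycle and
  \<open>y\<close> pose a lifting problem whose solution maps to \<open>y\<close>.\<close>

lemma lp_surj:
 assumes p: "p \<in> Hom ch X Y" and l: "!!n. lp X Y p n c" and c: "c \<in> Obj C" and y: "y \<in> K Y n c"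
 shows "\<exists>w\<in>K X n c. ev p n c w = y"
proof -
 note XY = Hom_ObjD[OF p]
 obtain x where x: "x \<in> K X (n - 1) c" "bd X (n - 1) c x = zr X (n - 1 - 1) c" "ev p (n - 1) c x = bd Y n c y"
  using lp_cycles[OF p l c, of "bd Y n c y" "n - 1"] XY c y by auto
 show ?thesis using lpD[OF l[of "n - 1"] x(1), of y] x(2,3) y by auto
qed

lemma lp_iff:
 assumes p: "p \<in> Hom ch X Y"
 shows "(\<forall>n. \<forall>c\<in>Obj C. lp X Y p n c) \<longleftrightarrow> (\<forall>n. \<forall>c\<in>Obj C. \<forall>y\<in>K Y n c. \<exists>x\<in>K X n c. ev p n c x = y) & wq X Y p"
  (is "?l \<longleftrightarrow> ?s & ?w")
proof
 have X: "X \<in> Obj ch" and Y: "Y \<in> Obj ch" using Hom_ObjD[OF p] by auto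
 {
  assume l: ?l
  have ?s using lp_surj[OF p] l by blast
  moreover have ?w
   unfolding wq_def
  proof (intro allI ballI conjI impI)
   fix n c x assume c: "c \<in> Obj C" and x: "x \<in> K X n c" "bd X n c x = zr X (n - 1) c" "\<exists>y\<in>K Y (n + 1) c. ev p n c x = bd Y (n + 1) c y"
   then show "\<exists>w\<in>K X (n + 1) c. x = bd X (n + 1) c w" using lpD[of X Y p n c x] l by blast
  next
   fix n c y assume c: "c \<in> Obj C" and y: "y \<in> K Y n c" "bd Y n c y = zr Y (n - 1) c"
   then obtain x where x: "x \<in> K X n c" "bd X n c x = zr X (n - 1) c" "ev p n c x = y" using lp_cycles[OF p _ c] l by blast
   then have "y = pl Y n c (bd Y (n + 1) c (zr Y (n + 1) c)) (ev p n c x)" using Y c y by simp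
   then show "\<exists>x\<in>K X n c. bd X n c x = zr X (n - 1) c & (\<exists>w\<in>K Y (n + 1) c. y = pl Y n c (bd Y (n + 1) c w) (ev p n c x))"
    using x Y c by blast
  qed
  ultimately show "?s & ?w" ..
 }
 assume sw: "?s & ?w"
 show ?l
  unfolding lp_def
 proof (intro allI ballI impI)
  fix n c x y assume c: "c \<in> Obj C" and x: "x \<in> K X n c" and y: "y \<in> K Y (n + 1) c" and z: "bd X n c x = zr X (n - 1) c"
   and e: "ev p n c x = bd Y (n + 1) c y"
  \<comment> \<open>A first guess: \<open>x\<close> bounds some \<open>w\<close>, whose image may
    differ from \<open>y\<close>.\<close>
  obtain w where w: "w \<in> K X (n + 1) c" "x = bd X (n + 1) c w" using sw c x y z e unfolding wq_def by blast
  \<comment> \<open>The error is a cycle, hence a boundary plus the image of a cycle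
    \<open>x1\<close>; lifting the bounding section \<open>v\<close> to \<open>v'\<close> then
    provides the correction of \<open>w\<close>.\<close>
  let ?z = "pl Y (n + 1) c y (ng Y (n + 1) c (ev p (n + 1) c w))"
  have pw: "ev p (n + 1) c w \<in> K Y (n + 1) c" using p c w by simp
  have bpw: "bd Y (n + 1) c (ev p (n + 1) c w) = bd Y (n + 1) c y" using ev_bd[OF p c w(1)] w(2) e by simp
  have zK: "?z \<in> K Y (n + 1) c" and zb: "bd Y (n + 1) c ?z = zr Y (n + 1 - 1) c"
   using Y c y pw bd_pl[OF Y c y, of "ng Y (n + 1) c (ev p (n + 1) c w)"] bd_ng[OF Y c pw] bpw by simp_all
  obtain x1 v where x1: "x1 \<in> K X (n + 1) c" "bd X (n + 1) c x1 = zr X n c" and v: "v \<in> K Y (n + 1 + 1) c"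
   and zv: "?z = pl Y (n + 1) c (bd Y (n + 1 + 1) c v) (ev p (n + 1) c x1)"
   using sw c zK zb unfolding wq_def by (metis add_diff_cancel_right')
  obtain v' where v': "v' \<in> K X (n + 1 + 1) c" "ev p (n + 1 + 1) c v' = v" using sw c v by blast
  let ?b = "bd X (n + 1 + 1) c v'"
  have bK: "?b \<in> K X (n + 1) c" using X c v' by simp
  let ?w = "pl X (n + 1) c (pl X (n + 1) c ?b x1) w"
  have "bd X (n + 1) c ?w = x"
   using X c w x1 bK x bd_bd[OF X c v'(1), of "n + 1"] by (simp add: bd_pl)
  moreover have "ev p (n + 1) c ?w = y"
  proof -
   have "ev p (n + 1) c ?b = bd Y (n + 1 + 1) c v" using ev_bd[OF p c v'(1)] v'(2) by (simp only: add_diff_cancel_right')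
   then have "ev p (n + 1) c ?w = pl Y (n + 1) c ?z (ev p (n + 1) c w)"
    using X c w x1 bK p zv by (simp add: ev_pl[OF p])
   also have "\<dots> = y" using Y c y pw by (simp add: pl_assoc)
   finally show ?thesis .
  qed
  moreover have "?w \<in> K X (n + 1) c" using X c w x1 bK by simp
  ultimately show "\<exists>w\<in>K X (n + 1) c. bd X (n + 1) c w = x & ev p (n + 1) c w = y" by blast
 qed
qed

abbreviation "\<W> \<equiv> homology_isos \<mu> C R"
abbreviation "\<F> \<equiv> levelwise_surjections \<mu> C R"
abbreviation "\<I> \<equiv> gen_I \<mu> C R S"
abbreviation "\<T> \<equiv> injectives ch \<I>"

lemma W_Arr: "\<W> \<subseteq> Arr ch" by (auto simp: homology_isos_def)
lemma T_Arr: "\<T> \<subseteq> Arr ch" by (auto simp: injectives_def)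

lemma trivial_fibrations: "\<F> \<inter> \<W> = \<T>"
proof (rule Set.set_eqI)
 fix p
 show "p \<in> \<F> \<inter> \<W> \<longleftrightarrow> p \<in> \<T>"
 proof (cases "p \<in> Arr ch")
  case True
  then have p: "p \<in> Hom ch (Dom ch p) (Cod ch p)" by (rule Hom_ch_Arr)
  show ?thesis using levelwise_iff[OF p] homology_isos_iff[OF p] injectives_I_iff[OF p] lp_iff[OF p] by blast
 qed (use Arr_levelwise T_Arr in blast)
qed

subsection \<open>Homology isomorphisms\<close>

text \<open>For two-out-of-three and for retracts, homology is viewed as plain functions on sets of
  cosets, where the claims are about bijections.\<close>

definition hq :: "('o, 'a, 'r, 'u) psh_cplx_arr => int => 'o => 'u set => 'u set" where
 "hq f n c = app (homology_map C n f) c"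

definition HH :: "('o, 'a, 'r, 'u) psh_cplx => int => 'o => 'u set set" where
 "HH X n c = cs X n c ` cyc X n c"

lemma W_iff_bij:
 assumes f: "f \<in> Hom ch X Y" shows "f \<in> \<W> \<longleftrightarrow> (\<forall>n. \<forall>c\<in>Obj C. bij_betw (hq f n c) (HH X n c) (HH Y n c))"
 using f is_iso_psh_cat[OF homology_map_Hom[OF f]] carrier_H[of X] carrier_H[of Y] Hom_ObjD[OF f]
 unfolding homology_isos_def hq_def HH_def by (auto simp: Hom_def)

lemma hq_Cmp:
 assumes f: "f \<in> Hom ch X Y" and g: "g \<in> Hom ch Y Z" and c: "c \<in> Obj C" and a: "a \<in> HH X n c"
 shows "hq (g \<star> f) n c a = hq g n c (hq f n c a)"
proof -
 obtain x where x: "x \<in> cyc X n c" "a = cs X n c x" using a by (auto simp: HH_def)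
 have xK: "x \<in> K X n c" using x cyc_K Hom_ObjD[OF f] by blast
 show ?thesis unfolding hq_def x(2)
  using homology_map_app[OF Cmp_in_Hom_ch[OF f g] c x(1)] homology_map_app[OF f c x(1)]
   homology_map_app[OF g c ev_cyc[OF f c x(1)]] ev_Cmp[OF f g c xK] by simp
qed

lemma hq_closed:
 assumes f: "f \<in> Hom ch X Y" and c: "c \<in> Obj C" shows "a \<in> HH X n c ==> hq f n c a \<in> HH Y n c"
 using homology_map_app[OF f c] ev_cyc[OF f c] by (auto simp: HH_def hq_def)

lemma hq_Idn:
 assumes X: "X \<in> Obj ch" and c: "c \<in> Obj C" and a: "a \<in> HH X n c" shows "hq (Idn ch X) n c a = a"
proof -
 obtain x where x: "x \<in> cyc X n c" "a = cs X n c x" using a by (auto simp: HH_def)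
 then show ?thesis unfolding hq_def using homology_map_app[OF Idn_in_Hom_ch[OF X] c x(1)] cyc_K[OF X x(1)] c by simp
qed

lemma two_out_of_three_W: "two_out_of_three ch \<W>"
 unfolding two_out_of_three_def
proof (intro ballI impI)
 fix f g assume fA: "f \<in> Arr ch" and gA: "g \<in> Arr ch" and e: "Dom ch g = Cod ch f"
 let ?X = "Dom ch f" and ?Y = "Cod ch f" and ?Z = "Cod ch g"
 have f: "f \<in> Hom ch ?X ?Y" and g: "g \<in> Hom ch ?Y ?Z" using fA gA e by (auto simp: Hom_def)
 note gf = Cmp_in_Hom_ch[OF f g]
 have gf_bij: "bij_betw (hq (g \<star> f) n c) (HH ?X n c) (HH ?Z n c) \<longleftrightarrow> bij_betw (hq g n c \<circ> hq f n c) (HH ?X n c) (HH ?Z n c)"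
  if "c \<in> Obj C" for n c by (rule bij_betw_cong) (use hq_Cmp[OF f g that] in simp)
 have sub: "hq f n c ` HH ?X n c \<subseteq> HH ?Y n c" if "c \<in> Obj C" for n c using hq_closed[OF f that] by blast
 have A: "bij_betw (hq g n c) (HH ?Y n c) (HH ?Z n c) \<longleftrightarrow> bij_betw (hq (g \<star> f) n c) (HH ?X n c) (HH ?Z n c)"
  if "bij_betw (hq f n c) (HH ?X n c) (HH ?Y n c)" "c \<in> Obj C" for n c
  unfolding gf_bij[OF that(2)] by (rule bij_betw_comp_iff[OF that(1)])
 have B: "bij_betw (hq f n c) (HH ?X n c) (HH ?Y n c) \<longleftrightarrow> bij_betw (hq (g \<star> f) n c) (HH ?X n c) (HH ?Z n c)"
  if "bij_betw (hq g n c) (HH ?Y n c) (HH ?Z n c)" "c \<in> Obj C" for n c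
  unfolding gf_bij[OF that(2)] by (rule bij_betw_comp_iff2[OF that(1) sub[OF that(2)]])
 show "(f \<in> \<W> & g \<in> \<W> --> g \<star> f \<in> \<W>) & (f \<in> \<W> & g \<star> f \<in> \<W> --> g \<in> \<W>) & (g \<in> \<W> & g \<star> f \<in> \<W> --> f \<in> \<W>)"
  unfolding W_iff_bij[OF f] W_iff_bij[OF g] W_iff_bij[OF gf]
  using A B by blast
qed

lemma retracts_W: "retracts ch \<W> \<subseteq> \<W>"
proof
 fix f assume "f \<in> retracts ch \<W>"
 then obtain g where gW: "g \<in> \<W>" and r: "is_retract ch f g" by (auto simp: retracts_def)
 obtain i s i' s' where f: "f \<in> Hom ch (Dom ch f) (Cod ch f)" and g: "g \<in> Hom ch (Dom ch g) (Cod ch g)"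
  and i: "i \<in> Hom ch (Dom ch f) (Dom ch g)" and s: "s \<in> Hom ch (Dom ch g) (Dom ch f)"
  and i': "i' \<in> Hom ch (Cod ch f) (Cod ch g)" and s': "s' \<in> Hom ch (Cod ch g) (Cod ch f)"
  and si: "s \<star> i = Idn ch (Dom ch f)" and si': "s' \<star> i' = Idn ch (Cod ch f)"
  and gi: "g \<star> i = i' \<star> f" and fs: "f \<star> s = s' \<star> g"
  using r Hom_ch_Arr unfolding is_retract_def by blast
 have O: "Dom ch f \<in> Obj ch" "Cod ch f \<in> Obj ch" using Hom_ObjD[OF f] by auto
 show "f \<in> \<W>"
  unfolding W_iff_bij[OF f]
 proof (intro allI ballI)
  fix n c assume c: "c \<in> Obj C"
  have b: "bij_betw (hq g n c) (HH (Dom ch g) n c) (HH (Cod ch g) n c)" using gW c unfolding W_iff_bij[OF g] by blast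
  have sq1: "hq g n c (hq i n c a) = hq i' n c (hq f n c a)" if "a \<in> HH (Dom ch f) n c" for a
   using hq_Cmp[OF i g c that] hq_Cmp[OF f i' c that] gi by simp
  have sq2: "hq f n c (hq s n c a) = hq s' n c (hq g n c a)" if "a \<in> HH (Dom ch g) n c" for a
   using hq_Cmp[OF s f c that] hq_Cmp[OF g s' c that] fs by simp
  have id1: "hq s n c (hq i n c a) = a" if "a \<in> HH (Dom ch f) n c" for a
   using hq_Cmp[OF i s c that] hq_Idn[OF O(1) c that] si by simp
  have id2: "hq s' n c (hq i' n c a) = a" if "a \<in> HH (Cod ch f) n c" for a
   using hq_Cmp[OF i' s' c that] hq_Idn[OF O(2) c that] si' by simp
  show "bij_betw (hq f n c) (HH (Dom ch f) n c) (HH (Cod ch f) n c)"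
   unfolding bij_betw_def
  proof
   show "inj_on (hq f n c) (HH (Dom ch f) n c)"
   proof (rule inj_onI)
    fix a d assume a: "a \<in> HH (Dom ch f) n c" and d: "d \<in> HH (Dom ch f) n c" and e: "hq f n c a = hq f n c d"
    then have "hq g n c (hq i n c a) = hq g n c (hq i n c d)" using sq1 by simp
    then have "hq i n c a = hq i n c d" by (rule inj_onD[OF bij_betw_imp_inj_on[OF b] _ hq_closed[OF i c a] hq_closed[OF i c d]])
    then have "hq s n c (hq i n c a) = hq s n c (hq i n c d)" by (rule arg_cong)
    then show "a = d" unfolding id1[OF a] id1[OF d] .
   qed
   show "hq f n c ` HH (Dom ch f) n c = HH (Cod ch f) n c"
   proof
    show "hq f n c ` HH (Dom ch f) n c \<subseteq> HH (Cod ch f) n c" using hq_closed[OF f c] by blast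
    show "HH (Cod ch f) n c \<subseteq> hq f n c ` HH (Dom ch f) n c"
    proof
     fix y assume y: "y \<in> HH (Cod ch f) n c"
     have "hq i' n c y \<in> hq g n c ` HH (Dom ch g) n c" using hq_closed[OF i' c y] b by (simp add: bij_betw_imp_surj_on)
     then obtain z where z: "z \<in> HH (Dom ch g) n c" "hq i' n c y = hq g n c z" by blast
     have "hq f n c (hq s n c z) = y" using sq2[OF z(1)] z(2) id2[OF y] by simp
     then show "y \<in> hq f n c ` HH (Dom ch f) n c" using hq_closed[OF s c z(1)] by blast
    qed
   qed
  qed
 qed
qed

lemma Idn_W: "X \<in> Obj ch ==> Idn ch X \<in> \<W>"
 unfolding W_iff_bij[OF Idn_in_Hom_ch]
 using hq_Idn by (auto simp: bij_betw_def inj_on_def image_iff)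

subsection \<open>Two cones\<close>

text \<open>The boundary of \<open>(z, h)\<close> is \<open>(bd z, z - bd h)\<close>, which makes
  this a contractible complex over \<open>Z\<close>. A chain map into it with first component
  \<open>d\<close> has as its second component a null-homotopy of \<open>d\<close>; on a cycle
  \<open>z\<close> this says that \<open>d z\<close> is a boundary.\<close>

definition path_sd :: "('o, 'a, 'r, 'u) psh_cplx => ('o, 'a, 'r, 'u \<times> 'u) sd" where
 "path_sd Z = \<lparr>EQ = (\<lambda>n c p q. p = q & fst p \<in> K Z n c & snd p \<in> K Z (n + 1) c),
  AD = (\<lambda>n c p q. (pl Z n c (fst p) (fst q), pl Z (n + 1) c (snd p) (snd q))),
  ZR = (\<lambda>n c. (zr Z n c, zr Z (n + 1) c)), NG = (\<lambda>n c p. (ng Z n c (fst p), ng Z (n + 1) c (snd p))),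
  SM = (\<lambda>n c a p. (sm Z n c a (fst p), sm Z (n + 1) c a (snd p))),
  RS = (\<lambda>n f p. (rs Z n f (fst p), rs Z (n + 1) f (snd p))),
  BD = (\<lambda>n c p. (bd Z n c (fst p), pl Z n c (fst p) (ng Z n c (bd Z (n + 1) c (snd p)))))\<rparr>"

text \<open>The cone of the identity, with boundary \<open>(bd x + y, - bd y)\<close>. It is
  contractible and contains \<open>Z\<close> through the first component.\<close>

definition cone_sd :: "('o, 'a, 'r, 'u) psh_cplx => ('o, 'a, 'r, 'u \<times> 'u) sd" where
 "cone_sd Z = \<lparr>EQ = (\<lambda>n c p q. p = q & fst p \<in> K Z n c & snd p \<in> K Z (n - 1) c),
  AD = (\<lambda>n c p q. (pl Z n c (fst p) (fst q), pl Z (n - 1) c (snd p) (snd q))),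
  ZR = (\<lambda>n c. (zr Z n c, zr Z (n - 1) c)), NG = (\<lambda>n c p. (ng Z n c (fst p), ng Z (n - 1) c (snd p))),
  SM = (\<lambda>n c a p. (sm Z n c a (fst p), sm Z (n - 1) c a (snd p))),
  RS = (\<lambda>n f p. (rs Z n f (fst p), rs Z (n - 1) f (snd p))),
  BD = (\<lambda>n c p. (pl Z (n - 1) c (bd Z n c (fst p)) (snd p), ng Z (n - 2) c (bd Z (n - 1) c (snd p))))\<rparr>"

lemma small_pairs:
 assumes "Z \<in> Obj ch" "c \<in> Obj C"
 shows "small \<mu> (f ` {p. fst p \<in> K Z n c & snd p \<in> K Z m c})"
proof -
 have "{p. fst p \<in> K Z n c & snd p \<in> K Z m c} = K Z n c \<times> K Z m c" by auto
 then show ?thesis using small_image[OF U small_Sigma[OF U small_K[OF assms] small_K[OF assms]]] by simp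
qed

lemma sdata_path: assumes Z: "Z \<in> Obj ch" shows "sdata C \<mu> R S (path_sd Z)"
proof
 show "c \<in> Obj C ==> small \<mu> (cls (path_sd Z) n c ` {x. EQ (path_sd Z) n c x x})" for c n
  using small_pairs[OF Z, of c "cls (path_sd Z) n c" n "n + 1"] by (simp add: path_sd_def)
qed (insert Z, unfold path_sd_def sd.simps,
  (auto simp: pl_assoc pl_comm pl_lcomm sm_add sm_pl sm_mult sm_ng rs_pl rs_sm rs_ng rs_rs bd_pl bd_sm bd_ng bd_rs ng_pl
   Dom_closed Cod_closed rres_closed Cmp_Arr; fail)+)

lemma sdata_cone: assumes Z: "Z \<in> Obj ch" shows "sdata C \<mu> R S (cone_sd Z)"
proof
 show "c \<in> Obj C ==> small \<mu> (cls (cone_sd Z) n c ` {x. EQ (cone_sd Z) n c x x})" for c n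
  using small_pairs[OF Z, of c "cls (cone_sd Z) n c" n "n - 1"] by (simp add: cone_sd_def)
qed (insert Z, unfold cone_sd_def sd.simps,
  (auto simp: pl_assoc pl_comm pl_lcomm sm_add sm_pl sm_mult sm_ng rs_pl rs_sm rs_ng rs_rs bd_pl bd_sm bd_ng bd_rs ng_pl
   Dom_closed Cod_closed rres_closed Cmp_Arr; fail)+)

definition to_zero :: "('o, 'a, 'r, 'u) psh_cplx => ('o, 'a, 'r, 'u) psh_cplx_arr" where
 "to_zero X = mk X Zc (\<lambda>n c x. zr Zc n c)"

lemma zero_hm: "X \<in> Obj ch ==> Y \<in> Obj ch ==> hm X Y (\<lambda>n c x. zr Y n c)"
 by (rule hmI) simp_all

lemma to_zero_Hom: "X \<in> Obj ch ==> to_zero X \<in> Hom ch X Zc"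
 unfolding to_zero_def by (rule mk_in_Hom[OF _ Zc_Obj zero_hm]) simp_all

lemma to_zero_unique: "f \<in> Hom ch X Zc ==> g \<in> Hom ch X Zc ==> f = g"
 using ev_closed[of f X Zc] ev_closed[of g X Zc] by (intro arr_eqI) auto

lemma hm_cong:
 assumes X: "X \<in> Obj ch" and \<phi>: "hm X Y \<phi>"
  and e: "!!n c x. c \<in> Obj C ==> x \<in> K X n c ==> \<psi> n c x = \<phi> n c x"
 shows "hm X Y \<psi>"
 by (rule hmI; insert \<phi>; simp add: hm_def e[OF _ pl_closed[OF X]] e[OF _ sm_closed[OF X]] e[OF _ bd_closed[OF X]]
   e[OF _ rs_closed[OF X]] e Dom_closed Cod_closed)

lemma hm_diff:
 assumes f: "f \<in> Hom ch X Y" and g: "g \<in> Hom ch X Y"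
 shows "hm X Y (\<lambda>n c x. pl Y n c (ev f n c x) (ng Y n c (ev g n c x)))"
proof (rule hmI)
 have Y: "Y \<in> Obj ch" using Hom_ObjD[OF f] by simp
 fix n c x assume c: "c \<in> Obj C" and x: "x \<in> K X n c"
 note E = ev_closed[OF f c] ev_closed[OF g c]
 show "pl Y n c (ev f n c x) (ng Y n c (ev g n c x)) \<in> K Y n c" using Y c E x by simp
 show "pl Y n c (ev f n c (pl X n c x y)) (ng Y n c (ev g n c (pl X n c x y))) =
   pl Y n c (pl Y n c (ev f n c x) (ng Y n c (ev g n c x))) (pl Y n c (ev f n c y) (ng Y n c (ev g n c y)))"
  if y: "y \<in> K X n c" for y
  using Y c E[OF x] E[OF y] ev_pl[OF f c x y] ev_pl[OF g c x y] by (simp add: ng_pl pl_assoc pl_lcomm[of Y c "ev f n c y"])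
 show "pl Y n c (ev f n c (sm X n c a x)) (ng Y n c (ev g n c (sm X n c a x))) =
   sm Y n c a (pl Y n c (ev f n c x) (ng Y n c (ev g n c x)))" if a: "a \<in> \<R> c" for a
  using Y c E[OF x] a ev_sm[OF f c a x] ev_sm[OF g c a x] by (simp add: sm_pl sm_ng)
 show "pl Y (n - 1) c (ev f (n - 1) c (bd X n c x)) (ng Y (n - 1) c (ev g (n - 1) c (bd X n c x))) =
   bd Y n c (pl Y n c (ev f n c x) (ng Y n c (ev g n c x)))"
  using Y c E[OF x] ev_bd[OF f c x] ev_bd[OF g c x] by (simp add: bd_pl bd_ng)
next
 have Y: "Y \<in> Obj ch" using Hom_ObjD[OF f] by simp
 fix n h x assume h: "h \<in> Arr C" and x: "x \<in> K X n (Cod C h)"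
 show "pl Y n (Dom C h) (ev f n (Dom C h) (rs X n h x)) (ng Y n (Dom C h) (ev g n (Dom C h) (rs X n h x))) =
   rs Y n h (pl Y n (Cod C h) (ev f n (Cod C h) x) (ng Y n (Cod C h) (ev g n (Cod C h) x)))"
  using Y ev_rs[OF f h x] ev_rs[OF g h x] ev_closed[OF f Cod_closed[OF h] x] ev_closed[OF g Cod_closed[OF h] x] Cod_closed[OF h]
  by (simp add: rs_pl[OF Y h] rs_ng[OF Y h])
qed

text \<open>
 A map with the left lifting property against all fibrations is a homology isomorphism: lifting
 against \<open>Z \<rightarrow> 0\<close> gives a retraction, and lifting against the path fibration over its target gives
 a homotopy.
\<close>

lemma llp_fibrations_W:
 assumes j: "j \<in> llp ch \<F>" shows "j \<in> \<W>"
proof -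
 let ?X = "Dom ch j" and ?Z = "Cod ch j"
 have jH: "j \<in> Hom ch ?X ?Z" using j Hom_ch_Arr by (simp add: llp_def)
 have X: "?X \<in> Obj ch" and Z: "?Z \<in> Obj ch" using Hom_ObjD[OF jH] by auto
 have lift: "has_lifts ch j p" if "p \<in> \<F>" for p using j that by (simp add: llp_def)
 have "to_zero ?X \<in> \<F>" unfolding levelwise_iff[OF to_zero_Hom[OF X]]
 proof (intro allI ballI)
  fix n c y assume c: "c \<in> Obj C" and y: "y \<in> K Zc n c"
  show "\<exists>x\<in>K ?X n c. ev (to_zero ?X) n c x = y"
   using ev_closed[OF to_zero_Hom[OF X] c zr_closed[OF X c, of n]] y zr_closed[OF X c] by auto
 qed
 from ch.has_liftsD[OF lift[OF this] jH to_zero_Hom[OF X] Idn_in_Hom_ch[OF X] to_zero_Hom[OF Z]]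
 obtain r where r: "r \<in> Hom ch ?Z ?X" "r \<star> j = Idn ch ?X"
  using to_zero_unique[OF Cmp_in_Hom_ch[OF Idn_in_Hom_ch[OF X] to_zero_Hom[OF X]] Cmp_in_Hom_ch[OF jH to_zero_Hom[OF Z]]] by blast
 have rj: "ev r n c (ev j n c x) = x" if "c \<in> Obj C" "x \<in> K ?X n c" for n c x
  using ev_Cmp[OF jH r(1) that] r(2) that by simp
 interpret P: sdata C \<mu> R S "path_sd ?Z" by (rule sdata_path[OF Z])
 define p where "p = P.out ?Z (\<lambda>n c. fst)"
 have p: "p \<in> Hom ch P.obj ?Z" unfolding p_def by (rule P.out_map(1)[OF Z]) (auto simp: path_sd_def)
 have evp: "ev p n c (P.em n c q) = fst q" if "c \<in> Obj C" "EQ (path_sd ?Z) n c q q" for n c q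
  unfolding p_def by (rule P.out_map(2)[OF Z]) (use that in \<open>auto simp: path_sd_def\<close>)
 have "p \<in> \<F>" unfolding levelwise_iff[OF p]
 proof (intro allI ballI)
  fix n c y assume c: "c \<in> Obj C" and y: "y \<in> K ?Z n c"
  have q: "EQ (path_sd ?Z) n c (y, zr ?Z (n + 1) c) (y, zr ?Z (n + 1) c)" using c y Z by (simp add: path_sd_def)
  show "\<exists>x\<in>K P.obj n c. ev p n c x = y" using evp[OF c q] P.em_in_K[OF q] by (intro bexI[of _ "P.em n c (y, zr ?Z (n + 1) c)"]) auto
 qed
 note lp = lift[OF this]
 \<comment> \<open>The identity minus \<open>j\<close> after \<open>r\<close>. It vanishes on the
   image of \<open>j\<close>, so the zero map into the path complex completes the square, and the
   lift \<open>H\<close> is a null-homotopy of \<open>d\<close>.\<close>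
 define d where "d n c z = pl ?Z n c z (ng ?Z n c (ev j n c (ev r n c z)))" for n c z
 have jr: "ev j n c (ev r n c z) \<in> K ?Z n c" if "c \<in> Obj C" "z \<in> K ?Z n c" for n c z
  using ev_closed[OF jH that(1) ev_closed[OF r(1) that]] .
 have "hm ?Z ?Z d"
  by (rule hm_cong[OF Z hm_diff[OF Idn_in_Hom_ch[OF Z] Cmp_in_Hom_ch[OF r(1) jH]]])
   (simp add: d_def ev_Cmp[OF r(1) jH])
 then have D: "mk ?Z ?Z d \<in> Hom ch ?Z ?Z" by (rule mk_in_Hom[OF Z Z])
 let ?z = "mk ?X P.obj (\<lambda>n c x. zr P.obj n c)"
 have zH: "?z \<in> Hom ch ?X P.obj" by (rule mk_in_Hom[OF X P.obj_in_Obj zero_hm[OF X P.obj_in_Obj]])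
 have "p \<star> ?z = mk ?Z ?Z d \<star> j"
 proof (rule arr_eqI[OF Cmp_in_Hom_ch[OF zH p] Cmp_in_Hom_ch[OF jH D]])
  fix n c x assume c: "c \<in> Obj C" and x: "x \<in> K ?X n c"
  have "ev (p \<star> ?z) n c x = zr ?Z n c" using ev_Cmp[OF zH p c x] c x ev_zr[OF p c] by simp
  moreover have "ev (mk ?Z ?Z d \<star> j) n c x = zr ?Z n c"
   using ev_Cmp[OF jH D c x] ev_closed[OF jH c x] c x rj[OF c x] Z by (simp add: d_def)
  ultimately show "ev (p \<star> ?z) n c x = ev (mk ?Z ?Z d \<star> j) n c x" by simp
 qed
 from ch.has_liftsD[OF lp jH p zH D this]
 obtain H where H: "H \<in> Hom ch ?Z P.obj" "p \<star> H = mk ?Z ?Z d" by blast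
 have "wq ?X ?Z j"
  unfolding wq_def
 proof (intro allI ballI conjI impI)
  fix n c x assume c: "c \<in> Obj C" and x: "x \<in> K ?X n c" and "\<exists>y\<in>K ?Z (n + 1) c. ev j n c x = bd ?Z (n + 1) c y"
  then obtain y where y: "y \<in> K ?Z (n + 1) c" "ev j n c x = bd ?Z (n + 1) c y" by blast
  have "x = bd ?X (n + 1) c (ev r (n + 1) c y)" using rj[OF c x] y(2) ev_bd[OF r(1) c y(1)] by simp
  then show "\<exists>w\<in>K ?X (n + 1) c. x = bd ?X (n + 1) c w" using ev_closed[OF r(1) c y(1)] by blast
 next
  fix n c z assume c: "c \<in> Obj C" and z: "z \<in> K ?Z n c" "bd ?Z n c z = zr ?Z (n - 1) c"
  obtain q where q: "EQ (path_sd ?Z) n c q q" "ev H n c z = P.em n c q" using P.K_objD[OF ev_closed[OF H(1) c z(1)]] by blast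
  have qK: "fst q \<in> K ?Z n c" "snd q \<in> K ?Z (n + 1) c" using q(1) by (auto simp: path_sd_def)
  have fq: "fst q = d n c z" using ev_Cmp[OF H(1) p c z(1)] H(2) evp[OF c q(1)] q(2) c z(1) by simp
  \<comment> \<open>\<open>H\<close> sends the cycle \<open>z\<close> to a cycle of the path
    complex; the second component of its boundary equates \<open>d n c z\<close> with the boundary
    of \<open>snd q\<close>.\<close>
  have "P.em (n - 1) c (BD (path_sd ?Z) n c q) = P.em (n - 1) c (ZR (path_sd ?Z) (n - 1) c)"
   using ev_bd[OF H(1) c z(1)] z(2) ev_zr[OF H(1) c] P.bd_em[OF c q(1)] q(2) P.zr_em[OF c] by simp
  then have "EQ (path_sd ?Z) (n - 1) c (BD (path_sd ?Z) n c q) (ZR (path_sd ?Z) (n - 1) c)"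
   using P.em_eq[OF c P.em_closure(6)[OF c q(1) HOL.refl] P.ZR_refl[OF c]] by simp
  then have "pl ?Z n c (fst q) (ng ?Z n c (bd ?Z (n + 1) c (snd q))) = zr ?Z n c" by (simp add: path_sd_def)
  then have dz: "d n c z = bd ?Z (n + 1) c (snd q)" using eq_of_pl_ng[OF Z c qK(1)] qK Z c fq by simp
  have "z = pl ?Z n c (d n c z) (ev j n c (ev r n c z))" using Z c z(1) jr[OF c z(1)] by (simp add: d_def pl_assoc)
  moreover have "bd ?X n c (ev r n c z) = zr ?X (n - 1) c" using ev_bd[OF r(1) c z(1)] z(2) ev_zr[OF r(1) c] by simp
  ultimately show "\<exists>x\<in>K ?X n c. bd ?X n c x = zr ?X (n - 1) c & (\<exists>w\<in>K ?Z (n + 1) c. z = pl ?Z n c (bd ?Z (n + 1) c w) (ev j n c x))"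
   using ev_closed[OF r(1) c z(1)] dz qK(2) by auto
 qed
 then show ?thesis using homology_isos_iff[OF jH] by blast
qed

text \<open>Lifting against the trivial fibration from the cone of the source to zero.\<close>

lemma cofibration_injective:
 assumes i: "i \<in> llp ch \<T>" and iH: "i \<in> Hom ch X Z" and c: "c \<in> Obj C" and x: "x \<in> K X n c" and y: "y \<in> K X n c"
  and e: "ev i n c x = ev i n c y"
 shows "x = y"
proof -
 have X: "X \<in> Obj ch" and Z: "Z \<in> Obj ch" using Hom_ObjD[OF iH] by auto
 interpret P: sdata C \<mu> R S "cone_sd X" by (rule sdata_cone[OF X])
 have "to_zero P.obj \<in> \<T>"
  unfolding injectives_I_iff[OF to_zero_Hom[OF P.obj_in_Obj]] lp_def
 proof (intro allI ballI impI)
  fix n d u v assume d: "d \<in> Obj C" and u: "u \<in> K P.obj n d" and v: "v \<in> K Zc (n + 1) d" and z: "bd P.obj n d u = zr P.obj (n - 1) d"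
  obtain q where q: "EQ (cone_sd X) n d q q" "u = P.em n d q" using P.K_objD[OF u] by blast
  have qK: "fst q \<in> K X n d" "snd q \<in> K X (n - 1) d" using q(1) by (auto simp: cone_sd_def)
  have "P.em (n - 1) d (BD (cone_sd X) n d q) = P.em (n - 1) d (ZR (cone_sd X) (n - 1) d)"
   using z P.bd_em[OF d q(1)] q(2) P.zr_em[OF d] by simp
  then have "EQ (cone_sd X) (n - 1) d (BD (cone_sd X) n d q) (ZR (cone_sd X) (n - 1) d)"
   using P.em_eq[OF d P.em_closure(6)[OF d q(1) HOL.refl] P.ZR_refl[OF d]] by simp
  then have "pl X (n - 1) d (bd X n d (fst q)) (snd q) = zr X (n - 1) d" by (simp add: cone_sd_def)
  \<comment> \<open>The second component of a cycle is minus the boundary of the first, so the cycle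
    bounds \<open>(0, fst q)\<close>: the cone is acyclic, and its map to zero is a trivial
    fibration.\<close>
  then have sq: "snd q = ng X (n - 1) d (bd X n d (fst q))" using ng_unique[OF X d, of "bd X n d (fst q)" "n - 1" "snd q"] qK X d by simp
  let ?w = "(zr X (n + 1) d, fst q)"
  have w: "EQ (cone_sd X) (n + 1) d ?w ?w" using X d qK by (simp add: cone_sd_def)
  have "BD (cone_sd X) (n + 1) d ?w = q" using X d qK sq by (simp add: cone_sd_def prod_eq_iff)
  then have "bd P.obj (n + 1) d (P.em (n + 1) d ?w) = u" using P.bd_em[OF d w] q(2) by simp
  moreover have "ev (to_zero P.obj) (n + 1) d (P.em (n + 1) d ?w) = v"
   using ev_closed[OF to_zero_Hom[OF P.obj_in_Obj] d P.em_in_K[OF w]] v by simp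
  ultimately show "\<exists>w\<in>K P.obj (n + 1) d. bd P.obj (n + 1) d w = u & ev (to_zero P.obj) (n + 1) d w = v"
   using P.em_in_K[OF w] by blast
 qed
 then have l: "has_lifts ch i (to_zero P.obj)" using i by (simp add: llp_def)
 \<comment> \<open>The inclusion of \<open>X\<close> into its cone is visibly injective, and the
   lift extends it along \<open>i\<close>.\<close>
 let ?s = "P.into X (\<lambda>n c x. (x, zr X (n - 1) c))"
 have m: "?s \<in> Hom ch X P.obj" "!!n c x. c \<in> Obj C ==> x \<in> K X n c ==> ev ?s n c x = P.em n c (x, zr X (n - 1) c)"
  by ((rule P.into_map(1)[OF X] | rule P.into_map(2)[OF X]); insert X; simp add: cone_sd_def Dom_closed)+
 from ch.has_liftsD[OF l iH to_zero_Hom[OF P.obj_in_Obj] m(1) to_zero_Hom[OF Z]]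
 obtain h where h: "h \<in> Hom ch Z P.obj" "h \<star> i = ?s"
  using to_zero_unique[OF Cmp_in_Hom_ch[OF m(1) to_zero_Hom[OF P.obj_in_Obj]] Cmp_in_Hom_ch[OF iH to_zero_Hom[OF Z]]] by blast
 have "P.em n c (x, zr X (n - 1) c) = P.em n c (y, zr X (n - 1) c)"
  using ev_Cmp[OF iH h(1) c x] ev_Cmp[OF iH h(1) c y] h(2) m(2)[OF c x] m(2)[OF c y] e by simp
 then have "EQ (cone_sd X) n c (x, zr X (n - 1) c) (y, zr X (n - 1) c)"
  using P.em_eq[OF c, of n "(x, zr X (n - 1) c)" "(y, zr X (n - 1) c)"] X c x y by (simp add: cone_sd_def)
 then show ?thesis by (simp add: cone_sd_def)
qed

end

section \<open>Functoriality of terms and of factorizations\<close>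

context psh_setup begin

text \<open>Relabelling along a square of maps: \<open>U\<close> acts on sections of the source and
  \<open>V\<close> on the prescribed images of cells, also inside boundary terms. \<open>V\<close>
  is applied one degree up, where the cell lives.\<close>

primrec mp :: "(int => 'o => 'u => 'u) => (int => 'o => 'u => 'u) => (unit, 'o, 'a, 'r, 'u) tm => (unit, 'o, 'a, 'r, 'u) tm" where
 "mp U V (Gn j n c x) = Gn j n c (U n c x)"
| "mp U V (Cl n c t y) = Cl n c (mp U V t) (V (n + 1) c y)"
| "mp U V Zr = Zr"
| "mp U V (Ad s t) = Ad (mp U V s) (mp U V t)"
| "mp U V (Ng t) = Ng (mp U V t)"
| "mp U V (Sm a t) = Sm a (mp U V t)"
| "mp U V (Rs f t) = Rs f (mp U V t)"
| "mp U V (Bd t) = Bd (mp U V t)"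

text \<open>All labels are actual sections. \<open>ev\<close> is controlled on sections only, so it
  is on such terms that relabelling preserves identities and composites.\<close>

primrec good :: "('o, 'a, 'r, 'u) psh_cplx => ('o, 'a, 'r, 'u) psh_cplx => (unit, 'o, 'a, 'r, 'u) tm => bool" where
 "good X Y (Gn j n c x) = (c \<in> Obj C & x \<in> K X n c)"
| "good X Y (Cl n c t y) = (c \<in> Obj C & good X Y t & y \<in> K Y (n + 1) c)"
| "good X Y Zr = True"
| "good X Y (Ad s t) = (good X Y s & good X Y t)"
| "good X Y (Ng t) = good X Y t"
| "good X Y (Sm a t) = good X Y t"
| "good X Y (Rs f t) = good X Y t"
| "good X Y (Bd t) = good X Y t"

abbreviation ok1 where "ok1 X D \<equiv> ok {()} (\<lambda>_. X) D"
abbreviation teq1 where "teq1 X D E \<equiv> teq {()} (\<lambda>_. X) D E"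
abbreviation psd1 where "psd1 X D E \<equiv> psd {()} (\<lambda>_. X) D E"

lemma ok_good: "(!!e. e \<in> D ==> good X Y e) ==> ok1 X D t n c ==> good X Y t"
proof (induction t arbitrary: n c)
 case (Cl m d t y)
 then have "Cl m d t y \<in> D" by auto
 then show ?case by (rule Cl.prems(1))
qed auto

lemma flat_mp: "flat t ==> flat (mp U V t)"
 by (induction t) auto

lemma ok_mp:
 assumes U: "hm X X' U" and D: "!!e. e \<in> D ==> mp U V e \<in> D'"
 shows "ok1 X D t n c ==> ok1 X' D' (mp U V t) n c"
proof (induction t arbitrary: n c)
 case (Gn j m d x)
 then show ?case using U by (auto simp: hm_def)
next
 case (Cl m d t y)
 then show ?case using D[of "Cl m d t y"] by auto
qed auto

text \<open>Induction on the derivation. The relations \<open>E\<close> must be stable under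
  relabelling, which is why the boundary term of a cell is relabelled together with the
  cell.\<close>

lemma teq_mp:
 assumes X: "X \<in> Obj ch" and U: "hm X X' U" and D: "!!e. e \<in> D ==> mp U V e \<in> D'"
  and E: "!!n c t s. E n c t s ==> E n c (mp U V t) (mp U V s)"
 shows "teq1 X D E n c t s ==> teq1 X' D' E n c (mp U V t) (mp U V s)"
proof (induction rule: teq.induct)
 note o = ok_mp[OF U D]
 case (te_ext n c t s)
 then show ?case by (simp add: teq.te_ext E o)
next
 note o = ok_mp[OF U D]
 case (te_gn_pl j c x n y)
 then have "U n c x \<in> K X' n c" "U n c y \<in> K X' n c" "U n c (pl X n c x y) = pl X' n c (U n c x) (U n c y)" using U by (auto simp: hm_def)
 then show ?case using te_gn_pl teq.te_gn_pl[of j "{()}" c "U n c x" "\<lambda>_. X'"] by simp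
next
 case (te_gn_sm j c a x n)
 then have "U n c x \<in> K X' n c" "U n c (sm X n c a x) = sm X' n c a (U n c x)" using U by (auto simp: hm_def)
 then show ?case using te_gn_sm teq.te_gn_sm[of j "{()}" c a "U n c x" "\<lambda>_. X'"] by simp
next
 case (te_gn_rs j f x n)
 then have "U n (Cod C f) x \<in> K X' n (Cod C f)" "U n (Dom C f) (rs X n f x) = rs X' n f (U n (Cod C f) x)"
  using U Cod_closed by (auto simp: hm_def)
 then show ?case using te_gn_rs teq.te_gn_rs[of j "{()}" f "U n (Cod C f) x" "\<lambda>_. X'"] by simp
next
 case (te_gn_bd j c x n)
 then have "U n c x \<in> K X' n c" "U (n - 1) c (bd X n c x) = bd X' n c (U n c x)" using U by (auto simp: hm_def)
 then show ?case using te_gn_bd teq.te_gn_bd[of j "{()}" c "U n c x" "\<lambda>_. X'"] by simp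
next
 case te_trans then show ?case by (blast intro: teq.te_trans)
next
 case te_sym then show ?case by (blast intro: teq.te_sym)
qed ((simp only: mp.simps)?; rule teq.te_refl teq.te_ad teq.te_ng teq.te_sm teq.te_rs teq.te_bd teq.te_assoc teq.te_comm
  teq.te_zr teq.te_inv teq.te_sm_add teq.te_sm_ad teq.te_sm_mult teq.te_sm_one teq.te_rs_ad teq.te_rs_sm teq.te_rs_zr teq.te_rs_ng
  teq.te_rs_id teq.te_rs_cmp teq.te_bd_ad teq.te_bd_sm teq.te_bd_rs teq.te_bd_bd; simp add: ok_mp[OF U D])+

text \<open>The prescribed map to the target of \<open>f\<close>: sections go along
  \<open>f\<close>, and a cell goes to the label that it carries.\<close>

definition kap :: "('o, 'a, 'r, 'u) psh_cplx_arr => int => 'o => (unit, 'o, 'a, 'r, 'u) tm => 'u" where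
 "kap f n c t = (case t of Gn j m d x => ev f n c x | Cl m d t y => y | _ => undefined)"

lemma kap_simps [simp]: "kap f n c (Gn j m d x) = ev f n c x" "kap f n c (Cl m d t y) = y"
 by (simp_all add: kap_def)

lemma evt_good_closed:
 assumes f: "f \<in> Hom ch X Y" and D: "!!e. e \<in> D ==> good X Y e"
 shows "ok1 X D t n c ==> evt Y (kap f) t n c \<in> K Y n c"
proof (induction t arbitrary: n c)
 case (Cl m d t y) then show ?case using D[of "Cl m d t y"] by auto
next
 case (Bd t) then show ?case using Hom_ObjD[OF f] ok_Obj[OF Bd.prems] by auto
qed (use f Hom_ObjD[OF f] in \<open>auto dest: ok_Obj\<close>)

lemma evt_mp:
 assumes f: "f \<in> Hom ch X Y" and g: "g \<in> Hom ch X' Y'" and u: "u \<in> Hom ch X X'" and v: "v \<in> Hom ch Y Y'"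
  and sq: "g \<star> u = v \<star> f" and D: "!!e. e \<in> D ==> good X Y e"
 shows "ok1 X D t n c ==> evt Y' (kap g) (mp (ev u) (ev v) t) n c = ev v n c (evt Y (kap f) t n c)"
proof (induction t arbitrary: n c)
 case (Gn j m d x)
 then show ?case using ev_Cmp[OF u g, of c x n] ev_Cmp[OF f v, of c x n] sq by simp
next
 case (Ad s t)
 then show ?case using ev_pl[OF v ok_Obj[OF Ad.prems] evt_good_closed[OF f D] evt_good_closed[OF f D]] by simp
next
 case (Ng t)
 then show ?case using ev_ng[OF v ok_Obj[OF Ng.prems] evt_good_closed[OF f D]] by simp
next
 case (Sm a t)
 then show ?case using ev_sm[OF v ok_Obj[OF Sm.prems] _ evt_good_closed[OF f D]] by simp
next
 case (Rs h t)
 then show ?case using ev_rs[OF v, of h "evt Y (kap f) t n (Cod C h)" n] evt_good_closed[OF f D] by auto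
next
 case (Bd t)
 then have o: "ok1 X D t (n + 1) c" by simp
 show ?case using Bd.IH[OF o] ev_bd[OF v ok_Obj[OF o] evt_good_closed[OF f D o]] by simp
next
 case Zr
 then show ?case using v by simp
qed auto

lemma mp_id:
 assumes "X \<in> Obj ch" "Y \<in> Obj ch" shows "good X Y t ==> mp (ev (Idn ch X)) (ev (Idn ch Y)) t = t"
 by (induction t) auto

lemma mp_comp:
 assumes u: "u \<in> Hom ch X X'" and v: "v \<in> Hom ch Y Y'" and u': "u' \<in> Hom ch X' X''" and v': "v' \<in> Hom ch Y' Y''"
 shows "good X Y t ==> mp (ev (u' \<star> u)) (ev (v' \<star> v)) t = mp (ev u') (ev v') (mp (ev u) (ev v) t)"
 by (induction t) (auto simp: ev_Cmp[OF u u'] ev_Cmp[OF v v'])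

end

text \<open>A functorial choice of cells attached to the source of each map, with relations.\<close>

locale fac = psh_setup C \<mu> R S for C :: "('o, 'a) cat" (structure) and \<mu> :: "'u rel"
  and R :: "('o, 'a, 'r) rpsh" and S :: "'o set" +
 fixes Df :: "('o, 'a, 'r, 'u) psh_cplx_arr => (unit, 'o, 'a, 'r, 'u) tm set"
  and E :: "int => 'o => (unit, 'o, 'a, 'r, 'u) tm => (unit, 'o, 'a, 'r, 'u) tm => bool"
 assumes D_small: "f \<in> Hom ch X Y ==> small \<mu> (Df f)"
  and D_good: "f \<in> Hom ch X Y ==> e \<in> Df f ==> good X Y e"
  and D_E: "f \<in> Hom ch X Y ==> E n c t s ==> ok1 X (Df f) t n c ==> ok1 X (Df f) s n c ==>
   evt Y (kap f) t n c = evt Y (kap f) s n c"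
  and D_nat: "f \<in> Hom ch X Y ==> g \<in> Hom ch X' Y' ==> u \<in> Hom ch X X' ==> v \<in> Hom ch Y Y' ==>
   g \<star> u = v \<star> f ==> e \<in> Df f ==> mp (ev u) (ev v) e \<in> Df g"
  and E_nat: "E n c t s ==> E n c (mp V W t) (mp V W s)"
begin

lemma pres_fac: "f \<in> Hom ch X Y ==> pres C \<mu> R S {()} (\<lambda>_. X) (Df f)"
 by unfold_locales (auto simp: small_finite[OF U] D_small dest: Hom_ObjD)

abbreviation A where "A f \<equiv> psd1 (Dom ch f) (Df f) E"
definition mid :: "('o, 'a, 'r, 'u) psh_cplx_arr => ('o, 'a, 'r, 'u) psh_cplx" where "mid f = ob C (A f)"
definition lft :: "('o, 'a, 'r, 'u) psh_cplx_arr => ('o, 'a, 'r, 'u) psh_cplx_arr" where "lft f = mk (Dom ch f) (mid f) (\<lambda>n c x. emb (A f) n c (Gn () n c x))"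
definition rgt :: "('o, 'a, 'r, 'u) psh_cplx_arr => ('o, 'a, 'r, 'u) psh_cplx_arr" where "rgt f = mk (mid f) (Cod ch f) (\<lambda>n c w. evt (Cod ch f) (kap f) (rp (A f) n c w) n c)"
definition kk :: "('o, 'a, 'r, 'u) psh_cplx_arr => ('o, 'a, 'r, 'u) psh_cplx_arr => ('o, 'a, 'r, 'u) psh_cplx_arr => ('o, 'a, 'r, 'u) psh_cplx_arr => ('o, 'a, 'r, 'u) psh_cplx_arr" where "kk f g u v = mk (mid f) (mid g) (\<lambda>n c w. emb (A g) n c (mp (ev u) (ev v) (rp (A f) n c w)))"

lemma fac_map:
 assumes f: "f \<in> Hom ch X Y"
 shows lft_Hom: "lft f \<in> Hom ch X (mid f)" and ev_lft: "!!n c x. c \<in> Obj C ==> x \<in> K X n c ==> ev (lft f) n c x = emb (A f) n c (Gn () n c x)"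
  and rgt_Hom: "rgt f \<in> Hom ch (mid f) Y" and ev_rgt: "!!n c t. ok1 X (Df f) t n c ==> ev (rgt f) n c (emb (A f) n c t) = evt Y (kap f) t n c"
proof -
 have XY: "Dom ch f = X" "Cod ch f = Y" using f by (auto simp: Hom_def)
 interpret P: pres C \<mu> R S "{()}" "\<lambda>_. X" "Df f" E by (rule pres_fac[OF f])
 have l: "lft f = P.inj_gn ()" by (simp add: lft_def P.inj_gn_def P.into_def mid_def XY)
 show "lft f \<in> Hom ch X (mid f)" unfolding l mid_def XY by (rule P.inj_gn_map(1)) simp
 show "ev (lft f) n c x = emb (A f) n c (Gn () n c x)" if "c \<in> Obj C" "x \<in> K X n c" for n c x
  unfolding l XY by (rule P.inj_gn_map(2)) (use that in auto)
 have M: "P.model Y (kap f)"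
  unfolding P.model_def
 proof (intro conjI ballI allI impI)
  show "Y \<in> Obj ch" using Hom_ObjD[OF f] by simp
  show "hm X Y (\<lambda>n c x. kap f n c (Gn j n c x))" for j :: unit using hm_ev[OF f] by simp
  show "kap f (m + 1) d (Cl m d t y) \<in> K Y (m + 1) d" if "Cl m d t y \<in> Df f" for m d t y
   using D_good[OF f that] by simp
 qed (rule D_E[OF f])
 have r: "rgt f = P.ind Y (kap f)" by (simp add: rgt_def P.ind_def P.out_def mid_def XY)
 show "rgt f \<in> Hom ch (mid f) Y" unfolding r mid_def XY by (rule P.ind_map(1)[OF M])
 show "ev (rgt f) n c (emb (A f) n c t) = evt Y (kap f) t n c" if "ok1 X (Df f) t n c" for n c t
  unfolding r XY by (rule P.ind_map(2)[OF M that])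
qed

lemma rgt_lft: assumes f: "f \<in> Hom ch X Y" shows "rgt f \<star> lft f = f"
proof (rule arr_eqI[OF Cmp_in_Hom_ch[OF lft_Hom[OF f] rgt_Hom[OF f]] f])
 fix n c x assume c: "c \<in> Obj C" and x: "x \<in> K X n c"
 then show "ev (rgt f \<star> lft f) n c x = ev f n c x"
  using ev_Cmp[OF lft_Hom[OF f] rgt_Hom[OF f] c x] ev_lft[OF f c x] ev_rgt[OF f, of "Gn () n c x" n c] by simp
qed

lemma mid_elem:
 assumes f: "f \<in> Hom ch X Y" and w: "w \<in> K (mid f) n c" shows "\<exists>t. ok1 X (Df f) t n c & flat t & w = emb (A f) n c t"
proof -
 have XY: "Dom ch f = X" "Cod ch f = Y" using f by (auto simp: Hom_def)
 interpret P: pres C \<mu> R S "{()}" "\<lambda>_. X" "Df f" E by (rule pres_fac[OF f])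
 show ?thesis using P.K_obj_flat w unfolding mid_def XY by blast
qed

lemma kk_map:
 assumes f: "f \<in> Hom ch X Y" and g: "g \<in> Hom ch X' Y'" and u: "u \<in> Hom ch X X'" and v: "v \<in> Hom ch Y Y'"
  and sq: "g \<star> u = v \<star> f"
 shows kk_Hom: "kk f g u v \<in> Hom ch (mid f) (mid g)"
  and ev_kk: "!!n c t. ok1 X (Df f) t n c ==> ev (kk f g u v) n c (emb (A f) n c t) = emb (A g) n c (mp (ev u) (ev v) t)"
proof -
 have XY: "Dom ch f = X" "Cod ch f = Y" "Dom ch g = X'" "Cod ch g = Y'" using f g by (auto simp: Hom_def)
 interpret P: pres C \<mu> R S "{()}" "\<lambda>_. X" "Df f" E by (rule pres_fac[OF f])
 interpret Q: pres C \<mu> R S "{()}" "\<lambda>_. X'" "Df g" E by (rule pres_fac[OF g])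
 let ?m = "mp (ev u) (ev v)"
 have X: "X \<in> Obj ch" using Hom_ObjD[OF f] by simp
 have o: "Q.okk (?m t) n c" if "P.okk t n c" for t n c
  by (rule ok_mp[OF hm_ev[OF u] D_nat[OF f g u v sq] that])
 have e: "Q.te n c (?m t) (?m s)" if "P.te n c t s" for t s n c
  by (rule teq_mp[OF X hm_ev[OF u] D_nat[OF f g u v sq] E_nat that])
 have k: "kk f g u v = P.out Q.obj (\<lambda>n c t. Q.em n c (?m t))"
  by (simp add: kk_def P.out_def mid_def XY)
 have *: "P.out Q.obj (\<lambda>n c t. Q.em n c (?m t)) \<in> Hom ch P.obj Q.obj"
  by (rule P.out_map(1)[OF Q.obj_in_Obj])
   (auto simp: P.EQ_psd P.te_iff Q.em_teq[OF e] o Q.obj_ops_em)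
 then show "kk f g u v \<in> Hom ch (mid f) (mid g)" unfolding k mid_def XY .
 show "ev (kk f g u v) n c (emb (A f) n c t) = emb (A g) n c (?m t)" if t: "ok1 X (Df f) t n c" for n c t
  unfolding k XY
  by (rule P.out_map(2)[OF Q.obj_in_Obj])
   (use t ok_Obj[OF t] in \<open>auto simp: P.EQ_psd P.te_iff Q.em_teq[OF e] o Q.obj_ops_em\<close>)
qed

text \<open>The identity and composition laws hold strictly, since the induced maps come from
  relabelling terms and relabelling is strictly functorial on good terms.\<close>

lemma functorial:
 assumes LR: "!!f. f \<in> Arr ch ==> lft f \<in> L & rgt f \<in> RR"
 shows "functorial_factorization ch L RR"
proof -
 have H: "f \<in> Hom ch (Dom ch f) (Cod ch f)" if "f \<in> Arr ch" for f using that by (rule Hom_ch_Arr)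
 have "(\<forall>f \<in> Arr ch. lft f \<in> L & rgt f \<in> RR & Dom ch (lft f) = Dom ch f & Cod ch (rgt f) = Cod ch f &
     Cod ch (lft f) = Dom ch (rgt f) & rgt f \<star> lft f = f)"
 proof
  fix f assume f: "f \<in> Arr ch"
  show "lft f \<in> L & rgt f \<in> RR & Dom ch (lft f) = Dom ch f & Cod ch (rgt f) = Cod ch f &
     Cod ch (lft f) = Dom ch (rgt f) & rgt f \<star> lft f = f"
   using LR[OF f] rgt_lft[OF H[OF f]] HomD[OF lft_Hom[OF H[OF f]]] HomD[OF rgt_Hom[OF H[OF f]]] by simp
 qed
 moreover have "(\<forall>f g u v. square ch f g u v -->
     kk f g u v \<in> Hom ch (Cod ch (lft f)) (Cod ch (lft g)) &
     kk f g u v \<star> lft f = lft g \<star> u & rgt g \<star> kk f g u v = v \<star> rgt f)"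
 proof (intro allI impI)
  fix f g u v assume sq: "square ch f g u v"
  let ?X = "Dom ch f" and ?Y = "Cod ch f"
  have f: "f \<in> Hom ch ?X ?Y" and g: "g \<in> Hom ch (Dom ch g) (Cod ch g)" and u: "u \<in> Hom ch ?X (Dom ch g)"
   and v: "v \<in> Hom ch ?Y (Cod ch g)" and e: "g \<star> u = v \<star> f" using sq H by (auto simp: square_def)
  note k = kk_Hom[OF f g u v e]
  have "kk f g u v \<star> lft f = lft g \<star> u"
  proof (rule arr_eqI[OF Cmp_in_Hom_ch[OF lft_Hom[OF f] k] Cmp_in_Hom_ch[OF u lft_Hom[OF g]]])
   fix n c x assume c: "c \<in> Obj C" and x: "x \<in> K ?X n c"
   then show "ev (kk f g u v \<star> lft f) n c x = ev (lft g \<star> u) n c x"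
    using ev_Cmp[OF lft_Hom[OF f] k c x] ev_Cmp[OF u lft_Hom[OF g] c x] ev_lft[OF f c x] ev_lft[OF g c ev_closed[OF u c x]]
     ev_kk[OF f g u v e, of "Gn () n c x" n c] by simp
  qed
  moreover have "rgt g \<star> kk f g u v = v \<star> rgt f"
  proof (rule arr_eqI[OF Cmp_in_Hom_ch[OF k rgt_Hom[OF g]] Cmp_in_Hom_ch[OF rgt_Hom[OF f] v]])
   fix n c w assume c: "c \<in> Obj C" and w: "w \<in> K (mid f) n c"
   obtain t where t: "ok1 ?X (Df f) t n c" "w = emb (A f) n c t" using mid_elem[OF f w] by blast
   have "ok1 (Dom ch g) (Df g) (mp (ev u) (ev v) t) n c"
    by (rule ok_mp[OF hm_ev[OF u] D_nat[OF f g u v e] t(1)])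
   then show "ev (rgt g \<star> kk f g u v) n c w = ev (v \<star> rgt f) n c w"
    using ev_Cmp[OF k rgt_Hom[OF g] c w] ev_Cmp[OF rgt_Hom[OF f] v c w] ev_kk[OF f g u v e t(1)] ev_rgt[OF f t(1)]
     ev_rgt[OF g] evt_mp[OF f g u v e D_good[OF f] t(1)] t(2) by simp
  qed
  ultimately show "kk f g u v \<in> Hom ch (Cod ch (lft f)) (Cod ch (lft g)) &
     kk f g u v \<star> lft f = lft g \<star> u & rgt g \<star> kk f g u v = v \<star> rgt f"
   using k HomD[OF lft_Hom[OF f]] HomD[OF lft_Hom[OF g]] by simp
 qed
 moreover have "(\<forall>f \<in> Arr ch. kk f f (Idn ch (Dom ch f)) (Idn ch (Cod ch f)) = Idn ch (Cod ch (lft f)))"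
 proof
  fix f assume "f \<in> Arr ch"
  then have f: "f \<in> Hom ch (Dom ch f) (Cod ch f)" by (rule H)
  note O = Hom_ObjD[OF f]
  have i: "Idn ch (Dom ch f) \<in> Hom ch (Dom ch f) (Dom ch f)" "Idn ch (Cod ch f) \<in> Hom ch (Cod ch f) (Cod ch f)" using O by auto
  have e: "f \<star> Idn ch (Dom ch f) = Idn ch (Cod ch f) \<star> f"
   using ch.Cmp_Idn_left[OF f] ch.Cmp_Idn_right[OF f] by simp
  have M: "mid f \<in> Obj ch" using Hom_ObjD[OF rgt_Hom[OF f]] by simp
  have "kk f f (Idn ch (Dom ch f)) (Idn ch (Cod ch f)) = Idn ch (mid f)"
  proof (rule arr_eqI[OF kk_Hom[OF f f i e] Idn_in_Hom_ch[OF M]])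
   fix n c w assume c: "c \<in> Obj C" and w: "w \<in> K (mid f) n c"
   obtain t where t: "ok1 (Dom ch f) (Df f) t n c" "w = emb (A f) n c t" using mid_elem[OF f w] by blast
   show "ev (kk f f (Idn ch (Dom ch f)) (Idn ch (Cod ch f))) n c w = ev (Idn ch (mid f)) n c w"
    using ev_kk[OF f f i e t(1)] mp_id[OF conjunct1[OF O] conjunct2[OF O] ok_good[OF D_good[OF f] t(1)]] t(2) c w by simp
  qed
  then show "kk f f (Idn ch (Dom ch f)) (Idn ch (Cod ch f)) = Idn ch (Cod ch (lft f))"
   using HomD[OF lft_Hom[OF f]] by simp
 qed
 moreover have "(\<forall>f g h u v u' v'. square ch f g u v & square ch g h u' v' -->
     kk f h (u' \<star> u) (v' \<star> v) = kk g h u' v' \<star> kk f g u v)"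
 proof (intro allI impI, elim conjE)
  fix f g h u v u' v' assume s1: "square ch f g u v" and s2: "square ch g h u' v'"
  have f: "f \<in> Hom ch (Dom ch f) (Cod ch f)" and g: "g \<in> Hom ch (Dom ch g) (Cod ch g)" and h: "h \<in> Hom ch (Dom ch h) (Cod ch h)"
   and u: "u \<in> Hom ch (Dom ch f) (Dom ch g)" and v: "v \<in> Hom ch (Cod ch f) (Cod ch g)" and e: "g \<star> u = v \<star> f"
   and u': "u' \<in> Hom ch (Dom ch g) (Dom ch h)" and v': "v' \<in> Hom ch (Cod ch g) (Cod ch h)" and e': "h \<star> u' = v' \<star> g"
   using s1 s2 H by (auto simp: square_def)
  note uu = Cmp_in_Hom_ch[OF u u'] and vv = Cmp_in_Hom_ch[OF v v']
  have ee: "h \<star> (u' \<star> u) = (v' \<star> v) \<star> f"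
   using ch.Cmp_assoc[OF u u' h] ch.Cmp_assoc[OF u g v'] ch.Cmp_assoc[OF f v v'] e e' by simp
  note k1 = kk_Hom[OF f g u v e] and k2 = kk_Hom[OF g h u' v' e']
  show "kk f h (u' \<star> u) (v' \<star> v) = kk g h u' v' \<star> kk f g u v"
  proof (rule arr_eqI[OF kk_Hom[OF f h uu vv ee] Cmp_in_Hom_ch[OF k1 k2]])
   fix n c w assume c: "c \<in> Obj C" and w: "w \<in> K (mid f) n c"
   obtain t where t: "ok1 (Dom ch f) (Df f) t n c" "w = emb (A f) n c t" using mid_elem[OF f w] by blast
   have o: "ok1 (Dom ch g) (Df g) (mp (ev u) (ev v) t) n c"
    by (rule ok_mp[OF hm_ev[OF u] D_nat[OF f g u v e] t(1)])
   show "ev (kk f h (u' \<star> u) (v' \<star> v)) n c w = ev (kk g h u' v' \<star> kk f g u v) n c w"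
    using ev_kk[OF f h uu vv ee t(1)] ev_Cmp[OF k1 k2 c w] ev_kk[OF f g u v e t(1)] ev_kk[OF g h u' v' e' o]
     mp_comp[OF u v u' v' ok_good[OF D_good[OF f] t(1)]] t(2) by simp
  qed
 qed
 ultimately show ?thesis unfolding functorial_factorization_def by blast
qed

end

context psh_setup begin

subsection \<open>Acyclic cofibrations\<close>

text \<open>One disk for each section of the target. No relation is imposed for these cells, so the
  boundary of a cell is free and each cell generates a disk; the boundary term \<open>Zr\<close> is
  a placeholder and does not make the cell a cycle.\<close>

definition disk_cells :: "('o, 'a, 'r, 'u) psh_cplx_arr => (unit, 'o, 'a, 'r, 'u) tm set" where
 "disk_cells f = {Cl n c Zr y | n c y. c \<in> S & y \<in> K (Cod ch f) (n + 1) c}"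

sublocale J: fac C \<mu> R S disk_cells "\<lambda>n c t s. False"
proof
 fix f X Y assume f: "f \<in> Hom ch X Y"
 have XY: "Cod ch f = Y" using f by (auto simp: Hom_def)
 have Y: "Y \<in> Obj ch" using Hom_ObjD[OF f] by simp
 have "disk_cells f = (\<Union>n::int. \<Union>c\<in>S. (\<lambda>y. Cl n c Zr y) ` K Y (n + 1) c)" by (auto simp: disk_cells_def XY)
 moreover have "small \<mu> \<dots>"
  using S_Obj by (intro small_UN[OF U] small_UN[OF U S_small] small_image[OF U] small_K[OF Y]) (auto intro: small_countable[OF U])
 ultimately show "small \<mu> (disk_cells f)" by simp
 show "e \<in> disk_cells f ==> good X Y e" for e using S_Obj XY by (auto simp: disk_cells_def)
next
 fix f X Y g X' Y' u v e assume f: "f \<in> Hom ch X Y" and g: "g \<in> Hom ch X' Y'" and v: "v \<in> Hom ch Y Y'" and e: "e \<in> disk_cells f"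
 have XY: "Cod ch f = Y" "Cod ch g = Y'" using f g by (auto simp: Hom_def)
 obtain n c y where "e = Cl n c Zr y" "c \<in> S" "y \<in> K Y (n + 1) c" using e by (auto simp: disk_cells_def XY)
 moreover then have "ev v (n + 1) c y \<in> K Y' (n + 1) c" using ev_closed[OF v] S_Obj by blast
 ultimately show "mp (ev u) (ev v) e \<in> disk_cells g" by (simp add: disk_cells_def XY)
qed auto

lemma J_rgt: assumes fA: "f \<in> Arr ch" shows "J.rgt f \<in> \<F>"
proof -
 let ?X = "Dom ch f" and ?Y = "Cod ch f"
 have f: "f \<in> Hom ch ?X ?Y" using fA by (rule Hom_ch_Arr)
 interpret P: pres C \<mu> R S "{()}" "\<lambda>_. ?X" "disk_cells f" "\<lambda>n c t s. False" by (rule J.pres_fac[OF f])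
 have "\<exists>x\<in>K (J.mid f) n s. ev (J.rgt f) n s x = y" if s: "s \<in> S" and y: "y \<in> K ?Y n s" for n s y
 proof -
  \<comment> \<open>Cells lie one degree above their index, so this one is in degree
    \<open>n\<close>; it is sent to its label \<open>y\<close>.\<close>
  let ?e = "Cl (n - 1) s Zr y"
  have "P.okk ?e n s" using s y S_Obj by (auto simp: disk_cells_def)
  then show ?thesis using J.ev_rgt[OF f, of ?e n s] P.em_in_K' unfolding J.mid_def by force
 qed
 then show ?thesis unfolding levelwise_iff[OF J.rgt_Hom[OF f]] using surj_transfer[OF J.rgt_Hom[OF f]] by blast
qed

text \<open>The middle object is the source with disks freely added, so a lift amounts to an
  independent choice of a preimage for every cell.\<close>

lemma J_lft: assumes fA: "f \<in> Arr ch" shows "J.lft f \<in> llp ch \<F>"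
proof -
 let ?X = "Dom ch f" and ?Y = "Cod ch f"
 have f: "f \<in> Hom ch ?X ?Y" using fA by (rule Hom_ch_Arr)
 interpret P: pres C \<mu> R S "{()}" "\<lambda>_. ?X" "disk_cells f" "\<lambda>n c t s. False" by (rule J.pres_fac[OF f])
 note lH = J.lft_Hom[OF f]
 have mid: "J.mid f = P.obj" by (simp add: J.mid_def)
 have "has_lifts ch (J.lft f) p" if pF: "p \<in> \<F>" for p
 proof -
  have pA: "p \<in> Arr ch" using pF Arr_levelwise by blast
  let ?Q = "Dom ch p" and ?B = "Cod ch p"
  have p: "p \<in> Hom ch ?Q ?B" using pA by (rule Hom_ch_Arr)
  have surj: "\<exists>x\<in>K ?Q n c. ev p n c x = y" if "c \<in> Obj C" "y \<in> K ?B n c" for n c y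
   using pF that unfolding levelwise_iff[OF p] by blast
  show ?thesis
  proof (rule ch.has_liftsI[OF lH p])
   fix a b assume a: "a \<in> Hom ch ?X ?Q" and b: "b \<in> Hom ch (J.mid f) ?B" and e: "p \<star> a = b \<star> J.lft f"
   \<comment> \<open>On a cell, the value is some preimage under \<open>p\<close> of the section
     that \<open>b\<close> prescribes.\<close>
   define \<kappa> where "\<kappa> n c t = (case t of Gn j m d x => ev a n c x
    | _ => (SOME x. x \<in> K ?Q n c & ev p n c x = ev b n c (P.em n c t)))" for n c and t :: "(unit, 'o, 'a, 'r, 'u) tm"
   have \<kappa>cl: "\<kappa> (n + 1) c (Cl n c t y) \<in> K ?Q (n + 1) c & ev p (n + 1) c (\<kappa> (n + 1) c (Cl n c t y)) = ev b (n + 1) c (P.em (n + 1) c (Cl n c t y))"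
    if "Cl n c t y \<in> disk_cells f" "c \<in> Obj C" for n c t y
   proof -
    have "P.em (n + 1) c (Cl n c t y) \<in> K P.obj (n + 1) c" using that by (intro P.em_in_K') simp
    then have "ev b (n + 1) c (P.em (n + 1) c (Cl n c t y)) \<in> K ?B (n + 1) c" using ev_closed[OF b that(2)] mid by simp
    from surj[OF that(2) this] show ?thesis unfolding \<kappa>_def by simp (rule someI_ex, blast)
   qed
   have M: "P.model ?Q \<kappa>"
    unfolding P.model_def using \<kappa>cl hm_ev[OF a] Hom_ObjD[OF a] by (auto simp: \<kappa>_def)
   note h = P.ind_map[OF M]
   have hH: "P.ind ?Q \<kappa> \<in> Hom ch (J.mid f) ?Q" using h(1) mid by simp
   have "P.ind ?Q \<kappa> \<star> J.lft f = a"
   proof (rule arr_eqI[OF Cmp_in_Hom_ch[OF lH hH] a])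
    fix n c x assume c: "c \<in> Obj C" and x: "x \<in> K ?X n c"
    show "ev (P.ind ?Q \<kappa> \<star> J.lft f) n c x = ev a n c x"
     using ev_Cmp[OF lH hH c x] J.ev_lft[OF f c x] h(2)[of "Gn () n c x" n c] c x by (simp add: \<kappa>_def)
   qed
   moreover have "p \<star> P.ind ?Q \<kappa> = b"
   proof (rule P.hom_eq_on_leaves)
    show "p \<star> P.ind ?Q \<kappa> \<in> Hom ch P.obj ?B" using Cmp_in_Hom_ch[OF h(1) p] .
    show "b \<in> Hom ch P.obj ?B" using b mid by simp
    fix n c t y assume m: "Cl n c t y \<in> disk_cells f" and c: "c \<in> Obj C"
    then have k: "P.okk (Cl n c t y) (n + 1) c" by simp
    show "ev (p \<star> P.ind ?Q \<kappa>) (n + 1) c (P.em (n + 1) c (Cl n c t y)) = ev b (n + 1) c (P.em (n + 1) c (Cl n c t y))"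
     using ev_Cmp[OF h(1) p c P.em_in_K'[OF k]] h(2)[OF k] \<kappa>cl[OF m c] by simp
   next
    fix j n c x assume c: "c \<in> Obj C" and x: "x \<in> K ?X n c"
    then have k: "P.okk (Gn j n c x) n c" by simp
    have "ev p n c (ev a n c x) = ev b n c (P.em n c (Gn () n c x))"
     using ev_Cmp[OF a p c x] ev_Cmp[OF lH b c x] J.ev_lft[OF f c x] e by simp
    then show "ev (p \<star> P.ind ?Q \<kappa>) n c (P.em n c (Gn j n c x)) = ev b n c (P.em n c (Gn j n c x))"
     using ev_Cmp[OF h(1) p c P.em_in_K'[OF k]] h(2)[OF k] by (simp add: \<kappa>_def)
   qed
   ultimately show "\<exists>h\<in>Hom ch (J.mid f) ?Q. h \<star> J.lft f = a & p \<star> h = b" using hH by blast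
  qed
 qed
 then show ?thesis using lH by (auto simp: llp_def Hom_def)
qed

end

section \<open>Attaching cells one at a time\<close>

context pres begin

text \<open>Evaluation with values read off from an arrow reproduces the arrow; this compares a term
  with its value at a stage of a sequence.\<close>

lemma evt_hom:
 assumes h: "h \<in> Hom ch obj Q"
  and gn: "!!j n c x. j \<in> Jo ==> c \<in> Obj C ==> x \<in> K (X j) n c ==> \<kappa> n c (Gn j n c x) = ev h n c (em n c (Gn j n c x))"
  and cl: "!!n c t y. Cl n c t y \<in> D ==> c \<in> Obj C ==> \<kappa> (n + 1) c (Cl n c t y) = ev h (n + 1) c (em (n + 1) c (Cl n c t y))"
 shows "okk t n c ==> evt Q \<kappa> t n c = ev h n c (em n c t)"
proof (induction t arbitrary: n c)
 case (Gn j m d x) then show ?case using gn by auto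
next
 case (Cl m d t y) then show ?case using cl by auto
next
 case Zr then show ?case using ev_zr[OF h] by (simp add: obj_ops_em)
next
 case (Ad s t)
 then show ?case using ev_pl[OF h ok_Obj[OF Ad.prems] em_in_K' em_in_K'] by (simp add: obj_ops_em)
next
 case (Ng t)
 then show ?case using ev_ng[OF h ok_Obj[OF Ng.prems] em_in_K'] by (simp add: obj_ops_em)
next
 case (Sm a t)
 then show ?case using ev_sm[OF h ok_Obj[OF Sm.prems] _ em_in_K'] by (simp add: obj_ops_em)
next
 case (Rs f t)
 then have f: "f \<in> Arr C" "Dom C f = c" "okk t n (Cod C f)" by auto
 then show ?case using ev_rs[OF h f(1) em_in_K'[OF f(3)]] obj_ops_em(5)[OF f(1,3)] Rs.IH[OF f(3)] by simp
next
 case (Bd t)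
 then have o: "okk t (n + 1) c" by simp
 show ?case using ev_bd[OF h ok_Obj[OF o] em_in_K'[OF o]] obj_ops_em(6)[OF o] Bd.IH[OF o] by simp
qed

end

text \<open>The lexicographic order by rank and then by \<open>w\<close>. It serves to sort cells by
  the round in which they appear, and to move one extra element to the end.\<close>

lemma Well_order_by_rank:
 fixes q :: "'b => 'c::wellorder"
 assumes w: "Well_order w"
 defines "r \<equiv> {(a, b). a \<in> Field w & b \<in> Field w & (q a < q b \<or> q a = q b & (a, b) \<in> w)}"
 shows "Well_order r" "Field r = Field w"
proof -
 note f = Well_order_facts[OF w]
 show F: "Field r = Field w" 
 proof (rule Set.set_eqI)
  fix a show "a \<in> Field r \<longleftrightarrow> a \<in> Field w" using f(1)[of a] unfolding r_def Field_def by blast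
 qed
 have "r - Id \<subseteq> inv_image ({(x, y). x < y} <*lex*> (w - Id)) (\<lambda>a. (q a, a))" by (auto simp: r_def)
 moreover have "wf (inv_image ({(x :: 'c, y). x < y} <*lex*> (w - Id)) (\<lambda>a. (q a, a)))"
  by (intro wf_inv_image wf_lex_prod wf f(5))
 ultimately have "wf (r - Id)" using wf_subset by blast
 moreover have "refl_on (Field r) r" unfolding F by (rule refl_onI) (auto simp: r_def intro: f(1))
 moreover have "trans r"
 proof (rule transI)
  fix a b c assume "(a, b) \<in> r" "(b, c) \<in> r"
  then show "(a, c) \<in> r" using f(2)[of a b c] by (auto simp: r_def)
 qed
 moreover have "antisym r"
 proof (rule antisymI)
  fix a b assume "(a, b) \<in> r" "(b, a) \<in> r"
  then show "a = b" using f(3)[of a b] by (auto simp: r_def)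
 qed
 moreover have "total_on (Field r) r" unfolding F
 proof (rule total_onI)
  fix a b assume "a \<in> Field w" "b \<in> Field w"
  then show "(a, b) \<in> r \<or> (b, a) \<in> r" using f(4)[of a b] linorder_less_linear[of "q a" "q b"] by (auto simp: r_def)
 qed
 moreover have "r \<subseteq> Field r \<times> Field r" by (auto simp: Field_def)
 ultimately show "Well_order r" unfolding order_on_defs by blast
qed

lemma Well_order_least:
 assumes r: "Well_order r" and "Field r \<noteq> {}" shows "\<exists>b. is_least r b"
proof -
 obtain b where b: "b \<in> Field r" "!!y. (y, b) \<in> r - Id ==> y \<notin> Field r"
  using Well_order_facts(5)[OF r] assms(2) unfolding wf_eq_minimal by (metis ex_in_conv)
 then have "underS r b = {}" unfolding underS_def Field_def by blast
 then show ?thesis using b(1) unfolding is_least_def by blast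
qed

context psh_setup begin

text \<open>Makes the term stored in a cell its actual boundary. The rule \<open>te_ext\<close>
  applies to well-typed terms, so the relation takes effect only for cells that are present.\<close>

definition CE :: "int => 'o => (unit, 'o, 'a, 'r, 'u) tm => (unit, 'o, 'a, 'r, 'u) tm => bool" where
 "CE n c t s \<longleftrightarrow> (\<exists>y. t = Bd (Cl n c s y))"

abbreviation psc where "psc X D \<equiv> psd1 X D CE"
abbreviation pe :: "('o, 'a, 'r, 'u) psh_cplx => (unit, 'o, 'a, 'r, 'u) tm set => int => 'o => (unit, 'o, 'a, 'r, 'u) tm => 'u" where
 "pe X D \<equiv> emb (psc X D)"
definition Po :: "('o, 'a, 'r, 'u) psh_cplx => (unit, 'o, 'a, 'r, 'u) tm set => ('o, 'a, 'r, 'u) psh_cplx" where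
 "Po X D = ob C (psc X D)"
definition inc :: "('o, 'a, 'r, 'u) psh_cplx => (unit, 'o, 'a, 'r, 'u) tm set => (unit, 'o, 'a, 'r, 'u) tm set => ('o, 'a, 'r, 'u) psh_cplx_arr" where
 "inc X D D' = mk (Po X D) (Po X D') (\<lambda>n c w. pe X D' n c (rp (psc X D) n c w))"

lemma inc_map:
 assumes D: "pres C \<mu> R S {()} (\<lambda>_. X) D" and D': "pres C \<mu> R S {()} (\<lambda>_. X) D'" and sub: "D \<subseteq> D'"
 shows "inc X D D' \<in> Hom ch (Po X D) (Po X D')"
  and "!!n c t. ok1 X D t n c ==> ev (inc X D D') n c (pe X D n c t) = pe X D' n c t"
proof -
 interpret P: pres C \<mu> R S "{()}" "\<lambda>_. X" D CE by (rule D)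
 interpret Q: pres C \<mu> R S "{()}" "\<lambda>_. X" D' CE by (rule D')
 have o: "Q.okk t n c" if "P.okk t n c" for t n c by (rule ok_mono[OF that sub])
 have e: "Q.te n c t s" if "P.te n c t s" for t s n c by (rule teq_mono[OF that sub])
 have k: "inc X D D' = P.out Q.obj (\<lambda>n c t. Q.em n c t)" by (simp add: inc_def P.out_def Po_def)
 show "inc X D D' \<in> Hom ch (Po X D) (Po X D')" unfolding k Po_def
  by (rule P.out_map(1)[OF Q.obj_in_Obj]) (auto simp: P.EQ_psd P.te_iff Q.em_teq[OF e] o Q.obj_ops_em)
 show "ev (inc X D D') n c (pe X D n c t) = pe X D' n c t" if t: "ok1 X D t n c" for n c t
  unfolding k
  by (rule P.out_map(2)[OF Q.obj_in_Obj])
   (use t ok_Obj[OF t] in \<open>auto simp: P.EQ_psd P.te_iff Q.em_teq[OF e] o Q.obj_ops_em\<close>)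
qed

end

text \<open>Attaching the cells in \<open>D\<close> one at a time, in the order \<open>r\<close>; the last element \<open>tp\<close> is not a cell.\<close>

locale cell_seq = psh_setup C \<mu> R S for C :: "('o, 'a) cat" (structure) and \<mu> :: "'u rel"
  and R :: "('o, 'a, 'r) rpsh" and S :: "'o set" +
 fixes X :: "('o, 'a, 'r, 'u) psh_cplx" and D :: "(unit, 'o, 'a, 'r, 'u) tm set" and r :: "'u rel" and tp :: 'u
  and \<phi> :: "(unit, 'o, 'a, 'r, 'u) tm => 'u"
 assumes X: "X \<in> Obj ch" and wo: "Well_order r" and r_small: "small \<mu> (Field r)"
  and tp: "tp \<in> Field r" and tp_max: "!!i. i \<in> Field r ==> (i, tp) \<in> r"
  and \<phi>: "bij_betw \<phi> D (Field r - {tp})"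
  and cell: "!!e. e \<in> D ==> \<exists>n c t y. e = Cl n c t y & c \<in> S & ok1 X {e' \<in> D. \<phi> e' \<in> underS r (\<phi> e)} t n c &
   teq1 X {e' \<in> D. \<phi> e' \<in> underS r (\<phi> e)} CE (n - 1) c (Bd t) Zr"
begin

text \<open>Stage \<open>j\<close> has the cells strictly before \<open>j\<close>: the cell indexed
  by \<open>i\<close> appears in the step from \<open>i\<close> to its successor, and the stage
  \<open>tp\<close> has all cells.\<close>

definition Dn where "Dn j = {e \<in> D. \<phi> e \<in> underS r j}"
abbreviation F where "F j \<equiv> Po X (Dn j)"
abbreviation inj where "inj i j \<equiv> inc X (Dn i) (Dn j)"
abbreviation Fa where "Fa \<equiv> \<lambda>u. inj (fst u) (snd u)"

lemmas wof = Well_order_facts[OF wo]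

lemma D_small: "small \<mu> D"
 by (rule small_inj_on[OF U bij_betw_imp_inj_on[OF \<phi>] _ r_small]) (use \<phi> in \<open>auto simp: bij_betw_def\<close>)

lemma pr: "pres C \<mu> R S {()} (\<lambda>_. X) (Dn j)"
 by unfold_locales (auto simp: X small_finite[OF U] Dn_def intro: small_mono[OF U D_small])

lemma Dn_mono: "(i, j) \<in> r ==> Dn i \<subseteq> Dn j"
 unfolding Dn_def underS_def using wof(2,3) by blast

lemma Dn_tp: "Dn tp = D"
proof -
 have "\<phi> e \<in> Field r & \<phi> e \<noteq> tp" if "e \<in> D" for e using bij_betwE[OF \<phi>] that by auto
 then show ?thesis unfolding Dn_def underS_def using tp_max by auto
qed

lemma F_Obj: "F j \<in> Obj ch"
proof -
 interpret P: pres C \<mu> R S "{()}" "\<lambda>_. X" "Dn j" CE by (rule pr)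
 show ?thesis unfolding Po_def by (rule P.obj_in_Obj)
qed

lemma inj_Hom: "(i, j) \<in> r ==> inj i j \<in> Hom ch (F i) (F j)"
 using inc_map(1)[OF pr pr Dn_mono] .

lemma ev_inj: "(i, j) \<in> r ==> ok1 X (Dn i) t n c ==> ev (inj i j) n c (pe X (Dn i) n c t) = pe X (Dn j) n c t"
 using inc_map(2)[OF pr pr Dn_mono] .

lemma pe_in_K: "ok1 X (Dn i) t n c ==> pe X (Dn i) n c t \<in> K (F i) n c"
proof -
 interpret P: pres C \<mu> R S "{()}" "\<lambda>_. X" "Dn i" CE by (rule pr)
 show "ok1 X (Dn i) t n c ==> ?thesis" unfolding Po_def by (rule P.em_in_K')
qed

lemma F_elem: "w \<in> K (F i) n c ==> \<exists>t. ok1 X (Dn i) t n c & w = pe X (Dn i) n c t"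
proof -
 interpret P: pres C \<mu> R S "{()}" "\<lambda>_. X" "Dn i" CE by (rule pr)
 show "w \<in> K (F i) n c ==> ?thesis" unfolding Po_def by (rule P.K_obj_ok)
qed

lemma inj_comp: assumes ij: "(i, j) \<in> r" and jk: "(j, k) \<in> r" shows "inj j k \<star> inj i j = inj i k"
proof (rule arr_eqI[OF Cmp_in_Hom_ch[OF inj_Hom[OF ij] inj_Hom[OF jk]] inj_Hom[OF wof(2)[OF ij jk]]])
 fix n c w assume c: "c \<in> Obj C" and w: "w \<in> K (F i) n c"
 obtain t where t: "ok1 X (Dn i) t n c" "w = pe X (Dn i) n c t" using F_elem[OF w] by blast
 show "ev (inj j k \<star> inj i j) n c w = ev (inj i k) n c w"
  using ev_Cmp[OF inj_Hom[OF ij] inj_Hom[OF jk] c w] ev_inj[OF ij t(1)] ev_inj[OF jk ok_mono[OF t(1) Dn_mono[OF ij]]]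
   ev_inj[OF wof(2)[OF ij jk] t(1)] t(2) by simp
qed

lemma inj_id: assumes i: "i \<in> Field r" shows "inj i i = Idn ch (F i)"
proof (rule arr_eqI[OF inj_Hom[OF wof(1)[OF i]] Idn_in_Hom_ch[OF F_Obj]])
 fix n c w assume c: "c \<in> Obj C" and w: "w \<in> K (F i) n c"
 obtain t where t: "ok1 X (Dn i) t n c" "w = pe X (Dn i) n c t" using F_elem[OF w] by blast
 show "ev (inj i i) n c w = ev (Idn ch (F i)) n c w" using ev_inj[OF wof(1)[OF i] t(1)] t(2) c w by simp
qed

lemma diag: "diagram (ord_cat r) ch F Fa"
 unfolding diagram_def
proof (intro conjI ballI impI)
 fix u assume "u \<in> Arr (ord_cat r)"
 then show "Fa u \<in> Hom ch (F (Dom (ord_cat r) u)) (F (Cod (ord_cat r) u))" using inj_Hom[of "fst u" "snd u"] by simp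
next
 fix u v assume "u \<in> Arr (ord_cat r)" "v \<in> Arr (ord_cat r)" "Dom (ord_cat r) v = Cod (ord_cat r) u"
 then have "(fst u, snd u) \<in> r" "(snd u, snd v) \<in> r" "fst v = snd u" by (auto simp: prod_eq_iff) (metis prod.collapse)
 then show "Fa (v \<cdot>\<^bsub>ord_cat r\<^esub> u) = Fa v \<star> Fa u" using inj_comp[of "fst u" "snd u" "snd v"] by simp
qed (auto simp: F_Obj inj_id)

lemma cellD:
 assumes "Cl n c t y \<in> Dn j" "(j, k) \<in> r \<or> k = j"
 shows "c \<in> S" "c \<in> Obj C" "ok1 X (Dn k) t n c" "ok1 X (Dn k) (Cl n c t y) (n + 1) c"
  and "pe X (Dn k) n c t = bd (F k) (n + 1) c (pe X (Dn k) (n + 1) c (Cl n c t y))"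
proof -
 interpret P: pres C \<mu> R S "{()}" "\<lambda>_. X" "Dn k" CE by (rule pr)
 have e: "Cl n c t y \<in> Dn k" using assms Dn_mono[of j k] by blast
 then have k: "\<phi> (Cl n c t y) \<in> underS r k" and "Cl n c t y \<in> D" by (auto simp: Dn_def)
 then have 1: "c \<in> S" "ok1 X (Dn (\<phi> (Cl n c t y))) t n c" using cell unfolding Dn_def by blast+
 then show c: "c \<in> S" "c \<in> Obj C" using S_Obj by auto
 have "Dn (\<phi> (Cl n c t y)) \<subseteq> Dn k" using k by (intro Dn_mono) (simp add: underS_def)
 then show t: "P.okk t n c" using 1 ok_mono by blast
 show o: "P.okk (Cl n c t y) (n + 1) c" using e c by simp
 have "P.te n c (Bd (Cl n c t y)) t" by (rule te_ext) (use t o in \<open>auto simp: CE_def\<close>)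
 then show "pe X (Dn k) n c t = bd (F k) (n + 1) c (pe X (Dn k) (n + 1) c (Cl n c t y))"
  unfolding Po_def using P.em_teq[of n c "Bd (Cl n c t y)" t] P.obj_ops_em(6)[OF o] by simp
qed

text \<open>A cell present at a limit stage is present at an earlier one, so a compatible family of
  maps prescribes values for all generators and cells, and each relation between them can be checked
  at an earlier stage.\<close>

lemma limit_stage:
 assumes lim: "is_limit_elem r j"
 shows "colimit_cocone (ord_cat (Restr r (underS r j))) ch F Fa (F j) (\<lambda>i. Fa (i, j))"
proof -
 let ?J = "underS r j" and ?r = "Restr r (underS r j)"
 have Fi: "Field ?r = ?J" by (rule Field_Restr_underS[OF wo])
 have jF: "j \<in> Field r" using lim by (simp add: is_limit_elem_def)
 have J: "(i, j) \<in> r" if "i \<in> ?J" for i using that by (simp add: underS_def)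
 have JF: "i \<in> Field r" if "i \<in> ?J" for i using J[OF that] by (auto simp: Field_def)
 \<comment> \<open>Otherwise the index of \<open>e\<close> would be the largest element below
   \<open>j\<close>, making \<open>j\<close> a successor.\<close>
 have cellJ: "\<exists>i\<in>?J. e \<in> Dn i" if "e \<in> Dn j" for e
 proof (rule ccontr)
  assume n: "\<not> ?thesis"
  have e: "\<phi> e \<in> ?J" "e \<in> D" using that by (auto simp: Dn_def)
  have "(k, \<phi> e) \<in> r" if k: "k \<in> ?J" for k
   using n k e wof(4)[OF JF[OF k] JF[OF e(1)]] wof(1)[OF JF[OF k]] unfolding Dn_def by (auto simp: underS_def)
  then have "is_succ r (\<phi> e) j" using e(1) by (simp add: is_succ_def)
  then show False using lim by (auto simp: is_limit_elem_def)
 qed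
 obtain b where b: "b \<in> ?J" using lim by (auto simp: is_limit_elem_def)
 interpret P: pres C \<mu> R S "{()}" "\<lambda>_. X" "Dn j" CE by (rule pr)
 have FP: "F j = P.obj" by (simp add: Po_def)
 have "\<exists>!h. h \<in> Hom ch (F j) L' & (\<forall>i\<in>Obj (ord_cat ?r). h \<star> Fa (i, j) = \<iota>' i)"
  if cc: "cocone (ord_cat ?r) ch F Fa L' \<iota>'" for L' \<iota>'
 proof -
  have iH: "\<iota>' i \<in> Hom ch (F i) L'" if "i \<in> ?J" for i using cc that by (simp add: cocone_def Fi)
  have ic: "\<iota>' k \<star> inj i k = \<iota>' i" if "i \<in> ?J" "k \<in> ?J" "(i, k) \<in> r" for i k
  proof -
   have "\<forall>u\<in>?r. \<iota>' (snd u) \<star> Fa u = \<iota>' (fst u)" using cc by (simp add: cocone_def)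
   from bspec[OF this, of "(i, k)"] show ?thesis using that by simp
  qed
  have L: "L' \<in> Obj ch" using cc by (simp add: cocone_def)
  have v1: "ev (\<iota>' k) n c (pe X (Dn k) n c t) = ev (\<iota>' i) n c (pe X (Dn i) n c t)"
   if "i \<in> ?J" "k \<in> ?J" "(i, k) \<in> r" "ok1 X (Dn i) t n c" for i k n c t
   using ic[OF that(1-3)] ev_Cmp[OF inj_Hom[OF that(3)] iH[OF that(2)] ok_Obj[OF that(4)] pe_in_K[OF that(4)]] ev_inj[OF that(3,4)] by simp
  have v2: "ev (\<iota>' k) n c (pe X (Dn k) n c t) = ev (\<iota>' i) n c (pe X (Dn i) n c t)"
   if "i \<in> ?J" "k \<in> ?J" "ok1 X (Dn i) t n c" "ok1 X (Dn k) t n c" for i k n c t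
   using wof(4)[OF JF[OF that(1)] JF[OF that(2)]] v1[of i k] v1[of k i] that by metis
  \<comment> \<open>Any earlier stage at which the term is well-typed gives the same value.\<close>
  define \<kappa> where "\<kappa> n c t = (let i = SOME i. i \<in> ?J & ok1 X (Dn i) t n c in ev (\<iota>' i) n c (pe X (Dn i) n c t))" for n c t
  have \<kappa>: "\<kappa> n c t = ev (\<iota>' i) n c (pe X (Dn i) n c t)" if "i \<in> ?J" "ok1 X (Dn i) t n c" for i n c t
  proof -
   have "(SOME i. i \<in> ?J & ok1 X (Dn i) t n c) \<in> ?J & ok1 X (Dn (SOME i. i \<in> ?J & ok1 X (Dn i) t n c)) t n c"
    by (rule someI[of "\<lambda>i. i \<in> ?J & ok1 X (Dn i) t n c" i]) (use that in simp)
   then show ?thesis unfolding \<kappa>_def Let_def using v2 that by blast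
  qed
  have eh: "evt L' \<kappa> t n c = ev (\<iota>' i) n c (pe X (Dn i) n c t)" if i: "i \<in> ?J" and t: "ok1 X (Dn i) t n c" for i t n c
  proof -
   interpret I: pres C \<mu> R S "{()}" "\<lambda>_. X" "Dn i" CE by (rule pr)
   show ?thesis
    by (rule I.evt_hom[OF _ _ _ t]) (use iH[OF i] \<kappa>[OF i] in \<open>auto simp: Po_def\<close>)
  qed
  have M: "P.model L' \<kappa>"
   unfolding P.model_def
  proof (intro conjI ballI allI impI)
   interpret B: pres C \<mu> R S "{()}" "\<lambda>_. X" "Dn b" CE by (rule pr)
   have g: "B.inj_gn () \<in> Hom ch X (F b)" unfolding Po_def by (rule B.inj_gn_map(1)) simp
   show "hm X L' (\<lambda>n c x. \<kappa> n c (Gn u n c x))" for u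
   proof (rule hm_cong[OF X hm_ev[OF Cmp_in_Hom_ch[OF g iH[OF b]]]])
    show "\<kappa> n c (Gn u n c x) = ev (\<iota>' b \<star> B.inj_gn ()) n c x" if "c \<in> Obj C" "x \<in> K X n c" for n c x
     using ev_Cmp[OF g iH[OF b] that] B.inj_gn_map(2)[of "()", OF _ that] \<kappa>[OF b, of "Gn () n c x" n c] that by simp
   qed
  next
   fix m d t y assume e: "Cl m d t y \<in> Dn j" and d: "d \<in> Obj C"
   obtain i where i: "i \<in> ?J" "Cl m d t y \<in> Dn i" using cellJ[OF e] by blast
   note o = cellD(4)[OF i(2) disjI2[OF HOL.refl]]
   show "\<kappa> (m + 1) d (Cl m d t y) \<in> K L' (m + 1) d" unfolding \<kappa>[OF i(1) o] by (rule ev_closed[OF iH[OF i(1)] d pe_in_K[OF o]])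
  next
   fix n c t s assume "CE n c t s" "P.okk t n c"
   then obtain y where y: "t = Bd (Cl n c s y)" "Cl n c s y \<in> Dn j" by (auto simp: CE_def)
   obtain i where i: "i \<in> ?J" "Cl n c s y \<in> Dn i" using cellJ[OF y(2)] by blast
   note q = cellD[OF i(2) disjI2[OF HOL.refl]]
   show "evt L' \<kappa> t n c = evt L' \<kappa> s n c"
    unfolding eh[OF i(1) q(3)] y(1) evt.simps \<kappa>[OF i(1) q(4)] q(5)
    using ev_bd[OF iH[OF i(1)] q(2) pe_in_K[OF q(4)]] by simp
  qed (rule L)
  note h = P.ind_map[OF M]
  have hH: "P.ind L' \<kappa> \<in> Hom ch (F j) L'" using h(1) FP by simp
  have hi: "P.ind L' \<kappa> \<star> Fa (i, j) = \<iota>' i" if i: "i \<in> ?J" for i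
  proof (rule arr_eqI[OF _ iH[OF i]])
   note a = inj_Hom[OF J[OF i]]
   show "P.ind L' \<kappa> \<star> Fa (i, j) \<in> Hom ch (F i) L'" using Cmp_in_Hom_ch[OF a hH] by simp
   fix n c w assume c: "c \<in> Obj C" and w: "w \<in> K (F i) n c"
   obtain t where t: "ok1 X (Dn i) t n c" "w = pe X (Dn i) n c t" using F_elem[OF w] by blast
   show "ev (P.ind L' \<kappa> \<star> Fa (i, j)) n c w = ev (\<iota>' i) n c w"
    using ev_Cmp[OF a hH c w] ev_inj[OF J[OF i] t(1)] h(2)[OF ok_mono[OF t(1) Dn_mono[OF J[OF i]]]] eh[OF i t(1)] t(2) by simp
  qed
  show ?thesis
  proof (rule ex1I)
   show "P.ind L' \<kappa> \<in> Hom ch (F j) L' & (\<forall>i\<in>Obj (ord_cat ?r). P.ind L' \<kappa> \<star> Fa (i, j) = \<iota>' i)"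
    using hH hi Fi by simp
   fix k assume k: "k \<in> Hom ch (F j) L' & (\<forall>i\<in>Obj (ord_cat ?r). k \<star> Fa (i, j) = \<iota>' i)"
   then have kH: "k \<in> Hom ch (F j) L'" and ki: "!!i. i \<in> ?J ==> k \<star> inj i j = \<iota>' i" using Fi by auto
   have eq: "ev k n c (pe X (Dn j) n c t) = ev (P.ind L' \<kappa>) n c (pe X (Dn j) n c t)" if i: "i \<in> ?J" and t: "ok1 X (Dn i) t n c" for i t n c
    using ev_Cmp[OF inj_Hom[OF J[OF i]] kH ok_Obj[OF t] pe_in_K[OF t]] ev_Cmp[OF inj_Hom[OF J[OF i]] hH ok_Obj[OF t] pe_in_K[OF t]]
     ki[OF i] hi[OF i] ev_inj[OF J[OF i] t] by simp
   show "k = P.ind L' \<kappa>"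
   proof (rule P.hom_eq_on_leaves)
    show "k \<in> Hom ch P.obj L'" "P.ind L' \<kappa> \<in> Hom ch P.obj L'" using kH h(1) FP by simp_all
    show "ev k n c (P.em n c (Gn u n c x)) = ev (P.ind L' \<kappa>) n c (P.em n c (Gn u n c x))"
     if "c \<in> Obj C" "x \<in> K X n c" for u n c x
     by (rule eq[OF b]) (use that in simp)
    fix n c t y assume e: "Cl n c t y \<in> Dn j" "c \<in> Obj C"
    obtain i where i: "i \<in> ?J" "Cl n c t y \<in> Dn i" using cellJ[OF e(1)] by blast
    show "ev k (n + 1) c (P.em (n + 1) c (Cl n c t y)) = ev (P.ind L' \<kappa>) (n + 1) c (P.em (n + 1) c (Cl n c t y))"
     by (rule eq[OF i(1)]) (use i e in simp)
   qed
  qed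
 qed
 moreover have "cocone (ord_cat ?r) ch F Fa (F j) (\<lambda>i. Fa (i, j))"
  unfolding cocone_def using Fi F_Obj inj_Hom[OF J] inj_comp J by auto
 ultimately show ?thesis unfolding colimit_cocone_def by blast
qed

text \<open>Adding one cell is the pushout of \<open>gi c n\<close> along the map from the sphere
  that represents the boundary term of the cell.\<close>

lemma successor_stage:
 assumes su: "is_succ r i j" shows "inj i j \<in> pushouts_of ch \<I>"
proof -
 have ij: "(i, j) \<in> r" "i \<noteq> j" and below: "!!k. k \<in> underS r j ==> (k, i) \<in> r"
  using su by (auto simp: is_succ_def underS_def)
 have F: "i \<in> Field r" "j \<in> Field r" using ij by (auto simp: Field_def)
 have "i \<noteq> tp" using tp_max[OF F(2)] wof(3) ij by blast
 \<comment> \<open>Every index except the top belongs to exactly one cell; the one at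
   \<open>i\<close> is attached in this step.\<close>
 then obtain e where e: "e \<in> D" "\<phi> e = i" using \<phi> F by (auto simp: bij_betw_def image_iff) (metis DiffI imageE singletonD)
 obtain n c t y where ey: "e = Cl n c t y" and z: "c \<in> S" "ok1 X (Dn i) t n c" "teq1 X (Dn i) CE (n - 1) c (Bd t) Zr"
  using cell[OF e(1)] e(2) unfolding Dn_def by blast
 have c: "c \<in> Obj C" using z(1) S_Obj by blast
 have eDj: "Cl n c t y \<in> Dn j" using e ij ey by (simp add: Dn_def underS_def)
 have eDi: "Cl n c t y \<notin> Dn i" using e ey by (simp add: Dn_def underS_def)
 have Dj: "f = Cl n c t y \<or> f \<in> Dn i" if "f \<in> Dn j" for f
 proof -
  have "f \<in> D" "(\<phi> f, i) \<in> r" using that below by (auto simp: Dn_def)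
  then show ?thesis using e ey bij_betw_imp_inj_on[OF \<phi>] by (auto simp: Dn_def underS_def dest: inj_onD)
 qed
 interpret I: pres C \<mu> R S "{()}" "\<lambda>_. X" "Dn i" CE by (rule pr)
 interpret P: pres C \<mu> R S "{()}" "\<lambda>_. X" "Dn j" CE by (rule pr)
 have FP: "F j = P.obj" "F i = I.obj" by (simp_all add: Po_def)
 note q = inj_Hom[OF ij(1)]
 \<comment> \<open>The derivation that comes with the cell makes its boundary term a cycle at stage
   \<open>i\<close>, hence a map from the sphere.\<close>
 have cyc: "bd (F i) n c (pe X (Dn i) n c t) = zr (F i) (n - 1) c"
  using I.em_teq[OF z(3)] I.obj_ops_em(2)[OF c] I.obj_ops_em(6)[OF z(2)] FP by simp
 obtain u where u: "u \<in> Hom ch (Sp c n) (F i)" "ev u n c (\<eta> c) = pe X (Dn i) n c t"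
  using sphere_map[OF c F_Obj pe_in_K[OF z(2)] cyc] by blast
 note ce = cellD[OF eDj disjI2[OF HOL.refl]]
 obtain v where v: "v \<in> Hom ch (Dk c n) (F j)" "ev v (n + 1) c (\<eta> c) = pe X (Dn j) (n + 1) c (Cl n c t y)"
  using disk_map[OF c F_Obj pe_in_K[OF ce(4)]] by blast
 note g = gi_Hom[OF c, of n]
 have sq: "v \<star> gi c n = inj i j \<star> u"
  by (rule sphere_eq[OF c Cmp_in_Hom_ch[OF g v(1)] Cmp_in_Hom_ch[OF u(1) q]])
   (use ev_disk_gi[OF c v(1)] v(2) ev_Cmp[OF u(1) q c \<eta>_K(1)[OF c]] u(2) ev_inj[OF ij(1) z(2)] ce(5) in simp)
 have "\<exists>!h. h \<in> Hom ch (F j) Q & h \<star> v = v' & h \<star> inj i j = q'"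
  if v': "v' \<in> Hom ch (Dk c n) Q" and q': "q' \<in> Hom ch (F i) Q" and e': "v' \<star> gi c n = q' \<star> u" for v' q' Q
 proof -
  have Q: "Q \<in> Obj ch" using Hom_ObjD[OF q'] by simp
  \<comment> \<open>The new cell takes its value from the disk, everything else from
    \<open>q'\<close>; by \<open>eDi\<close> no old cell is affected by the exception.\<close>
  define \<kappa> where "\<kappa> m d s = (if s = Cl n c t y then ev v' (n + 1) c (\<eta> c) else ev q' m d (pe X (Dn i) m d s))" for m d s
  have eh: "evt Q \<kappa> s m d = ev q' m d (pe X (Dn i) m d s)" if "I.okk s m d" for s m d
   by (rule I.evt_hom[OF _ _ _ that]) (use q' FP eDi in \<open>auto simp: \<kappa>_def\<close>)
  have M: "P.model Q \<kappa>"
   unfolding P.model_def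
  proof (intro conjI ballI allI impI)
   have gn: "I.inj_gn () \<in> Hom ch X (F i)" unfolding FP by (rule I.inj_gn_map(1)) simp
   show "hm X Q (\<lambda>n c x. \<kappa> n c (Gn a n c x))" for a
   proof (rule hm_cong[OF X hm_ev[OF Cmp_in_Hom_ch[OF gn q']]])
    show "\<kappa> n c (Gn a n c x) = ev (q' \<star> I.inj_gn ()) n c x" if "c \<in> Obj C" "x \<in> K X n c" for n c x
     using ev_Cmp[OF gn q' that] I.inj_gn_map(2)[of "()", OF _ that] by (simp add: \<kappa>_def)
   qed
  next
   fix m d s x assume f: "Cl m d s x \<in> Dn j" and d: "d \<in> Obj C"
   show "\<kappa> (m + 1) d (Cl m d s x) \<in> K Q (m + 1) d"
    using Dj[OF f] ev_closed[OF v' c \<eta>_K(3)[OF c]] ev_closed[OF q' d pe_in_K, of "Cl m d s x" "m + 1"] d by (auto simp: \<kappa>_def)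
  next
   fix m d w s assume "CE m d w s" "P.okk w m d"
   then obtain x where x: "w = Bd (Cl m d s x)" "Cl m d s x \<in> Dn j" by (auto simp: CE_def)
   show "evt Q \<kappa> w m d = evt Q \<kappa> s m d"
   proof (cases "Cl m d s x = Cl n c t y")
    case True
    have "bd Q (n + 1) c (ev v' (n + 1) c (\<eta> c)) = ev q' n c (pe X (Dn i) n c t)"
     using ev_disk_gi[OF c v'] ev_Cmp[OF u(1) q' c \<eta>_K(1)[OF c]] u(2) e' by simp
    then show ?thesis using True x(1) eh[OF z(2)] by (simp add: \<kappa>_def)
   next
    case False
    then have "Cl m d s x \<in> Dn i" using Dj[OF x(2)] by blast
    note p = cellD[OF this disjI2[OF HOL.refl]]
    have "\<kappa> (m + 1) d (Cl m d s x) = ev q' (m + 1) d (pe X (Dn i) (m + 1) d (Cl m d s x))"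
     unfolding \<kappa>_def using False by (rule if_not_P)
    then show ?thesis unfolding eh[OF p(3)] p(5) x(1) using ev_bd[OF q' p(2) pe_in_K[OF p(4)]] by simp
   qed
  qed (rule Q)
  note h = P.ind_map[OF M]
  have hH: "P.ind Q \<kappa> \<in> Hom ch (F j) Q" using h(1) FP by simp
  have hv: "P.ind Q \<kappa> \<star> v = v'"
   by (rule disk_eq[OF c Cmp_in_Hom_ch[OF v(1) hH] v'])
    (use ev_Cmp[OF v(1) hH c \<eta>_K(3)[OF c]] v(2) h(2)[OF ce(4)] in \<open>simp add: \<kappa>_def\<close>)
  have hq: "P.ind Q \<kappa> \<star> inj i j = q'"
  proof (rule arr_eqI[OF Cmp_in_Hom_ch[OF q hH] q'])
   fix m d w assume d: "d \<in> Obj C" and w: "w \<in> K (F i) m d"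
   obtain s where s: "ok1 X (Dn i) s m d" "w = pe X (Dn i) m d s" using F_elem[OF w] by blast
   show "ev (P.ind Q \<kappa> \<star> inj i j) m d w = ev q' m d w"
    using ev_Cmp[OF q hH d w] ev_inj[OF ij(1) s(1)] h(2)[OF ok_mono[OF s(1) Dn_mono[OF ij(1)]]] eh[OF s(1)] s(2) by simp
  qed
  show ?thesis
  proof (rule ex1I)
   show "P.ind Q \<kappa> \<in> Hom ch (F j) Q & P.ind Q \<kappa> \<star> v = v' & P.ind Q \<kappa> \<star> inj i j = q'" using hH hv hq by blast
   fix k assume "k \<in> Hom ch (F j) Q & k \<star> v = v' & k \<star> inj i j = q'"
   then have k: "k \<in> Hom ch (F j) Q" "k \<star> v = v'" "k \<star> inj i j = q'" by auto
   have eq: "ev k m d (pe X (Dn j) m d s) = ev (P.ind Q \<kappa>) m d (pe X (Dn j) m d s)" if s: "ok1 X (Dn i) s m d" for s m d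
    using ev_Cmp[OF q k(1) ok_Obj[OF s] pe_in_K[OF s]] ev_Cmp[OF q hH ok_Obj[OF s] pe_in_K[OF s]] k(3) hq ev_inj[OF ij(1) s] by simp
   show "k = P.ind Q \<kappa>"
   proof (rule P.hom_eq_on_leaves)
    show "k \<in> Hom ch P.obj Q" "P.ind Q \<kappa> \<in> Hom ch P.obj Q" using k(1) h(1) FP by simp_all
    show "ev k m d (P.em m d (Gn a m d x)) = ev (P.ind Q \<kappa>) m d (P.em m d (Gn a m d x))"
     if "d \<in> Obj C" "x \<in> K X m d" for a m d x
     by (rule eq) (use that in simp)
    fix m d s x assume f: "Cl m d s x \<in> Dn j" "d \<in> Obj C"
    show "ev k (m + 1) d (P.em (m + 1) d (Cl m d s x)) = ev (P.ind Q \<kappa>) (m + 1) d (P.em (m + 1) d (Cl m d s x))"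
    proof (cases "Cl m d s x = Cl n c t y")
     case True
     then have "m = n" "d = c" "s = t" "x = y" by auto
     then show ?thesis
      using ev_Cmp[OF v(1) k(1) c \<eta>_K(3)[OF c]] ev_Cmp[OF v(1) hH c \<eta>_K(3)[OF c]] v(2) k(2) hv by simp
    next
     case False
     show ?thesis by (rule eq) (use False Dj[OF f(1)] f(2) in auto)
    qed
   qed
  qed
 qed
 note * = this
 have "is_pushout ch (gi c n) u v (inj i j)"
  unfolding is_pushout_def
 proof (intro conjI ballI impI, goal_cases)
  case (7 v' q')
  then have "v' \<in> Hom ch (Dk c n) (Cod ch q')" "q' \<in> Hom ch (F i) (Cod ch q')" using HomD[OF g] HomD[OF u(1)] by (auto simp: Hom_def)
  then show ?case using * 7 HomD[OF q] by simp
 qed (use HomD[OF g] HomD[OF u(1)] HomD[OF v(1)] HomD[OF q] sq in auto)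
 then show ?thesis unfolding pushouts_of_def gen_I_def using z(1) by blast
qed

text \<open>The order has a top element, so the stage there is the colimit of the sequence. At the
  least index no cell is present yet and the stage is a copy of \<open>X\<close>; composing with
  this isomorphism is what costs a retract.\<close>

lemma in_rel_cell: "mk X (Po X D) (\<lambda>n c x. pe X D n c (Gn () n c x)) \<in> retracts ch (rel_cell \<mu> ch \<I>)"
proof -
 have "Field r \<noteq> {}" using tp by blast
 then obtain b where b: "is_least r b" using Well_order_least[OF wo] by blast
 have bF: "b \<in> Field r" using b by (simp add: is_least_def)
 note bt = tp_max[OF bF]
 have sq: "sequence_in ch (pushouts_of ch \<I>) r F Fa"
  unfolding sequence_in_def using wo tp diag limit_stage successor_stage by auto
 have "\<exists>!h. h \<in> Hom ch (F tp) L' & (\<forall>i\<in>Obj (ord_cat r). h \<star> Fa (i, tp) = \<iota>' i)"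
  if cc: "cocone (ord_cat r) ch F Fa L' \<iota>'" for L' \<iota>'
 proof (rule ex1I)
  have H: "\<iota>' tp \<in> Hom ch (F tp) L'" using cc tp by (simp add: cocone_def)
  moreover have "\<iota>' tp \<star> Fa (i, tp) = \<iota>' i" if "i \<in> Field r" for i
   using cc tp_max[OF that] by (auto simp: cocone_def)
  ultimately show "\<iota>' tp \<in> Hom ch (F tp) L' & (\<forall>i\<in>Obj (ord_cat r). \<iota>' tp \<star> Fa (i, tp) = \<iota>' i)" by simp
  fix k assume k: "k \<in> Hom ch (F tp) L' & (\<forall>i\<in>Obj (ord_cat r). k \<star> Fa (i, tp) = \<iota>' i)"
  then have "k \<star> inj tp tp = \<iota>' tp" using tp by simp
  then show "k = \<iota>' tp" using k ch.Cmp_Idn_right[of k "F tp" L'] inj_id[OF tp] by simp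
 qed
 moreover have "cocone (ord_cat r) ch F Fa (F tp) (\<lambda>i. Fa (i, tp))"
  unfolding cocone_def
 proof (intro conjI ballI)
  fix u assume "u \<in> Arr (ord_cat r)"
  then have u: "(fst u, snd u) \<in> r" by simp
  show "Fa (Cod (ord_cat r) u, tp) \<star> Fa u = Fa (Dom (ord_cat r) u, tp)"
   using inj_comp[OF u tp_max[OF FieldI2[OF u]]] by simp
 qed (use F_Obj inj_Hom[OF tp_max] in auto)
 ultimately have "colimit_cocone (ord_cat r) ch F Fa (F tp) (\<lambda>i. Fa (i, tp))" unfolding colimit_cocone_def by blast
 then have "inj b tp \<in> rel_cell \<mu> ch \<I>"
  unfolding rel_cell_def transfinite_compositions_def using r_small sq b by fastforce
 moreover
 interpret B: pres C \<mu> R S "{()}" "\<lambda>_. X" "Dn b" CE by (rule pr)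
 interpret T: pres C \<mu> R S "{()}" "\<lambda>_. X" D CE using pr[of tp] by (simp add: Dn_tp)
 have Db: "Dn b = {}" using b by (simp add: is_least_def Dn_def)
 have FP: "F b = B.obj" "F tp = T.obj" by (simp_all add: Po_def Dn_tp)
 have g: "B.inj_gn () \<in> Hom ch X (F b)" unfolding FP by (rule B.inj_gn_map(1)) simp
 note eg = B.inj_gn_map(2)[of "()", simplified]
 \<comment> \<open>Reads a section back: with no cells present, stage \<open>b\<close> maps to
   \<open>X\<close>, and this map inverts the inclusion of the generators.\<close>
 define \<kappa> where "\<kappa> n c t = (case t of Gn j m d x => x | _ => undefined)" for n :: int and c :: 'o and t :: "(unit, 'o, 'a, 'r, 'u) tm"
 have M: "B.model X \<kappa>"
  unfolding B.model_def using X Db by (auto simp: \<kappa>_def hm_def CE_def Dom_closed Cod_closed)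
 note h = B.ind_map[OF M]
 have hH: "B.ind X \<kappa> \<in> Hom ch (F b) X" using h(1) FP by simp
 have evh: "ev (B.ind X \<kappa>) n c (B.em n c (Gn u n c x)) = x" if "c \<in> Obj C" "x \<in> K X n c" for n c x u
  using h(2)[of "Gn u n c x" n c] that by (simp add: \<kappa>_def)
 have i1: "B.ind X \<kappa> \<star> B.inj_gn () = Idn ch X"
  by (rule arr_eqI[OF Cmp_in_Hom_ch[OF g hH] Idn_in_Hom_ch[OF X]]) (simp add: ev_Cmp[OF g hH] eg evh)
 have i2: "B.inj_gn () \<star> B.ind X \<kappa> = Idn ch (F b)"
 proof (rule B.hom_eq_on_leaves)
  show "B.inj_gn () \<star> B.ind X \<kappa> \<in> Hom ch B.obj (F b)" "Idn ch (F b) \<in> Hom ch B.obj (F b)"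
   using Cmp_in_Hom_ch[OF hH g] Idn_in_Hom_ch[OF F_Obj[of b]] FP by simp_all
  fix u n c x assume c: "c \<in> Obj C" and x: "x \<in> K X n c"
  have "B.em n c (Gn u n c x) \<in> K (F b) n c" unfolding FP by (rule B.em_in_K') (use c x in simp)
  then show "ev (B.inj_gn () \<star> B.ind X \<kappa>) n c (B.em n c (Gn u n c x)) = ev (Idn ch (F b)) n c (B.em n c (Gn u n c x))"
   using ev_Cmp[OF hH g c] evh[OF c x] eg[OF c x] c by simp
 qed (use Db in simp)
 ultimately have rc: "inj b tp \<star> B.inj_gn () \<in> retracts ch (rel_cell \<mu> ch \<I>)"
  using ch.iso_precomp_retract[OF inj_Hom[OF bt] g hH i2 i1] by (auto simp: retracts_def)
 have "inj b tp \<star> B.inj_gn () = T.inj_gn ()"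
 proof (rule arr_eqI[OF Cmp_in_Hom_ch[OF g inj_Hom[OF bt]]])
  show "T.inj_gn () \<in> Hom ch X (F tp)" unfolding FP by (rule T.inj_gn_map(1)) simp
  fix n c x assume c: "c \<in> Obj C" and x: "x \<in> K X n c"
  show "ev (inj b tp \<star> B.inj_gn ()) n c x = ev (T.inj_gn ()) n c x"
   using ev_Cmp[OF g inj_Hom[OF bt] c x] eg[OF c x] ev_inj[OF bt, of "Gn () n c x" n c] T.inj_gn_map(2)[of "()", OF _ c x] c x Dn_tp by simp
 qed
 then show ?thesis using rc by (simp add: T.inj_gn_def T.into_def Po_def)
qed

end

context psh_setup begin

subsection \<open>Cofibrations\<close>

text \<open>A term or a derivation mentions finitely many cells, all of which lie in one member of
  the chain. Phrasing this as eventual truth combines the premises of a rule without naming a common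
  index.\<close>

lemma teq_directed:
 assumes m: "!!k. E k \<subseteq> E (Suc k)"
 shows "ok1 X (\<Union>k. E k) t n c ==> \<forall>\<^sub>F k in sequentially. ok1 X (E k) t n c"
  and "teq1 X (\<Union>k. E k) G n c t s ==> \<forall>\<^sub>F k in sequentially. teq1 X (E k) G n c t s"
proof -
 have mm: "E k \<subseteq> E l" if "k \<le> l" for k l using lift_Suc_mono_le[of E, OF m that] .
 show o: "ok1 X (\<Union>k. E k) t n c ==> \<forall>\<^sub>F k in sequentially. ok1 X (E k) t n c" for t n c
 proof (induction t arbitrary: n c)
  case (Cl m d t y)
  then obtain k where k: "Cl m d t y \<in> E k" and *: "n = m + 1" "d = c" "c \<in> Obj C" by auto
  have "\<forall>\<^sub>F l in sequentially. k \<le> l" by (rule eventually_ge_at_top)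
  then show ?case by eventually_elim (use k * mm in auto)
 next
  case (Ad s t)
  then show ?case by (auto intro: eventually_conj)
 qed auto
 show "teq1 X (\<Union>k. E k) G n c t s ==> \<forall>\<^sub>F k in sequentially. teq1 X (E k) G n c t s"
 proof (induction rule: teq.induct)
  case (te_refl t n c) from o[OF te_refl] show ?case by eventually_elim (rule teq.te_refl)
 next
  case (te_sym n c t s) from te_sym(2) show ?case by eventually_elim (rule teq.te_sym)
 next
  case (te_trans n c t s u) from te_trans(3,4) show ?case by eventually_elim (rule teq.te_trans)
 next
  case (te_ext n c t s) from o[OF te_ext(2)] o[OF te_ext(3)] show ?case by eventually_elim (rule teq.te_ext[where E = G and t = t and s = s], rule te_ext(1))
 next
  case (te_ad n c t t' s s') from te_ad(3,4) show ?case by eventually_elim (rule teq.te_ad)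
 next
  case (te_ng n c t t') from te_ng(2) show ?case by eventually_elim (rule teq.te_ng)
 next
  case (te_sm a c n t t') from te_sm(3) show ?case by eventually_elim (rule teq.te_sm[OF te_sm(1)])
 next
  case (te_rs f n t t') from te_rs(3) show ?case by eventually_elim (rule teq.te_rs[OF te_rs(1)])
 next
  case (te_bd n c t t') from te_bd(2) show ?case by eventually_elim (rule teq.te_bd)
 next
  case (te_assoc s n c t u) from te_assoc[THEN o] show ?case by eventually_elim (rule teq.te_assoc)
 next
  case (te_comm s n c t) from te_comm[THEN o] show ?case by eventually_elim (rule teq.te_comm)
 next
  case (te_zr t n c) from o[OF te_zr] show ?case by eventually_elim (rule teq.te_zr)
 next
  case (te_inv t n c) from o[OF te_inv] show ?case by eventually_elim (rule teq.te_inv)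
 next
  case (te_sm_add a c b t n) from o[OF te_sm_add(3)] show ?case by eventually_elim (rule teq.te_sm_add[OF te_sm_add(1,2)])
 next
  case (te_sm_ad a c s n t) from te_sm_ad(2,3)[THEN o] show ?case by eventually_elim (rule teq.te_sm_ad[OF te_sm_ad(1)])
 next
  case (te_sm_mult a c b t n) from o[OF te_sm_mult(3)] show ?case by eventually_elim (rule teq.te_sm_mult[OF te_sm_mult(1,2)])
 next
  case (te_sm_one t n c) from o[OF te_sm_one] show ?case by eventually_elim (rule teq.te_sm_one)
 next
  case (te_rs_ad f s n t) from te_rs_ad(2,3)[THEN o] show ?case by eventually_elim (rule teq.te_rs_ad[OF te_rs_ad(1)])
 next
  case (te_rs_sm f a t n) from o[OF te_rs_sm(3)] show ?case by eventually_elim (rule teq.te_rs_sm[OF te_rs_sm(1,2)])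
 next
  case (te_rs_ng f t n) from o[OF te_rs_ng(2)] show ?case by eventually_elim (rule teq.te_rs_ng[OF te_rs_ng(1)])
 next
  case (te_rs_id t n c) from o[OF te_rs_id] show ?case by eventually_elim (rule teq.te_rs_id)
 next
  case (te_rs_cmp f g t n) from o[OF te_rs_cmp(4)] show ?case by eventually_elim (rule teq.te_rs_cmp[OF te_rs_cmp(1-3)])
 next
  case (te_bd_ad s n c t) from te_bd_ad[THEN o] show ?case by eventually_elim (rule teq.te_bd_ad)
 next
  case (te_bd_sm a c t n) from o[OF te_bd_sm(2)] show ?case by eventually_elim (rule teq.te_bd_sm[OF te_bd_sm(1)])
 next
  case (te_bd_rs f t n) from o[OF te_bd_rs(2)] show ?case by eventually_elim (rule teq.te_bd_rs[OF te_bd_rs(1)])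
 next
  case (te_bd_bd t n c) from o[OF te_bd_bd] show ?case by eventually_elim (rule teq.te_bd_bd)
 qed (rule always_eventually, rule allI, rule teq.te_gn_pl teq.te_gn_sm teq.te_gn_rs teq.te_gn_bd teq.te_rs_zr; simp)+
qed

text \<open>All cells that can be attached to the source of \<open>f\<close>, or to cells attached before.\<close>

primrec cells :: "('o, 'a, 'r, 'u) psh_cplx_arr => nat => (unit, 'o, 'a, 'r, 'u) tm set" where
 "cells f 0 = {}"
| "cells f (Suc k) = {Cl n c t y | n c t y. c \<in> S & ok1 (Dom ch f) (cells f k) t n c & flat t &
  teq1 (Dom ch f) (cells f k) CE (n - 1) c (Bd t) Zr & y \<in> K (Cod ch f) (n + 1) c &
  evt (Cod ch f) (kap f) t n c = bd (Cod ch f) (n + 1) c y}"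

lemma cells_mono: "cells f k \<subseteq> cells f (Suc k)"
proof (induction k)
 case (Suc k)
 have "ok1 X (cells f k) t n c ==> ok1 X (cells f (Suc k)) t n c"
  "teq1 X (cells f k) CE n c t s ==> teq1 X (cells f (Suc k)) CE n c t s" for X t s n c
  using ok_mono[OF _ Suc] teq_mono[OF _ Suc] by blast+
 then show ?case unfolding cells.simps(2)[of f k] cells.simps(2)[of f "Suc k"] by blast
qed simp

text \<open>Requiring boundary terms to be flat keeps the number of possible attachments small in
  each round.\<close>

lemma cells_small:
 assumes f: "f \<in> Hom ch X Y" shows "small \<mu> (cells f k)"
proof (induction k)
 case (Suc k)
 have XY: "Dom ch f = X" "Cod ch f = Y" using f by (auto simp: Hom_def)
 interpret P: pres C \<mu> R S "{()}" "\<lambda>_. X" "cells f k" CE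
  by unfold_locales (simp_all add: Suc small_finite[OF U] conjunct1[OF Hom_ObjD[OF f]])
 have "small \<mu> (\<Union>n::int. \<Union>c\<in>S. \<Union>t\<in>{t. flat t & (\<exists>n. P.okk t n c)}. (\<lambda>y. Cl n c t y) ` K Y (n + 1) c)"
 proof (intro small_UN[OF U] small_UN[OF U S_small] small_image[OF U])
  show "small \<mu> (UNIV :: int set)" by (rule small_countable[OF U]) simp
  show "small \<mu> S" by (rule S_small)
  fix c n assume "c \<in> S"
  then have c: "c \<in> Obj C" using S_Obj by blast
  show "small \<mu> {t. flat t & (\<exists>n. P.okk t n c)}" by (rule P.small_flat[OF c])
  show "small \<mu> (K Y (n + 1) c)" by (rule small_K[OF conjunct2[OF Hom_ObjD[OF f]] c])
 qed
 then show ?case unfolding cells.simps XY by (rule small_mono[OF U]) blast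
qed (simp add: small_finite[OF U])

lemma cells_good: assumes f: "f \<in> Hom ch X Y" shows "e \<in> cells f k ==> good X Y e"
proof (induction k arbitrary: e)
 case (Suc k)
 have XY: "Dom ch f = X" "Cod ch f = Y" using f by (auto simp: Hom_def)
 obtain n c t y where e: "e = Cl n c t y" "c \<in> S" "ok1 X (cells f k) t n c" "y \<in> K Y (n + 1) c"
  using Suc.prems unfolding cells.simps XY by blast
 then show ?case using ok_good[OF Suc.IH e(3)] S_Obj by auto
qed simp

definition all_cells where "all_cells f = (\<Union>k. cells f k)"

text \<open>All conditions on a cell survive relabelling, including derivability of the cycle
  condition. Since cells are labelled by terms and not by sections of the previous stage, no choice
  of representatives can disturb this.\<close>

lemma cells_nat:
 assumes f: "f \<in> Hom ch X Y" and g: "g \<in> Hom ch X' Y'" and u: "u \<in> Hom ch X X'" and v: "v \<in> Hom ch Y Y'"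
  and sq: "g \<star> u = v \<star> f"
 shows "e \<in> cells f k ==> mp (ev u) (ev v) e \<in> cells g k"
proof (induction k arbitrary: e)
 case (Suc k)
 have XY: "Dom ch f = X" "Cod ch f = Y" "Dom ch g = X'" "Cod ch g = Y'" using f g by (auto simp: Hom_def)
 obtain n c t y where e: "e = Cl n c t y" "c \<in> S" "ok1 X (cells f k) t n c" "flat t" "teq1 X (cells f k) CE (n - 1) c (Bd t) Zr"
   "y \<in> K Y (n + 1) c" "evt Y (kap f) t n c = bd Y (n + 1) c y"
  using Suc.prems unfolding cells.simps XY by blast
 have c: "c \<in> Obj C" using e(2) S_Obj by blast
 let ?m = "mp (ev u) (ev v)"
 have "ok1 X' (cells g k) (?m t) n c" by (rule ok_mp[OF hm_ev[OF u] Suc.IH e(3)])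
 moreover have "teq1 X' (cells g k) CE (n - 1) c (?m (Bd t)) (?m Zr)"
  by (rule teq_mp[OF _ hm_ev[OF u] Suc.IH _ e(5)]) (use Hom_ObjD[OF f] in \<open>auto simp: CE_def\<close>)
 moreover have "evt Y' (kap g) (?m t) n c = bd Y' (n + 1) c (ev v (n + 1) c y)"
  using evt_mp[OF f g u v sq cells_good[OF f] e(3)] e(7) ev_bd[OF v c e(6)] by simp
 ultimately show ?case using e(1,2) flat_mp[OF e(4)] ev_closed[OF v c e(6)] XY by simp
qed simp

sublocale I: fac C \<mu> R S all_cells CE
proof
 fix f X Y assume f: "f \<in> Hom ch X Y"
 show "small \<mu> (all_cells f)" unfolding all_cells_def
  by (rule small_UN[OF U]) (auto intro: small_countable[OF U] cells_small[OF f])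
 show "e \<in> all_cells f ==> good X Y e" for e unfolding all_cells_def using cells_good[OF f] by blast
 fix n c t s assume "CE n c t s" and o: "ok1 X (all_cells f) t n c"
 then obtain y where t: "t = Bd (Cl n c s y)" unfolding CE_def by blast
 then have y: "t = Bd (Cl n c s y)" "Cl n c s y \<in> all_cells f" using o by simp_all
 then obtain k where "Cl n c s y \<in> cells f k" by (auto simp: all_cells_def)
 moreover have "Dom ch f = X" "Cod ch f = Y" using f by (auto simp: Hom_def)
 ultimately have "evt Y (kap f) s n c = bd Y (n + 1) c y" by (cases k) simp_all
 then show "evt Y (kap f) t n c = evt Y (kap f) s n c" using y(1) by simp
next
 fix f X Y g X' Y' u v e assume "f \<in> Hom ch X Y" "g \<in> Hom ch X' Y'" "u \<in> Hom ch X X'" "v \<in> Hom ch Y Y'"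
  "g \<star> u = v \<star> f" "e \<in> all_cells f"
 then show "mp (ev u) (ev v) e \<in> all_cells g" unfolding all_cells_def using cells_nat[of f X Y g X' Y' u v e] by blast
next
 fix n c t s V W assume "CE n c t s" then show "CE n c (mp V W t) (mp V W s)" unfolding CE_def by auto
qed

text \<open>A cycle of the middle object is given by a flat term, and after some round
  \<open>k\<close> both the term and a derivation that its boundary vanishes are available; round
  \<open>k + 1\<close> attaches a cell that bounds it and has the required image.\<close>

lemma I_rgt: assumes fA: "f \<in> Arr ch" shows "I.rgt f \<in> \<T>"
proof -
 let ?X = "Dom ch f" and ?Y = "Cod ch f"
 have f: "f \<in> Hom ch ?X ?Y" using fA by (rule Hom_ch_Arr)
 interpret P: pres C \<mu> R S "{()}" "\<lambda>_. ?X" "all_cells f" CE by (rule I.pres_fac[OF f])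
 have mid: "I.mid f = P.obj" by (simp add: I.mid_def)
 have "lp (I.mid f) ?Y (I.rgt f) n s" if s: "s \<in> S" for n s
  unfolding lp_def
 proof (intro ballI impI)
  have sO: "s \<in> Obj C" using s S_Obj by blast
  fix x y assume x: "x \<in> K (I.mid f) n s" and y: "y \<in> K ?Y (n + 1) s" and z: "bd (I.mid f) n s x = zr (I.mid f) (n - 1) s"
   and e: "ev (I.rgt f) n s x = bd ?Y (n + 1) s y"
  obtain t where t: "P.okk t n s" "flat t" "x = P.em n s t" using P.K_obj_flat x unfolding mid by blast
  have ob: "P.okk (Bd t) (n - 1) s" using t(1) by simp
  have "P.em (n - 1) s (Bd t) = P.em (n - 1) s Zr"
   using z P.obj_ops_em(6)[OF t(1)] P.obj_ops_em(2)[OF sO] unfolding mid t(3) by simp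
  then have "P.te (n - 1) s (Bd t) Zr" using P.em_eq'[OF ob] sO by simp
  from teq_directed(2)[of "cells f", OF cells_mono this[unfolded all_cells_def]] teq_directed(1)[of "cells f", OF cells_mono t(1)[unfolded all_cells_def]]
  have "\<forall>\<^sub>F k in sequentially. teq1 ?X (cells f k) CE (n - 1) s (Bd t) Zr & ok1 ?X (cells f k) t n s" by (rule eventually_conj)
  then obtain k where k: "teq1 ?X (cells f k) CE (n - 1) s (Bd t) Zr" "ok1 ?X (cells f k) t n s" by (auto simp: eventually_sequentially)
  have "evt ?Y (kap f) t n s = bd ?Y (n + 1) s y" using e t(3) I.ev_rgt[OF f t(1)] by simp
  then have "Cl n s t y \<in> cells f (Suc k)" using k t(2) y s by simp
  then have m: "Cl n s t y \<in> all_cells f" unfolding all_cells_def by blast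
  then have o: "P.okk (Cl n s t y) (n + 1) s" using sO by simp
  have "P.te n s (Bd (Cl n s t y)) t" by (rule te_ext) (use o t(1) in \<open>auto simp: CE_def\<close>)
  then have "bd (I.mid f) (n + 1) s (P.em (n + 1) s (Cl n s t y)) = x"
   using P.em_teq[of n s "Bd (Cl n s t y)" t] P.obj_ops_em(6)[OF o] unfolding mid t(3) by simp
  then show "\<exists>w\<in>K (I.mid f) (n + 1) s. bd (I.mid f) (n + 1) s w = x & ev (I.rgt f) (n + 1) s w = y"
   using I.ev_rgt[OF f o] P.em_in_K'[OF o] unfolding mid by (intro bexI[of _ "P.em (n + 1) s (Cl n s t y)"]) auto
 qed
 then show ?thesis using injectives_I_iff_S[OF I.rgt_Hom[OF f]] by blast
qed

lemma I_lft: assumes fA: "f \<in> Arr ch" shows "I.lft f \<in> retracts ch (rel_cell \<mu> ch \<I>)"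
proof -
 let ?X = "Dom ch f" and ?Y = "Cod ch f" and ?D = "all_cells f"
 have f: "f \<in> Hom ch ?X ?Y" using fA by (rule Hom_ch_Arr)
 \<comment> \<open>\<open>None\<close> becomes the extra last element that \<open>cell_seq\<close>
   expects.\<close>
 define P0 where "P0 = insert None (Some ` ?D)"
 have sO: "small \<mu> P0" unfolding P0_def
  using small_Un[OF U small_finite[OF U, of "{None}"] small_image[OF U I.D_small[OF f], of Some]] by simp
 obtain g :: "(unit, 'o, 'a, 'r, 'u) tm option => 'u" where g: "inj_on g P0" using small_embeds[OF U sO] by blast
 obtain w where "well_order_on P0 w" using well_order_on by blast
 then have w: "Well_order w" "Field w = P0" using well_order_on_Well_order by blast+
 \<comment> \<open>The round in which \<open>e\<close> first appears, shifted by one so that the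
   boundary term of \<open>e\<close> uses cells of \<open>cells f (rk e)\<close>.\<close>
 define rk where "rk e = (LEAST k. e \<in> cells f (Suc k))" for e
 define q1 where "q1 a = (case a of None => 0 | Some e => rk e)" for a
 define w1 where "w1 = {(a, b). a \<in> Field w & b \<in> Field w & (q1 a < q1 b \<or> q1 a = q1 b & (a, b) \<in> w)}"
 have w1: "Well_order w1" "Field w1 = P0" using Well_order_by_rank[OF w(1), of q1] w(2) unfolding w1_def by auto
 \<comment> \<open>Sorting by rank has placed \<open>None\<close> among the cells of rank zero; a
   second sorting moves it to the end.\<close>
 define q2 :: "(unit, 'o, 'a, 'r, 'u) tm option => nat" where "q2 a = (if a = None then 1 else 0)" for a
 define r0 where "r0 = {(a, b). a \<in> Field w1 & b \<in> Field w1 & (q2 a < q2 b \<or> q2 a = q2 b & (a, b) \<in> w1)}"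
 have r0: "Well_order r0" "Field r0 = P0" using Well_order_by_rank[OF w1(1), of q2] w1(2) unfolding r0_def by auto
 \<comment> \<open>Transfinite compositions are indexed by well-orders on \<open>'u\<close>, so the
   order is carried along \<open>g\<close>.\<close>
 define r where "r = dir_image r0 g"
 have r: "Well_order r" "Field r = g ` P0"
  unfolding r_def using Well_order_dir_image[OF r0(1), of g] dir_image_Field[of r0 g] g r0(2) by simp_all
 have rk: "e \<in> cells f (Suc (rk e))" if "e \<in> ?D" for e
 proof -
  obtain k where k: "e \<in> cells f k" using \<open>e \<in> ?D\<close> by (auto simp: all_cells_def)
  then obtain k' where "k = Suc k'" by (cases k) auto
  then show ?thesis unfolding rk_def using k LeastI[of "\<lambda>k. e \<in> cells f (Suc k)" k'] by blast
 qed
 \<comment> \<open>A cell available for attaching \<open>e\<close> has smaller rank and so precedes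
   \<open>e\<close> in the order.\<close>
 have below: "cells f (rk e) \<subseteq> {e' \<in> ?D. g (Some e') \<in> underS r (g (Some e))}" if e: "e \<in> ?D" for e
 proof
  fix e' assume e': "e' \<in> cells f (rk e)"
  then obtain k where k: "rk e = Suc k" by (cases "rk e") auto
  have D: "e' \<in> ?D" using e' by (auto simp: all_cells_def)
  have "rk e' \<le> k" unfolding rk_def[of e'] by (rule Least_le) (use e' k in simp)
  then have rk: "rk e' < rk e" using k by simp
  have F: "Some e' \<in> P0" "Some e \<in> P0" unfolding P0_def using D e by simp_all
  have "(Some e', Some e) \<in> w1" using rk F unfolding w1_def w(2) by (simp add: q1_def)
  then have "(Some e', Some e) \<in> r0" using F unfolding r0_def w1(2) by (simp add: q2_def)
  moreover have ne: "e' \<noteq> e" using rk by blast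
  moreover have "g (Some e') \<noteq> g (Some e)" using inj_on_eq_iff[OF g, of "Some e'" "Some e"] D e ne by (simp add: P0_def)
  ultimately show "e' \<in> {e' \<in> ?D. g (Some e') \<in> underS r (g (Some e))}"
   using D unfolding r_def dir_image_def underS_def by blast
 qed
 interpret L: cell_seq C \<mu> R S ?X ?D r "g None" "\<lambda>e. g (Some e)"
 proof unfold_locales
  show "?X \<in> Obj ch" using Hom_ObjD[OF f] by simp
  show "Well_order r" by (rule r(1))
  show "small \<mu> (Field r)" unfolding r(2) by (rule small_image[OF U sO])
  show "g None \<in> Field r" unfolding r(2) P0_def by simp
  show "(i, g None) \<in> r" if "i \<in> Field r" for i
  proof -
   have "i \<in> g ` P0" using that r(2) by simp
   then obtain a where a: "i = g a" "a \<in> P0" by (rule imageE)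
   have N: "None \<in> Field w1" and aF: "a \<in> Field w1" using a(2) w1(2) by (simp_all add: P0_def)
   have "(None, None) \<in> w1" by (rule Well_order_facts(1)[OF w1(1) N])
   moreover have "q2 a < q2 None" if "a \<noteq> None" using that by (simp add: q2_def)
   ultimately have "(a, None) \<in> r0" unfolding r0_def using N aF by (cases "a = None") simp_all
   then show ?thesis unfolding r_def dir_image_def a(1) by blast
  qed
  have "Some ` ?D = P0 - {None}" "None \<in> P0" by (auto simp: P0_def)
  then have "bij_betw g (Some ` ?D) (Field r - {g None})"
   unfolding bij_betw_def r(2) using inj_on_image_set_diff[OF g, of P0 "{None}"] inj_on_subset[OF g] by simp
  from bij_betw_trans[OF _ this, of Some ?D] show "bij_betw (\<lambda>e. g (Some e)) ?D (Field r - {g None})"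
   by (simp add: bij_betw_def comp_def)
  fix e assume e: "e \<in> ?D"
  obtain n c t y where "e = Cl n c t y" "c \<in> S" "ok1 ?X (cells f (rk e)) t n c" "teq1 ?X (cells f (rk e)) CE (n - 1) c (Bd t) Zr"
   using rk[OF e] unfolding cells.simps by blast
  then show "\<exists>n c t y. e = Cl n c t y & c \<in> S & ok1 ?X {e' \<in> ?D. g (Some e') \<in> underS r (g (Some e))} t n c &
   teq1 ?X {e' \<in> ?D. g (Some e') \<in> underS r (g (Some e))} CE (n - 1) c (Bd t) Zr"
   using ok_mono[OF _ below[OF e]] teq_mono[OF _ below[OF e]] by blast
 qed
 show ?thesis using L.in_rel_cell by (simp add: I.lft_def I.mid_def Po_def)
qed

end

text \<open>
 The colimit of a sequence, described by germs of sections along the sequence: they are determined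
 by one of their values, so that there are few of them.
\<close>

locale dseq = psh_setup C \<mu> R S for C :: "('o, 'a) cat" (structure) and \<mu> :: "'u rel"
  and R :: "('o, 'a, 'r) rpsh" and S :: "'o set" +
 fixes r :: "'u rel" and Fo :: "'u => ('o, 'a, 'r, 'u) psh_cplx" and Fa :: "'u \<times> 'u => ('o, 'a, 'r, 'u) psh_cplx_arr"
  and L :: "('o, 'a, 'r, 'u) psh_cplx" and \<iota> :: "'u => ('o, 'a, 'r, 'u) psh_cplx_arr"
 assumes wo: "Well_order r" and ne: "Field r \<noteq> {}" and r_small: "small \<mu> (Field r)"
  and dg: "diagram (ord_cat r) ch Fo Fa" and cl: "colimit_cocone (ord_cat r) ch Fo Fa L \<iota>"
begin

lemmas wof = Well_order_facts[OF wo]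

lemma r_Field: "(i, j) \<in> r ==> i \<in> Field r" "(i, j) \<in> r ==> j \<in> Field r"
 by (auto simp: Field_def)

lemma upper: "i \<in> Field r ==> j \<in> Field r ==> \<exists>k\<in>Field r. (i, k) \<in> r & (j, k) \<in> r"
 using wof(4)[of i j] wof(1)[of i] wof(1)[of j] by blast

text \<open>The filter generated by the end segments of the index order; two families with the same
  germ agree eventually with respect to it.\<close>

definition tails :: "'u filter" where "tails = (INF k\<in>Field r. principal {j. (k, j) \<in> r})"

lemma ev_iff: "eventually P tails \<longleftrightarrow> (\<exists>k\<in>Field r. \<forall>j. (k, j) \<in> r --> P j)"
proof -
 have "eventually P tails \<longleftrightarrow> (\<exists>k\<in>Field r. eventually P (principal {j. (k, j) \<in> r}))"
  unfolding tails_def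
 proof (rule eventually_INF_base[OF ne])
  fix i j assume "i \<in> Field r" "j \<in> Field r"
  then obtain k where k: "k \<in> Field r" "(i, k) \<in> r" "(j, k) \<in> r" using upper by blast
  then have "{m. (k, m) \<in> r} \<subseteq> {m. (i, m) \<in> r} \<inter> {m. (j, m) \<in> r}" using wof(2) by blast
  then show "\<exists>x\<in>Field r. principal {m. (x, m) \<in> r} \<le> inf (principal {m. (i, m) \<in> r}) (principal {m. (j, m) \<in> r})"
   using k(1) by (intro bexI[of _ k]) (simp_all only: inf_principal principal_le_iff)
 qed
 then show ?thesis by (simp add: eventually_principal)
qed

lemma ev_ge: "i \<in> Field r ==> \<forall>\<^sub>F j in tails. (i, j) \<in> r" unfolding ev_iff by blast

lemma ev_ex: "eventually P tails ==> \<exists>j\<in>Field r. P j" unfolding ev_iff using wof(1) by blast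

lemma FO: "i \<in> Field r ==> Fo i \<in> Obj ch" using dg by (simp add: diagram_def)

lemma FH: "(i, j) \<in> r ==> Fa (i, j) \<in> Hom ch (Fo i) (Fo j)"
 using dg unfolding diagram_def by force

lemma Fc:
 assumes ij: "(i, j) \<in> r" and jk: "(j, k) \<in> r" shows "Fa (j, k) \<star> Fa (i, j) = Fa (i, k)"
proof -
 have "\<forall>u\<in>r. \<forall>v\<in>r. fst v = snd u --> Fa (fst u, snd v) = Fa v \<star> Fa u" using dg by (simp add: diagram_def)
 from bspec[OF bspec[OF this ij] jk] show ?thesis by simp
qed

lemma LO: "L \<in> Obj ch" and \<iota>H: "i \<in> Field r ==> \<iota> i \<in> Hom ch (Fo i) L"
 using cl by (simp_all add: colimit_cocone_def cocone_def)

lemma \<iota>c: assumes ij: "(i, j) \<in> r" shows "\<iota> j \<star> Fa (i, j) = \<iota> i"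
proof -
 have "\<forall>u\<in>r. \<iota> (snd u) \<star> Fa u = \<iota> (fst u)" using cl by (simp add: colimit_cocone_def cocone_def)
 from bspec[OF this ij] show ?thesis by simp
qed

lemma ev_Fc: "(i, j) \<in> r ==> (j, k) \<in> r ==> c \<in> Obj C ==> x \<in> K (Fo i) n c ==>
  ev (Fa (j, k)) n c (ev (Fa (i, j)) n c x) = ev (Fa (i, k)) n c x"
 using ev_Cmp[OF FH FH, of i j k c x n] Fc[of i j k] by simp

lemma ev_\<iota>c: "(i, j) \<in> r ==> c \<in> Obj C ==> x \<in> K (Fo i) n c ==> ev (\<iota> j) n c (ev (Fa (i, j)) n c x) = ev (\<iota> i) n c x"
 using ev_Cmp[OF FH \<iota>H, of i j c x n] \<iota>c[of i j] r_Field by simp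

text \<open>From some index on, the family is the trace of a single section; its earlier values are
  arbitrary.\<close>

definition coh where
 "coh n c s \<longleftrightarrow> (\<exists>i\<in>Field r. \<exists>x\<in>K (Fo i) n c. \<forall>j. (i, j) \<in> r --> s j = ev (Fa (i, j)) n c x)"

lemma coh_trace: "i \<in> Field r ==> x \<in> K (Fo i) n c ==> coh n c (\<lambda>j. ev (Fa (i, j)) n c x)"
 unfolding coh_def by blast

lemma coh2:
 assumes c: "c \<in> Obj C" and s: "coh n c s" and t: "coh n c t"
 shows "\<exists>i\<in>Field r. \<exists>x\<in>K (Fo i) n c. \<exists>y\<in>K (Fo i) n c. \<forall>j. (i, j) \<in> r -->
  s j = ev (Fa (i, j)) n c x & t j = ev (Fa (i, j)) n c y"
proof -
 obtain i x where i: "i \<in> Field r" "x \<in> K (Fo i) n c" "!!j. (i, j) \<in> r ==> s j = ev (Fa (i, j)) n c x"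
  using s unfolding coh_def by blast
 obtain k y where k: "k \<in> Field r" "y \<in> K (Fo k) n c" "!!j. (k, j) \<in> r ==> t j = ev (Fa (k, j)) n c y"
  using t unfolding coh_def by blast
 obtain m where m: "m \<in> Field r" "(i, m) \<in> r" "(k, m) \<in> r" using upper i(1) k(1) by blast
 show ?thesis
 proof (intro bexI[OF _ m(1)] bexI allI impI conjI)
  fix j assume j: "(m, j) \<in> r"
  show "s j = ev (Fa (m, j)) n c (ev (Fa (i, m)) n c x)" using i(3)[OF wof(2)[OF m(2) j]] ev_Fc[OF m(2) j c i(2)] by simp
  show "t j = ev (Fa (m, j)) n c (ev (Fa (k, m)) n c y)" using k(3)[OF wof(2)[OF m(3) j]] ev_Fc[OF m(3) j c k(2)] by simp
 qed (use ev_closed[OF FH[OF m(2)] c i(2)] ev_closed[OF FH[OF m(3)] c k(2)] in auto)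
qed

lemma coh_ev:
 assumes s: "coh n c s" and c: "c \<in> Obj C"
 shows "\<forall>\<^sub>F j in tails. Fo j \<in> Obj ch & s j \<in> K (Fo j) n c"
proof -
 obtain i x where i: "i \<in> Field r" "x \<in> K (Fo i) n c" "!!j. (i, j) \<in> r ==> s j = ev (Fa (i, j)) n c x"
  using s unfolding coh_def by blast
 have "Fo j \<in> Obj ch & s j \<in> K (Fo j) n c" if "(i, j) \<in> r" for j
  using i(3)[OF that] ev_closed[OF FH[OF that] c i(2)] FO[OF r_Field(2)[OF that]] by simp
 then show ?thesis unfolding ev_iff using i(1) by blast
qed

lemma coh_closed:
 assumes c: "c \<in> Obj C"
 shows "coh n c s ==> coh n c t ==> coh n c (\<lambda>j. pl (Fo j) n c (s j) (t j))"
  and "coh n c (\<lambda>j. zr (Fo j) n c)"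
  and "coh n c s ==> coh n c (\<lambda>j. ng (Fo j) n c (s j))"
  and "a \<in> \<R> c ==> coh n c s ==> coh n c (\<lambda>j. sm (Fo j) n c a (s j))"
  and "coh n c s ==> coh (n - 1) c (\<lambda>j. bd (Fo j) n c (s j))"
proof -
 show "coh n c (\<lambda>j. pl (Fo j) n c (s j) (t j))" if st: "coh n c s" "coh n c t"
 proof -
  obtain i x y where i: "i \<in> Field r" "x \<in> K (Fo i) n c" "y \<in> K (Fo i) n c"
   "!!j. (i, j) \<in> r ==> s j = ev (Fa (i, j)) n c x & t j = ev (Fa (i, j)) n c y" using coh2[OF c st] by blast
  show ?thesis unfolding coh_def
   by (intro bexI[OF _ i(1)] bexI[of _ "pl (Fo i) n c x y"] allI impI)
    (use i c FO in \<open>simp_all add: ev_pl[OF FH]\<close>)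
 qed
 obtain b where b: "b \<in> Field r" using ne by blast
 show "coh n c (\<lambda>j. zr (Fo j) n c)" unfolding coh_def
  by (intro bexI[OF _ b] bexI[of _ "zr (Fo b) n c"] allI impI) (use b c FO in \<open>simp_all add: ev_zr[OF FH]\<close>)
 assume "coh n c s"
 then obtain i x where i: "i \<in> Field r" "x \<in> K (Fo i) n c" "!!j. (i, j) \<in> r ==> s j = ev (Fa (i, j)) n c x"
  unfolding coh_def by blast
 show "coh n c (\<lambda>j. ng (Fo j) n c (s j))" unfolding coh_def
  by (intro bexI[OF _ i(1)] bexI[of _ "ng (Fo i) n c x"] allI impI) (use i c FO in \<open>simp_all add: ev_ng[OF FH]\<close>)
 show "coh n c (\<lambda>j. sm (Fo j) n c a (s j))" if "a \<in> \<R> c" unfolding coh_def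
  by (intro bexI[OF _ i(1)] bexI[of _ "sm (Fo i) n c a x"] allI impI) (use i c FO that in \<open>simp_all add: ev_sm[OF FH]\<close>)
 show "coh (n - 1) c (\<lambda>j. bd (Fo j) n c (s j))" unfolding coh_def
  by (intro bexI[OF _ i(1)] bexI[of _ "bd (Fo i) n c x"] allI impI) (use i c FO in \<open>simp_all add: ev_bd[OF FH]\<close>)
qed

lemma coh_rs:
 assumes f: "f \<in> Arr C" and s: "coh n (Cod C f) s" shows "coh n (Dom C f) (\<lambda>j. rs (Fo j) n f (s j))"
proof -
 obtain i x where i: "i \<in> Field r" "x \<in> K (Fo i) n (Cod C f)" "!!j. (i, j) \<in> r ==> s j = ev (Fa (i, j)) n (Cod C f) x"
  using s unfolding coh_def by blast
 show ?thesis unfolding coh_def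
  by (intro bexI[OF _ i(1)] bexI[of _ "rs (Fo i) n f x"] allI impI) (use i f FO in \<open>simp_all add: ev_rs[OF FH]\<close>)
qed

definition gs :: "('o, 'a, 'r, 'u => 'u) sd" where
 "gs = \<lparr>EQ = (\<lambda>n c s t. coh n c s & coh n c t & (\<forall>\<^sub>F j in tails. s j = t j)),
  AD = (\<lambda>n c s t j. pl (Fo j) n c (s j) (t j)), ZR = (\<lambda>n c j. zr (Fo j) n c), NG = (\<lambda>n c s j. ng (Fo j) n c (s j)),
  SM = (\<lambda>n c a s j. sm (Fo j) n c a (s j)), RS = (\<lambda>n f s j. rs (Fo j) n f (s j)), BD = (\<lambda>n c s j. bd (Fo j) n c (s j))\<rparr>"

lemma gs_sel: "EQ gs n c s t \<longleftrightarrow> coh n c s & coh n c t & (\<forall>\<^sub>F j in tails. s j = t j)"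
 "AD gs n c s t = (\<lambda>j. pl (Fo j) n c (s j) (t j))" "ZR gs n c = (\<lambda>j. zr (Fo j) n c)" "NG gs n c s = (\<lambda>j. ng (Fo j) n c (s j))"
 "SM gs n c a s = (\<lambda>j. sm (Fo j) n c a (s j))" "RS gs n f s = (\<lambda>j. rs (Fo j) n f (s j))" "BD gs n c s = (\<lambda>j. bd (Fo j) n c (s j))"
 by (simp_all add: gs_def)

text \<open>An identity valid in every complex of the sequence passes to germs, since coherent
  families eventually take values in sections.\<close>

lemma law:
 assumes "c \<in> Obj C" "coh n c x" "coh n c y" "coh n c z" "coh m d p" "coh m d q"
  and e: "!!j. Fo j \<in> Obj ch ==> x j \<in> K (Fo j) n c ==> y j \<in> K (Fo j) n c ==> z j \<in> K (Fo j) n c ==> p j = q j"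
 shows "EQ gs m d p q"
proof -
 from coh_ev[OF assms(2,1)] coh_ev[OF assms(3,1)] coh_ev[OF assms(4,1)] have "\<forall>\<^sub>F j in tails. p j = q j"
  by eventually_elim (rule e; simp)
 then show ?thesis using assms(5,6) by (simp add: gs_sel)
qed

sublocale G: sdata C \<mu> R S gs
proof
 note cc = coh_closed coh_rs
 show "EQ gs n c x y ==> EQ gs n c y x" for n c x y by (auto simp: gs_sel eq_commute)
 show "EQ gs n c x z" if "EQ gs n c x y" "EQ gs n c y z" for n c x y z
 proof -
  have "\<forall>\<^sub>F j in tails. x j = y j" "\<forall>\<^sub>F j in tails. y j = z j" using that by (simp_all add: gs_sel)
  then have "\<forall>\<^sub>F j in tails. x j = z j" by eventually_elim simp
  then show ?thesis using that by (simp add: gs_sel)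
 qed
 show "small \<mu> (cls gs n c ` {x. EQ gs n c x x})" if c: "c \<in> Obj C" for n c
 proof (rule small_mono[OF U])
  show "small \<mu> ((\<lambda>p. cls gs n c (\<lambda>j. ev (Fa (fst p, j)) n c (snd p))) ` (SIGMA i:Field r. K (Fo i) n c))"
   by (intro small_image[OF U] small_Sigma[OF U] r_small small_K c FO)
  have "\<exists>i\<in>Field r. \<exists>x\<in>K (Fo i) n c. cls gs n c s = cls gs n c (\<lambda>j. ev (Fa (i, j)) n c x)" if s: "coh n c s" for s
  proof -
   obtain i x where i: "i \<in> Field r" "x \<in> K (Fo i) n c" "!!j. (i, j) \<in> r ==> s j = ev (Fa (i, j)) n c x"
    using s unfolding coh_def by blast
   from ev_ge[OF i(1)] have e: "\<forall>\<^sub>F j in tails. s j = ev (Fa (i, j)) n c x" by eventually_elim (rule i(3))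
   have "(\<forall>\<^sub>F j in tails. s j = t j) \<longleftrightarrow> (\<forall>\<^sub>F j in tails. ev (Fa (i, j)) n c x = t j)" for t
    using e by (rule eventually_subst[OF eventually_mono]) simp
   then have "cls gs n c s = cls gs n c (\<lambda>j. ev (Fa (i, j)) n c x)"
    unfolding cls_def gs_sel using s coh_trace[OF i(1,2)] by simp
   then show ?thesis using i(1,2) by blast
  qed
  then show "cls gs n c ` {x. EQ gs n c x x} \<subseteq> (\<lambda>p. cls gs n c (\<lambda>j. ev (Fa (fst p, j)) n c (snd p))) ` (SIGMA i:Field r. K (Fo i) n c)"
   by (force simp: gs_sel)
 qed
 show "EQ gs n c (AD gs n c x y) (AD gs n c x' y')" if "c \<in> Obj C" "EQ gs n c x x'" "EQ gs n c y y'" for n c x x' y y'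
 proof -
  have "\<forall>\<^sub>F j in tails. x j = x' j" "\<forall>\<^sub>F j in tails. y j = y' j" using that by (simp_all add: gs_sel)
  then have "\<forall>\<^sub>F j in tails. AD gs n c x y j = AD gs n c x' y' j" by eventually_elim (simp add: gs_sel)
  then show ?thesis using that by (simp add: gs_sel cc)
 qed
 have un: "EQ gs m d p q" if "\<forall>\<^sub>F j in tails. x j = x' j" "coh m d p" "coh m d q" "!!j. x j = x' j ==> p j = q j"
  for m d p q and x x' :: "'u => 'u"
  using eventually_mono[OF that(1,4)] that(2,3) by (simp add: gs_sel)
 show "EQ gs n c (NG gs n c x) (NG gs n c x')" if "c \<in> Obj C" "EQ gs n c x x'" for n c x x'
  by (rule un[of x x']) (use that in \<open>simp_all add: gs_sel cc\<close>)
 show "EQ gs n c (SM gs n c a x) (SM gs n c a x')" if "c \<in> Obj C" "a \<in> \<R> c" "EQ gs n c x x'" for n c a x x'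
  by (rule un[of x x']) (use that in \<open>simp_all add: gs_sel cc\<close>)
 show "EQ gs n (Dom C f) (RS gs n f x) (RS gs n f x')" if "f \<in> Arr C" "EQ gs n (Cod C f) x x'" for n f x x'
  by (rule un[of x x']) (use that in \<open>simp_all add: gs_sel cc\<close>)
 show "EQ gs (n - 1) c (BD gs n c x) (BD gs n c x')" if "c \<in> Obj C" "EQ gs n c x x'" for n c x x'
  by (rule un[of x x']) (use that in \<open>simp_all add: gs_sel cc\<close>)
 show "EQ gs n c (ZR gs n c) (ZR gs n c)" if "c \<in> Obj C" for n c using that by (simp add: gs_sel cc)
 show "EQ gs n c (AD gs n c (AD gs n c x y) z) (AD gs n c x (AD gs n c y z))"
  if "c \<in> Obj C" "EQ gs n c x x" "EQ gs n c y y" "EQ gs n c z z" for n c x y z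
  by (rule law[of c n x y z]) (use that in \<open>simp_all add: gs_sel cc pl_assoc\<close>)
 show "EQ gs n c (AD gs n c x y) (AD gs n c y x)" if "c \<in> Obj C" "EQ gs n c x x" "EQ gs n c y y" for n c x y
  by (rule law[of c n x y y]) (use that in \<open>simp_all add: gs_sel cc pl_comm\<close>)
 show "EQ gs n c (AD gs n c (ZR gs n c) x) x" if "c \<in> Obj C" "EQ gs n c x x" for n c x
  by (rule law[of c n x x x]) (use that in \<open>simp_all add: gs_sel cc\<close>)
 show "EQ gs n c (AD gs n c (NG gs n c x) x) (ZR gs n c)" if "c \<in> Obj C" "EQ gs n c x x" for n c x
  by (rule law[of c n x x x]) (use that in \<open>simp_all add: gs_sel cc\<close>)
 show "EQ gs n c (SM gs n c (a \<oplus>\<^bsub>rsect R c\<^esub> b) x) (AD gs n c (SM gs n c a x) (SM gs n c b x))"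
  if "c \<in> Obj C" "a \<in> \<R> c" "b \<in> \<R> c" "EQ gs n c x x" for n c a b x
  by (rule law[of c n x x x]) (use that in \<open>simp_all add: gs_sel cc sm_add\<close>)
 show "EQ gs n c (SM gs n c a (AD gs n c x y)) (AD gs n c (SM gs n c a x) (SM gs n c a y))"
  if "c \<in> Obj C" "a \<in> \<R> c" "EQ gs n c x x" "EQ gs n c y y" for n c a x y
  by (rule law[of c n x y y]) (use that in \<open>simp_all add: gs_sel cc sm_pl\<close>)
 show "EQ gs n c (SM gs n c (a \<otimes>\<^bsub>rsect R c\<^esub> b) x) (SM gs n c a (SM gs n c b x))"
  if "c \<in> Obj C" "a \<in> \<R> c" "b \<in> \<R> c" "EQ gs n c x x" for n c a b x
  by (rule law[of c n x x x]) (use that in \<open>simp_all add: gs_sel cc sm_mult\<close>)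
 show "EQ gs n c (SM gs n c \<one>\<^bsub>rsect R c\<^esub> x) x" if "c \<in> Obj C" "EQ gs n c x x" for n c x
  by (rule law[of c n x x x]) (use that in \<open>simp_all add: gs_sel cc\<close>)
 show "EQ gs n (Dom C f) (RS gs n f (AD gs n (Cod C f) x y)) (AD gs n (Dom C f) (RS gs n f x) (RS gs n f y))"
  if "f \<in> Arr C" "EQ gs n (Cod C f) x x" "EQ gs n (Cod C f) y y" for n f x y
  by (rule law[of "Cod C f" n x y y]) (use that in \<open>simp_all add: gs_sel cc rs_pl Cod_closed Dom_closed\<close>)
 show "EQ gs n (Dom C f) (RS gs n f (SM gs n (Cod C f) a x)) (SM gs n (Dom C f) (rres R f a) (RS gs n f x))"
  if "f \<in> Arr C" "a \<in> \<R> (Cod C f)" "EQ gs n (Cod C f) x x" for n f a x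
  by (rule law[of "Cod C f" n x x x]) (use that in \<open>simp_all add: gs_sel cc rs_sm Cod_closed Dom_closed rres_closed\<close>)
 show "EQ gs n c (RS gs n (Idn C c) x) x" if "c \<in> Obj C" "EQ gs n c x x" for n c x
  using that cc(6)[of "Idn C c" n x] by (intro law[of c n x x x]) (simp_all add: gs_sel)
 show "EQ gs n (Dom C f) (RS gs n (g \<cdot> f) x) (RS gs n f (RS gs n g x))"
  if "f \<in> Arr C" "g \<in> Arr C" "Dom C g = Cod C f" "EQ gs n (Cod C g) x x" for n f g x
  using that Cmp_Arr[OF that(1-3)] cc(6)[of "g \<cdot> f" n x] cc(6)[of f n "RS gs n g x"] cc(6)[of g n x]
  by (intro law[of "Cod C g" n x x x]) (simp_all add: gs_sel Cod_closed rs_rs)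
 show "EQ gs (n - 1) c (BD gs n c (AD gs n c x y)) (AD gs (n - 1) c (BD gs n c x) (BD gs n c y))"
  if "c \<in> Obj C" "EQ gs n c x x" "EQ gs n c y y" for n c x y
  by (rule law[of c n x y y]) (use that in \<open>simp_all add: gs_sel cc bd_pl\<close>)
 show "EQ gs (n - 1) c (BD gs n c (SM gs n c a x)) (SM gs (n - 1) c a (BD gs n c x))"
  if "c \<in> Obj C" "a \<in> \<R> c" "EQ gs n c x x" for n c a x
  by (rule law[of c n x x x]) (use that in \<open>simp_all add: gs_sel cc bd_sm\<close>)
 show "EQ gs (n - 1) (Dom C f) (BD gs n (Dom C f) (RS gs n f x)) (RS gs (n - 1) f (BD gs n (Cod C f) x))"
  if "f \<in> Arr C" "EQ gs n (Cod C f) x x" for n f x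
  by (rule law[of "Cod C f" n x x x]) (use that in \<open>simp_all add: gs_sel cc bd_rs Cod_closed Dom_closed\<close>)
 show "EQ gs (n - 2) c (BD gs (n - 1) c (BD gs n c x)) (ZR gs (n - 2) c)" if "c \<in> Obj C" "EQ gs n c x x" for n c x
  using that cc(5)[of c "n - 1" "BD gs n c x"] by (intro law[of c n x x x]) (simp_all add: gs_sel cc)
qed

definition tr :: "'u => ('o, 'a, 'r, 'u) psh_cplx_arr" where
 "tr i = G.into (Fo i) (\<lambda>n c x j. ev (Fa (i, j)) n c x)"

lemma tr_map:
 assumes i: "i \<in> Field r"
 shows "tr i \<in> Hom ch (Fo i) G.obj"
  and "!!n c x. c \<in> Obj C ==> x \<in> K (Fo i) n c ==> ev (tr i) n c x = G.em n c (\<lambda>j. ev (Fa (i, j)) n c x)"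
proof -
 have X: "Fo i \<in> Obj ch" by (rule FO[OF i])
 let ?t = "\<lambda>n c x j. ev (Fa (i, j)) n c x"
 have co: "coh n c (?t n c x)" if "x \<in> K (Fo i) n c" for n c x by (rule coh_trace[OF i that])
 have E: "EQ gs n c p q" if "coh n c p" "coh n c q" "!!j. (i, j) \<in> r ==> p j = q j" for n c p q
  using eventually_mono[OF ev_ge[OF i] that(3)] that(1,2) by (simp add: gs_sel)
 note A = E[OF co]
 have 1: "c \<in> Obj C ==> x \<in> K (Fo i) n c ==> EQ gs n c (?t n c x) (?t n c x)" for n c x by (simp add: gs_sel co)
 have 2: "EQ gs n c (?t n c (pl (Fo i) n c x y)) (AD gs n c (?t n c x) (?t n c y))"
  if "c \<in> Obj C" "x \<in> K (Fo i) n c" "y \<in> K (Fo i) n c" for n c x y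
  by (rule A) (use that X in \<open>simp_all add: gs_sel co coh_closed ev_pl[OF FH]\<close>)
 have 3: "EQ gs n c (?t n c (sm (Fo i) n c a x)) (SM gs n c a (?t n c x))"
  if "c \<in> Obj C" "x \<in> K (Fo i) n c" "a \<in> \<R> c" for n c a x
  by (rule A) (use that X in \<open>simp_all add: gs_sel co coh_closed ev_sm[OF FH]\<close>)
 have 4: "EQ gs (n - 1) c (?t (n - 1) c (bd (Fo i) n c x)) (BD gs n c (?t n c x))"
  if "c \<in> Obj C" "x \<in> K (Fo i) n c" for n c x
  by (rule A) (use that X in \<open>simp_all add: gs_sel co coh_closed ev_bd[OF FH]\<close>)
 have 5: "EQ gs n (Dom C f) (?t n (Dom C f) (rs (Fo i) n f x)) (RS gs n f (?t n (Cod C f) x))"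
  if "f \<in> Arr C" "x \<in> K (Fo i) n (Cod C f)" for n f x
  by (rule A) (use that X in \<open>simp_all add: gs_sel co coh_rs ev_rs[OF FH]\<close>)
 show "tr i \<in> Hom ch (Fo i) G.obj" unfolding tr_def by (rule G.into_map(1)[OF X 1 2 3 4 5])
 show "ev (tr i) n c x = G.em n c (?t n c x)" if "c \<in> Obj C" "x \<in> K (Fo i) n c" for n c x
  unfolding tr_def by (rule G.into_map(2)[OF X 1 2 3 4 5 that])
qed

lemma em_trace_eq:
 assumes i: "i \<in> Field r" and c: "c \<in> Obj C" and x: "x \<in> K (Fo i) n c" and y: "y \<in> K (Fo i) n c"
  and e: "G.em n c (\<lambda>j. ev (Fa (i, j)) n c x) = G.em n c (\<lambda>j. ev (Fa (i, j)) n c y)"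
 shows "\<exists>j. (i, j) \<in> r & ev (Fa (i, j)) n c x = ev (Fa (i, j)) n c y"
proof -
 have "\<forall>\<^sub>F j in tails. ev (Fa (i, j)) n c x = ev (Fa (i, j)) n c y"
  using e G.em_eq[OF c] coh_trace[OF i x] coh_trace[OF i y] by (simp add: gs_sel)
 with ev_ge[OF i] have "\<forall>\<^sub>F j in tails. (i, j) \<in> r & ev (Fa (i, j)) n c x = ev (Fa (i, j)) n c y" by (rule eventually_conj)
 then show ?thesis using ev_ex by blast
qed

lemma tr_cocone: "cocone (ord_cat r) ch Fo Fa G.obj tr"
 unfolding cocone_def
proof (intro conjI ballI)
 fix u assume "u \<in> Arr (ord_cat r)"
 then obtain i j where u: "u = (i, j)" and ij: "(i, j) \<in> r" by (cases u) auto
 note F = r_Field[OF ij]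
 have "tr j \<star> Fa (i, j) = tr i"
 proof (rule arr_eqI[OF Cmp_in_Hom_ch[OF FH[OF ij] tr_map(1)[OF F(2)]] tr_map(1)[OF F(1)]])
  fix n c x assume c: "c \<in> Obj C" and x: "x \<in> K (Fo i) n c"
  note y = ev_closed[OF FH[OF ij] c x]
  have "\<forall>\<^sub>F k in tails. ev (Fa (j, k)) n c (ev (Fa (i, j)) n c x) = ev (Fa (i, k)) n c x"
   using eventually_mono[OF ev_ge[OF F(2)] ev_Fc[OF ij _ c x]] .
  then have "EQ gs n c (\<lambda>k. ev (Fa (j, k)) n c (ev (Fa (i, j)) n c x)) (\<lambda>k. ev (Fa (i, k)) n c x)"
   by (simp add: gs_sel coh_trace[OF F(2) y] coh_trace[OF F(1) x])
  then show "ev (tr j \<star> Fa (i, j)) n c x = ev (tr i) n c x"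
   using ev_Cmp[OF FH[OF ij] tr_map(1)[OF F(2)] c x] tr_map(2)[OF F(2) c y] tr_map(2)[OF F(1) c x] G.em_cong[OF c] by simp
 qed
 then show "tr (Cod (ord_cat r) u) \<star> Fa u = tr (Dom (ord_cat r) u)" using u by simp
qed (use G.obj_in_Obj tr_map(1) in auto)

text \<open>The cocone of traces factors through \<open>L\<close>, so sections that become equal in
  \<open>L\<close> have the same germ, that is, they agree at some later stage.\<close>

lemma colimit_eq:
 assumes i: "i \<in> Field r" and c: "c \<in> Obj C" and x: "x \<in> K (Fo i) n c" and y: "y \<in> K (Fo i) n c"
  and e: "ev (\<iota> i) n c x = ev (\<iota> i) n c y"
 shows "\<exists>j. (i, j) \<in> r & ev (Fa (i, j)) n c x = ev (Fa (i, j)) n c y"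
proof -
 obtain h where h: "h \<in> Hom ch L G.obj" "!!j. j \<in> Field r ==> h \<star> \<iota> j = tr j"
  using colimit_cocone_ex[OF cl tr_cocone] by auto
 have "ev (tr i) n c x = ev (tr i) n c y"
  using ev_Cmp[OF \<iota>H[OF i] h(1) c x] ev_Cmp[OF \<iota>H[OF i] h(1) c y] h(2)[OF i] e by simp
 then show ?thesis using em_trace_eq[OF i c x y] tr_map(2)[OF i c x] tr_map(2)[OF i c y] by simp
qed

text \<open>Sending a germ to its common value in \<open>L\<close> defines a map back, and going
  from \<open>L\<close> to germs and back is the identity by uniqueness. Hence every section of
  \<open>L\<close> is the value of a germ.\<close>

lemma colimit_elem:
 assumes c: "c \<in> Obj C" and l: "l \<in> K L n c"
 shows "\<exists>i\<in>Field r. \<exists>x\<in>K (Fo i) n c. l = ev (\<iota> i) n c x"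
proof -
 \<comment> \<open>The images in \<open>L\<close> of a coherent family are eventually
   constant.\<close>
 define lv where "lv n c s = (SOME l. \<forall>\<^sub>F j in tails. ev (\<iota> j) n c (s j) = l)" for n c s
 have lvI: "lv n c s = l" if "\<forall>\<^sub>F j in tails. ev (\<iota> j) n c (s j) = l" for n c s l
  unfolding lv_def
 proof (rule some_equality)
  fix l' assume "\<forall>\<^sub>F j in tails. ev (\<iota> j) n c (s j) = l'"
  with that have "\<forall>\<^sub>F j in tails. l' = l" by eventually_elim simp
  then show "l' = l" using ev_ex by blast
 qed (rule that)
 have lv: "\<forall>\<^sub>F j in tails. ev (\<iota> j) n c (s j) = lv n c s" "\<exists>i\<in>Field r. \<exists>x\<in>K (Fo i) n c. lv n c s = ev (\<iota> i) n c x"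
  if c: "c \<in> Obj C" and s: "coh n c s" for n c s
 proof -
  obtain i x where i: "i \<in> Field r" "x \<in> K (Fo i) n c" "!!j. (i, j) \<in> r ==> s j = ev (Fa (i, j)) n c x"
   using s unfolding coh_def by blast
  have "\<forall>\<^sub>F j in tails. ev (\<iota> j) n c (s j) = ev (\<iota> i) n c x"
   using eventually_mono[OF ev_ge[OF i(1)], of "\<lambda>j. ev (\<iota> j) n c (s j) = ev (\<iota> i) n c x"] ev_\<iota>c[OF _ c i(2)] i(3) by simp
  then show "\<forall>\<^sub>F j in tails. ev (\<iota> j) n c (s j) = lv n c s" "\<exists>i\<in>Field r. \<exists>x\<in>K (Fo i) n c. lv n c s = ev (\<iota> i) n c x"
   using lvI i by auto
 qed
 have evF: "\<forall>\<^sub>F j in tails. j \<in> Field r" using ne by (auto simp: ev_iff dest: r_Field(2))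
 have e1: "c \<in> Obj C ==> EQ gs n c s t ==> lv n c s = lv n c t" for n c s t
 proof -
  assume a: "EQ gs n c s t"
  have "(\<forall>\<^sub>F j in tails. ev (\<iota> j) n c (s j) = l) \<longleftrightarrow> (\<forall>\<^sub>F j in tails. ev (\<iota> j) n c (t j) = l)" for l
   by (rule eventually_subst) (use a in \<open>auto simp: gs_sel elim: eventually_mono\<close>)
  then show "lv n c s = lv n c t" by (simp add: lv_def)
 qed
 have e2: "lv n c s \<in> K L n c" if "c \<in> Obj C" "EQ gs n c s s" for n c s
 proof -
  have "coh n c s" using that by (simp add: gs_sel)
  from lv(2)[OF that(1) this] show ?thesis using ev_closed[OF \<iota>H that(1)] by auto
 qed
 have e3: "lv n c (AD gs n c s t) = pl L n c (lv n c s) (lv n c t)"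
  if c: "c \<in> Obj C" and st: "EQ gs n c s s" "EQ gs n c t t" for n c s t
 proof (rule lvI)
  have st: "coh n c s" "coh n c t" using st by (simp_all add: gs_sel)
  from lv(1)[OF c st(1)] lv(1)[OF c st(2)] coh_ev[OF st(1) c] coh_ev[OF st(2) c] evF
  show "\<forall>\<^sub>F j in tails. ev (\<iota> j) n c (AD gs n c s t j) = pl L n c (lv n c s) (lv n c t)"
   by eventually_elim (simp add: gs_sel ev_pl[OF \<iota>H c])
 qed
 have e4: "lv n c (SM gs n c a s) = sm L n c a (lv n c s)"
  if c: "c \<in> Obj C" and s: "EQ gs n c s s" and a: "a \<in> \<R> c" for n c a s
 proof (rule lvI)
  have s: "coh n c s" using s by (simp add: gs_sel)
  from lv(1)[OF c s] coh_ev[OF s c] evF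
  show "\<forall>\<^sub>F j in tails. ev (\<iota> j) n c (SM gs n c a s j) = sm L n c a (lv n c s)"
   by eventually_elim (simp add: gs_sel ev_sm[OF \<iota>H c a])
 qed
 have e5: "lv (n - 1) c (BD gs n c s) = bd L n c (lv n c s)" if c: "c \<in> Obj C" and s: "EQ gs n c s s" for n c s
 proof (rule lvI)
  have s: "coh n c s" using s by (simp add: gs_sel)
  from lv(1)[OF c s] coh_ev[OF s c] evF
  show "\<forall>\<^sub>F j in tails. ev (\<iota> j) (n - 1) c (BD gs n c s j) = bd L n c (lv n c s)"
   by eventually_elim (simp add: gs_sel ev_bd[OF \<iota>H c])
 qed
 have e6: "lv n (Dom C f) (RS gs n f s) = rs L n f (lv n (Cod C f) s)" if f: "f \<in> Arr C" and s: "EQ gs n (Cod C f) s s" for n f s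
 proof (rule lvI)
  have s: "coh n (Cod C f) s" using s by (simp add: gs_sel)
  from lv(1)[OF Cod_closed[OF f] s] coh_ev[OF s Cod_closed[OF f]] evF
  show "\<forall>\<^sub>F j in tails. ev (\<iota> j) n (Dom C f) (RS gs n f s j) = rs L n f (lv n (Cod C f) s)"
   by eventually_elim (simp add: gs_sel ev_rs[OF \<iota>H f])
 qed
 let ?k = "G.out L lv"
 have kH: "?k \<in> Hom ch G.obj L" by (rule G.out_map(1)[OF LO]) (rule e1 e2 e3 e4 e5 e6; assumption)+
 have kE: "ev ?k n c (G.em n c s) = lv n c s" if "c \<in> Obj C" "EQ gs n c s s" for n c s
  by (rule G.out_map(2)[OF LO]) (rule e1 e2 e3 e4 e5 e6 that; assumption)+
 obtain h where h: "h \<in> Hom ch L G.obj" "!!j. j \<in> Field r ==> h \<star> \<iota> j = tr j"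
  using colimit_cocone_ex[OF cl tr_cocone] by auto
 have "?k \<star> h = Idn ch L"
 proof (rule colimit_cocone_eq[OF cl])
  show "cocone (ord_cat r) ch Fo Fa L \<iota>" using cl by (simp add: colimit_cocone_def)
  show "?k \<star> h \<in> Hom ch L L" "Idn ch L \<in> Hom ch L L" using Cmp_in_Hom_ch[OF h(1) kH] LO by auto
  fix i assume "i \<in> Obj (ord_cat r)"
  then have i: "i \<in> Field r" by simp
  show "Idn ch L \<star> \<iota> i = \<iota> i" by (rule ch.Cmp_Idn_left[OF \<iota>H[OF i]])
  have "?k \<star> tr i = \<iota> i"
  proof (rule arr_eqI[OF Cmp_in_Hom_ch[OF tr_map(1)[OF i] kH] \<iota>H[OF i]])
   fix n c x assume c: "c \<in> Obj C" and x: "x \<in> K (Fo i) n c"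
   have "lv n c (\<lambda>j. ev (Fa (i, j)) n c x) = ev (\<iota> i) n c x"
    by (rule lvI) (use eventually_mono[OF ev_ge[OF i] ev_\<iota>c[OF _ c x]] in simp)
   then show "ev (?k \<star> tr i) n c x = ev (\<iota> i) n c x"
    using ev_Cmp[OF tr_map(1)[OF i] kH c x] tr_map(2)[OF i c x] kE[OF c, of n "\<lambda>j. ev (Fa (i, j)) n c x"] coh_trace[OF i x]
    by (simp add: gs_sel)
  qed
  then show "(?k \<star> h) \<star> \<iota> i = \<iota> i" using ch.Cmp_assoc[OF \<iota>H[OF i] h(1) kH] h(2)[OF i] by simp
 qed
 then have e: "ev ?k n c (ev h n c l) = l" using ev_Cmp[OF h(1) kH c l] c l by simp
 obtain s where s: "EQ gs n c s s" "ev h n c l = G.em n c s" using G.K_objD[OF ev_closed[OF h(1) c l]] by blast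
 have "coh n c s" using s(1) by (simp add: gs_sel)
 then show ?thesis using lv(2)[OF c, of n s] kE[OF c s(1)] e s(2) by simp
qed

end

section \<open>Smallness of the sources of the generating maps\<close>

context psh_setup begin

text \<open>The empty set serves as \<open>B\<close> in the smallness proofs: the filtered ordinals
  are then all nonempty limit ordinals, so maps are factored through a stage for every small
  sequence of limit length.\<close>

lemma cardSuc_empty: "cardSuc |{} :: 'u set| <o \<mu>"
proof -
 have "cardSuc |{} :: 'u set| \<le>o natLeq"
  by (rule cardSuc_least[OF card_of_Card_order natLeq_Card_order]) (simp add: finite_iff_ordLess_natLeq[symmetric])
 then show ?thesis using U unfolding universe_def by (meson ordLeq_ordLess_trans)
qed

lemma dseqI:
 assumes "small \<mu> (Field r)" "sequence_in ch Q r Fo Fa" "colimit_cocone (ord_cat r) ch Fo Fa L \<iota>"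
 shows "dseq C \<mu> R S r Fo Fa L \<iota>"
 using assms by unfold_locales (auto simp: sequence_in_def)

lemma small_Zc: "small_rel \<mu> ch Q Zc"
 unfolding small_rel_def kappa_small_rel_def
proof (intro conjI exI[of _ "{}"] allI impI Zc_Obj cardSuc_empty, goal_cases)
 case (1 r Fo Fa L \<iota>)
 then interpret D: dseq C \<mu> R S r Fo Fa L \<iota> by (intro dseqI) auto
 obtain b where b: "b \<in> Field r" using D.ne by blast
 have "\<exists>i\<in>Field r. \<exists>h\<in>Hom ch Zc (Fo i). \<iota> i \<star> h = g" if g: "g \<in> Hom ch Zc L" for g
 proof -
  note z = zero_map[OF D.FO[OF b]]
  show ?thesis using b z zero_map_unique[OF Cmp_in_Hom_ch[OF z D.\<iota>H[OF b]] g] by blast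
 qed
 then show ?case by blast
next
 case (2 r Fo Fa L \<iota>)
 then interpret D: dseq C \<mu> R S r Fo Fa L \<iota> by (intro dseqI) auto
 show ?case
 proof (intro ballI impI)
  fix i i' h h' assume i: "i \<in> Field r" "i' \<in> Field r" and h: "h \<in> Hom ch Zc (Fo i)" "h' \<in> Hom ch Zc (Fo i')"
  obtain j where j: "(i, j) \<in> r" "(i', j) \<in> r" using D.upper[OF i] by blast
  then show "\<exists>j. (i, j) \<in> r & (i', j) \<in> r & Fa (i, j) \<star> h = Fa (i', j) \<star> h'"
   using zero_map_unique[OF Cmp_in_Hom_ch[OF h(1) D.FH[OF j(1)]] Cmp_in_Hom_ch[OF h(2) D.FH[OF j(2)]]] by blast
 qed
qed

text \<open>A map from a sphere is a cycle of the colimit. The section comes from some stage, and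
  its boundary, being zero in the colimit, is already zero at a later stage, where the section
  becomes a cycle.\<close>

lemma small_Sp: assumes c: "c \<in> Obj C" shows "small_rel \<mu> ch Q (Sp c n)"
 unfolding small_rel_def kappa_small_rel_def
proof (intro conjI exI[of _ "{}"] allI impI Sp_Obj[OF c] cardSuc_empty, goal_cases)
 note e = \<eta>_K(1)[OF c, of n]
 case (1 r Fo Fa L \<iota>)
 then interpret D: dseq C \<mu> R S r Fo Fa L \<iota> by (intro dseqI) auto
 have "\<exists>i\<in>Field r. \<exists>h\<in>Hom ch (Sp c n) (Fo i). \<iota> i \<star> h = g" if g: "g \<in> Hom ch (Sp c n) L" for g
 proof -
  obtain i x where i: "i \<in> Field r" and x: "x \<in> K (Fo i) n c" "ev g n c (\<eta> c) = ev (\<iota> i) n c x"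
   using D.colimit_elem[OF c ev_closed[OF g c e]] by blast
  note iH = D.\<iota>H[OF i] and X = D.FO[OF i]
  have "ev (\<iota> i) (n - 1) c (bd (Fo i) n c x) = ev (\<iota> i) (n - 1) c (zr (Fo i) (n - 1) c)"
   using ev_bd[OF iH c x(1)] ev_zr[OF iH c] sphere_cycle[OF c g] x(2) by simp
  from D.colimit_eq[OF i c _ _ this] X c x(1)
  obtain j where j: "(i, j) \<in> r" and z: "ev (Fa (i, j)) (n - 1) c (bd (Fo i) n c x) = ev (Fa (i, j)) (n - 1) c (zr (Fo i) (n - 1) c)"
   by auto
  note F = D.FH[OF j] and jF = D.r_Field(2)[OF j]
  have "bd (Fo j) n c (ev (Fa (i, j)) n c x) = zr (Fo j) (n - 1) c" using z ev_bd[OF F c x(1)] ev_zr[OF F c] by simp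
  then obtain h where h: "h \<in> Hom ch (Sp c n) (Fo j)" "ev h n c (\<eta> c) = ev (Fa (i, j)) n c x"
   using sphere_map[OF c D.FO[OF jF] ev_closed[OF F c x(1)]] by blast
  have "\<iota> j \<star> h = g"
   by (rule sphere_eq[OF c Cmp_in_Hom_ch[OF h(1) D.\<iota>H[OF jF]] g])
    (use ev_Cmp[OF h(1) D.\<iota>H[OF jF] c e] h(2) D.ev_\<iota>c[OF j c x(1)] x(2) in simp)
  then show ?thesis using jF h(1) by blast
 qed
 then show ?case by blast
next
 note e = \<eta>_K(1)[OF c, of n]
 case (2 r Fo Fa L \<iota>)
 then interpret D: dseq C \<mu> R S r Fo Fa L \<iota> by (intro dseqI) auto
 show ?case
 proof (intro ballI impI)
  fix i i' h h' assume i: "i \<in> Field r" "i' \<in> Field r" and h: "h \<in> Hom ch (Sp c n) (Fo i)" "h' \<in> Hom ch (Sp c n) (Fo i')"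
   and q: "\<iota> i \<star> h = \<iota> i' \<star> h'"
  obtain k where kF: "k \<in> Field r" and k: "(i, k) \<in> r" "(i', k) \<in> r" using D.upper[OF i] by blast
  note x = ev_closed[OF h(1) c e] and y = ev_closed[OF h(2) c e]
  have "ev (\<iota> k) n c (ev (Fa (i, k)) n c (ev h n c (\<eta> c))) = ev (\<iota> k) n c (ev (Fa (i', k)) n c (ev h' n c (\<eta> c)))"
   using D.ev_\<iota>c[OF k(1) c x] D.ev_\<iota>c[OF k(2) c y] ev_Cmp[OF h(1) D.\<iota>H[OF i(1)] c e] ev_Cmp[OF h(2) D.\<iota>H[OF i(2)] c e] q by simp
  from D.colimit_eq[OF kF c ev_closed[OF D.FH[OF k(1)] c x] ev_closed[OF D.FH[OF k(2)] c y] this]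
  obtain j where kj: "(k, j) \<in> r" and w: "ev (Fa (k, j)) n c (ev (Fa (i, k)) n c (ev h n c (\<eta> c))) = ev (Fa (k, j)) n c (ev (Fa (i', k)) n c (ev h' n c (\<eta> c)))"
   by blast
  have j: "(i, j) \<in> r" "(i', j) \<in> r" using D.wof(2) k kj by blast+
  have "Fa (i, j) \<star> h = Fa (i', j) \<star> h'"
   by (rule sphere_eq[OF c Cmp_in_Hom_ch[OF h(1) D.FH[OF j(1)]] Cmp_in_Hom_ch[OF h(2) D.FH[OF j(2)]]])
    (use w D.ev_Fc[OF k(1) kj c x] D.ev_Fc[OF k(2) kj c y] ev_Cmp[OF h(1) D.FH[OF j(1)] c e] ev_Cmp[OF h(2) D.FH[OF j(2)] c e] in simp)
  then show "\<exists>j. (i, j) \<in> r & (i', j) \<in> r & Fa (i, j) \<star> h = Fa (i', j) \<star> h'" using j by blast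
 qed
qed

end

context psh_setup begin

subsection \<open>Properness\<close>

context
 fixes f u v q A B X Y and P :: "('o, 'a, 'r, 'u) psh_cplx"
 assumes f: "f \<in> Hom ch X Y" and u: "u \<in> Hom ch B Y" and v: "v \<in> Hom ch P X" and q: "q \<in> Hom ch P B"
  and pb: "is_pullback ch f u v q"
begin

lemma pullback_comm: "c \<in> Obj C ==> p \<in> K P n c ==> ev f n c (ev v n c p) = ev u n c (ev q n c p)"
 using pb ev_Cmp[OF v f, of c p n] ev_Cmp[OF q u, of c p n] by (simp add: is_pullback_def)

lemma pullback_ex1:
 assumes v': "v' \<in> Hom ch Z X" and q': "q' \<in> Hom ch Z B" and e: "f \<star> v' = u \<star> q'"
 shows "\<exists>!h. h \<in> Hom ch Z P & v \<star> h = v' & q \<star> h = q'"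
proof -
 note H = HomD[OF f] HomD[OF u] HomD[OF v] HomD[OF q] HomD[OF v'] HomD[OF q']
 from pb have "\<forall>v' \<in> Arr ch. \<forall>q' \<in> Arr ch.
    Cod ch v' = Dom ch f & Cod ch q' = Dom ch u & Dom ch v' = Dom ch q' & f \<star> v' = u \<star> q' -->
    (\<exists>!h. h \<in> Hom ch (Dom ch q') (Dom ch q) & v \<star> h = v' & q \<star> h = q')"
  by (simp add: is_pullback_def)
 from bspec[OF bspec[OF this], of v' q'] show ?thesis using H e by simp
qed

text \<open>Sections in degree \<open>n\<close> are maps from the disk whose top degree is
  \<open>n\<close>, so the universal property is tested on disks; hence the shift by one.\<close>

lemma pullback_elem:
 assumes c: "c \<in> Obj C" and x: "x \<in> K X n c" and b: "b \<in> K B n c" and e: "ev f n c x = ev u n c b"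
 shows "\<exists>p\<in>K P n c. ev v n c p = x & ev q n c p = b"
proof -
 define m where "m = n - 1"
 have n: "n = m + 1" by (simp add: m_def)
 obtain v' where v': "v' \<in> Hom ch (Dk c m) X" "ev v' (m + 1) c (\<eta> c) = x"
  using disk_map[OF c conjunct1[OF Hom_ObjD[OF f]], of x m] x n by blast
 obtain q' where q': "q' \<in> Hom ch (Dk c m) B" "ev q' (m + 1) c (\<eta> c) = b"
  using disk_map[OF c conjunct1[OF Hom_ObjD[OF u]], of b m] b n by blast
 have "f \<star> v' = u \<star> q'"
  by (rule disk_eq[OF c Cmp_in_Hom_ch[OF v'(1) f] Cmp_in_Hom_ch[OF q'(1) u]])
   (use ev_Cmp[OF v'(1) f c \<eta>_K(3)[OF c]] ev_Cmp[OF q'(1) u c \<eta>_K(3)[OF c]] v'(2) q'(2) e n in simp)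
 from pullback_ex1[OF v'(1) q'(1) this] obtain h where h: "h \<in> Hom ch (Dk c m) P" "v \<star> h = v'" "q \<star> h = q'" by blast
 show ?thesis
  by (rule bexI[of _ "ev h (m + 1) c (\<eta> c)"])
   (use ev_Cmp[OF h(1) v c \<eta>_K(3)[OF c]] ev_Cmp[OF h(1) q c \<eta>_K(3)[OF c]] h v' q' n ev_closed[OF h(1) c \<eta>_K(3)[OF c]] in simp_all)
qed

lemma pullback_eq:
 assumes c: "c \<in> Obj C" and p: "p \<in> K P n c" "p' \<in> K P n c" and e: "ev v n c p = ev v n c p'" "ev q n c p = ev q n c p'"
 shows "p = p'"
proof -
 define m where "m = n - 1"
 have n: "n = m + 1" by (simp add: m_def)
 have PO: "P \<in> Obj ch" using Hom_ObjD[OF v] by simp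
 obtain h where h: "h \<in> Hom ch (Dk c m) P" "ev h (m + 1) c (\<eta> c) = p" using disk_map[OF c PO, of p m] p n by blast
 obtain h' where h': "h' \<in> Hom ch (Dk c m) P" "ev h' (m + 1) c (\<eta> c) = p'" using disk_map[OF c PO, of p' m] p n by blast
 note E = ev_Cmp[OF _ _ c \<eta>_K(3)[OF c]]
 have 1: "v \<star> h = v \<star> h'"
  by (rule disk_eq[OF c Cmp_in_Hom_ch[OF h(1) v] Cmp_in_Hom_ch[OF h'(1) v]]) (use E[OF h(1) v] E[OF h'(1) v] h h' e n in simp)
 have 2: "q \<star> h = q \<star> h'"
  by (rule disk_eq[OF c Cmp_in_Hom_ch[OF h(1) q] Cmp_in_Hom_ch[OF h'(1) q]]) (use E[OF h(1) q] E[OF h'(1) q] h h' e n in simp)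
 have "f \<star> (v \<star> h) = u \<star> (q \<star> h)"
  using ch.Cmp_assoc[OF h(1) v f] ch.Cmp_assoc[OF h(1) q u] pb by (simp add: is_pullback_def)
 from pullback_ex1[OF Cmp_in_Hom_ch[OF h(1) v] Cmp_in_Hom_ch[OF h(1) q] this] have "h = h'" using h(1) h'(1) 1 2 by auto
 then show ?thesis using h(2) h'(2) by simp
qed

lemma pullback_wq:
 assumes w: "wq X Y f" and su: "!!n c y. c \<in> Obj C ==> y \<in> K Y n c ==> \<exists>b\<in>K B n c. ev u n c b = y"
 shows "wq P B q"
 unfolding wq_def
proof (intro allI ballI conjI impI)
 have XO: "X \<in> Obj ch" "Y \<in> Obj ch" "B \<in> Obj ch" "P \<in> Obj ch" using Hom_ObjD[OF f] Hom_ObjD[OF q] by auto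
 fix n c assume c: "c \<in> Obj C"
 have w1: "\<exists>t\<in>K X (n + 1) c. x = bd X (n + 1) c t" if "x \<in> K X n c" "bd X n c x = zr X (n - 1) c" "y \<in> K Y (n + 1) c" "ev f n c x = bd Y (n + 1) c y" for x y
  using w c that unfolding wq_def by blast
 have w2: "\<exists>x\<in>K X n c. bd X n c x = zr X (n - 1) c & (\<exists>t\<in>K Y (n + 1) c. y = pl Y n c (bd Y (n + 1) c t) (ev f n c x))"
  if "y \<in> K Y n c" "bd Y n c y = zr Y (n - 1) c" for n y using w c that unfolding wq_def by blast
 note cl = XO c ev_closed[OF f c] ev_closed[OF u c] ev_closed[OF v c] ev_closed[OF q c]
 {
  fix p assume p: "p \<in> K P n c" "bd P n c p = zr P (n - 1) c" and "\<exists>b\<in>K B (n + 1) c. ev q n c p = bd B (n + 1) c b"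
  then obtain b where b: "b \<in> K B (n + 1) c" "ev q n c p = bd B (n + 1) c b" by blast
  have ub: "ev u (n + 1) c b \<in> K Y (n + 1) c" using ev_closed[OF u c b(1)] .
  have bdu: "ev f n c (ev v n c p) = bd Y (n + 1) c (ev u (n + 1) c b)"
   using pullback_comm[OF c p(1)] b ev_bd[OF u c b(1)] by simp
  obtain x1 where x1: "x1 \<in> K X (n + 1) c" "ev v n c p = bd X (n + 1) c x1"
   using w1[OF ev_closed[OF v c p(1)] _ ub bdu] ev_bd[OF v c p(1)] p(2) ev_zr[OF v c] by auto
  have fx: "ev f (n + 1) c x1 \<in> K Y (n + 1) c" using ev_closed[OF f c x1(1)] .
  \<comment> \<open>The images in \<open>Y\<close> of \<open>x1\<close> and \<open>b\<close> differ
    by a cycle, which is the boundary of some \<open>t\<close> plus the image of a cycle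
    \<open>z\<close>. Subtracting \<open>z\<close> from \<open>x1\<close> and adding to
    \<open>b\<close> the boundary of a lift of \<open>t\<close> makes the images agree, so the
    corrected pair is a section of the pullback.\<close>
  let ?y = "pl Y (n + 1) c (ev f (n + 1) c x1) (ng Y (n + 1) c (ev u (n + 1) c b))"
  have "bd Y (n + 1) c ?y = zr Y (n + 1 - 1) c"
   using fx ub XO c bd_pl[OF XO(2) c fx, of "ng Y (n + 1) c (ev u (n + 1) c b)"] bd_ng[OF XO(2) c ub] ev_bd[OF f c x1(1)] x1(2) bdu by simp
  from w2[OF _ this] obtain z t where z: "z \<in> K X (n + 1) c" "bd X (n + 1) c z = zr X n c" and t: "t \<in> K Y (n + 1 + 1) c"
    and y: "?y = pl Y (n + 1) c (bd Y (n + 1 + 1) c t) (ev f (n + 1) c z)"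
   using fx ub XO c by auto
  obtain b' where b': "b' \<in> K B (n + 1 + 1) c" "ev u (n + 1 + 1) c b' = t" using su[OF c t] by blast
  let ?x = "pl X (n + 1) c x1 (ng X (n + 1) c z)" and ?b = "pl B (n + 1) c b (bd B (n + 1 + 1) c b')"
  have bb: "bd B (n + 1 + 1) c b' \<in> K B (n + 1) c" using b' XO c by simp
  have bt: "bd Y (n + 1 + 1) c t \<in> K Y (n + 1) c" using t XO c by simp
  have fz: "ev f (n + 1) c z \<in> K Y (n + 1) c" using ev_closed[OF f c z(1)] .
  have x: "?x \<in> K X (n + 1) c" and b1: "?b \<in> K B (n + 1) c" using x1 z b bb XO c by simp_all
  have "ev f (n + 1) c ?x = pl Y (n + 1) c (ev f (n + 1) c x1) (ng Y (n + 1) c (ev f (n + 1) c z))"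
   using x1 z XO c by (simp add: ev_pl[OF f] ev_ng[OF f])
  also have "ev f (n + 1) c x1 = pl Y (n + 1) c (ev u (n + 1) c b) ?y"
   using fx ub XO c by (simp add: pl_lcomm)
  also have "pl Y (n + 1) c (pl Y (n + 1) c (ev u (n + 1) c b) ?y) (ng Y (n + 1) c (ev f (n + 1) c z)) =
    pl Y (n + 1) c (ev u (n + 1) c b) (bd Y (n + 1 + 1) c t)"
   unfolding y using ub bt fz XO c by (simp add: pl_assoc)
  also have "\<dots> = ev u (n + 1) c ?b"
   using ev_pl[OF u c b(1) bb] ev_bd[OF u c b'(1)] b'(2) by (simp only: add_diff_cancel_right')
  finally obtain w where w: "w \<in> K P (n + 1) c" "ev v (n + 1) c w = ?x" "ev q (n + 1) c w = ?b"
   using pullback_elem[OF c x b1] by blast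
  have "p = bd P (n + 1) c w"
  proof (rule pullback_eq[OF c p(1)])
   show "bd P (n + 1) c w \<in> K P n c" using w XO c by simp
   show "ev v n c p = ev v n c (bd P (n + 1) c w)"
    using ev_bd[OF v c w(1)] w(2) x1 z XO c bd_pl[OF XO(1) c x1(1), of "ng X (n + 1) c z"] bd_ng[OF XO(1) c z(1)] by simp
   show "ev q n c p = ev q n c (bd P (n + 1) c w)"
    using ev_bd[OF q c w(1)] w(3) b bb b' XO c bd_pl[OF XO(3) c b(1) bb] by simp
  qed
  then show "\<exists>w\<in>K P (n + 1) c. p = bd P (n + 1) c w" using w(1) by blast
 next
  fix b assume b: "b \<in> K B n c" "bd B n c b = zr B (n - 1) c"
  note ub = ev_closed[OF u c b(1)]
  have "bd Y n c (ev u n c b) = zr Y (n - 1) c" using ev_bd[OF u c b(1)] b(2) ev_zr[OF u c] by simp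
  from w2[OF ub this] obtain x t where x: "x \<in> K X n c" "bd X n c x = zr X (n - 1) c" and t: "t \<in> K Y (n + 1) c"
   "ev u n c b = pl Y n c (bd Y (n + 1) c t) (ev f n c x)" by blast
  obtain b' where b': "b' \<in> K B (n + 1) c" "ev u (n + 1) c b' = t" using su[OF c t(1)] by blast
  have bb: "bd B (n + 1) c b' \<in> K B n c" and bt: "bd Y (n + 1) c t \<in> K Y n c" using b' t XO c by simp_all
  note fx = ev_closed[OF f c x(1)]
  \<comment> \<open>Subtracting the boundary of a lift of \<open>t\<close> makes the image of
    \<open>b\<close> in \<open>Y\<close> equal to that of \<open>x\<close>.\<close>
  let ?b = "pl B n c (ng B n c (bd B (n + 1) c b')) b"
  have b1: "?b \<in> K B n c" using bb b XO c by simp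
  have "ev u n c ?b = pl Y n c (ng Y n c (bd Y (n + 1) c t)) (ev u n c b)"
   using bb b XO c ev_bd[OF u c b'(1)] b'(2) by (simp add: ev_pl[OF u] ev_ng[OF u])
  also have "\<dots> = ev f n c x" unfolding t(2) using bt fx XO c by simp
  finally obtain p where p: "p \<in> K P n c" "ev v n c p = x" "ev q n c p = ?b" using pullback_elem[OF c x(1) b1] by metis
  have "bd P n c p = zr P (n - 1) c"
  proof (rule pullback_eq[OF c])
   show "bd P n c p \<in> K P (n - 1) c" "zr P (n - 1) c \<in> K P (n - 1) c" using p XO c by simp_all
   show "ev v (n - 1) c (bd P n c p) = ev v (n - 1) c (zr P (n - 1) c)" using ev_bd[OF v c p(1)] p(2) x(2) ev_zr[OF v c] by simp
   show "ev q (n - 1) c (bd P n c p) = ev q (n - 1) c (zr P (n - 1) c)"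
    using ev_bd[OF q c p(1)] p(3) ev_zr[OF q c] bd_pl[OF XO(3) c, of "ng B n c (bd B (n + 1) c b')" n b]
     bd_ng[OF XO(3) c bb] bb b b' XO c by simp
  qed
  moreover have "b = pl B n c (bd B (n + 1) c b') (ev q n c p)" unfolding p(3) using bb b XO c by simp
  ultimately show "\<exists>p\<in>K P n c. bd P n c p = zr P (n - 1) c & (\<exists>t\<in>K B (n + 1) c. b = pl B n c (bd B (n + 1) c t) (ev q n c p))"
   using p(1) b'(1) by blast
 }
qed

end

lemma right_proper_ch: "right_proper ch \<W> \<F>"
 unfolding right_proper_def
proof (intro allI impI, elim conjE)
 fix f u v q assume fW: "f \<in> \<W>" and uF: "u \<in> \<F>" and pb: "is_pullback ch f u v q"
 let ?X = "Dom ch f" and ?Y = "Cod ch f" and ?B = "Dom ch u" and ?P = "Dom ch q"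
 have H: "f \<in> Hom ch ?X ?Y" "u \<in> Hom ch ?B ?Y" "v \<in> Hom ch ?P ?X" "q \<in> Hom ch ?P ?B"
  using pb by (auto simp: is_pullback_def Hom_def)
 have "wq ?P ?B q"
  by (rule pullback_wq[OF H pb]) (use fW uF homology_isos_iff[OF H(1)] levelwise_iff[OF H(2)] in blast)+
 then show "q \<in> \<W>" using homology_isos_iff[OF H(4)] by blast
qed

text \<open>The explicit pushout: the quotient of the direct sum of \<open>X\<close> and
  \<open>B\<close> by the elements \<open>(f a, - u a)\<close>.\<close>

definition po_sd :: "('o, 'a, 'r, 'u) psh_cplx => ('o, 'a, 'r, 'u) psh_cplx => ('o, 'a, 'r, 'u) psh_cplx =>
  ('o, 'a, 'r, 'u) psh_cplx_arr => ('o, 'a, 'r, 'u) psh_cplx_arr => ('o, 'a, 'r, 'u \<times> 'u) sd" where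
 "po_sd A X B f u = \<lparr>EQ = (\<lambda>n c p q. c \<in> Obj C & fst p \<in> K X n c & snd p \<in> K B n c & fst q \<in> K X n c & snd q \<in> K B n c &
   (\<exists>a\<in>K A n c. fst p = pl X n c (fst q) (ev f n c a) & snd q = pl B n c (snd p) (ev u n c a))),
  AD = (\<lambda>n c p q. (pl X n c (fst p) (fst q), pl B n c (snd p) (snd q))),
  ZR = (\<lambda>n c. (zr X n c, zr B n c)), NG = (\<lambda>n c p. (ng X n c (fst p), ng B n c (snd p))),
  SM = (\<lambda>n c a p. (sm X n c a (fst p), sm B n c a (snd p))),
  RS = (\<lambda>n f p. (rs X n f (fst p), rs B n f (snd p))),
  BD = (\<lambda>n c p. (bd X n c (fst p), bd B n c (snd p)))\<rparr>"

context
 fixes f u v q A B X and P :: "('o, 'a, 'r, 'u) psh_cplx"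
 assumes f: "f \<in> Hom ch A X" and u: "u \<in> Hom ch A B" and v: "v \<in> Hom ch X P" and q: "q \<in> Hom ch B P"
  and po: "is_pushout ch f u v q"
begin

lemma po_O: "A \<in> Obj ch" "X \<in> Obj ch" "B \<in> Obj ch" "P \<in> Obj ch"
 using Hom_ObjD[OF f] Hom_ObjD[OF q] by auto

abbreviation PS where "PS \<equiv> po_sd A X B f u"

lemma PS_sel: "EQ PS n c s t \<longleftrightarrow> c \<in> Obj C & fst s \<in> K X n c & snd s \<in> K B n c & fst t \<in> K X n c & snd t \<in> K B n c &
   (\<exists>a\<in>K A n c. fst s = pl X n c (fst t) (ev f n c a) & snd t = pl B n c (snd s) (ev u n c a))"
 "AD PS n c s t = (pl X n c (fst s) (fst t), pl B n c (snd s) (snd t))"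
 "ZR PS n c = (zr X n c, zr B n c)" "NG PS n c s = (ng X n c (fst s), ng B n c (snd s))"
 "SM PS n c b s = (sm X n c b (fst s), sm B n c b (snd s))"
 "RS PS n h s = (rs X n h (fst s), rs B n h (snd s))"
 "BD PS n c s = (bd X n c (fst s), bd B n c (snd s))"
 by (simp_all add: po_sd_def)

lemma PS_I: "c \<in> Obj C ==> a \<in> K A n c ==> x' \<in> K X n c ==> y \<in> K B n c ==> x = pl X n c x' (ev f n c a) ==>
  y' = pl B n c y (ev u n c a) ==> EQ PS n c (x, y) (x', y')"
 using ev_closed[OF f] ev_closed[OF u] po_O by (auto simp: PS_sel)

lemma PS_refl: "c \<in> Obj C ==> x \<in> K X n c ==> y \<in> K B n c ==> x = x' ==> y = y' ==> EQ PS n c (x, y) (x', y')"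
 by (rule PS_I[of c "zr A n c"]) (use ev_zr[OF f] ev_zr[OF u] po_O in simp_all)

lemma PS_E:
 assumes "EQ PS n c s t"
 obtains x y a where "c \<in> Obj C" "x \<in> K X n c" "y \<in> K B n c" "a \<in> K A n c"
  "s = (pl X n c x (ev f n c a), y)" "t = (x, pl B n c y (ev u n c a))"
 using assms by (cases s; cases t) (auto simp: PS_sel)

lemma PS_rE:
 assumes "EQ PS n c s s" obtains x y where "c \<in> Obj C" "x \<in> K X n c" "y \<in> K B n c" "s = (x, y)"
 using assms by (cases s) (auto simp: PS_sel)

lemma sdata_po: "sdata C \<mu> R S PS"
proof
 note cl = ev_closed[OF f] ev_closed[OF u] po_O Dom_closed Cod_closed rres_closed Cmp_Arr
 note ac = pl_assoc pl_comm pl_lcomm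
 note hs = ev_pl[OF f] ev_pl[OF u] ev_ng[OF f] ev_ng[OF u] ev_sm[OF f] ev_sm[OF u] ev_rs[OF f] ev_rs[OF u] ev_bd[OF f] ev_bd[OF u]
 note ls = sm_add sm_pl sm_mult sm_ng rs_pl rs_sm rs_ng rs_rs bd_pl bd_sm bd_ng bd_rs ng_pl
 show "EQ PS n c t s" if "EQ PS n c s t" for n c s t
  using that
 proof (rule PS_E)
  fix x y a assume a: "c \<in> Obj C" "x \<in> K X n c" "y \<in> K B n c" "a \<in> K A n c"
   "s = (pl X n c x (ev f n c a), y)" "t = (x, pl B n c y (ev u n c a))"
  show ?thesis unfolding a(5,6)
   by (rule PS_I[OF a(1), of "ng A n c a"]) (use a(1-4) cl in \<open>simp_all add: hs pl_assoc\<close>)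
 qed
 show "EQ PS n c s w" if "EQ PS n c s t" "EQ PS n c t w" for n c s t w
  using that(1)
 proof (rule PS_E)
  fix x y a assume a: "c \<in> Obj C" "x \<in> K X n c" "y \<in> K B n c" "a \<in> K A n c"
   "s = (pl X n c x (ev f n c a), y)" "t = (x, pl B n c y (ev u n c a))"
  from that(2) show ?thesis
  proof (rule PS_E)
   fix x' y' a' assume b: "x' \<in> K X n c" "y' \<in> K B n c" "a' \<in> K A n c"
    "t = (pl X n c x' (ev f n c a'), y')" "w = (x', pl B n c y' (ev u n c a'))"
   have e: "x = pl X n c x' (ev f n c a')" "y' = pl B n c y (ev u n c a)" using a(6) b(4) by auto
   show ?thesis unfolding a(5) b(5) e
    by (rule PS_I[OF a(1), of "pl A n c a' a"]) (use a(1-4) b(1-3) cl in \<open>simp_all add: hs pl_assoc\<close>,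
     use a(1-4) b(1-3) cl in \<open>simp add: hs ac\<close>)
  qed
 qed
 show "small \<mu> (cls PS n c ` {x. EQ PS n c x x})" if c: "c \<in> Obj C" for n c
 proof (rule small_mono[OF U small_image[OF U small_Sigma[OF U small_K[OF po_O(2) c] small_K[OF po_O(3) c]]]])
  show "cls PS n c ` {x. EQ PS n c x x} \<subseteq> cls PS n c ` (K X n c \<times> K B n c)" by (auto simp: PS_sel)
 qed
 show "EQ PS n c (AD PS n c s t) (AD PS n c s' t')" if "c \<in> Obj C" "EQ PS n c s s'" "EQ PS n c t t'" for n c s s' t t'
  using that(2)
 proof (rule PS_E)
  fix x y a assume a: "c \<in> Obj C" "x \<in> K X n c" "y \<in> K B n c" "a \<in> K A n c"
   "s = (pl X n c x (ev f n c a), y)" "s' = (x, pl B n c y (ev u n c a))"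
  from that(3) show ?thesis
  proof (rule PS_E)
   fix x' y' a' assume b: "x' \<in> K X n c" "y' \<in> K B n c" "a' \<in> K A n c"
    "t = (pl X n c x' (ev f n c a'), y')" "t' = (x', pl B n c y' (ev u n c a'))"
   show ?thesis unfolding a(5,6) b(4,5) PS_sel(2) fst_conv snd_conv
    by (rule PS_I[OF a(1), of "pl A n c a a'"]) (use a(1-4) b(1-3) cl in \<open>simp_all add: hs ac\<close>)
  qed
 qed
 show "EQ PS n c (ZR PS n c) (ZR PS n c)" if "c \<in> Obj C" for n c
  unfolding PS_sel(3) by (rule PS_refl[OF that]) (use that cl in simp_all)
 show "EQ PS n c (NG PS n c s) (NG PS n c s')" if "c \<in> Obj C" "EQ PS n c s s'" for n c s s'
  using that(2)
 proof (rule PS_E)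
  fix x y a assume a: "c \<in> Obj C" "x \<in> K X n c" "y \<in> K B n c" "a \<in> K A n c"
   "s = (pl X n c x (ev f n c a), y)" "s' = (x, pl B n c y (ev u n c a))"
  show ?thesis unfolding a(5,6) PS_sel(4) fst_conv snd_conv
   by (rule PS_I[OF a(1), of "ng A n c a"]) (use a(1-4) cl in \<open>simp_all add: hs ls\<close>)
 qed
 show "EQ PS n c (SM PS n c r s) (SM PS n c r s')" if "c \<in> Obj C" "r \<in> \<R> c" "EQ PS n c s s'" for n c r s s'
  using that(3)
 proof (rule PS_E)
  fix x y a assume a: "c \<in> Obj C" "x \<in> K X n c" "y \<in> K B n c" "a \<in> K A n c"
   "s = (pl X n c x (ev f n c a), y)" "s' = (x, pl B n c y (ev u n c a))"
  show ?thesis unfolding a(5,6) PS_sel(5) fst_conv snd_conv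
   by (rule PS_I[OF a(1), of "sm A n c r a"]) (use a(1-4) that(2) cl in \<open>simp_all add: hs ls\<close>)
 qed
 show "EQ PS n (Dom C h) (RS PS n h s) (RS PS n h s')" if "h \<in> Arr C" "EQ PS n (Cod C h) s s'" for n h s s'
  using that(2)
 proof (rule PS_E)
  fix x y a assume a: "Cod C h \<in> Obj C" "x \<in> K X n (Cod C h)" "y \<in> K B n (Cod C h)" "a \<in> K A n (Cod C h)"
   "s = (pl X n (Cod C h) x (ev f n (Cod C h) a), y)" "s' = (x, pl B n (Cod C h) y (ev u n (Cod C h) a))"
  show ?thesis unfolding a(5,6) PS_sel(6) fst_conv snd_conv
   by (rule PS_I[OF Dom_closed[OF that(1)], of "rs A n h a"]) (use a(1-4) that(1) cl in \<open>simp_all add: hs ls\<close>)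
 qed
 show "EQ PS (n - 1) c (BD PS n c s) (BD PS n c s')" if "c \<in> Obj C" "EQ PS n c s s'" for n c s s'
  using that(2)
 proof (rule PS_E)
  fix x y a assume a: "c \<in> Obj C" "x \<in> K X n c" "y \<in> K B n c" "a \<in> K A n c"
   "s = (pl X n c x (ev f n c a), y)" "s' = (x, pl B n c y (ev u n c a))"
  show ?thesis unfolding a(5,6) PS_sel(7) fst_conv snd_conv
   by (rule PS_I[OF a(1), of "bd A n c a"]) (use a(1-4) cl in \<open>simp_all add: hs ls\<close>)
 qed
qed (insert po_O, (auto elim!: PS_rE intro!: PS_refl simp: PS_sel(2-) pl_assoc pl_comm pl_lcomm sm_add sm_pl sm_mult
  rs_pl rs_sm rs_rs bd_pl bd_sm bd_rs Dom_closed Cod_closed rres_closed Cmp_Arr; fail)+)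

lemma pushout_ex1:
 assumes v': "v' \<in> Hom ch X Z" and q': "q' \<in> Hom ch B Z" and e: "v' \<star> f = q' \<star> u"
 shows "\<exists>!h. h \<in> Hom ch P Z & h \<star> v = v' & h \<star> q = q'"
proof -
 note H = HomD[OF f] HomD[OF u] HomD[OF v] HomD[OF q] HomD[OF v'] HomD[OF q']
 from po have "\<forall>v' \<in> Arr ch. \<forall>q' \<in> Arr ch.
    Dom ch v' = Cod ch f & Dom ch q' = Cod ch u & Cod ch v' = Cod ch q' & v' \<star> f = q' \<star> u -->
    (\<exists>!h. h \<in> Hom ch (Cod ch q) (Cod ch q') & h \<star> v = v' & h \<star> q = q')"
  by (simp add: is_pushout_def)
 from bspec[OF bspec[OF this], of v' q'] show ?thesis using H e by simp
qed

lemma pushout_comm: "c \<in> Obj C ==> a \<in> K A n c ==> ev v n c (ev f n c a) = ev q n c (ev u n c a)"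
 using po ev_Cmp[OF f v, of c a n] ev_Cmp[OF u q, of c a n] by (simp add: is_pushout_def)

text \<open>The given pushout is compared with the explicit quotient. The map \<open>h\<close> to
  the quotient turns an equality in \<open>P\<close> into a relation witnessed by \<open>a\<close>,
  and the map \<open>?k\<close> back satisfies \<open>?k \<star> h = Idn ch P\<close>, so every
  section of \<open>P\<close> comes from a pair.\<close>

lemma pushout_elems:
 assumes c: "c \<in> Obj C"
 shows "p \<in> K P n c ==> \<exists>x\<in>K X n c. \<exists>b\<in>K B n c. p = pl P n c (ev v n c x) (ev q n c b)"
  and "x \<in> K X n c ==> b \<in> K B n c ==> ev v n c x = ev q n c b ==> \<exists>a\<in>K A n c. x = ev f n c a & b = ev u n c a"
proof -
 note OO = po_O
 interpret Q: sdata C \<mu> R S PS by (rule sdata_po)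
 define vX where "vX = Q.into X (\<lambda>n c x. (x, zr B n c))"
 define qB where "qB = Q.into B (\<lambda>n c b. (zr X n c, b))"
 note ps = PS_refl PS_sel(2-)
 have vX: "vX \<in> Hom ch X Q.obj" "!!n c x. c \<in> Obj C ==> x \<in> K X n c ==> ev vX n c x = Q.em n c (x, zr B n c)"
  unfolding vX_def
  by (rule Q.into_map(1)[OF OO(2)]; use OO in \<open>simp add: ps Dom_closed Cod_closed\<close>)
   (rule Q.into_map(2)[OF OO(2)]; use OO in \<open>simp add: ps Dom_closed Cod_closed\<close>)
 have qB: "qB \<in> Hom ch B Q.obj" "!!n c x. c \<in> Obj C ==> x \<in> K B n c ==> ev qB n c x = Q.em n c (zr X n c, x)"
  unfolding qB_def
  by (rule Q.into_map(1)[OF OO(3)]; use OO in \<open>simp add: ps Dom_closed Cod_closed\<close>)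
   (rule Q.into_map(2)[OF OO(3)]; use OO in \<open>simp add: ps Dom_closed Cod_closed\<close>)
 have sq: "vX \<star> f = qB \<star> u"
 proof (rule arr_eqI[OF Cmp_in_Hom_ch[OF f vX(1)] Cmp_in_Hom_ch[OF u qB(1)]])
  fix n c a assume c: "c \<in> Obj C" and a: "a \<in> K A n c"
  note fa = ev_closed[OF f c a] and ua = ev_closed[OF u c a]
  have "EQ PS n c (ev f n c a, zr B n c) (zr X n c, ev u n c a)"
   by (rule PS_I[OF c a]) (use OO c fa ua in simp_all)
  then show "ev (vX \<star> f) n c a = ev (qB \<star> u) n c a"
   using ev_Cmp[OF f vX(1) c a] ev_Cmp[OF u qB(1) c a] vX(2)[OF c fa] qB(2)[OF c ua] Q.em_cong[OF c] by simp
 qed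
 from pushout_ex1[OF vX(1) qB(1) sq] obtain h where h: "h \<in> Hom ch P Q.obj" "h \<star> v = vX" "h \<star> q = qB" by blast
 have hv: "ev h n c (ev v n c x) = Q.em n c (x, zr B n c)" if "c \<in> Obj C" "x \<in> K X n c" for n c x
  using ev_Cmp[OF v h(1) that] h(2) vX(2)[OF that] by simp
 have hq: "ev h n c (ev q n c x) = Q.em n c (zr X n c, x)" if "c \<in> Obj C" "x \<in> K B n c" for n c x
  using ev_Cmp[OF q h(1) that] h(3) qB(2)[OF that] by simp
 show "\<exists>a\<in>K A n c. x = ev f n c a & b = ev u n c a" if x: "x \<in> K X n c" and b: "b \<in> K B n c" and e: "ev v n c x = ev q n c b"
 proof -
  have "Q.em n c (x, zr B n c) = Q.em n c (zr X n c, b)" using hv[OF c x] hq[OF c b] e by simp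
  then have "EQ PS n c (x, zr B n c) (zr X n c, b)"
   using Q.em_eq[OF c PS_refl[OF c x, of "zr B n c"] PS_refl[OF c, of "zr X n c" n b]] OO c x b by simp
  then show ?thesis using ev_closed[OF f c] ev_closed[OF u c] OO c by (auto simp: PS_sel)
 qed
 define \<phi> where "\<phi> n c s = pl P n c (ev v n c (fst s)) (ev q n c (snd s))" for n c s
 note vq = ev_closed[OF v] ev_closed[OF q] ev_closed[OF f] ev_closed[OF u]
 have 1: "\<phi> n c s = \<phi> n c t" if "c \<in> Obj C" "EQ PS n c s t" for n c s t
  using that(2)
 proof (rule PS_E)
  fix x y a assume a: "c \<in> Obj C" "x \<in> K X n c" "y \<in> K B n c" "a \<in> K A n c"
   "s = (pl X n c x (ev f n c a), y)" "t = (x, pl B n c y (ev u n c a))"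
  show ?thesis unfolding a(5,6) \<phi>_def fst_conv snd_conv
   using a(1-4) vq OO by (simp add: ev_pl[OF v] ev_pl[OF q] pushout_comm pl_assoc pl_comm pl_lcomm)
 qed
 have 2: "\<phi> n c s \<in> K P n c" if "c \<in> Obj C" "EQ PS n c s s" for n c s
  using that vq OO by (auto simp: \<phi>_def PS_sel)
 have 3: "\<phi> n c (AD PS n c s t) = pl P n c (\<phi> n c s) (\<phi> n c t)" if "c \<in> Obj C" "EQ PS n c s s" "EQ PS n c t t" for n c s t
 proof -
  have "fst s \<in> K X n c" "snd s \<in> K B n c" "fst t \<in> K X n c" "snd t \<in> K B n c" using that by (simp_all add: PS_sel)
  then show ?thesis using that(1) vq OO by (simp add: \<phi>_def PS_sel(2) ev_pl[OF v] ev_pl[OF q] pl_assoc pl_comm pl_lcomm)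
 qed
 have 4: "\<phi> n c (SM PS n c r s) = sm P n c r (\<phi> n c s)" if "c \<in> Obj C" "EQ PS n c s s" "r \<in> \<R> c" for n c r s
 proof -
  have "fst s \<in> K X n c" "snd s \<in> K B n c" using that by (simp_all add: PS_sel)
  then show ?thesis using that(1,3) vq OO by (simp add: \<phi>_def PS_sel(5) ev_sm[OF v] ev_sm[OF q] sm_pl)
 qed
 have 5: "\<phi> (n - 1) c (BD PS n c s) = bd P n c (\<phi> n c s)" if "c \<in> Obj C" "EQ PS n c s s" for n c s
 proof -
  have "fst s \<in> K X n c" "snd s \<in> K B n c" using that by (simp_all add: PS_sel)
  then show ?thesis using that(1) vq OO by (simp add: \<phi>_def PS_sel(7) ev_bd[OF v] ev_bd[OF q] bd_pl)
 qed
 have 6: "\<phi> n (Dom C g) (RS PS n g s) = rs P n g (\<phi> n (Cod C g) s)" if "g \<in> Arr C" "EQ PS n (Cod C g) s s" for n g s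
 proof -
  have "fst s \<in> K X n (Cod C g)" "snd s \<in> K B n (Cod C g)" "Cod C g \<in> Obj C" using that by (simp_all add: PS_sel)
  then show ?thesis using that(1) vq OO by (simp add: \<phi>_def PS_sel(6) ev_rs[OF v] ev_rs[OF q] rs_pl)
 qed
 let ?k = "Q.out P \<phi>"
 have kH: "?k \<in> Hom ch Q.obj P" by (rule Q.out_map(1)[OF OO(4)]) (rule 1 2 3 4 5 6; assumption)+
 have kE: "ev ?k n c (Q.em n c s) = \<phi> n c s" if "c \<in> Obj C" "EQ PS n c s s" for n c s
  by (rule Q.out_map(2)[OF OO(4)]) (rule 1 2 3 4 5 6 that; assumption)+
 have kv: "ev ?k n c (Q.em n c (x, zr B n c)) = ev v n c x" if "c \<in> Obj C" "x \<in> K X n c" for n c x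
  using kE[OF that(1) PS_refl[OF that, of "zr B n c"]] that OO vq ev_zr[OF q] by (simp add: \<phi>_def)
 have kq: "ev ?k n c (Q.em n c (zr X n c, x)) = ev q n c x" if "c \<in> Obj C" "x \<in> K B n c" for n c x
  using kE[OF that(1) PS_refl[OF that(1) _ that(2), of "zr X n c"]] that OO vq ev_zr[OF v] by (simp add: \<phi>_def)
 have kh: "?k \<star> h \<in> Hom ch P P" by (rule Cmp_in_Hom_ch[OF h(1) kH])
 have e1: "(?k \<star> h) \<star> v = v"
  by (rule arr_eqI[OF Cmp_in_Hom_ch[OF v kh] v]) (use ev_Cmp[OF v kh] ev_Cmp[OF h(1) kH] vq hv kv in simp)
 have e2: "(?k \<star> h) \<star> q = q"
  by (rule arr_eqI[OF Cmp_in_Hom_ch[OF q kh] q]) (use ev_Cmp[OF q kh] ev_Cmp[OF h(1) kH] vq hq kq in simp)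
 have "v \<star> f = q \<star> u" using po by (simp add: is_pushout_def)
 from pushout_ex1[OF v q this] have kid: "?k \<star> h = Idn ch P"
  using kh e1 e2 ch.Cmp_Idn_left[OF v] ch.Cmp_Idn_left[OF q] Idn_in_Hom_ch[OF OO(4)] by auto
 show "\<exists>x\<in>K X n c. \<exists>b\<in>K B n c. p = pl P n c (ev v n c x) (ev q n c b)" if p: "p \<in> K P n c"
 proof -
  obtain s where s: "EQ PS n c s s" "ev h n c p = Q.em n c s" using Q.K_objD[OF ev_closed[OF h(1) c p]] by blast
  have "p = \<phi> n c s" using kid ev_Cmp[OF h(1) kH c p] kE[OF c s(1)] s(2) c p by simp
  moreover have "fst s \<in> K X n c" "snd s \<in> K B n c" using s(1) by (simp_all add: PS_sel)
  ultimately show ?thesis unfolding \<phi>_def by blast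
 qed
qed

lemma pushout_wq:
 assumes w: "wq A X f" and ui: "!!n c a a'. c \<in> Obj C ==> a \<in> K A n c ==> a' \<in> K A n c ==> ev u n c a = ev u n c a' ==> a = a'"
 shows "wq B P q"
 unfolding wq_def
proof (intro allI ballI conjI impI)
 note OO = po_O
 fix n c assume c: "c \<in> Obj C"
 have w1: "\<exists>t\<in>K A (n + 1) c. x = bd A (n + 1) c t" if "x \<in> K A n c" "bd A n c x = zr A (n - 1) c" "y \<in> K X (n + 1) c" "ev f n c x = bd X (n + 1) c y" for n x y
  using w c that unfolding wq_def by blast
 have w2: "\<exists>x\<in>K A n c. bd A n c x = zr A (n - 1) c & (\<exists>t\<in>K X (n + 1) c. y = pl X n c (bd X (n + 1) c t) (ev f n c x))"
  if "y \<in> K X n c" "bd X n c y = zr X (n - 1) c" for n y using w c that unfolding wq_def by blast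
 note cl = ev_closed[OF f c] ev_closed[OF u c] ev_closed[OF v c] ev_closed[OF q c]
 note el = pushout_elems[OF c]
 \<comment> \<open>Injectivity of \<open>u\<close> lets the cycle condition descend from
   \<open>B\<close> to \<open>A\<close>.\<close>
 have ucyc: "bd A m c a = zr A (m - 1) c" if "a \<in> K A m c" "bd B m c (ev u m c a) = zr B (m - 1) c" for a m
  by (rule ui[OF c, of _ "m - 1"]) (use that OO c ev_bd[OF u c that(1)] ev_zr[OF u c] in simp_all)
 {
  fix b assume b: "b \<in> K B n c" "bd B n c b = zr B (n - 1) c" and "\<exists>p\<in>K P (n + 1) c. ev q n c b = bd P (n + 1) c p"
  then obtain p where p: "p \<in> K P (n + 1) c" "ev q n c b = bd P (n + 1) c p" by blast
  obtain x1 b1 where x1: "x1 \<in> K X (n + 1) c" and b1: "b1 \<in> K B (n + 1) c" and pe: "p = pl P (n + 1) c (ev v (n + 1) c x1) (ev q (n + 1) c b1)"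
   using el(1)[OF p(1)] by blast
  have bb: "bd B (n + 1) c b1 \<in> K B n c" and bx: "bd X (n + 1) c x1 \<in> K X n c" using b1 x1 OO c by simp_all
  have "ev q n c b = pl P n c (ev v n c (bd X (n + 1) c x1)) (ev q n c (bd B (n + 1) c b1))"
   using p(2) pe bd_pl[OF OO(4) c ev_closed[OF v c x1] ev_closed[OF q c b1]] ev_bd[OF v c x1] ev_bd[OF q c b1] by simp
  then have "ev v n c (bd X (n + 1) c x1) = ev q n c (pl B n c b (ng B n c (bd B (n + 1) c b1)))"
   using bb bx b OO c cl by (simp add: ev_pl[OF q] ev_ng[OF q] pl_assoc)
  \<comment> \<open>Equal images in the pushout come from some \<open>a\<close>. It is a cycle whose
    image under \<open>f\<close> bounds, so it bounds itself, and \<open>b\<close> bounds along with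
    it.\<close>
  from el(2)[OF bx _ this] obtain a where a: "a \<in> K A n c" "bd X (n + 1) c x1 = ev f n c a"
    "pl B n c b (ng B n c (bd B (n + 1) c b1)) = ev u n c a" using bb b OO c by auto
  have "bd B n c (ev u n c a) = zr B (n - 1) c"
   using a(3)[symmetric] bd_pl[OF OO(3) c b(1), of "ng B n c (bd B (n + 1) c b1)"] bd_ng[OF OO(3) c bb] b bb b1 OO c by simp
  from ucyc[OF a(1) this] w1[OF a(1) _ x1 a(2)[symmetric]] obtain t where t: "t \<in> K A (n + 1) c" "a = bd A (n + 1) c t" by blast
  have bt: "ev u n c a = bd B (n + 1) c (ev u (n + 1) c t)" using ev_bd[OF u c t(1)] t(2) by simp
  have ua: "ev u n c a \<in> K B n c" using cl a by blast
  have "b = pl B n c (ev u n c a) (bd B (n + 1) c b1)" using a(3)[symmetric] b bb OO c by (simp add: pl_assoc)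
  then have "b = bd B (n + 1) c (pl B (n + 1) c (ev u (n + 1) c t) b1)"
   using bt bd_pl[OF OO(3) c ev_closed[OF u c t(1)] b1] by simp
  then show "\<exists>w\<in>K B (n + 1) c. b = bd B (n + 1) c w" using ev_closed[OF u c t(1)] b1 OO c by blast
 next
  fix p assume p: "p \<in> K P n c" "bd P n c p = zr P (n - 1) c"
  obtain x b where x: "x \<in> K X n c" and b: "b \<in> K B n c" and pe: "p = pl P n c (ev v n c x) (ev q n c b)" using el(1)[OF p(1)] by blast
  have bx: "bd X n c x \<in> K X (n - 1) c" and bb: "bd B n c b \<in> K B (n - 1) c" using x b OO c by simp_all
  have "pl P (n - 1) c (ev v (n - 1) c (bd X n c x)) (ev q (n - 1) c (bd B n c b)) = zr P (n - 1) c"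
   using p(2) pe bd_pl[OF OO(4) c ev_closed[OF v c x] ev_closed[OF q c b]] ev_bd[OF v c x] ev_bd[OF q c b] by simp
  then have "ev v (n - 1) c (bd X n c x) = ng P (n - 1) c (ev q (n - 1) c (bd B n c b))"
   using ng_unique[OF OO(4) c, of "ev q (n - 1) c (bd B n c b)" "n - 1" "ev v (n - 1) c (bd X n c x)"] cl bx bb
    pl_comm[OF OO(4) c, of "ev q (n - 1) c (bd B n c b)" "n - 1" "ev v (n - 1) c (bd X n c x)"] by simp
  then have "ev v (n - 1) c (bd X n c x) = ev q (n - 1) c (ng B (n - 1) c (bd B n c b))" using ev_ng[OF q c bb] by simp
  from el(2)[OF bx _ this] obtain a where a: "a \<in> K A (n - 1) c" "bd X n c x = ev f (n - 1) c a" "ng B (n - 1) c (bd B n c b) = ev u (n - 1) c a"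
   using bb OO c by auto
  have "bd B (n - 1) c (ev u (n - 1) c a) = zr B (n - 1 - 1) c" using a(3)[symmetric] bd_ng[OF OO(3) c bb] b OO c by simp
  note ac = ucyc[OF a(1) this]
  obtain t where t: "t \<in> K A n c" "a = bd A n c t" using w1[OF a(1) ac, of x] x a(2) by auto
  \<comment> \<open>Moving \<open>t\<close> from one component to the other leaves \<open>p\<close>
    unchanged, as \<open>v\<close> after \<open>f\<close> equals \<open>q\<close> after
    \<open>u\<close>, and it makes both components cycles.\<close>
  let ?x = "pl X n c x (ng X n c (ev f n c t))" and ?b = "pl B n c b (ev u n c t)"
  note ft = ev_closed[OF f c t(1)] and ut = ev_closed[OF u c t(1)]
  have "bd X n c ?x = zr X (n - 1) c"
   using bd_pl[OF OO(2) c x, of "ng X n c (ev f n c t)"] bd_ng[OF OO(2) c ft] ev_bd[OF f c t(1)] a(2) t(2) bx OO c ft by simp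
  from w2[OF _ this] obtain a2 x2 where a2: "a2 \<in> K A n c" "bd A n c a2 = zr A (n - 1) c" and x2: "x2 \<in> K X (n + 1) c"
   "?x = pl X n c (bd X (n + 1) c x2) (ev f n c a2)" using x ft OO c by auto
  have "bd B n c ?b = pl B (n - 1) c (bd B n c b) (ng B (n - 1) c (bd B n c b))"
   using bd_pl[OF OO(3) c b ut] ev_bd[OF u c t(1)] a(3) t(2) by simp
  then have b0: "bd B n c ?b = zr B (n - 1) c" using bb OO c by simp
  note fa = ev_closed[OF f c a2(1)] and ua = ev_closed[OF u c a2(1)]
  have bx2: "bd X (n + 1) c x2 \<in> K X n c" using x2 OO c by simp
  \<comment> \<open>The cycle \<open>?x\<close> is homologous to the image of \<open>a2\<close>
    under \<open>f\<close>, and in the pushout that image can be taken in \<open>B\<close>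
    instead.\<close>
  let ?c = "pl B n c (ev u n c a2) ?b"
  have cK: "?c \<in> K B n c" using ua b ut OO c by simp
  have ub: "bd B n c (ev u n c a2) = zr B (n - 1) c"
   unfolding ev_bd[OF u c a2(1), symmetric] a2(2) by (rule ev_zr[OF u c])
  have bK: "?b \<in> K B n c" using b ut OO c by simp
  have "bd B n c ?c = zr B (n - 1) c" unfolding bd_pl[OF OO(3) c ua bK] ub b0 using OO c by simp
  moreover have "p = pl P n c (bd P (n + 1) c (ev v (n + 1) c x2)) (ev q n c ?c)"
  proof -
   have "ev v n c x = pl P n c (ev v n c ?x) (ev v n c (ev f n c t))"
    using x ft OO c cl by (simp add: ev_pl[OF v] ev_ng[OF v] pl_assoc)
   also have "ev v n c ?x = pl P n c (bd P (n + 1) c (ev v (n + 1) c x2)) (ev q n c (ev u n c a2))"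
    unfolding x2(2) using ev_pl[OF v c bx2 fa] ev_bd[OF v c x2(1)] pushout_comm[OF c a2(1)] by simp
   finally have "ev v n c x = pl P n c (pl P n c (bd P (n + 1) c (ev v (n + 1) c x2)) (ev q n c (ev u n c a2))) (ev q n c (ev u n c t))"
    using pushout_comm[OF c t(1)] by simp
   moreover have "bd P (n + 1) c (ev v (n + 1) c x2) \<in> K P n c" using x2(1) cl OO c by simp
   ultimately show ?thesis unfolding pe using ua ut b OO c cl
    by (simp add: ev_pl[OF q] pl_assoc pl_comm pl_lcomm)
  qed
  ultimately show "\<exists>x\<in>K B n c. bd B n c x = zr B (n - 1) c & (\<exists>t\<in>K P (n + 1) c. p = pl P n c (bd P (n + 1) c t) (ev q n c x))"
   using cK ev_closed[OF v c x2(1)] by blast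
 }
qed

end

lemma left_proper_ch: "left_proper ch \<W> (llp ch \<T>)"
 unfolding left_proper_def
proof (intro allI impI, elim conjE)
 fix f u v q assume fW: "f \<in> \<W>" and uC: "u \<in> llp ch \<T>" and po: "is_pushout ch f u v q"
 let ?A = "Dom ch f" and ?X = "Cod ch f" and ?B = "Cod ch u" and ?P = "Cod ch q"
 have H: "f \<in> Hom ch ?A ?X" "u \<in> Hom ch ?A ?B" "v \<in> Hom ch ?X ?P" "q \<in> Hom ch ?B ?P"
  using po by (auto simp: is_pushout_def Hom_def)
 have "wq ?A ?X f" using fW homology_isos_iff[OF H(1)] by blast
 then have "wq ?B ?P q" by (rule pushout_wq[OF H po]) (rule cofibration_injective[OF uC H(2)])
 then show "q \<in> \<W>" using homology_isos_iff[OF H(4)] by blast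
qed

end

context psh_setup begin

subsection \<open>The model structure\<close>

lemma retracts_cell: "retracts ch (rel_cell \<mu> ch \<I>) \<subseteq> llp ch \<T>"
proof
 fix i assume "i \<in> retracts ch (rel_cell \<mu> ch \<I>)"
 then obtain g where g: "g \<in> rel_cell \<mu> ch \<I>" "is_retract ch i g" by (auto simp: retracts_def)
 show "i \<in> llp ch \<T>" by (rule ch.retract_in_llp[OF ch.rel_cell_in_llp[OF g(1) gen_I_Arr] g(2) T_Arr])
qed

text \<open>A map with the lifting property is a retract of the left half of its factorization,
  which in turn is a retract of a relative cell complex.\<close>

lemma cofibrations: "retracts ch (rel_cell \<mu> ch \<I>) = llp ch \<T>"
proof (intro subset_antisym retracts_cell subsetI)
 fix i assume i: "i \<in> llp ch \<T>"
 then have iA: "i \<in> Arr ch" by (simp add: llp_def)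
 note H = Hom_ch_Arr[OF iA]
 have "has_lifts ch (I.rgt i \<star> I.lft i) (I.rgt i)" using i I_rgt[OF iA] I.rgt_lft[OF H] by (simp add: llp_def)
 from ch.retract_argument[OF I.lft_Hom[OF H] I.rgt_Hom[OF H] this] have "is_retract ch i (I.lft i)" using I.rgt_lft[OF H] by simp
 moreover obtain g where "g \<in> rel_cell \<mu> ch \<I>" "is_retract ch (I.lft i) g" using I_lft[OF iA] by (auto simp: retracts_def)
 ultimately show "i \<in> retracts ch (rel_cell \<mu> ch \<I>)" using ch.is_retract_trans unfolding retracts_def by blast
qed

lemma T_subset_F: "\<T> \<subseteq> \<F>" using trivial_fibrations by blast

text \<open>For an acyclic cofibration, the right half of the factorization by disks is a weak
  equivalence by two-out-of-three, hence a trivial fibration, and the retract argument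
  applies.\<close>

lemma acyclic_cofibrations: "llp ch \<T> \<inter> \<W> = llp ch \<F>"
proof (intro subset_antisym subsetI)
 fix i assume "i \<in> llp ch \<T> \<inter> \<W>"
 then have i: "i \<in> llp ch \<T>" "i \<in> \<W>" by auto
 then have iA: "i \<in> Arr ch" by (simp add: llp_def)
 note H = Hom_ch_Arr[OF iA]
 note l = J.lft_Hom[OF H] and rr = J.rgt_Hom[OF H] and e = J.rgt_lft[OF H]
 have "J.lft i \<in> \<W>" by (rule llp_fibrations_W[OF J_lft[OF iA]])
 then have "J.rgt i \<in> \<W>"
  using two_out_of_three_W HomD[OF l] HomD[OF rr] e i(2) unfolding two_out_of_three_def by metis
 then have "J.rgt i \<in> \<T>" using J_rgt[OF iA] trivial_fibrations by blast
 then have "has_lifts ch (J.rgt i \<star> J.lft i) (J.rgt i)" using i(1) e by (simp add: llp_def)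
 from ch.retract_argument[OF l rr this] have "is_retract ch i (J.lft i)" using e by simp
 then show "i \<in> llp ch \<F>" by (rule ch.retract_in_llp[OF J_lft[OF iA] _ Arr_levelwise])
next
 fix i assume i: "i \<in> llp ch \<F>"
 then show "i \<in> llp ch \<T> \<inter> \<W>" using llp_fibrations_W[OF i] ch.llp_antimono[OF T_subset_F] by blast
qed

lemma subcategory_F: "subcategory_arrows ch \<F>"
 unfolding subcategory_arrows_def
proof (intro conjI ballI impI)
 show "\<F> \<subseteq> Arr ch" by (rule Arr_levelwise)
 show "Idn ch X \<in> \<F>" if X: "X \<in> Obj ch" for X
  unfolding levelwise_iff[OF Idn_in_Hom_ch[OF X]] by auto
 fix f g assume f: "f \<in> \<F>" and g: "g \<in> \<F>" and e: "Dom ch g = Cod ch f"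
 have fH: "f \<in> Hom ch (Dom ch f) (Cod ch f)" using f Arr_levelwise Hom_ch_Arr by blast
 have gH: "g \<in> Hom ch (Cod ch f) (Cod ch g)" using Hom_ch_Arr[OF subsetD[OF Arr_levelwise g]] e by simp
 show "g \<star> f \<in> \<F>"
  unfolding levelwise_iff[OF Cmp_in_Hom_ch[OF fH gH]]
 proof (intro allI ballI)
  fix n c y assume c: "c \<in> Obj C" and y: "y \<in> K (Cod ch g) n c"
  obtain z where z: "z \<in> K (Cod ch f) n c" "ev g n c z = y" using g c y unfolding levelwise_iff[OF gH] by blast
  obtain x where x: "x \<in> K (Dom ch f) n c" "ev f n c x = z" using f c z(1) unfolding levelwise_iff[OF fH] by blast
  show "\<exists>x\<in>K (Dom ch f) n c. ev (g \<star> f) n c x = y" using ev_Cmp[OF fH gH c x(1)] x z by auto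
 qed
qed

lemma retracts_F: "retracts ch \<F> \<subseteq> \<F>"
proof
 fix f assume "f \<in> retracts ch \<F>"
 then obtain g where g: "g \<in> \<F>" and r: "is_retract ch f g" by (auto simp: retracts_def)
 have fH: "f \<in> Hom ch (Dom ch f) (Cod ch f)" and gH: "g \<in> Hom ch (Dom ch g) (Cod ch g)"
  using r Hom_ch_Arr by (auto simp: is_retract_def)
 obtain s i' r' where s: "s \<in> Hom ch (Dom ch g) (Dom ch f)" and i': "i' \<in> Hom ch (Cod ch f) (Cod ch g)"
  and r': "r' \<in> Hom ch (Cod ch g) (Cod ch f)" and e: "r' \<star> i' = Idn ch (Cod ch f)" "f \<star> s = r' \<star> g"
  using r unfolding is_retract_def by blast
 show "f \<in> \<F>"
  unfolding levelwise_iff[OF fH]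
 proof (intro allI ballI)
  fix n c y assume c: "c \<in> Obj C" and y: "y \<in> K (Cod ch f) n c"
  obtain x where x: "x \<in> K (Dom ch g) n c" "ev g n c x = ev i' n c y"
   using g c ev_closed[OF i' c y] unfolding levelwise_iff[OF gH] by blast
  have "ev f n c (ev s n c x) = y"
   using ev_Cmp[OF s fH c x(1)] ev_Cmp[OF gH r' c x(1)] ev_Cmp[OF i' r' c y] e x(2) c y by simp
  then show "\<exists>x\<in>K (Dom ch f) n c. ev f n c x = y" using ev_closed[OF s c x(1)] by blast
 qed
qed

lemma model_category_ch: "model_category \<mu> ch \<W> (retracts ch (rel_cell \<mu> ch \<I>)) \<F>"
 unfolding model_category_def model_structure_def cofibrations
proof (intro conjI)
 show "category ch" by (rule ch.category_axioms)
 show "complete \<mu> ch" by (rule complete_ch)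
 show "cocomplete \<mu> ch" by (rule cocomplete_ch)
 show "two_out_of_three ch \<W>" by (rule two_out_of_three_W)
 show "retracts ch \<W> \<subseteq> \<W>" by (rule retracts_W)
 show "subcategory_arrows ch \<W>"
  using W_Arr Idn_W two_out_of_three_W unfolding subcategory_arrows_def two_out_of_three_def by blast
 show "subcategory_arrows ch (llp ch \<T>)"
  using ch.llp_subset_Arr ch.Idn_in_llp[OF _ T_Arr] ch.Cmp_in_llp[OF _ _ _ T_Arr] unfolding subcategory_arrows_def by blast
 show "subcategory_arrows ch \<F>" by (rule subcategory_F)
 show "retracts ch (llp ch \<T>) \<subseteq> llp ch \<T>" using ch.retract_in_llp[OF _ _ T_Arr] by (auto simp: retracts_def)
 show "retracts ch \<F> \<subseteq> \<F>" by (rule retracts_F)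
 show "\<forall>i\<in>llp ch \<T>. \<forall>p\<in>\<F>. i \<in> \<W> \<or> p \<in> \<W> --> has_lifts ch i p"
 proof (intro ballI impI)
  fix i p assume i: "i \<in> llp ch \<T>" and p: "p \<in> \<F>" and "i \<in> \<W> \<or> p \<in> \<W>"
  then consider "i \<in> llp ch \<F>" | "p \<in> \<T>" using acyclic_cofibrations trivial_fibrations by blast
  then show "has_lifts ch i p" using i p by cases (simp_all add: llp_def)
 qed
 show "functorial_factorization ch (llp ch \<T>) (\<F> \<inter> \<W>)"
  unfolding trivial_fibrations by (rule I.functorial) (use I_rgt subsetD[OF retracts_cell I_lft] in blast)
 show "functorial_factorization ch (llp ch \<T> \<inter> \<W>) \<F>"
  unfolding acyclic_cofibrations by (rule J.functorial) (use J_rgt J_lft in blast)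
qed

lemma proper_ch: "proper ch \<W> (retracts ch (rel_cell \<mu> ch \<I>)) \<F>"
 unfolding proper_def cofibrations using left_proper_ch right_proper_ch by blast

lemma small_gens_source:
 "i \<in> \<I> ==> small_rel \<mu> ch Q (Dom ch i)" "j \<in> gen_J \<mu> C R S ==> small_rel \<mu> ch Q (Dom ch j)"
proof -
 have S: "c \<in> Obj C" if "c \<in> S" for c using that S_Obj by blast
 show "small_rel \<mu> ch Q (Dom ch i)" if "i \<in> \<I>"
  using that HomD[OF gi_Hom[OF S]] small_Sp[OF S] by (auto simp: gen_I_def)
 show "small_rel \<mu> ch Q (Dom ch j)" if "j \<in> gen_J \<mu> C R S"
  using that HomD[OF gj_Hom[OF S]] small_Zc by (auto simp: gen_J_def)
qed

lemma cofibrantly_generated_ch: "cofibrantly_generated \<mu> ch \<W> \<F> \<I> (gen_J \<mu> C R S)"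
 unfolding cofibrantly_generated_def
 using gen_I_Arr gen_J_Arr small_gens small_gens_source Fib_injectives trivial_fibrations by blast

end

lemma (in category) isomorphic_sym: "isomorphic C X Y ==> isomorphic C Y X"
 unfolding isomorphic_def is_iso_def Hom_def by fastforce

theorem theorem3p2:
  fixes \<mu> :: "'u rel" and C :: "('o, 'a) cat" and T :: "'o \<Rightarrow> 'a set set"
    and R :: "('o, 'a, 'r) rpsh" and S :: "'o set"
  assumes "universe \<mu>"
    and "grothendieck_site C T" and "skeletally_small \<mu> C"
    and "sheaf_of_rings \<mu> C T R"
    and "is_skeleton C S"
  shows "\<exists>W Cof Fib.
    model_category \<mu> (ch_psh \<mu> C R) W Cof Fib \<and>
    proper (ch_psh \<mu> C R) W Cof Fib \<and>
    cofibrantly_generated \<mu> (ch_psh \<mu> C R) W Fib (gen_I \<mu> C R S) (gen_J \<mu> C R S) \<and>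
    W = homology_isos \<mu> C R \<and>
    Cof = retracts (ch_psh \<mu> C R) (rel_cell \<mu> (ch_psh \<mu> C R) (gen_I \<mu> C R S)) \<and>
    Fib = levelwise_surjections \<mu> C R \<and>
    (\<forall>i \<in> gen_I \<mu> C R S. small_object \<mu> (ch_psh \<mu> C R) (Dom (ch_psh \<mu> C R) i)) \<and>
    (\<forall>j \<in> gen_J \<mu> C R S. small_object \<mu> (ch_psh \<mu> C R) (Dom (ch_psh \<mu> C R) j))"
proof -
  interpret site: grothendieck_site C T by fact
  obtain S0 where S0: "is_skeleton C S0" "small \<mu> S0" using assms(3) by (auto simp: skeletally_small_def)
  \<comment> \<open>Any two skeletons are in bijection, so smallness passes from \<open>S0\<close>
    to the given \<open>S\<close>.\<close>
  have "s \<in> (\<lambda>t. THE s. s \<in> S \<and> isomorphic C t s) ` S0" if s: "s \<in> S" for s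
  proof -
    obtain t where t: "t \<in> S0" "isomorphic C s t" using S0(1) assms(5) s unfolding is_skeleton_def by blast
    have "\<exists>!s. s \<in> S \<and> isomorphic C t s" using assms(5) S0(1) t(1) unfolding is_skeleton_def by blast
    then have "(THE s. s \<in> S \<and> isomorphic C t s) = s" by (rule the1_equality) (use s site.isomorphic_sym[OF t(2)] in blast)
    then show ?thesis using t(1) by blast
  qed
  then have "S \<subseteq> (\<lambda>t. THE s. s \<in> S \<and> isomorphic C t s) ` S0" by blast
  then have S: "small \<mu> S" by (rule small_mono[OF assms(1) small_image[OF assms(1) S0(2)]])
  interpret psh_setup C \<mu> R S
    by unfold_locales (use assms S in \<open>auto simp: skeletally_small_def sheaf_of_rings_def is_skeleton_def\<close>)
  show ?thesis
    by (intro exI[of _ "homology_isos \<mu> C R"] exI[of _ "retracts (ch_psh \<mu> C R) (rel_cell \<mu> (ch_psh \<mu> C R) (gen_I \<mu> C R S))"]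
      exI[of _ "levelwise_surjections \<mu> C R"] conjI ballI HOL.refl model_category_ch proper_ch cofibrantly_generated_ch)
      (simp_all add: small_object_def small_gens_source)
qed

end
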